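(* The renormalized KdV2 Hamiltonian $H_2^\star$, when written as a function of the actions, extends real analytically to $h_+^1$. Moreover, for any $I\in h_+^1$, the $\ell^2$-gradient $\partial_IH_2^\star$ can be identified with $\omega^{(2)\star}(I)$, and there exists a neighborhood $U$ of $I=0$ in $h_+^1$ on which $H_2^\star$ is strictly concave in the sense that $$\langle d_I^2H_2^\star J,J\rangle_{h^{-1},h^1}\le\tfrac12\langle\Lambda J,J\rangle_{h^{-1},h^1}\qquad\text{for all }I\in U,\ J\in h^1,$$ where $\Lambda=\mathrm{diag}\big((-80n^2\pi^2)_{n\ge1}\big)$.
   Context: Spaces. $\mathbb T=\mathbb R/\mathbb Z$, $\mathbb N=\{1,2,\dots\}$, $\langle n\rangle=1+|n|$. $h^s_{0,\mathbb C}$ is the space of complex sequences $z=(z_n)_{n\in\mathbb Z}$ with $z_0=0$ and $\sum_n\langle n\rangle^{2s}|z_n|^2<\infty$; $h_0^s$ is its real subspace $\{z_{-n}=\overline{z_n}\}$. For $s\in\mathbb R$, $1\le p<\infty$, $\ell^{s,p}_{\mathbb C}$ and $\ell^{s,p}$ are the spaces of complex, respectively real, sequences $(x_n)_{n\ge1}$ with $\sum_n\langle n\rangle^{sp}|x_n|^p<\infty$; $\ell_+^{s,p}=\{I\in\ell^{s,p}: I_n\ge0\ \forall n\}$; $h^s=\ell^{s,2}$, $h^1_+=\ell_+^{1,2}$. $\langle\cdot,\cdot\rangle_{h^{-1},h^1}$ is the dual pairing extending the $\ell^2$ inner product. $\mathcal H_0^s$ is the Sobolev space of real mean-zero distributions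 $u$ on $\mathbb T$ with Fourier coefficients $(u_n)\in h_0^s$, and $\mathcal H^s_{0,\mathbb C}$ its complex version. Birkhoff map (known background). Gardner bracket: $\{F,G\}=\int_0^1\partial_uF\,\partial_x\partial_uG\,dx$. KdV2 Hamiltonian: $H_2(u)=\frac12\int_0^1(u_{xx}^2+10uu_x^2+5u^4)\,dx$. There is a complex neighborhood $\mathcal W$ of $\mathcal H_0^{-1}$ in $\mathcal H_{0,\mathbb C}^{-1}$ and an analytic map $\Phi\colon\mathcal W\to h_{0,\mathbb C}^{-1/2}$, $u\mapsto(z_n(u))_{n\in\mathbb Z}$, $\Phi(0)=0$, such that for every $s\ge-1$, $\Phi|_{\mathcal H_0^s}$ is a real analytic diffeomorphism onto $h_0^{s+1/2}$; $\{z_n,z_{-n}\}=i$ for $n\ge1$ and all other brackets between coordinate functions vanish; $H_1\circ\Phi^{-1}$ on $h_0^{3/2}$ (with $H_1(u)=\frac12\int_0^1(u_x^2+2u^3)dx$) and $H_2\circ\Phi^{-1}$ on $h_0^{5/2}$ are real analytic functions of the actions $I_n=z_nz_{-n}$, $n\ge1$, alone; and $d_0\Phi(u)=((2|n|\pi)^{-1/2}u_n)_{n\ne0}$. Renormalized quantities. With $H_0=\frac12\int_0^1u^2dx=\sum_{n\ge1}(2n\pi)I_n$, set $H_2^\star=H_2-\sum_{n\ge1}(2n\pi)^5I_n-10H_0^2$ and $\omega_n^{(2)\star}=\partial_{I_n}H_2-(2n\pi)^5-20(2n\pi)H_0=\partial_{I_n}H_2^\star$, functions of the actions, initially on $\ell_+^{5,1}$;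 $\omega^{(2)\star}=(\omega_n^{(2)\star})_{n\ge1}$. The map $\omega^{(2)\star}$ extends to a real analytic map $h_+^1=\ell_+^{1,2}\to\ell^{-1,2}=h^{-1}$, again denoted $\omega^{(2)\star}$. Convention. A map on a non-open set $\ell_+^{s,p}$ is real analytic if it is the restriction of an analytic map on a neighborhood of it in $\ell_{\mathbb C}^{s,p}$; differentials are those of the extension. Neighborhoods in $h^1_+$ are relative. *)

theory Defs
  imports "HOL-Analysis.Analysis" "HOL-Library.Function_Algebras"
begin

text \<open>
  The weighted sequence spaces depend on a real regularity index, so they are modelled as
  carrier sets inside the function types \<open>int \<Rightarrow> complex\<close> and \<open>nat \<Rightarrow> complex\<close>, with pointwise
  addition. The norm field is meaningful only on the carrier.
\<close>

record 'v cspace =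
  carr :: "'v set"
  smul :: "complex \<Rightarrow> 'v \<Rightarrow> 'v"
  nrm  :: "'v \<Rightarrow> real"

definition Cspace :: "complex cspace" where
  "Cspace = \<lparr>carr = UNIV, smul = (*), nrm = norm\<rparr>"

definition open_in :: "'v::ab_group_add cspace \<Rightarrow> 'v set \<Rightarrow> bool" where
  "open_in X V \<longleftrightarrow> V \<subseteq> carr X \<and>
     (\<forall>x\<in>V. \<exists>r>0. \<forall>y\<in>carr X. nrm X (y - x) < r \<longrightarrow> y \<in> V)"

definition bounded_clin ::
    "'v::ab_group_add cspace \<Rightarrow> 'w::ab_group_add cspace \<Rightarrow> ('v \<Rightarrow> 'w) \<Rightarrow> bool" where
  "bounded_clin X Y L \<longleftrightarrow>
     (\<forall>x\<in>carr X. L x \<in> carr Y) \<and>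
     (\<forall>x\<in>carr X. \<forall>y\<in>carr X. L (x + y) = L x + L y) \<and>
     (\<forall>c. \<forall>x\<in>carr X. L (smul X c x) = smul Y c (L x)) \<and>
     (\<exists>K. \<forall>x\<in>carr X. nrm Y (L x) \<le> K * nrm X x)"

text \<open>Complex Frechet derivative; \<open>L\<close> is determined by \<open>f\<close> and \<open>x\<close> on the carrier of \<open>X\<close>.\<close>

definition has_cderiv ::
    "'v::ab_group_add cspace \<Rightarrow> 'w::ab_group_add cspace \<Rightarrow> ('v \<Rightarrow> 'w) \<Rightarrow> 'v \<Rightarrow> ('v \<Rightarrow> 'w) \<Rightarrow> bool" where
  "has_cderiv X Y f x L \<longleftrightarrow> bounded_clin X Y L \<and>
     (\<forall>\<epsilon>>0. \<exists>\<delta>>0. \<forall>h\<in>carr X. nrm X h < \<delta> \<longrightarrow>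
        f (x + h) - f x - L h \<in> carr Y \<and>
        nrm Y (f (x + h) - f x - L h) \<le> \<epsilon> * nrm X h)"

definition analytic_map ::
    "'v::ab_group_add cspace \<Rightarrow> 'w::ab_group_add cspace \<Rightarrow> 'v set \<Rightarrow> ('v \<Rightarrow> 'w) \<Rightarrow> bool" where
  "analytic_map X Y V f \<longleftrightarrow> open_in X V \<and> f ` V \<subseteq> carr Y \<and> (\<forall>x\<in>V. \<exists>L. has_cderiv X Y f x L)"

text \<open>
  Real analyticity of \<open>f : S \<rightarrow> T\<close>, where \<open>S\<close> and \<open>T\<close> consist of real elements of the complex
  spaces \<open>X\<close> and \<open>Y\<close>: \<open>f\<close> is the restriction of an analytic map on a neighbourhood of \<open>S\<close> in \<open>X\<close>.
\<close>

definition real_analytic_map ::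
    "'v::ab_group_add cspace \<Rightarrow> 'w::ab_group_add cspace \<Rightarrow> 'v set \<Rightarrow> 'w set \<Rightarrow> ('v \<Rightarrow> 'w) \<Rightarrow> bool" where
  "real_analytic_map X Y S T f \<longleftrightarrow> f ` S \<subseteq> T \<and>
     (\<exists>V g. S \<subseteq> V \<and> analytic_map X Y V g \<and> (\<forall>x\<in>S. g x = f x))"

text \<open>Sequences over \<open>n \<ge> 1\<close> are encoded as functions on \<open>nat\<close> vanishing at \<open>0\<close>.\<close>

definition weighted_lp :: "('i::zero \<Rightarrow> real) \<Rightarrow> real \<Rightarrow> real \<Rightarrow> ('i \<Rightarrow> complex) cspace" where
  "weighted_lp w s p =
     \<lparr>carr = {x. x 0 = 0 \<and> (\<lambda>n. w n powr (s * p) * norm (x n) powr p) summable_on UNIV},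
      smul = (\<lambda>c x n. c * x n),
      nrm = (\<lambda>x. (\<Sum>\<^sub>\<infinity>n. w n powr (s * p) * norm (x n) powr p) powr (1 / p))\<rparr>"

definition h0C :: "real \<Rightarrow> (int \<Rightarrow> complex) cspace" where
  "h0C s = weighted_lp (\<lambda>n. 1 + real_of_int \<bar>n\<bar>) s 2"

definition h0 :: "real \<Rightarrow> (int \<Rightarrow> complex) set" where
  "h0 s = {z \<in> carr (h0C s). \<forall>n. z (- n) = cnj (z n)}"

definition lC :: "real \<Rightarrow> real \<Rightarrow> (nat \<Rightarrow> complex) cspace" where
  "lC s p = weighted_lp (\<lambda>n. 1 + real n) s p"

definition lreal :: "real \<Rightarrow> real \<Rightarrow> (nat \<Rightarrow> complex) set" where
  "lreal s p = {x \<in> carr (lC s p). \<forall>n. x n \<in> \<real>}"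

definition lplus :: "real \<Rightarrow> real \<Rightarrow> (nat \<Rightarrow> complex) set" where
  "lplus s p = {x \<in> lreal s p. \<forall>n. 0 \<le> Re (x n)}"

text \<open>
  The dual pairing is the complex bilinear extension of the real \<open>\<ell>\<^sup>2\<close> inner product.
\<close>

definition dpair :: "(nat \<Rightarrow> complex) \<Rightarrow> (nat \<Rightarrow> complex) \<Rightarrow> complex" where
  "dpair x y = (\<Sum>\<^sub>\<infinity>n. x n * y n)"

definition has_l2_gradient ::
    "((nat \<Rightarrow> complex) \<Rightarrow> complex) \<Rightarrow> (nat \<Rightarrow> complex) \<Rightarrow> (nat \<Rightarrow> complex) \<Rightarrow> bool" where
  "has_l2_gradient G I v \<longleftrightarrow> v \<in> carr (lC (-1) 2) \<and> has_cderiv (lC 1 2) Cspace G I (\<lambda>J. dpair v J)"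

text \<open>
  Second Frechet differential at \<open>I\<close> of a functional \<open>G\<close> on an open subset \<open>V\<close> of \<open>h\<^sup>1\<close>, as an
  operator \<open>A : h\<^sup>1 \<rightarrow> h\<^sup>-\<^sup>1\<close>: the map \<open>x \<mapsto> d\<^sub>xG\<close> into the dual of \<open>h\<^sup>1\<close> (with the operator
  norm) has at \<open>I\<close> the derivative \<open>h \<mapsto> \<langle>A h, \<cdot>\<rangle>\<close>.
\<close>

definition has_second_differential ::
    "(nat \<Rightarrow> complex) set \<Rightarrow> ((nat \<Rightarrow> complex) \<Rightarrow> complex) \<Rightarrow> (nat \<Rightarrow> complex) \<Rightarrow>
     ((nat \<Rightarrow> complex) \<Rightarrow> (nat \<Rightarrow> complex)) \<Rightarrow> bool" where
  "has_second_differential V G I A \<longleftrightarrow> bounded_clin (lC 1 2) (lC (-1) 2) A \<and>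
     (\<exists>D. (\<forall>x\<in>V. has_cderiv (lC 1 2) Cspace G x (D x)) \<and>
       (\<forall>\<epsilon>>0. \<exists>\<delta>>0. \<forall>h\<in>carr (lC 1 2). nrm (lC 1 2) h < \<delta> \<longrightarrow>
         I + h \<in> V \<and>
         (\<forall>k\<in>carr (lC 1 2).
           norm (D (I + h) k - D I k - dpair (A h) k) \<le> \<epsilon> * nrm (lC 1 2) h * nrm (lC 1 2) k)))"

text \<open>
  A distribution on \<open>\<real>/\<int>\<close> is identified with its sequence of Fourier coefficients
  \<open>u\<^sub>k = \<integral>\<^sub>0\<^sup>1 u(x) exp(-2\<pi>ikx) dx\<close>, so that \<open>h0 s\<close> and \<open>h0C s\<close> also serve as the Sobolev spaces
  of real and complex mean-zero distributions. For square summable \<open>a\<close>, \<open>fun_of a\<close> is the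
  \<open>L\<^sup>2\<close> function with Fourier coefficients \<open>a\<close>, unique up to null sets.
\<close>

definition has_fourier_coeffs :: "(real \<Rightarrow> complex) \<Rightarrow> (int \<Rightarrow> complex) \<Rightarrow> bool" where
  "has_fourier_coeffs f a \<longleftrightarrow> f \<in> borel_measurable borel \<and>
     set_integrable lborel {0..1} (\<lambda>x. (norm (f x))\<^sup>2) \<and>
     (\<forall>k. (LINT x:{0..1}|lborel. f x * exp (- (2 * of_real pi * \<i> * of_int k * of_real x))) = a k)"

definition fun_of :: "(int \<Rightarrow> complex) \<Rightarrow> real \<Rightarrow> complex" where
  "fun_of a = (SOME f. has_fourier_coeffs f a)"

definition dx :: "(int \<Rightarrow> complex) \<Rightarrow> int \<Rightarrow> complex" where
  "dx a = (\<lambda>k. 2 * of_real pi * \<i> * of_int k * a k)"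

text \<open>
  No conjugates or absolute values occur below, so these functionals also make sense for complex
  \<open>u\<close>; they are real for real \<open>u\<close>.
\<close>

definition H0 :: "(int \<Rightarrow> complex) \<Rightarrow> complex" where
  "H0 u = 1/2 * (LINT x:{0..1}|lborel. (fun_of u x)^2)"

definition H1 :: "(int \<Rightarrow> complex) \<Rightarrow> complex" where
  "H1 u = 1/2 * (LINT x:{0..1}|lborel. (fun_of (dx u) x)^2 + 2 * (fun_of u x)^3)"

definition H2 :: "(int \<Rightarrow> complex) \<Rightarrow> complex" where
  "H2 u = 1/2 * (LINT x:{0..1}|lborel.
     (fun_of (dx (dx u)) x)^2 + 10 * fun_of u x * (fun_of (dx u) x)^2 + 5 * (fun_of u x)^4)"

text \<open>
  \<open>L\<^sup>2\<close>-gradient (as Fourier coefficients, in \<open>H\<^sup>1\<close>) of a functional \<open>F\<close> on \<open>H\<^sup>-\<^sup>1\<close>: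
  \<open>d\<^sub>uF(v) = \<integral> \<partial>\<^sub>uF v dx\<close>, where the integral stands for the pairing \<open>\<Sum>\<^sub>k (\<partial>\<^sub>uF)\<^sub>-\<^sub>k v\<^sub>k\<close>.
\<close>

definition gradient :: "((int \<Rightarrow> complex) \<Rightarrow> complex) \<Rightarrow> (int \<Rightarrow> complex) \<Rightarrow> (int \<Rightarrow> complex)" where
  "gradient F u = (THE g. g \<in> carr (h0C 1) \<and>
     has_cderiv (h0C (-1)) Cspace F u (\<lambda>v. \<Sum>\<^sub>\<infinity>k. g (- k) * v k))"

definition gardner_bracket ::
    "((int \<Rightarrow> complex) \<Rightarrow> complex) \<Rightarrow> ((int \<Rightarrow> complex) \<Rightarrow> complex) \<Rightarrow> (int \<Rightarrow> complex) \<Rightarrow> complex" where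
  "gardner_bracket F G u =
     (LINT x:{0..1}|lborel. fun_of (gradient F u) x * fun_of (dx (gradient G u)) x)"

definition actions :: "(int \<Rightarrow> complex) \<Rightarrow> nat \<Rightarrow> complex" where
  "actions z = (\<lambda>n. z (int n) * z (- int n))"

definition H0_act :: "(nat \<Rightarrow> complex) \<Rightarrow> complex" where
  "H0_act I = (\<Sum>\<^sub>\<infinity>n. of_real (2 * real n * pi) * I n)"

definition analytic_function_of_actions ::
    "((int \<Rightarrow> complex) \<Rightarrow> (int \<Rightarrow> complex)) \<Rightarrow> ((int \<Rightarrow> complex) \<Rightarrow> complex) \<Rightarrow> real \<Rightarrow> bool" where
  "analytic_function_of_actions \<Phi> H s \<longleftrightarrow>
     real_analytic_map (h0C s) Cspace (h0 s) \<real> (\<lambda>z. H (inv_into (h0 (-1)) \<Phi> z)) \<and>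
     (\<forall>z\<in>h0 s. \<forall>z'\<in>h0 s. actions z = actions z' \<longrightarrow>
        H (inv_into (h0 (-1)) \<Phi> z) = H (inv_into (h0 (-1)) \<Phi> z'))"

text \<open>The bracket relation includes the values \<open>{z\<^sub>-\<^sub>n, z\<^sub>n} = -\<i>\<close> forced by antisymmetry.\<close>

definition birkhoff_map ::
    "(int \<Rightarrow> complex) set \<Rightarrow> ((int \<Rightarrow> complex) \<Rightarrow> (int \<Rightarrow> complex)) \<Rightarrow> bool" where
  "birkhoff_map W \<Phi> \<longleftrightarrow>
     h0 (-1) \<subseteq> W \<and>
     analytic_map (h0C (-1)) (h0C (-1/2)) W \<Phi> \<and>
     \<Phi> 0 = 0 \<and>
     (\<forall>s\<ge>-1. bij_betw \<Phi> (h0 s) (h0 (s + 1/2)) \<and>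
        real_analytic_map (h0C s) (h0C (s + 1/2)) (h0 s) (h0 (s + 1/2)) \<Phi> \<and>
        real_analytic_map (h0C (s + 1/2)) (h0C s) (h0 (s + 1/2)) (h0 s) (inv_into (h0 (-1)) \<Phi>)) \<and>
     (\<forall>u\<in>W. \<forall>n m. n \<noteq> 0 \<longrightarrow> m \<noteq> 0 \<longrightarrow>
        gardner_bracket (\<lambda>v. \<Phi> v n) (\<lambda>v. \<Phi> v m) u = (if m = - n then of_int (sgn n) * \<i> else 0)) \<and>
     analytic_function_of_actions \<Phi> H1 (3/2) \<and>
     analytic_function_of_actions \<Phi> H2 (5/2) \<and>
     (\<forall>u\<in>h0 0. H0 u = H0_act (actions (\<Phi> u))) \<and>
     has_cderiv (h0C (-1)) (h0C (-1/2)) \<Phi> 0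
       (\<lambda>u n. of_real ((2 * real_of_int \<bar>n\<bar> * pi) powr (-1/2)) * u n)"

text \<open>\<open>H2\<close> as a function of the actions \<open>I\<close>, on \<open>lplus 5 1\<close>: its value at any potential with these actions.\<close>

definition H2_act :: "((int \<Rightarrow> complex) \<Rightarrow> (int \<Rightarrow> complex)) \<Rightarrow> (nat \<Rightarrow> complex) \<Rightarrow> complex" where
  "H2_act \<Phi> I = H2 (SOME u. u \<in> h0 2 \<and> actions (\<Phi> u) = I)"

definition H2_star :: "((int \<Rightarrow> complex) \<Rightarrow> (int \<Rightarrow> complex)) \<Rightarrow> (nat \<Rightarrow> complex) \<Rightarrow> complex" where
  "H2_star \<Phi> I = H2_act \<Phi> I - (\<Sum>\<^sub>\<infinity>n. of_real ((2 * real n * pi)^5) * I n) - 10 * (H0_act I)^2"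

text \<open>Partial derivative with respect to the action \<open>I\<^sub>n \<ge> 0\<close>, one-sided where \<open>I\<^sub>n = 0\<close>.\<close>

definition partial_action :: "nat \<Rightarrow> ((nat \<Rightarrow> complex) \<Rightarrow> complex) \<Rightarrow> (nat \<Rightarrow> complex) \<Rightarrow> complex" where
  "partial_action n F I = vector_derivative (\<lambda>t. F (I(n := of_real t))) (at (Re (I n)) within {0..})"

definition omega2_star :: "((int \<Rightarrow> complex) \<Rightarrow> (int \<Rightarrow> complex)) \<Rightarrow> (nat \<Rightarrow> complex) \<Rightarrow> nat \<Rightarrow> complex" where
  "omega2_star \<Phi> I = (\<lambda>n. if n = 0 then 0 else
     partial_action n (H2_act \<Phi>) I - of_real ((2 * real n * pi)^5)
       - 20 * of_real (2 * real n * pi) * H0_act I)"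

definition Lam :: "(nat \<Rightarrow> complex) \<Rightarrow> nat \<Rightarrow> complex" where
  "Lam J = (\<lambda>n. of_real (- 80 * (real n)\<^sup>2 * pi\<^sup>2) * J n)"

end

theory Submission
  imports Defs "HOL-Complex_Analysis.Complex_Analysis"
begin

text \<open>On finitely supported positive actions, \<open>\<omega>\<close> is the gradient of \<open>H2_star\<close>, because \<open>H2\<close> is analytic in
  the coordinates \<open>z\<^sub>n = z\<^sub>-\<^sub>n = \<surd>I\<^sub>n\<close>. Hence the integral \<open>G\<close> of an analytic extension \<open>g\<close> of \<open>\<omega>\<close> along rays
  extends \<open>H2_star\<close>, and \<open>\<partial>\<^sub>nG = g\<^sub>n\<close> spreads to the whole domain by the identity theorem on complex lines
  and by density.

  By Cauchy's estimates the second differential is continuous at \<open>0\<close>, so concavity reduces to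
  \<open>\<partial>\<omega>\<^sub>n/\<partial>I\<^sub>m(0) = - 80 \<pi>\<^sup>2 n\<^sup>2 \<delta>\<^sub>n\<^sub>m\<close>. This is read off from the evolution equation \<open>z\<^sub>n' = i (\<partial>H2/\<partial>I\<^sub>n) z\<^sub>n\<close> of KdV2 at
  trigonometric polynomials \<open>s u\<close>, expanded in \<open>s\<close>. The terms of order two determine the quadratic part
  of the Birkhoff map. The third order part of the map is unknown, but averaging along the periodic linear
  flow \<open>u\<^sub>k \<mapsto> exp (i (2 \<pi> k)\<^sup>5 t) u\<^sub>k\<close> removes it and leaves only resonant terms; the coefficient of
  \<open>|u\<^sub>m|\<^sup>2 u\<^sub>n\<close> gives the derivative.\<close>

section \<open>Normed complex sequence spaces and their holomorphic functions\<close>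

text \<open>Square roots of actions are not differentiable at 0, so the gradient property is first
  available only at entries \<open>I n > 0\<close>; the ray integral still covers all of
  \<open>lplus 5 1\<close>, because a coordinate with \<open>I n = 0\<close> contributes nothing to
  the radial derivative. The integral also forces the domain of the extension to be star-shaped
  about 0.

  The unknown third order part of the Birkhoff map enters the evolution equation twice, through the
  derivative along the linear vector field and through \<open>\<i> * om n\<close> times the
  coordinate. Both are collected in the time derivative of \<open>exp (- \<i> * om n * t)\<close>
  times the coordinate along the linear flow, and that derivative integrates to zero over the common
  period \<open>1 / (2 * pi) ^ 4\<close> of all modes.

  In the resonant sum the renormalising term \<open>20 * kn n * H0\<close> cancels the coupling of
  distinct indices: without it the second differential at 0 would have the entries
  \<open>20 * kn n * kn m\<close> off the diagonal. The factor 1/2 in the concavity estimate is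
  slack: the other half of \<open>Lam\<close> dominates the squared norm of h^1 and absorbs the
  variation of the second differential near 0.\<close>

lemma holomorphic_Taylor_bound:
  fixes g :: "complex \<Rightarrow> complex"
  assumes hol: "g holomorphic_on ball 0 r" and r: "0 < r" and M: "0 < M"
    and bd: "\<And>t. norm t < r \<Longrightarrow> norm (g t) \<le> M" and t: "norm t \<le> r / 2"
  shows "norm (g t - (\<Sum>i\<le>n. (deriv ^^ i) g 0 * t ^ i / fact i))
    \<le> 2 * real (Suc n) * 4 ^ Suc n * M * (norm t / r) ^ Suc n"
proof -
  \<comment> \<open>\<open>Cauchy_higher_deriv_bound\<close> asks for values in an open ball while
    the bound M is not strict, hence \<open>2 * M\<close>. The radius r / 4 keeps the discs around
    points of \<open>cball 0 (r/2)\<close> inside \<open>ball 0 r\<close>.\<close>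
  have bound: "norm ((deriv ^^ Suc n) g s) \<le> fact (Suc n) * (2 * M) / (r / 4) ^ Suc n"
    if s: "s \<in> cball 0 (r/2)" for s
  proof (rule Cauchy_higher_deriv_bound[where y = 0])
    have sub: "cball s (r/4) \<subseteq> ball 0 r"
    proof
      fix w assume "w \<in> cball s (r/4)"
      then have "norm (w - s) \<le> r/4" using norm_minus_commute[of w s] by (simp add: dist_norm)
      moreover have "norm s \<le> r/2" using s by simp
      ultimately have "norm w < r" using norm_triangle_ineq2[of w s] r by linarith
      then show "w \<in> ball 0 r" by simp
    qed
    show "g holomorphic_on ball s (r / 4)"
      using hol sub by (meson ball_subset_cball holomorphic_on_subset order_trans)
    show "continuous_on (cball s (r / 4)) g"
      using hol sub holomorphic_on_imp_continuous_on holomorphic_on_subset by blast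
    show "g w \<in> ball 0 (2 * M)" if "w \<in> ball s (r / 4)" for w
    proof -
      have "w \<in> ball 0 r" using sub that ball_subset_cball by blast
      then have "norm (g w) \<le> M" using bd by simp
      then show ?thesis using M by simp
    qed
  qed (use r in auto)
  have der: "((deriv ^^ i) g has_field_derivative (deriv ^^ Suc i) g x) (at x within cball 0 (r/2))"
    if "x \<in> cball 0 (r/2)" for i x
  proof -
    have "(deriv ^^ i) g holomorphic_on ball 0 r"
      by (rule holomorphic_higher_deriv[OF hol]) simp
    moreover have "x \<in> ball 0 r" using that r by simp
    ultimately have "((deriv ^^ i) g has_field_derivative deriv ((deriv ^^ i) g) x) (at x)"
      by (intro holomorphic_derivI[OF _ open_ball])
    then show ?thesis by (simp add: has_field_derivative_at_within)
  qed
  have "norm (g t - (\<Sum>i\<le>n. (deriv ^^ i) g 0 * (t - 0) ^ i / fact i))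
      \<le> (fact (Suc n) * (2 * M) / (r / 4) ^ Suc n) * norm (t - 0) ^ Suc n / fact n"
    using complex_Taylor[of "cball 0 (r/2)" n "\<lambda>i. (deriv ^^ i) g"
        "fact (Suc n) * (2 * M) / (r / 4) ^ Suc n" 0 t] bound der t r
    by (simp del: funpow.simps)
  also have "\<dots> = 2 * real (Suc n) * 4 ^ Suc n * M * (norm t / r) ^ Suc n"
  proof -
    have "K * F * (2 * M) / (r / 4) ^ m * T ^ m / F = 2 * K * 4 ^ m * M * (T / r) ^ m"
      if "F > 0" for K F T :: real and m
      using that by (simp add: power_divide)
    from this[of "fact n" "real (Suc n)" "Suc n"] show ?thesis by (simp add: fact_Suc del: power_Suc)
  qed
  finally show ?thesis by simp
qed

lemma Cspace_simps [simp]: "carr Cspace = UNIV" "smul Cspace = (*)" "nrm Cspace = norm"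
  by (simp_all add: Cspace_def)

lemma has_cderiv_Cspace:
  "has_cderiv X Cspace f x L \<longleftrightarrow> bounded_clin X Cspace L \<and>
    (\<forall>e>0. \<exists>d>0. \<forall>h\<in>carr X. nrm X h < d \<longrightarrow> norm (f (x + h) - f x - L h) \<le> e * nrm X h)"
  by (simp add: has_cderiv_def)

text \<open>The axioms on \<open>smul\<close> are not restricted to the carrier: scalars act on all functions.\<close>

locale cnorm =
  fixes X :: "'v::ab_group_add cspace"
  assumes carr_0 [simp]: "0 \<in> carr X"
    and carr_add [simp]: "x \<in> carr X \<Longrightarrow> y \<in> carr X \<Longrightarrow> x + y \<in> carr X"
    and carr_smul [simp]: "x \<in> carr X \<Longrightarrow> smul X c x \<in> carr X"
    and smul_add_right: "smul X c (x + y) = smul X c x + smul X c y"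
    and smul_add_left: "smul X (c + d) x = smul X c x + smul X d x"
    and smul_smul [simp]: "smul X c (smul X d x) = smul X (c * d) x"
    and smul_1 [simp]: "smul X 1 x = x"
    and nrm_nonneg [simp]: "0 \<le> nrm X x"
    and nrm_triangle: "x \<in> carr X \<Longrightarrow> y \<in> carr X \<Longrightarrow> nrm X (x + y) \<le> nrm X x + nrm X y"
    and nrm_smul: "x \<in> carr X \<Longrightarrow> nrm X (smul X c x) = norm c * nrm X x"
begin

lemma smul_0_left [simp]: "smul X 0 x = 0"
  using smul_add_left[of 0 0 x] by simp

lemma smul_0_right [simp]: "smul X c 0 = 0"
  using smul_add_right[of c 0 0] by simp

lemma smul_minus_left: "smul X (- c) x = - smul X c x"
  using smul_add_left[of "- c" c x] by (simp add: eq_neg_iff_add_eq_0)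

lemma smul_minus_1 [simp]: "smul X (- 1) x = - x"
  by (simp add: smul_minus_left)

lemma smul_diff_left: "smul X (c - d) x = smul X c x - smul X d x"
  using smul_add_left[of c "- d" x] by (simp add: smul_minus_left)

lemma carr_uminus [simp]: "x \<in> carr X \<Longrightarrow> - x \<in> carr X"
  using carr_smul[of x "- 1"] by simp

lemma carr_diff [simp]: "x \<in> carr X \<Longrightarrow> y \<in> carr X \<Longrightarrow> x - y \<in> carr X"
  using carr_add[of x "- y"] by simp

lemma nrm_0 [simp]: "nrm X 0 = 0"
  using nrm_smul[of 0 0] by simp

lemma nrm_minus: "x \<in> carr X \<Longrightarrow> nrm X (- x) = nrm X x"
  using nrm_smul[of x "- 1"] by simp

lemma nrm_diff_commute: "x \<in> carr X \<Longrightarrow> y \<in> carr X \<Longrightarrow> nrm X (x - y) = nrm X (y - x)"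
  using nrm_minus[of "x - y"] by simp

end

subsection \<open>Bounded linear maps and derivatives\<close>

lemma bounded_clinD:
  assumes "bounded_clin X Y L" "x \<in> carr X"
  shows "L x \<in> carr Y" "L (smul X c x) = smul Y c (L x)" "y \<in> carr X \<Longrightarrow> L (x + y) = L x + L y"
  using assms unfolding bounded_clin_def by auto

lemma bounded_clinI:
  assumes "\<And>x. x \<in> carr X \<Longrightarrow> L x \<in> carr Y"
    "\<And>x y. x \<in> carr X \<Longrightarrow> y \<in> carr X \<Longrightarrow> L (x + y) = L x + L y"
    "\<And>c x. x \<in> carr X \<Longrightarrow> L (smul X c x) = smul Y c (L x)"
    "\<And>x. x \<in> carr X \<Longrightarrow> nrm Y (L x) \<le> K * nrm X x"
  shows "bounded_clin X Y L"
  unfolding bounded_clin_def using assms by blast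

lemma cnorm_Cspace: "cnorm Cspace"
  by unfold_locales (auto simp: algebra_simps norm_mult norm_triangle_ineq)

lemma bounded_clin_bound:
  assumes "cnorm X" "bounded_clin X Y L"
  obtains K where "0 < K" "\<And>x. x \<in> carr X \<Longrightarrow> nrm Y (L x) \<le> K * nrm X x"
proof -
  obtain K where K: "\<And>x. x \<in> carr X \<Longrightarrow> nrm Y (L x) \<le> K * nrm X x"
    using assms(2) unfolding bounded_clin_def by blast
  show thesis
  proof (rule that)
    show "0 < \<bar>K\<bar> + 1" by simp
    fix x assume "x \<in> carr X"
    then show "nrm Y (L x) \<le> (\<bar>K\<bar> + 1) * nrm X x"
      using K[of x] mult_right_mono[of K "\<bar>K\<bar> + 1" "nrm X x"] cnorm.nrm_nonneg[OF assms(1), of x] by linarith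
  qed
qed

lemma bounded_clin_compose:
  assumes X: "cnorm X" and Y: "cnorm Y" and L: "bounded_clin X Y L" and M: "bounded_clin Y Z M"
  shows "bounded_clin X Z (\<lambda>v. M (L v))"
proof -
  obtain K where K: "\<And>x. x \<in> carr X \<Longrightarrow> nrm Y (L x) \<le> K * nrm X x" by (rule bounded_clin_bound[OF X L]) (rule that)
  obtain C where C: "C > 0" "\<And>x. x \<in> carr Y \<Longrightarrow> nrm Z (M x) \<le> C * nrm Y x" by (rule bounded_clin_bound[OF Y M]) (rule that)
  note l = bounded_clinD[OF L] and m = bounded_clinD[OF M]
  show ?thesis
  proof (rule bounded_clinI)
    show "nrm Z (M (L x)) \<le> (C * K) * nrm X x" if "x \<in> carr X" for x
      using order_trans[OF C(2)[OF l(1)[OF that]] mult_left_mono[OF K[OF that]]] C(1) by (simp add: mult.assoc)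
  qed (simp_all add: l m)
qed

lemma bounded_clin_diff:
  assumes X: "cnorm X" and L: "bounded_clin X Cspace L" and M: "bounded_clin X Cspace M"
  shows "bounded_clin X Cspace (\<lambda>v. L v - M v)"
proof -
  obtain K where K: "\<And>x. x \<in> carr X \<Longrightarrow> nrm Cspace (L x) \<le> K * nrm X x" by (rule bounded_clin_bound[OF X L]) (rule that)
  obtain C where C: "\<And>x. x \<in> carr X \<Longrightarrow> nrm Cspace (M x) \<le> C * nrm X x" by (rule bounded_clin_bound[OF X M]) (rule that)
  show ?thesis
  proof (rule bounded_clinI)
    show "nrm Cspace (L v - M v) \<le> (K + C) * nrm X v" if "v \<in> carr X" for v
      using norm_triangle_ineq4[of "L v" "M v"] K[OF that] C[OF that] by (simp add: distrib_right)
  qed (simp_all add: bounded_clinD[OF L] bounded_clinD[OF M] right_diff_distrib)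
qed

definition rmd :: "('v::ab_group_add \<Rightarrow> 'w::ab_group_add) \<Rightarrow> 'v \<Rightarrow> ('v \<Rightarrow> 'w) \<Rightarrow> 'v \<Rightarrow> 'w" where
  "rmd f x L h = f (x + h) - f x - L h"

lemma has_cderivI:
  assumes "bounded_clin X Y L"
    "\<And>e. 0 < e \<Longrightarrow> \<exists>d>0. \<forall>h\<in>carr X. nrm X h < d \<longrightarrow> rmd f x L h \<in> carr Y \<and> nrm Y (rmd f x L h) \<le> e * nrm X h"
  shows "has_cderiv X Y f x L"
  using assms unfolding has_cderiv_def rmd_def by blast

lemma has_cderivE:
  assumes "has_cderiv X Y f x L" "0 < e"
  obtains d where "0 < d" "\<And>h. h \<in> carr X \<Longrightarrow> nrm X h < d \<Longrightarrow> rmd f x L h \<in> carr Y"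
    "\<And>h. h \<in> carr X \<Longrightarrow> nrm X h < d \<Longrightarrow> nrm Y (rmd f x L h) \<le> e * nrm X h"
proof -
  have "\<forall>e>0. \<exists>d>0. \<forall>h\<in>carr X. nrm X h < d \<longrightarrow> rmd f x L h \<in> carr Y \<and> nrm Y (rmd f x L h) \<le> e * nrm X h"
    using assms(1) unfolding has_cderiv_def rmd_def by (rule conjunct2)
  from this[rule_format, OF assms(2)] show thesis using that by blast
qed

lemma has_cderiv_clin: "has_cderiv X Y f x L \<Longrightarrow> bounded_clin X Y L"
  by (simp add: has_cderiv_def)

lemma has_cderiv_continuous:
  assumes X: "cnorm X" and Y: "cnorm Y" and f: "has_cderiv X Y f x L" and e: "0 < e"
  obtains d where "0 < d" "\<And>h. h \<in> carr X \<Longrightarrow> nrm X h < d \<Longrightarrow> f (x + h) - f x \<in> carr Y"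
    "\<And>h. h \<in> carr X \<Longrightarrow> nrm X h < d \<Longrightarrow> nrm Y (f (x + h) - f x) \<le> e"
proof -
  interpret Y: cnorm Y by fact
  note bL = has_cderiv_clin[OF f]
  obtain K where K: "K > 0" "\<And>x. x \<in> carr X \<Longrightarrow> nrm Y (L x) \<le> K * nrm X x" by (rule bounded_clin_bound[OF X bL]) (rule that)
  obtain d where d: "0 < d" "\<And>h. h \<in> carr X \<Longrightarrow> nrm X h < d \<Longrightarrow> rmd f x L h \<in> carr Y"
    "\<And>h. h \<in> carr X \<Longrightarrow> nrm X h < d \<Longrightarrow> nrm Y (rmd f x L h) \<le> 1 * nrm X h" by (rule has_cderivE[OF f zero_less_one]) (rule that)
  have eq: "f (x + h) - f x = rmd f x L h + L h" for h by (simp add: rmd_def)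
  show thesis
  proof (rule that)
    show "0 < min d (e / (1 + K))" using d e K by simp
    fix h assume h: "h \<in> carr X" "nrm X h < min d (e / (1 + K))"
    then have c: "rmd f x L h \<in> carr Y" "L h \<in> carr Y" using d(2) bounded_clinD(1)[OF bL] by auto
    then show "f (x + h) - f x \<in> carr Y" unfolding eq by simp
    have "nrm Y (f (x + h) - f x) \<le> (1 + K) * nrm X h"
      unfolding eq using Y.nrm_triangle[OF c] d(3)[of h] K(2)[of h] h by (simp add: distrib_right)
    also have "\<dots> \<le> e" using h K by (simp add: pos_less_divide_eq mult.commute)
    finally show "nrm Y (f (x + h) - f x) \<le> e" .
  qed
qed

lemma has_cderiv_bounded_near:
  assumes X: "cnorm X" and Y: "cnorm Y" and f: "has_cderiv X Y f x L" and fx: "f x \<in> carr Y"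
  shows "\<exists>r>0. \<exists>M>0. \<forall>h\<in>carr X. nrm X h < r \<longrightarrow> f (x + h) \<in> carr Y \<and> nrm Y (f (x + h)) \<le> M"
proof -
  interpret Y: cnorm Y by fact
  obtain d where d: "0 < d" "\<And>h. h \<in> carr X \<Longrightarrow> nrm X h < d \<Longrightarrow> f (x + h) - f x \<in> carr Y"
    "\<And>h. h \<in> carr X \<Longrightarrow> nrm X h < d \<Longrightarrow> nrm Y (f (x + h) - f x) \<le> 1"
    by (rule has_cderiv_continuous[OF X Y f zero_less_one]) (rule that)
  have "f (x + h) \<in> carr Y \<and> nrm Y (f (x + h)) \<le> nrm Y (f x) + 1" if "h \<in> carr X" "nrm X h < d" for h
    using Y.nrm_triangle[OF fx d(2)[OF that]] Y.carr_add[OF fx d(2)[OF that]] d(3)[OF that] by simp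
  moreover have "nrm Y (f x) + 1 > 0" by (simp add: add_nonneg_pos)
  ultimately show ?thesis using d(1) by blast
qed

lemma has_cderiv_quadratic:
  assumes X: "cnorm X" and L: "bounded_clin X Y L" and C: "0 \<le> C"
    and f: "\<And>h. h \<in> carr X \<Longrightarrow> rmd f x L h \<in> carr Y" "\<And>h. h \<in> carr X \<Longrightarrow> nrm Y (rmd f x L h) \<le> C * (nrm X h)\<^sup>2"
  shows "has_cderiv X Y f x L"
proof (rule has_cderivI[OF L])
  fix e :: real assume e: "e > 0"
  have "nrm Y (rmd f x L h) \<le> e * nrm X h" if h: "h \<in> carr X" "nrm X h < e / (C + 1)" for h
  proof -
    have "C * nrm X h \<le> (C + 1) * nrm X h" using cnorm.nrm_nonneg[OF X] by (intro mult_right_mono) auto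
    also have "\<dots> \<le> e" using h(2) C by (simp add: pos_less_divide_eq mult.commute)
    finally show ?thesis
      using order_trans[OF f(2)[OF h(1)]] mult_right_mono[of "C * nrm X h" e "nrm X h"] cnorm.nrm_nonneg[OF X, of h]
      by (simp add: power2_eq_square mult.assoc)
  qed
  then show "\<exists>d>0. \<forall>h\<in>carr X. nrm X h < d \<longrightarrow> rmd f x L h \<in> carr Y \<and> nrm Y (rmd f x L h) \<le> e * nrm X h"
    using e C f(1) by (intro exI[of _ "e / (C + 1)"]) auto
qed

lemma has_cderiv_affine:
  assumes X: "cnorm X" and Y: "cnorm Y" and L: "bounded_clin X Y L" and f: "\<And>h. h \<in> carr X \<Longrightarrow> f (x + h) = f x + L h"
  shows "has_cderiv X Y f x L"
proof (rule has_cderiv_quadratic[OF X L order_refl])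
  interpret Y: cnorm Y by fact
  fix h assume h: "h \<in> carr X"
  then have "rmd f x L h = 0" using f[OF h] by (simp add: rmd_def)
  then show "rmd f x L h \<in> carr Y" "nrm Y (rmd f x L h) \<le> 0 * (nrm X h)\<^sup>2" by simp_all
qed

lemma has_cderiv_linear:
  assumes "cnorm X" "cnorm Y" "bounded_clin X Y L" "x \<in> carr X"
  shows "has_cderiv X Y L x L"
  by (rule has_cderiv_affine[OF assms(1-3)]) (rule bounded_clinD(3)[OF assms(3,4)])

lemma has_cderiv_chain:
  assumes X: "cnorm X" and Y: "cnorm Y" and Z: "cnorm Z" and f: "has_cderiv X Y f x L" and h: "has_cderiv Y Z h (f x) M"
  shows "has_cderiv X Z (\<lambda>x. h (f x)) x (\<lambda>v. M (L v))"
proof -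
  interpret X: cnorm X by fact
  interpret Y: cnorm Y by fact
  interpret Z: cnorm Z by fact
  note bL = has_cderiv_clin[OF f] and bM = has_cderiv_clin[OF h]
  obtain K where K: "K > 0" "\<And>x. x \<in> carr X \<Longrightarrow> nrm Y (L x) \<le> K * nrm X x" by (rule bounded_clin_bound[OF X bL]) (rule that)
  obtain C where C: "C > 0" "\<And>x. x \<in> carr Y \<Longrightarrow> nrm Z (M x) \<le> C * nrm Y x" by (rule bounded_clin_bound[OF Y bM]) (rule that)
  show ?thesis
  proof (rule has_cderivI[OF bounded_clin_compose[OF X Y bL bM]])
    fix e :: real assume e: "e > 0"
    define e1 where "e1 = min 1 (e / (2 * C))"
    define e2 where "e2 = e / (2 * (K + 1))"
    have e1: "e1 > 0" "e1 \<le> 1" "C * e1 \<le> e / 2" and e2: "e2 > 0" "e2 * (K + 1) = e / 2"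
      using e K C by (auto simp: e1_def e2_def min_def field_simps)
    obtain d1 where d1: "0 < d1" "\<And>v. v \<in> carr X \<Longrightarrow> nrm X v < d1 \<Longrightarrow> rmd f x L v \<in> carr Y"
      "\<And>v. v \<in> carr X \<Longrightarrow> nrm X v < d1 \<Longrightarrow> nrm Y (rmd f x L v) \<le> e1 * nrm X v" by (rule has_cderivE[OF f e1(1)]) (rule that)
    obtain d2 where d2: "0 < d2" "\<And>v. v \<in> carr Y \<Longrightarrow> nrm Y v < d2 \<Longrightarrow> rmd h (f x) M v \<in> carr Z"
      "\<And>v. v \<in> carr Y \<Longrightarrow> nrm Y v < d2 \<Longrightarrow> nrm Z (rmd h (f x) M v) \<le> e2 * nrm Y v" by (rule has_cderivE[OF h e2(1)]) (rule that)
    let ?r = "rmd (\<lambda>x. h (f x)) x (\<lambda>v. M (L v))"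
    have "?r v \<in> carr Z \<and> nrm Z (?r v) \<le> e * nrm X v" if v: "v \<in> carr X" "nrm X v < min d1 (d2 / (K + 1))" for v
    proof -
      define R where "R = rmd f x L v"
      have R: "R \<in> carr Y" "nrm Y R \<le> e1 * nrm X v" using d1(2,3)[OF v(1)] v(2) by (auto simp: R_def)
      note Lc = bounded_clinD(1)[OF bL v(1)]
      define w where "w = L v + R"
      have w: "w \<in> carr Y" using R Lc by (simp add: w_def)
      have "e1 * nrm X v \<le> 1 * nrm X v" using e1 by (intro mult_right_mono) auto
      then have wn: "nrm Y w \<le> (K + 1) * nrm X v"
        using Y.nrm_triangle[OF Lc R(1)] K(2)[OF v(1)] R(2) by (simp add: w_def distrib_right)
      also have "\<dots> < d2" using v(2) K by (simp add: pos_less_divide_eq mult.commute)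
      finally have wd: "nrm Y w < d2" .
      have fw: "f (x + v) = f x + w" by (simp add: w_def R_def rmd_def)
      have e: "?r v = rmd h (f x) M w + M R"
        using bounded_clinD(3)[OF bM Lc R(1)] by (simp add: rmd_def fw w_def)
      note c = d2(2)[OF w wd] bounded_clinD(1)[OF bM R(1)]
      have "nrm Z (?r v) \<le> e2 * nrm Y w + C * nrm Y R"
        unfolding e using Z.nrm_triangle[OF c] d2(3)[OF w wd] C(2)[OF R(1)] by linarith
      also have "\<dots> \<le> e2 * ((K + 1) * nrm X v) + C * (e1 * nrm X v)"
        using wn R(2) e2(1) C(1) by (intro add_mono mult_left_mono) auto
      also have "\<dots> = (e2 * (K + 1)) * nrm X v + (C * e1) * nrm X v" by simp
      also have "\<dots> \<le> e / 2 * nrm X v + e / 2 * nrm X v" unfolding e2(2) using e1(3) by (intro add_left_mono mult_right_mono) auto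
      finally show ?thesis unfolding e using c by simp
    qed
    then show "\<exists>d>0. \<forall>v\<in>carr X. nrm X v < d \<longrightarrow> ?r v \<in> carr Z \<and> nrm Z (?r v) \<le> e * nrm X v"
      using d1(1) d2(1) K(1) by (intro exI[of _ "min d1 (d2 / (K + 1))"]) auto
  qed
qed

lemma has_cderiv_add:
  assumes X: "cnorm X" and Y: "cnorm Y" and f: "has_cderiv X Y f x L" and h: "has_cderiv X Y h x M"
  shows "has_cderiv X Y (\<lambda>y. f y + h y) x (\<lambda>v. L v + M v)"
proof (rule has_cderivI)
  interpret X: cnorm X by fact
  interpret Y: cnorm Y by fact
  note bL = has_cderiv_clin[OF f] and bM = has_cderiv_clin[OF h]
  note l = bounded_clinD[OF bL] and m = bounded_clinD[OF bM]
  obtain K where K: "\<And>x. x \<in> carr X \<Longrightarrow> nrm Y (L x) \<le> K * nrm X x" by (rule bounded_clin_bound[OF X bL]) (rule that)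
  obtain C where C: "\<And>x. x \<in> carr X \<Longrightarrow> nrm Y (M x) \<le> C * nrm X x" by (rule bounded_clin_bound[OF X bM]) (rule that)
  show "bounded_clin X Y (\<lambda>v. L v + M v)"
  proof (rule bounded_clinI)
    show "nrm Y (L v + M v) \<le> (K + C) * nrm X v" if "v \<in> carr X" for v
      using Y.nrm_triangle[OF l(1)[OF that] m(1)[OF that]] K[OF that] C[OF that] by (simp add: distrib_right)
  qed (simp_all add: l m Y.smul_add_right)
  fix e :: real assume "e > 0"
  then have e: "e / 2 > 0" by simp
  obtain d1 where d1: "0 < d1" "\<And>v. v \<in> carr X \<Longrightarrow> nrm X v < d1 \<Longrightarrow> rmd f x L v \<in> carr Y"
    "\<And>v. v \<in> carr X \<Longrightarrow> nrm X v < d1 \<Longrightarrow> nrm Y (rmd f x L v) \<le> e / 2 * nrm X v" by (rule has_cderivE[OF f e]) (rule that)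
  obtain d2 where d2: "0 < d2" "\<And>v. v \<in> carr X \<Longrightarrow> nrm X v < d2 \<Longrightarrow> rmd h x M v \<in> carr Y"
    "\<And>v. v \<in> carr X \<Longrightarrow> nrm X v < d2 \<Longrightarrow> nrm Y (rmd h x M v) \<le> e / 2 * nrm X v" by (rule has_cderivE[OF h e]) (rule that)
  let ?r = "rmd (\<lambda>y. f y + h y) x (\<lambda>v. L v + M v)"
  have "?r v \<in> carr Y \<and> nrm Y (?r v) \<le> e * nrm X v" if v: "v \<in> carr X" "nrm X v < min d1 d2" for v
  proof -
    have "?r v = rmd f x L v + rmd h x M v" by (simp add: rmd_def)
    then show ?thesis
      using Y.nrm_triangle[OF d1(2)[OF v(1)] d2(2)[OF v(1)]] d1(2,3)[OF v(1)] d2(2,3)[OF v(1)] v(2) by simp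
  qed
  then show "\<exists>d>0. \<forall>v\<in>carr X. nrm X v < d \<longrightarrow> ?r v \<in> carr Y \<and> nrm Y (?r v) \<le> e * nrm X v"
    using d1(1) d2(1) by (intro exI[of _ "min d1 d2"]) auto
qed

text \<open>The bridge to one complex variable: for scalar maps this derivative is the usual one, so
  composing with an affine line makes the restrictions of a differentiable functional
  holomorphic.\<close>

lemma has_cderiv_Cspace_iff:
  "has_cderiv Cspace Cspace p z (\<lambda>v. p' * v) \<longleftrightarrow> (p has_field_derivative p') (at z)"
proof -
  have "bounded_clin Cspace Cspace (\<lambda>v. p' * v)"
    by (rule bounded_clinI[where K = "norm p'"]) (auto simp: algebra_simps norm_mult)
  moreover have "(\<forall>h :: complex. norm h < d \<longrightarrow> norm (p (z + h) - p z - p' * h) \<le> e * norm h) \<longleftrightarrow>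
    (\<forall>y. norm (y - z) < d \<longrightarrow> norm (p y - p z - p' * (y - z)) \<le> e * norm (y - z))" for d e :: real
  proof (intro iffI allI impI)
    fix y assume "\<forall>h. norm h < d \<longrightarrow> norm (p (z + h) - p z - p' * h) \<le> e * norm h" "norm (y - z) < d"
    from spec[OF this(1), of "y - z"] this(2) show "norm (p y - p z - p' * (y - z)) \<le> e * norm (y - z)" by simp
  next
    fix h :: complex assume "\<forall>y. norm (y - z) < d \<longrightarrow> norm (p y - p z - p' * (y - z)) \<le> e * norm (y - z)" "norm h < d"
    from spec[OF this(1), of "z + h"] this(2) show "norm (p (z + h) - p z - p' * h) \<le> e * norm h" by simp
  qed
  ultimately show ?thesis
    by (simp add: has_cderiv_def has_field_derivative_def has_derivative_at_alt bounded_linear_mult_right)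
qed

section \<open>Directional derivatives and Cauchy estimates on complex lines\<close>

context cnorm
begin

lemma has_cderiv_line:
  assumes d: "has_cderiv X Cspace f (x + smul X t h) L" and h: "h \<in> carr X"
  shows "((\<lambda>t. f (x + smul X t h)) has_field_derivative L h) (at t)"
proof -
  have "bounded_clin Cspace X (\<lambda>s. smul X s h)"
    by (rule bounded_clinI[where K = "nrm X h"]) (auto simp: h smul_add_left nrm_smul)
  then have "has_cderiv Cspace X (\<lambda>t. x + smul X t h) t (\<lambda>s. smul X s h)"
    by (rule has_cderiv_affine[OF cnorm_Cspace cnorm_axioms]) (simp add: smul_add_left add.assoc)
  from has_cderiv_chain[OF cnorm_Cspace cnorm_axioms cnorm_Cspace this d]
  have "has_cderiv Cspace Cspace (\<lambda>t. f (x + smul X t h)) t (\<lambda>s. L h * s)"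
    using bounded_clinD(2)[OF has_cderiv_clin[OF d] h] by (simp add: mult.commute)
  then show ?thesis by (simp add: has_cderiv_Cspace_iff)
qed

text \<open>Taken along a single complex line, so that the derivative becomes a function of the base
  point without a choice. It agrees with the Frechet derivative wherever the latter exists, see
  \<open>cdir_eq\<close>.\<close>

definition cdir :: "('v \<Rightarrow> complex) \<Rightarrow> 'v \<Rightarrow> 'v \<Rightarrow> complex" where
  "cdir f x h = deriv (\<lambda>t. f (x + smul X t h)) 0"

lemma cdir_eq: "has_cderiv X Cspace f x L \<Longrightarrow> h \<in> carr X \<Longrightarrow> cdir f x h = L h"
  unfolding cdir_def by (rule DERIV_imp_deriv) (rule has_cderiv_line, auto)

lemma has_cderiv_cong:
  assumes "has_cderiv X Y f x L" "\<And>h. h \<in> carr X \<Longrightarrow> L h = L' h"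
  shows "has_cderiv X Y f x L'"
proof -
  have "bounded_clin X Y L' \<longleftrightarrow> bounded_clin X Y L"
    using assms(2) by (simp add: bounded_clin_def)
  then show ?thesis using assms by (simp add: has_cderiv_def)
qed

lemma has_cderiv_cdir:
  "has_cderiv X Cspace f x L \<Longrightarrow> has_cderiv X Cspace f x (cdir f x)"
  using has_cderiv_cong cdir_eq by (metis (no_types, lifting))

lemma analytic_has_cderiv:
  "analytic_map X Cspace V f \<Longrightarrow> x \<in> V \<Longrightarrow> has_cderiv X Cspace f x (cdir f x)"
  unfolding analytic_map_def using has_cderiv_cdir by blast

lemma cdir_linear:
  assumes "has_cderiv X Cspace f x L"
  shows "h \<in> carr X \<Longrightarrow> k \<in> carr X \<Longrightarrow> cdir f x (h + k) = cdir f x h + cdir f x k"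
    and "h \<in> carr X \<Longrightarrow> cdir f x (smul X c h) = c * cdir f x h"
  using has_cderiv_cdir[OF assms] by (auto simp: has_cderiv_def bounded_clin_def)

text \<open>The data behind all Cauchy estimates: once a differentiable functional is bounded by M
  on the ball of radius r, its derivatives are controlled by r and M alone. Such constants are
  uniform in parameters, which is what integrals and limits require.\<close>

definition bounded_at :: "('v \<Rightarrow> complex) \<Rightarrow> 'v \<Rightarrow> real \<Rightarrow> real \<Rightarrow> bool" where
  "bounded_at f x r M \<longleftrightarrow> 0 < r \<and> 0 < M \<and> x \<in> carr X \<and>
     (\<forall>h\<in>carr X. nrm X h < r \<longrightarrow> norm (f (x + h)) \<le> M \<and> (\<exists>L. has_cderiv X Cspace f (x + h) L))"

lemma analytic_bounded_at:
  assumes "analytic_map X Cspace V f" "x \<in> V"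
  shows "\<exists>r M. bounded_at f x r M \<and> (\<forall>h\<in>carr X. nrm X h < r \<longrightarrow> x + h \<in> V)"
proof -
  obtain r M where r: "r > 0" "M > 0" "\<And>h. h \<in> carr X \<Longrightarrow> nrm X h < r \<Longrightarrow> norm (f (x + h)) \<le> M"
    using has_cderiv_bounded_near[OF cnorm_axioms cnorm_Cspace analytic_has_cderiv[OF assms]] by auto
  have V: "V \<subseteq> carr X" and o: "open_in X V" using assms by (auto simp: analytic_map_def open_in_def)
  obtain s where s: "s > 0" "\<And>y. y \<in> carr X \<Longrightarrow> nrm X (y - x) < s \<Longrightarrow> y \<in> V"
    using o assms(2) by (auto simp: open_in_def)
  have "x + h \<in> V" if "h \<in> carr X" "nrm X h < min r s" for h
    using s(2)[of "x + h"] that V assms(2) by auto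
  then show ?thesis
    using r s V assms
    by (intro exI[of _ "min r s"] exI[of _ M]) (auto simp: bounded_at_def analytic_map_def)
qed

lemma bounded_at_line_holomorphic:
  assumes b: "bounded_at f x r M" and h: "h \<in> carr X" and rho: "\<rho> * nrm X h \<le> r" "0 < \<rho>"
  shows "(\<lambda>t. f (x + smul X t h)) holomorphic_on ball 0 \<rho>"
    "\<And>t. norm t < \<rho> \<Longrightarrow> norm (f (x + smul X t h)) \<le> M"
proof -
  have *: "nrm X (smul X t h) < r" if "norm t < \<rho>" for t
  proof (cases "nrm X h = 0")
    case True then show ?thesis using b h by (simp add: nrm_smul bounded_at_def)
  next
    case False
    then have "norm t * nrm X h < \<rho> * nrm X h"
      using that nrm_nonneg[of h] by (intro mult_strict_right_mono) (auto simp: less_le)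
    then show ?thesis using rho h by (simp add: nrm_smul)
  qed
  show "norm (f (x + smul X t h)) \<le> M" if "norm t < \<rho>" for t
    using b *[OF that] h by (auto simp: bounded_at_def)
  show "(\<lambda>t. f (x + smul X t h)) holomorphic_on ball 0 \<rho>"
    unfolding holomorphic_on_def
  proof
    fix t :: complex assume "t \<in> ball 0 \<rho>"
    then have "nrm X (smul X t h) < r" using * by simp
    then obtain L where "has_cderiv X Cspace f (x + smul X t h) L"
      using b h by (auto simp: bounded_at_def)
    from has_cderiv_line[OF this h] show "(\<lambda>t. f (x + smul X t h)) field_differentiable at t within ball 0 \<rho>"
      using field_differentiable_at_within field_differentiable_def by blast
  qed
qed

lemma bounded_at_deriv:
  assumes "bounded_at f x r M"
  shows "has_cderiv X Cspace f x (cdir f x)"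
proof -
  obtain L where "has_cderiv X Cspace f (x + 0) L"
    using assms carr_0 nrm_0 unfolding bounded_at_def by fastforce
  then show ?thesis using has_cderiv_cdir by simp
qed

text \<open>The axioms of \<open>cnorm\<close> allow nonzero vectors of norm 0, and Cauchy estimates
  on a disc of radius \<open>r / nrm X h\<close> are meaningless for them. The definition of the
  derivative itself makes \<open>f\<close> constant in these directions.\<close>

lemma cdir_nrm_0:
  assumes "has_cderiv X Cspace f x L" "h \<in> carr X" "nrm X h = 0"
  shows "f (x + h) = f x" "cdir f x h = 0"
proof -
  have "bounded_clin X Cspace L" using assms by (auto simp: has_cderiv_Cspace)
  then have L: "L h = 0" using assms by (auto simp: bounded_clin_def)
  then show "cdir f x h = 0" using assms cdir_eq by simp
  obtain d where "d > 0" "\<And>k. k \<in> carr X \<Longrightarrow> nrm X k < d \<Longrightarrow>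
      norm (f (x + k) - f x - L k) \<le> 1 * nrm X k"
    using assms unfolding has_cderiv_Cspace by (meson zero_less_one)
  from this(2)[of h] this(1) show "f (x + h) = f x" using assms L by simp
qed

lemma cdir_bound:
  assumes b: "bounded_at f x r M" and h: "h \<in> carr X"
  shows "norm (cdir f x h) \<le> 16 * M / r * nrm X h"
proof (cases "nrm X h = 0")
  case True
  then show ?thesis using cdir_nrm_0(2)[OF bounded_at_deriv[OF b] h] by simp
next
  case False
  then have pos: "nrm X h > 0" using nrm_nonneg[of h] by linarith
  have r: "r > 0" "M > 0" using b by (auto simp: bounded_at_def)
  \<comment> \<open>On the line in direction h the functional is holomorphic and bounded by M for
    parameters of modulus below \<open>\<rho>\<close>. Cauchy's inequality then yields the constant
    4, which is rounded up to 16.\<close>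
  define \<rho> where "\<rho> = r / nrm X h"
  have rho: "\<rho> > 0" "\<rho> * nrm X h \<le> r" using pos r by (auto simp: \<rho>_def)
  note hol = bounded_at_line_holomorphic[OF b h rho(2,1)]
  define g where "g = (\<lambda>t. f (x + smul X t h))"
  have "norm ((deriv ^^ 1) g 0) \<le> fact 1 * (2 * M) / (\<rho>/2) ^ 1"
  proof (rule Cauchy_higher_deriv_bound[where y = 0])
    show "g holomorphic_on ball 0 (\<rho>/2)"
      by (rule holomorphic_on_subset[OF hol(1)[folded g_def]]) (use rho in auto)
    show "continuous_on (cball 0 (\<rho>/2)) g"
      by (rule holomorphic_on_imp_continuous_on, rule holomorphic_on_subset[OF hol(1)[folded g_def]])
         (use rho in auto)
    show "g w \<in> ball 0 (2 * M)" if "w \<in> ball 0 (\<rho> / 2)" for w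
    proof -
      have "norm w < \<rho>" using that rho by simp
      then have "norm (g w) \<le> M" using hol(2) by (simp add: g_def)
      then show ?thesis using r by simp
    qed
  qed (use rho in auto)
  then have "norm (cdir f x h) \<le> 4 * M / \<rho>" by (simp add: cdir_def g_def field_simps)
  also have "\<dots> = 4 * M / r * nrm X h" by (simp add: \<rho>_def)
  also have "\<dots> \<le> 16 * M / r * nrm X h"
    using r by (intro mult_right_mono divide_right_mono) auto
  finally show ?thesis .
qed

lemma cdir_remainder:
  assumes b: "bounded_at f x r M" and h: "h \<in> carr X" "nrm X h \<le> r / 2"
  shows "norm (f (x + h) - f x - cdir f x h) \<le> 64 * M / r\<^sup>2 * (nrm X h)\<^sup>2"
proof (cases "nrm X h = 0")
  case True
  then show ?thesis using cdir_nrm_0[OF bounded_at_deriv[OF b] h(1)] by simp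
next
  case False
  then have pos: "nrm X h > 0" using nrm_nonneg[of h] by linarith
  have r: "r > 0" "M > 0" using b by (auto simp: bounded_at_def)
  define \<rho> where "\<rho> = r / nrm X h"
  have rho: "\<rho> > 0" "\<rho> * nrm X h \<le> r" using pos r by (auto simp: \<rho>_def)
  \<comment> \<open>\<open>holomorphic_Taylor_bound\<close> reaches only the inner half of the disc,
    and the parameter 1 has to lie there.\<close>
  have rho2: "\<rho> \<ge> 2" using h pos by (simp add: \<rho>_def field_simps)
  note hol = bounded_at_line_holomorphic[OF b h(1) rho(2,1)]
  define g where "g = (\<lambda>t. f (x + smul X t h))"
  have "norm (g 1 - (\<Sum>i\<le>1. (deriv ^^ i) g 0 * 1 ^ i / fact i))
    \<le> 2 * real (Suc 1) * 4 ^ Suc 1 * M * (norm (1::complex) / \<rho>) ^ Suc 1"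
    by (rule holomorphic_Taylor_bound) (use hol rho r rho2 in \<open>auto simp: g_def\<close>)
  then have "norm (f (x + h) - f x - cdir f x h) \<le> 64 * M * (1 / \<rho>)\<^sup>2"
    by (simp add: g_def cdir_def power2_eq_square diff_diff_eq)
  also have "\<dots> = 64 * M / r\<^sup>2 * (nrm X h)\<^sup>2"
    by (simp add: \<rho>_def power_divide)
  finally show ?thesis .
qed

lemma lipschitz_near:
  assumes b: "bounded_at f x r M" and h: "h \<in> carr X" "nrm X h \<le> r / 2"
  shows "norm (f (x + h) - f x) \<le> 48 * M / r * nrm X h"
proof -
  have r: "r > 0" "M > 0" using b by (auto simp: bounded_at_def)
  have "norm (f (x + h) - f x) \<le> norm (cdir f x h) + norm (f (x + h) - f x - cdir f x h)"
    by (metis add.commute diff_add_cancel norm_triangle_ineq)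
  also have "\<dots> \<le> 16 * M / r * nrm X h + 64 * M / r\<^sup>2 * (nrm X h)\<^sup>2"
    using cdir_bound[OF b h(1)] cdir_remainder[OF b h] by linarith
  also have "64 * M / r\<^sup>2 * (nrm X h)\<^sup>2 \<le> 64 * M / r\<^sup>2 * (nrm X h * (r / 2))"
    unfolding power2_eq_square using h r by (intro mult_left_mono) auto
  also have "\<dots> = 32 * M / r * nrm X h" using r by (simp add: power2_eq_square)
  finally show ?thesis by (simp add: algebra_simps)
qed

lemma bounded_at_shift:
  assumes b: "bounded_at f x r M" and h: "h \<in> carr X" "nrm X h \<le> r / 2"
  shows "bounded_at f (x + h) (r / 2) M"
proof -
  have "nrm X (h + k) < r" if "k \<in> carr X" "nrm X k < r/2" for k
    using nrm_triangle[of h k] h that by simp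
  then show ?thesis using b h unfolding bounded_at_def by (auto simp: add.assoc)
qed

lemma ex_scale:
  assumes "r > 0" "u \<in> carr X"
  shows "\<exists>\<rho>>0. \<rho> * nrm X u \<le> r"
proof -
  have pos: "nrm X u + 1 > 0" using nrm_nonneg[of u] by linarith
  have "r / (nrm X u + 1) * nrm X u \<le> r / (nrm X u + 1) * (nrm X u + 1)"
    using assms pos by (intro mult_left_mono) auto
  also have "\<dots> = r" using pos by simp
  finally show ?thesis using assms pos by (intro exI[of _ "r / (nrm X u + 1)"]) auto
qed

text \<open>The remainder estimate depends only on r and M, so the difference quotients converge
  uniformly in the parameter t. Holomorphy and continuity in t thereby pass from the functional to
  its directional derivative, by the theorems on uniform limits.\<close>

lemma cdir_uniform_quotient:
  fixes F :: "'t \<Rightarrow> 'v \<Rightarrow> complex"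
  assumes b: "\<And>t. t \<in> S \<Longrightarrow> bounded_at (F t) (y t) r M" and h: "h \<in> carr X" and eta: "0 < \<eta>" "\<eta> * nrm X h \<le> r / 2"
  defines "s \<equiv> \<lambda>n. \<eta> * inverse (real (Suc n))"
  shows "uniform_limit S (\<lambda>n t. (F t (y t + smul X (of_real (s n)) h) - F t (y t)) / of_real (s n)) (\<lambda>t. cdir (F t) (y t) h) sequentially"
    and "s n > 0" "nrm X (smul X (of_real (s n)) h) \<le> r / 2"
proof -
  have s: "s n > 0" "s n \<le> \<eta>" for n using eta by (auto simp: s_def field_simps)
  then show "s n > 0" by blast
  have nh: "nrm X (smul X (of_real (s n)) h) = s n * nrm X h" "s n * nrm X h \<le> r / 2" for n
    using h s[of n] eta mult_right_mono[OF s(2)[of n], of "nrm X h"] by (simp_all add: nrm_smul less_imp_le)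
  then show "nrm X (smul X (of_real (s n)) h) \<le> r / 2" by simp
  define C where "C = 64 * M / r\<^sup>2 * (nrm X h)\<^sup>2"
  have close: "norm ((F t (y t + smul X (of_real (s n)) h) - F t (y t)) / of_real (s n) - cdir (F t) (y t) h) \<le> C * s n"
    if t: "t \<in> S" for n t
  proof -
    define e where "e = F t (y t + smul X (of_real (s n)) h) - F t (y t) - of_real (s n) * cdir (F t) (y t) h"
    have "norm e \<le> C * (s n)\<^sup>2"
      using cdir_remainder[OF b[OF t] carr_smul[OF h], of "of_real (s n)"] nh[of n] cdir_linear(2)[OF bounded_at_deriv[OF b[OF t]] h, of "of_real (s n)"]
      by (simp add: e_def C_def power_mult_distrib mult_ac)
    moreover have "(F t (y t + smul X (of_real (s n)) h) - F t (y t)) / of_real (s n) - cdir (F t) (y t) h = e / of_real (s n)"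
      using s[of n] by (simp add: e_def field_simps)
    ultimately show ?thesis using s[of n] by (simp add: norm_divide pos_divide_le_eq power2_eq_square mult.assoc)
  qed
  show "uniform_limit S (\<lambda>n t. (F t (y t + smul X (of_real (s n)) h) - F t (y t)) / of_real (s n)) (\<lambda>t. cdir (F t) (y t) h) sequentially"
    unfolding uniform_limit_iff
  proof (intro allI impI)
    fix e :: real assume e: "e > 0"
    have "(\<lambda>n. C * s n) \<longlonglongrightarrow> C * 0"
      unfolding s_def by (intro tendsto_mult tendsto_const tendsto_mult_right_zero[OF LIMSEQ_inverse_real_of_nat])
    then have "\<forall>\<^sub>F n in sequentially. C * s n < e" using e by (auto dest: order_tendstoD)
    then show "\<forall>\<^sub>F n in sequentially. \<forall>t\<in>S. dist ((F t (y t + smul X (of_real (s n)) h) - F t (y t)) / of_real (s n)) (cdir (F t) (y t) h) < e"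
      by eventually_elim (use le_less_trans[OF close] in \<open>simp add: dist_norm\<close>)
  qed
qed

lemma cdir_line_holomorphic_near:
  assumes b: "bounded_at f x r M" and h: "h \<in> carr X" and k: "k \<in> carr X"
    and rho: "\<rho> * nrm X k \<le> r / 2" "0 < \<rho>"
  shows "(\<lambda>t. cdir f (x + smul X t k) h) holomorphic_on ball 0 \<rho>"
proof -
  have r: "r > 0" using b by (auto simp: bounded_at_def)
  have b': "bounded_at f (x + smul X t k) (r / 2) M" if "t \<in> ball 0 \<rho>" for t
  proof -
    have "norm t * nrm X k \<le> \<rho> * nrm X k" using that by (intro mult_right_mono) auto
    then show ?thesis using bounded_at_shift[OF b carr_smul[OF k]] k rho by (simp add: nrm_smul)
  qed
  obtain \<eta> where eta: "\<eta> > 0" "\<eta> * nrm X h \<le> r / 2 / 2" using ex_scale[OF _ h, of "r / 2 / 2"] r by auto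
  note q = cdir_uniform_quotient[where S = "ball 0 \<rho>" and F = "\<lambda>_. f" and y = "\<lambda>t. x + smul X t k", OF b' h eta]
  show ?thesis
  proof (rule holomorphic_uniform_sequence[OF open_ball])
    fix n :: nat
    let ?s = "complex_of_real (\<eta> * inverse (real (Suc n)))"
    have b'': "bounded_at f (x + smul X ?s h) (r/2) M"
      using bounded_at_shift[OF b carr_smul[OF h], of ?s] q(3)[where n = n] r by linarith
    have "(\<lambda>t. f (x + smul X ?s h + smul X t k)) holomorphic_on ball 0 \<rho>"
      by (rule bounded_at_line_holomorphic(1)[OF b'' k rho])
    moreover have "(\<lambda>t. f (x + smul X t k)) holomorphic_on ball 0 \<rho>"
      by (rule bounded_at_line_holomorphic(1)[OF b k]) (use rho r in auto)
    ultimately show "(\<lambda>t. (f (x + smul X t k + smul X ?s h) - f (x + smul X t k)) / ?s) holomorphic_on ball 0 \<rho>"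
      using q(2)[where n = n] by (intro holomorphic_intros) (auto simp: add_ac)
  next
    fix t :: complex assume "t \<in> ball 0 \<rho>"
    then obtain d where "d > 0" "cball t d \<subseteq> ball 0 \<rho>" by (meson open_ball open_contains_cball)
    then show "\<exists>d>0. cball t d \<subseteq> ball 0 \<rho> \<and> uniform_limit (cball t d) (\<lambda>n t. (f (x + smul X t k + smul X (of_real (\<eta> * inverse (real (Suc n)))) h)
        - f (x + smul X t k)) / of_real (\<eta> * inverse (real (Suc n)))) (\<lambda>t. cdir f (x + smul X t k) h) sequentially"
      using uniform_limit_on_subset[OF q(1)] by blast
  qed
qed

text \<open>The summand 1 in the bound keeps it positive for v of norm 0, as
  \<open>holomorphic_Taylor_bound\<close> demands of its M. It is carried along in all later
  estimates of derivatives.\<close>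

lemma cdir_line_ball:
  assumes b: "bounded_at f x r M" and u: "u \<in> carr X" and v: "v \<in> carr X" and rho: "0 < \<rho>" "\<rho> * nrm X u \<le> r / 2"
  shows "(\<lambda>s. cdir f (x + smul X s u) v) holomorphic_on ball 0 \<rho>"
    and "\<And>s. norm s < \<rho> \<Longrightarrow> norm (cdir f (x + smul X s u) v) \<le> 32 * M / r * (nrm X v + 1)"
proof -
  have r: "r > 0" "M > 0" using b by (auto simp: bounded_at_def)
  show "(\<lambda>s. cdir f (x + smul X s u) v) holomorphic_on ball 0 \<rho>"
    by (rule cdir_line_holomorphic_near[OF b v u rho(2,1)])
  fix s :: complex assume s: "norm s < \<rho>"
  have "norm s * nrm X u \<le> \<rho> * nrm X u" using s by (intro mult_right_mono) auto
  then have "nrm X (smul X s u) \<le> r/2" using rho u by (simp add: nrm_smul)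
  from cdir_bound[OF bounded_at_shift[OF b carr_smul[OF u] this] v]
  have "norm (cdir f (x + smul X s u) v) \<le> 32 * M / r * nrm X v" by simp
  also have "\<dots> \<le> 32 * M / r * (nrm X v + 1)" using r by (intro mult_left_mono) auto
  finally show "norm (cdir f (x + smul X s u) v) \<le> 32 * M / r * (nrm X v + 1)" .
qed

lemma cdir_lipschitz:
  assumes b: "bounded_at f x r M" and u: "u \<in> carr X" "nrm X u \<le> \<eta>" and v: "v \<in> carr X"
    and \<eta>: "0 < \<eta>" "\<eta> \<le> r / 4"
  shows "norm (cdir f (x + u) v - cdir f x v) \<le> 512 * M * \<eta> / r\<^sup>2 * (nrm X v + 1)"
proof -
  have r: "r > 0" "M > 0" using b by (auto simp: bounded_at_def)
  \<comment> \<open>The disc is measured by the bound \<open>\<eta>\<close> and not by the norm of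
    u, which may be 0.\<close>
  define \<rho> where "\<rho> = r / (2 * \<eta>)"
  have rho: "\<rho> > 0" "1 \<le> \<rho> / 2" using r \<eta> by (auto simp: \<rho>_def field_simps)
  have "\<rho> * nrm X u \<le> \<rho> * \<eta>" using u(2) rho by (intro mult_left_mono) auto
  also have "\<dots> = r / 2" using \<eta> by (simp add: \<rho>_def)
  finally have ru: "\<rho> * nrm X u \<le> r / 2" .
  note h = cdir_line_ball[OF b u(1) v rho(1) ru]
  have Mb: "32 * M / r * (nrm X v + 1) > 0" using r by (simp add: add_nonneg_pos)
  from holomorphic_Taylor_bound[OF h(1) rho(1) Mb h(2), of 1 0] rho
  have "norm (cdir f (x + u) v - cdir f x v) \<le> 8 * (32 * M / r * (nrm X v + 1)) / \<rho>" by simp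
  also have "\<dots> = 512 * M * \<eta> / r\<^sup>2 * (nrm X v + 1)" using r \<eta> by (simp add: \<rho>_def power2_eq_square field_simps)
  finally show ?thesis .
qed

lemma cdir_continuous:
  assumes b: "bounded_at f x r M" and h: "h \<in> carr X" and e: "e > 0"
  shows "\<exists>d>0. \<forall>k\<in>carr X. nrm X k < d \<longrightarrow> norm (cdir f (x + k) h - cdir f x h) \<le> e"
proof -
  define D where "D = 512 * M / r\<^sup>2 * (nrm X h + 1)"
  have r: "r > 0" "D > 0" using b by (auto simp: bounded_at_def D_def add_nonneg_pos)
  define \<eta> where "\<eta> = min (r / 4) (e / D)"
  have \<eta>: "0 < \<eta>" "\<eta> \<le> r / 4" "\<eta> * D \<le> e" using r e by (auto simp: \<eta>_def min_def field_simps)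
  have "norm (cdir f (x + k) h - cdir f x h) \<le> e" if "k \<in> carr X" "nrm X k < \<eta>" for k
    using cdir_lipschitz[OF b that(1) less_imp_le[OF that(2)] h \<eta>(1,2)] \<eta>(3) by (simp add: D_def mult_ac)
  then show ?thesis using \<eta>(1) by blast
qed

lemma cdir_line_holomorphic:
  assumes an: "analytic_map X Cspace V f" and h: "h \<in> carr X" and k: "k \<in> carr X"
    and O: "open O'" "\<And>t. t \<in> O' \<Longrightarrow> x + smul X t k \<in> V"
  shows "(\<lambda>t. cdir f (x + smul X t k) h) holomorphic_on O'"
  unfolding holomorphic_on_def
proof
  fix t0 assume t0: "t0 \<in> O'"
  obtain r M where b: "bounded_at f (x + smul X t0 k) r M" using analytic_bounded_at[OF an O(2)[OF t0]] by blast
  have r: "r > 0" using b by (auto simp: bounded_at_def)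
  define \<rho> where "\<rho> = r / (2 * (nrm X k + 1))"
  have pos: "nrm X k + 1 > 0" using nrm_nonneg[of k] by linarith
  have rho: "\<rho> > 0" using r pos by (simp add: \<rho>_def)
  have "\<rho> * nrm X k \<le> \<rho> * (nrm X k + 1)" using rho by (intro mult_left_mono) auto
  also have "\<dots> = r/2" using pos by (simp add: \<rho>_def divide_simps)
  finally have rho': "\<rho> * nrm X k \<le> r/2" .
  have "(\<lambda>t. cdir f (x + smul X t0 k + smul X t k) h) holomorphic_on ball 0 \<rho>"
    by (rule cdir_line_holomorphic_near[OF b h k rho' rho])
  then have "(\<lambda>t. cdir f (x + smul X t0 k + smul X t k) h) field_differentiable at 0"
    using rho by (meson centre_in_ball holomorphic_on_imp_differentiable_at open_ball)
  then have "((\<lambda>t. cdir f (x + smul X t0 k + smul X t k) h) \<circ> (\<lambda>t. t - t0)) field_differentiable at t0"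
    by (intro field_differentiable_compose) (auto intro: derivative_intros)
  moreover have "(\<lambda>t. cdir f (x + smul X t0 k + smul X t k) h) \<circ> (\<lambda>t. t - t0) = (\<lambda>t. cdir f (x + smul X t k) h)"
    by (auto simp: fun_eq_iff add.assoc simp flip: smul_add_left)
  ultimately show "(\<lambda>t. cdir f (x + smul X t k) h) field_differentiable at t0 within O'"
    using field_differentiable_at_within by force
qed

lemma analytic_line_holomorphic:
  assumes an: "analytic_map X Cspace V f" and k: "k \<in> carr X"
    and O: "\<And>t. t \<in> O' \<Longrightarrow> x + smul X t k \<in> V"
  shows "(\<lambda>t. f (x + smul X t k)) holomorphic_on O'"
  unfolding holomorphic_on_def
proof
  fix t0 assume t0: "t0 \<in> O'"
  from has_cderiv_line[OF analytic_has_cderiv[OF an O[OF t0]] k]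
  show "(\<lambda>t. f (x + smul X t k)) field_differentiable at t0 within O'"
    using field_differentiable_at_within field_differentiable_def by blast
qed

lemma open_line_preimage:
  assumes "open_in X V" "x \<in> carr X" "k \<in> carr X"
  shows "open {t. x + smul X t k \<in> V}"
  unfolding open_contains_ball
proof
  fix t assume t: "t \<in> {t. x + smul X t k \<in> V}"
  then obtain r where r: "r > 0" "\<And>y. y \<in> carr X \<Longrightarrow> nrm X (y - (x + smul X t k)) < r \<Longrightarrow> y \<in> V"
    using assms by (auto simp: open_in_def)
  have pos: "nrm X k + 1 > 0" using nrm_nonneg[of k] by linarith
  have "x + smul X s k \<in> V" if "s \<in> ball t (r / (nrm X k + 1))" for s
  proof (rule r(2))
    have "x + smul X s k - (x + smul X t k) = smul X (s - t) k" by (simp add: smul_diff_left)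
    then have "nrm X (x + smul X s k - (x + smul X t k)) = norm (s - t) * nrm X k"
      using assms by (simp add: nrm_smul)
    also have "\<dots> \<le> norm (s - t) * (nrm X k + 1)" by (intro mult_left_mono) auto
    also have "\<dots> < r" using that pos by (simp add: dist_norm norm_minus_commute field_simps)
    finally show "nrm X (x + smul X s k - (x + smul X t k)) < r" .
  qed (use assms in auto)
  then show "\<exists>e>0. ball t e \<subseteq> {t. x + smul X t k \<in> V}"
    using r pos by (intro exI[of _ "r / (nrm X k + 1)"]) auto
qed

section \<open>Second derivatives at the origin\<close>

definition cdir2 :: "('v \<Rightarrow> complex) \<Rightarrow> 'v \<Rightarrow> 'v \<Rightarrow> complex" where
  "cdir2 f u v = deriv (\<lambda>s. cdir f (smul X s u) v) 0"

lemmas cdir_line_ball_0 = cdir_line_ball[of _ 0, unfolded add_0]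

lemma cdir2_deriv:
  assumes b: "bounded_at f 0 r M" and u: "u \<in> carr X" and v: "v \<in> carr X"
  shows "((\<lambda>s. cdir f (smul X s u) v) has_field_derivative cdir2 f u v) (at 0)"
proof -
  have "r/2 > 0" using b by (auto simp: bounded_at_def)
  then obtain \<rho> where rho: "\<rho> > 0" "\<rho> * nrm X u \<le> r/2" using ex_scale u by blast
  show ?thesis unfolding cdir2_def
    by (rule holomorphic_derivI[OF cdir_line_ball_0(1)[OF b u v rho]]) (use rho in auto)
qed

lemma cdir_expansion:
  assumes b: "bounded_at f 0 r M"
  shows "\<exists>C>0. \<forall>u\<in>carr X. \<forall>v\<in>carr X. nrm X u \<le> r / 4 \<longrightarrow>
    norm (cdir f u v - cdir f 0 v - cdir2 f u v) \<le> C * (nrm X u)\<^sup>2 * (nrm X v + 1)"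
proof -
  have r: "r > 0" "M > 0" using b by (auto simp: bounded_at_def)
  define C where "C = 64 * (32 * M / r) * (2 / r)\<^sup>2"
  have "norm (cdir f u v - cdir f 0 v - cdir2 f u v) \<le> C * (nrm X u)\<^sup>2 * (nrm X v + 1)"
    if u: "u \<in> carr X" and v: "v \<in> carr X" and ur: "nrm X u \<le> r / 4" for u v
  proof (cases "nrm X u = 0")
    \<comment> \<open>The whole line has norm 0 here, so the functional is bounded on discs of every
      radius \<open>\<rho>\<close>. Letting \<open>\<rho>\<close> tend to infinity removes the
      remainder, as in Liouville's theorem.\<close>
    case True
    define g where "g = (\<lambda>s. cdir f (smul X s u) v)"
    have vp: "nrm X v + 1 > 0" using nrm_nonneg[of v] by linarith
    have *: "norm (cdir f u v - cdir f 0 v - cdir2 f u v) \<le> 64 * (32 * M / r * (nrm X v + 1)) * (1 / \<rho>)\<^sup>2"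
      if "\<rho> \<ge> 2" for \<rho>
    proof -
      have "norm (g 1 - (\<Sum>i\<le>1. (deriv ^^ i) g 0 * 1 ^ i / fact i))
        \<le> 2 * real (Suc 1) * 4 ^ Suc 1 * (32 * M / r * (nrm X v + 1)) * (norm (1::complex) / \<rho>) ^ Suc 1"
        by (rule holomorphic_Taylor_bound)
          (use cdir_line_ball_0[OF b u v, of \<rho>] True r that vp in \<open>auto simp: g_def\<close>)
      also have "\<dots> \<le> 64 * (32 * M / r * (nrm X v + 1)) * (1 / \<rho>)\<^sup>2"
        using r vp by (simp add: power2_eq_square)
      finally show ?thesis by (simp add: g_def cdir2_def diff_diff_eq)
    qed
    define K where "K = 64 * (32 * M / r * (nrm X v + 1))"
    have "((\<lambda>\<rho>. K * (1 / \<rho>)\<^sup>2) \<longlongrightarrow> K * 0\<^sup>2) at_top"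
      by (intro tendsto_intros tendsto_divide_0[OF tendsto_const] filterlim_at_top_imp_at_infinity filterlim_ident)
    moreover have "\<forall>\<^sub>F \<rho> in at_top. norm (cdir f u v - cdir f 0 v - cdir2 f u v) \<le> K * (1 / \<rho>)\<^sup>2"
      using * eventually_ge_at_top[of 2] unfolding K_def by (rule eventually_mono[rotated]) auto
    ultimately have "norm (cdir f u v - cdir f 0 v - cdir2 f u v) \<le> K * 0\<^sup>2"
      by (rule tendsto_lowerbound) simp
    then show ?thesis using True by simp
  next
    case False
    then have pos: "nrm X u > 0" using nrm_nonneg[of u] by linarith
    define g where "g = (\<lambda>s. cdir f (smul X s u) v)"
    define \<rho> where "\<rho> = r / (2 * nrm X u)"
    have rho: "\<rho> > 0" "\<rho> * nrm X u \<le> r/2" "\<rho> \<ge> 2" using pos r ur by (auto simp: \<rho>_def field_simps)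
    have vp: "nrm X v + 1 > 0" using nrm_nonneg[of v] by linarith
    have "norm (g 1 - (\<Sum>i\<le>1. (deriv ^^ i) g 0 * 1 ^ i / fact i))
      \<le> 2 * real (Suc 1) * 4 ^ Suc 1 * (32 * M / r * (nrm X v + 1)) * (norm (1::complex) / \<rho>) ^ Suc 1"
      by (rule holomorphic_Taylor_bound)
        (use cdir_line_ball_0[OF b u v, of \<rho>] rho r vp in \<open>auto simp: g_def\<close>)
    also have "\<dots> \<le> 64 * (32 * M / r * (nrm X v + 1)) * (1 / \<rho>)\<^sup>2"
      using r vp by (simp add: power2_eq_square)
    also have "\<dots> = C * (nrm X u)\<^sup>2 * (nrm X v + 1)"
      by (simp add: C_def \<rho>_def power_divide power_mult_distrib)
    finally show ?thesis by (simp add: g_def cdir2_def diff_diff_eq)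
  qed
  moreover have "C > 0" using r by (simp add: C_def)
  ultimately show ?thesis by blast
qed

lemma cdir2_add_right:
  assumes b: "bounded_at f 0 r M" and u: "u \<in> carr X" and v: "v \<in> carr X" and w: "w \<in> carr X"
  shows "cdir2 f u (v + w) = cdir2 f u v + cdir2 f u w"
proof -
  have r: "r/2 > 0" using b by (auto simp: bounded_at_def)
  then obtain \<rho> where rho: "\<rho> > 0" "\<rho> * nrm X u \<le> r/2" using ex_scale u by blast
  have eq: "cdir f (smul X s u) (v + w) = cdir f (smul X s u) v + cdir f (smul X s u) w" if "norm s < \<rho>" for s
  proof -
    have "norm s * nrm X u \<le> \<rho> * nrm X u" using that by (intro mult_right_mono) auto
    then have "nrm X (smul X s u) < r" using rho u r by (simp add: nrm_smul)
    then obtain L where "has_cderiv X Cspace f (smul X s u) L"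
      using b u unfolding bounded_at_def by (metis add_0 carr_smul)
    then show ?thesis using cdir_linear(1) v w by blast
  qed
  have "((\<lambda>s. cdir f (smul X s u) v + cdir f (smul X s u) w) has_field_derivative cdir2 f u v + cdir2 f u w) (at 0)"
    by (intro derivative_intros cdir2_deriv[OF b u] v w)
  then have "((\<lambda>s. cdir f (smul X s u) (v + w)) has_field_derivative cdir2 f u v + cdir2 f u w) (at 0)"
    by (rule has_field_derivative_transform_within_open[of _ _ _ "ball 0 \<rho>"]) (use rho eq in auto)
  then show ?thesis using cdir2_deriv[OF b u carr_add[OF v w]] DERIV_unique by blast
qed

lemma cdir2_smul_right:
  assumes b: "bounded_at f 0 r M" and u: "u \<in> carr X" and v: "v \<in> carr X"
  shows "cdir2 f u (smul X c v) = c * cdir2 f u v"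
proof -
  have r: "r/2 > 0" using b by (auto simp: bounded_at_def)
  then obtain \<rho> where rho: "\<rho> > 0" "\<rho> * nrm X u \<le> r/2" using ex_scale u by blast
  have eq: "cdir f (smul X s u) (smul X c v) = c * cdir f (smul X s u) v" if "norm s < \<rho>" for s
  proof -
    have "norm s * nrm X u \<le> \<rho> * nrm X u" using that by (intro mult_right_mono) auto
    then have "nrm X (smul X s u) < r" using rho u r by (simp add: nrm_smul)
    then obtain L where "has_cderiv X Cspace f (smul X s u) L"
      using b u unfolding bounded_at_def by (metis add_0 carr_smul)
    then show ?thesis using cdir_linear(2) v by blast
  qed
  have "((\<lambda>s. c * cdir f (smul X s u) v) has_field_derivative c * cdir2 f u v) (at 0)"
    by (intro derivative_intros DERIV_cmult cdir2_deriv[OF b u] v)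
  then have "((\<lambda>s. cdir f (smul X s u) (smul X c v)) has_field_derivative c * cdir2 f u v) (at 0)"
    by (rule has_field_derivative_transform_within_open[of _ _ _ "ball 0 \<rho>"]) (use rho eq in auto)
  then show ?thesis using cdir2_deriv[OF b u carr_smul[OF v]] DERIV_unique by blast
qed

lemma cdir2_smul_left:
  assumes b: "bounded_at f 0 r M" and u: "u \<in> carr X" and v: "v \<in> carr X"
  shows "cdir2 f (smul X c u) v = c * cdir2 f u v"
proof -
  have "((\<lambda>s. cdir f (smul X s u) v) has_field_derivative cdir2 f u v) (at (c * 0))"
    using cdir2_deriv[OF b u v] by simp
  from DERIV_chain2[OF this DERIV_cmult_Id]
  have "((\<lambda>s. cdir f (smul X (c * s) u) v) has_field_derivative cdir2 f u v * c) (at 0)" by simp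
  then show ?thesis
    using cdir2_deriv[OF b carr_smul[OF u] v, of c] DERIV_unique by (force simp: mult.commute)
qed

text \<open>Both mixed derivatives are the leading coefficient of the same second difference.\<close>

lemma second_difference:
  assumes b: "bounded_at f 0 r M" and u: "u \<in> carr X" and v: "v \<in> carr X"
  shows "\<exists>K. \<exists>d>0. \<forall>s. 0 < s \<longrightarrow> s < d \<longrightarrow>
    norm (f (smul X (of_real s) (u + v)) - f (smul X (of_real s) u) - f (smul X (of_real s) v) + f 0
      - of_real s ^ 2 * cdir2 f u v) \<le> K * s ^ 3"
proof -
  have r: "r > 0" "M > 0" using b by (auto simp: bounded_at_def)
  obtain C where C: "C > 0" "\<And>u v. u \<in> carr X \<Longrightarrow> v \<in> carr X \<Longrightarrow> nrm X u \<le> r / 4 \<Longrightarrow>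
    norm (cdir f u v - cdir f 0 v - cdir2 f u v) \<le> C * (nrm X u)\<^sup>2 * (nrm X v + 1)"
    using cdir_expansion[OF b] by blast
  obtain \<rho> where rho: "\<rho> > 0" "\<rho> * nrm X u \<le> r/4" using ex_scale[OF _ u, of "r/4"] r by auto
  obtain \<sigma> where sig: "\<sigma> > 0" "\<sigma> * nrm X v \<le> r/4" using ex_scale[OF _ v, of "r/4"] r by auto
  define U where "U = nrm X u + 1"
  have U: "U > 0" "nrm X u \<le> U" using nrm_nonneg[of u] by (simp_all add: U_def add_nonneg_pos)
  define d where "d = min \<rho> (\<sigma>/2)"
  define K where "K = 64 * (96 * M / r * U) / \<sigma>\<^sup>2 + C * (nrm X u)\<^sup>2 * (nrm X v + 1)"
  have "norm (f (smul X (of_real s) (u + v)) - f (smul X (of_real s) u) - f (smul X (of_real s) v) + f 0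
      - of_real s ^ 2 * cdir2 f u v) \<le> K * s ^ 3" if s: "0 < s" "s < d" for s
  proof -
    have su: "nrm X (smul X (of_real s) u) \<le> r/4"
    proof -
      have "s * nrm X u \<le> \<rho> * nrm X u" using s by (intro mult_right_mono) (auto simp: d_def)
      then show ?thesis using s rho u by (simp add: nrm_smul)
    qed
    have tv: "nrm X (smul X t v) \<le> r/4" if "norm t < \<sigma>" for t
    proof -
      have "norm t * nrm X v \<le> \<sigma> * nrm X v" using that by (intro mult_right_mono) auto
      then show ?thesis using sig v by (simp add: nrm_smul)
    qed
    have bu: "bounded_at f (smul X (of_real s) u) (r/2) M"
      using bounded_at_shift[OF b, of "smul X (of_real s) u"] u su r by simp
    \<comment> \<open>The second difference at s is \<open>k s - k 0\<close>. By the Lipschitz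
      estimate k is of size O(s) on a disc whose radius does not depend on s, so its Taylor
      remainder of order two at the point s is O(s^3).\<close>
    define k where "k = (\<lambda>t. f (smul X (of_real s) u + smul X t v) - f (smul X t v))"
    have k: "k holomorphic_on ball 0 \<sigma>"
      unfolding k_def
      using bounded_at_line_holomorphic(1)[OF bu v _ sig(1)] bounded_at_line_holomorphic(1)[OF b v _ sig(1)] sig r
      by (intro holomorphic_intros) auto
    have kb: "norm (k t) \<le> 96 * M / r * U * s" if t: "norm t < \<sigma>" for t
    proof -
      have bt: "bounded_at f (smul X t v) (r/2) M"
        using bounded_at_shift[OF b, of "smul X t v"] v tv[OF t] r by simp
      have "norm (f (smul X t v + smul X (of_real s) u) - f (smul X t v)) \<le> 48 * M / (r/2) * nrm X (smul X (of_real s) u)"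
        by (rule lipschitz_near[OF bt]) (use u su in auto)
      also have "\<dots> = 96 * M / r * (s * nrm X u)" using u s by (simp add: nrm_smul)
      also have "\<dots> \<le> 96 * M / r * (s * U)" using r U s by (intro mult_left_mono) auto
      finally show ?thesis by (simp add: k_def algebra_simps)
    qed
    have kd: "deriv k 0 = cdir f (smul X (of_real s) u) v - cdir f 0 v"
    proof (rule DERIV_imp_deriv)
      have "has_cderiv X Cspace f (smul X (of_real s) u + smul X 0 v) (cdir f (smul X (of_real s) u))"
        using bounded_at_deriv[OF bu] by simp
      note 1 = has_cderiv_line[OF this v]
      have "has_cderiv X Cspace f (0 + smul X 0 v) (cdir f 0)" using bounded_at_deriv[OF b] by simp
      note 2 = has_cderiv_line[OF this v]
      show "(k has_field_derivative cdir f (smul X (of_real s) u) v - cdir f 0 v) (at 0)"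
        using DERIV_diff[OF 1 2] by (simp add: k_def)
    qed
    have "norm (k (of_real s) - (\<Sum>i\<le>1. (deriv ^^ i) k 0 * of_real s ^ i / fact i))
      \<le> 2 * real (Suc 1) * 4 ^ Suc 1 * (96 * M / r * U * s) * (norm (complex_of_real s) / \<sigma>) ^ Suc 1"
      by (rule holomorphic_Taylor_bound) (use k kb s r U sig in \<open>auto simp: d_def\<close>)
    also have "\<dots> = 64 * (96 * M / r * U) / \<sigma>\<^sup>2 * s ^ 3"
      using s by (simp add: power2_eq_square power3_eq_cube)
    finally have 1: "norm (k (of_real s) - k 0 - of_real s * deriv k 0) \<le> 64 * (96 * M / r * U) / \<sigma>\<^sup>2 * s ^ 3"
      by (simp add: diff_diff_eq mult.commute)
    define A where "A = C * (nrm X u)\<^sup>2 * (nrm X v + 1)"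
    have "norm (deriv k 0 - of_real s * cdir2 f u v) \<le> C * (nrm X (smul X (of_real s) u))\<^sup>2 * (nrm X v + 1)"
      using C(2)[OF carr_smul[OF u] v su] cdir2_smul_left[OF b u v] kd by simp
    also have "\<dots> = s\<^sup>2 * A"
      using s u by (simp add: A_def nrm_smul power_mult_distrib)
    finally have "s * norm (deriv k 0 - of_real s * cdir2 f u v) \<le> s * (s\<^sup>2 * A)"
      using s by (intro mult_left_mono) auto
    also have "s * (s\<^sup>2 * A) = A * s ^ 3" by (simp add: power2_eq_square power3_eq_cube)
    finally have 2: "norm (of_real s * (deriv k 0 - of_real s * cdir2 f u v)) \<le> A * s ^ 3"
      using s unfolding norm_mult by simp
    have "f (smul X (of_real s) (u + v)) - f (smul X (of_real s) u) - f (smul X (of_real s) v) + f 0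
      - of_real s ^ 2 * cdir2 f u v = (k (of_real s) - k 0 - of_real s * deriv k 0)
        + of_real s * (deriv k 0 - of_real s * cdir2 f u v)"
      by (simp add: k_def smul_add_right power2_eq_square algebra_simps)
    then have "norm (f (smul X (of_real s) (u + v)) - f (smul X (of_real s) u) - f (smul X (of_real s) v) + f 0
      - of_real s ^ 2 * cdir2 f u v) \<le> 64 * (96 * M / r * U) / \<sigma>\<^sup>2 * s ^ 3
        + A * s ^ 3"
      using norm_triangle_mono[OF 1 2] by metis
    then show ?thesis by (simp add: K_def A_def distrib_right)
  qed
  moreover have "d > 0" using rho sig by (simp add: d_def)
  ultimately show ?thesis by blast
qed

lemma cdir2_commute:
  assumes b: "bounded_at f 0 r M" and u: "u \<in> carr X" and v: "v \<in> carr X"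
  shows "cdir2 f u v = cdir2 f v u"
proof (rule ccontr)
  assume ne: "cdir2 f u v \<noteq> cdir2 f v u"
  define \<eta> where "\<eta> = norm (cdir2 f u v - cdir2 f v u)"
  have eta: "\<eta> > 0" using ne by (simp add: \<eta>_def)
  define \<phi> where "\<phi> = (\<lambda>s. f (smul X (of_real s) (u + v)) - f (smul X (of_real s) u) - f (smul X (of_real s) v) + f 0)"
  obtain K1 d1 where 1: "d1 > 0" "\<And>s. 0 < s \<Longrightarrow> s < d1 \<Longrightarrow> norm (\<phi> s - of_real s ^ 2 * cdir2 f u v) \<le> K1 * s ^ 3"
    using second_difference[OF b u v] unfolding \<phi>_def by blast
  obtain K2 d2 where 2: "d2 > 0" "\<And>s. 0 < s \<Longrightarrow> s < d2 \<Longrightarrow> norm (\<phi> s - of_real s ^ 2 * cdir2 f v u) \<le> K2 * s ^ 3"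
  proof -
    have "\<phi> s = f (smul X (of_real s) (v + u)) - f (smul X (of_real s) v) - f (smul X (of_real s) u) + f 0" for s
      by (simp add: \<phi>_def add.commute[of u v])
    then show thesis using second_difference[OF b v u] that by metis
  qed
  define K where "K = \<bar>K1\<bar> + \<bar>K2\<bar> + 1"
  have K: "K > 0" by (simp add: K_def add_nonneg_pos)
  define s where "s = min (min (d1/2) (d2/2)) (\<eta> / (2 * K))"
  have s: "0 < s" "s < d1" "s < d2" "s * K \<le> \<eta>/2"
  proof -
    show "0 < s" "s < d1" "s < d2" using 1(1) 2(1) eta K by (auto simp: s_def)
    have "s * K \<le> \<eta> / (2 * K) * K" using K by (intro mult_right_mono) (auto simp: s_def)
    then show "s * K \<le> \<eta>/2" using K by simp
  qed
  have "of_real s ^ 2 * (cdir2 f u v - cdir2 f v u) =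
      (\<phi> s - of_real s ^ 2 * cdir2 f v u) - (\<phi> s - of_real s ^ 2 * cdir2 f u v)"
    by (simp add: algebra_simps)
  then have "norm (of_real s ^ 2 * (cdir2 f u v - cdir2 f v u)) \<le> K2 * s ^ 3 + K1 * s ^ 3"
    using norm_triangle_ineq4 1(2)[OF s(1,2)] 2(2)[OF s(1,3)] by (smt (verit))
  also have "\<dots> \<le> K * s ^ 3"
    using s by (simp add: K_def flip: distrib_right)
  also have "\<dots> = s\<^sup>2 * (s * K)" by (simp add: power2_eq_square power3_eq_cube)
  also have "\<dots> \<le> s\<^sup>2 * (\<eta>/2)" using s by (intro mult_left_mono) auto
  finally have "s\<^sup>2 * \<eta> \<le> s\<^sup>2 * (\<eta>/2)" by (simp add: norm_mult \<eta>_def norm_power)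
  then show False using s eta by simp
qed

lemma cdir2_add_left:
  assumes "bounded_at f 0 r M" "u \<in> carr X" "v \<in> carr X" "w \<in> carr X"
  shows "cdir2 f (u + v) w = cdir2 f u w + cdir2 f v w"
  using cdir2_add_right[OF assms(1,4,2,3)] cdir2_commute[OF assms(1)] assms(2-4) by simp

lemma value_expansion:
  assumes b: "bounded_at f 0 r M"
  shows "\<exists>C>0. \<forall>u\<in>carr X. \<forall>s. norm s * nrm X u \<le> r / 4 \<longrightarrow>
    norm (f (smul X s u) - f 0 - s * cdir f 0 u - s\<^sup>2 * cdir2 f u u / 2) \<le> C * (norm s * (nrm X u + 1)) ^ 3"
proof -
  have r: "r > 0" "M > 0" using b by (auto simp: bounded_at_def)
  define C where "C = 384 * M * (2 / r + 2) ^ 3"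
  have C: "C > 0" unfolding C_def using r by (intro mult_pos_pos zero_less_power add_pos_pos) auto
  have "norm (f (smul X s u) - f 0 - s * cdir f 0 u - s\<^sup>2 * cdir2 f u u / 2) \<le> C * (norm s * (nrm X u + 1)) ^ 3"
    if u: "u \<in> carr X" and s: "norm s * nrm X u \<le> r / 4" for u s
  proof -
    define U where "U = nrm X u"
    have U: "U \<ge> 0" by (simp add: U_def)
    define \<rho> where "\<rho> = (if U = 0 then 2 * norm s + 1 else r / (2 * U))"
    have rho: "\<rho> > 0" "\<rho> * U \<le> r/2" "norm s \<le> \<rho>/2"
    proof -
      show "\<rho> > 0" using r U by (auto simp: \<rho>_def intro: add_nonneg_pos)
      show "\<rho> * U \<le> r/2" using r U by (auto simp: \<rho>_def)
      have "norm s \<le> r / (2 * U) / 2" if "U \<noteq> 0"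
      proof -
        have "U > 0" using that U by simp
        then show ?thesis using s by (simp add: U_def pos_le_divide_eq mult_ac)
      qed
      then show "norm s \<le> \<rho>/2" by (auto simp: \<rho>_def)
    qed
    define g where "g = (\<lambda>t. f (smul X t u))"
    have hol: "g holomorphic_on ball 0 \<rho>" "\<And>t. norm t < \<rho> \<Longrightarrow> norm (g t) \<le> M"
      unfolding g_def
      using bounded_at_line_holomorphic[OF b u, of \<rho>] rho r by (auto simp: U_def)
    have d1: "deriv g t = cdir f (smul X t u) u" if "norm t < \<rho>" for t
    proof -
      have "norm t * U \<le> \<rho> * U" using that U by (intro mult_right_mono) auto
      then have "nrm X (smul X t u) < r" using rho u r by (simp add: nrm_smul U_def)
      then obtain L where L: "has_cderiv X Cspace f (smul X t u) L"
        using b u unfolding bounded_at_def by (metis add_0 carr_smul)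
      then have "has_cderiv X Cspace f (0 + smul X t u) L" by simp
      from DERIV_imp_deriv[OF has_cderiv_line[OF this u]] show ?thesis
        using cdir_eq[OF L u] by (simp add: g_def)
    qed
    have d2: "deriv (deriv g) 0 = cdir2 f u u"
      unfolding cdir2_def
    proof (rule deriv_cong_ev)
      have "\<forall>\<^sub>F t in nhds 0. t \<in> ball 0 \<rho>" using rho by (intro eventually_nhds_in_open) auto
      then show "\<forall>\<^sub>F t in nhds 0. deriv g t = cdir f (smul X t u) u"
        by eventually_elim (simp add: d1)
    qed simp
    have "norm (g s - (\<Sum>i\<le>2. (deriv ^^ i) g 0 * s ^ i / fact i))
      \<le> 2 * real (Suc 2) * 4 ^ Suc 2 * M * (norm s / \<rho>) ^ Suc 2"
      by (rule holomorphic_Taylor_bound) (use hol rho r in auto)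
    also have "\<dots> = 384 * M * (norm s / \<rho>) ^ 3" by simp
    finally have *: "norm (g s - (\<Sum>i\<le>2. (deriv ^^ i) g 0 * s ^ i / fact i)) \<le> 384 * M * (norm s / \<rho>) ^ 3" .
    have **: "384 * M * (norm s / \<rho>) ^ 3 \<le> 384 * M * (norm s * ((2 / r + 2) * (U + 1))) ^ 3 \<or> U = 0"
    proof (cases "U = 0")
      case False
      have "1 / \<rho> = 2 * U / r" using False by (simp add: \<rho>_def)
      also have "\<dots> \<le> (2 / r + 2) * (U + 1)" using U r by (simp add: field_simps)
      finally have "norm s * (1 / \<rho>) \<le> norm s * ((2 / r + 2) * (U + 1))" by (intro mult_left_mono) auto
      then have "(norm s / \<rho>) ^ 3 \<le> (norm s * ((2 / r + 2) * (U + 1))) ^ 3"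
        using rho by (intro power_mono) auto
      then show ?thesis using r by (intro disjI1 mult_left_mono) auto
    qed simp
    have *: "norm (g s - (\<Sum>i\<le>2. (deriv ^^ i) g 0 * s ^ i / fact i))
      \<le> 384 * M * (norm s * ((2 / r + 2) * (U + 1))) ^ 3 \<or> U = 0"
      using * ** by linarith
    have sum: "(\<Sum>i\<le>2. (deriv ^^ i) g 0 * s ^ i / fact i) = f 0 + s * cdir f 0 u + s\<^sup>2 * cdir2 f u u / 2"
      using d1[of 0] d2 rho by (simp add: numeral_2_eq_2) (simp add: g_def)
    show ?thesis
    proof (cases "U = 0")
      case False
      then show ?thesis using * unfolding sum
        by (simp add: g_def C_def U_def power_mult_distrib mult_ac diff_diff_eq)
    next
      case True
      have 0: "nrm X (smul X t u) = 0" for t using True u by (simp add: nrm_smul U_def)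
      have gt: "f (smul X t u) = f 0" for t
        using cdir_nrm_0(1)[OF bounded_at_deriv[OF b] carr_smul[OF u] 0] by simp
      have "g = (\<lambda>t. f 0)" using gt by (simp add: g_def)
      then have "g s - (\<Sum>i\<le>2. (deriv ^^ i) g 0 * s ^ i / fact i) = 0"
        by (simp add: numeral_2_eq_2)
      then have "f (smul X s u) - f 0 - s * cdir f 0 u - s\<^sup>2 * cdir2 f u u / 2 = 0"
        unfolding sum by (simp add: g_def diff_diff_eq)
      moreover have "0 \<le> C * (norm s * (nrm X u + 1)) ^ 3"
        using C nrm_nonneg[of u] by (intro mult_nonneg_nonneg zero_le_power) auto
      ultimately show ?thesis by (simp only: norm_zero)
    qed
  qed
  then show ?thesis using C by blast
qed

text \<open>Differentiation under the integral sign: with r and M common to all t, the quadratic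
  remainder is uniform in t and can be integrated. The derivatives are continuous in t as uniform
  limits of difference quotients, hence integrable.\<close>

lemma has_cderiv_integral:
  assumes b: "\<And>t. t \<in> {0..1::real} \<Longrightarrow> bounded_at (F t) x r M"
    and c: "\<And>h. h \<in> carr X \<Longrightarrow> nrm X h < r \<Longrightarrow> continuous_on {0..1} (\<lambda>t. F t (x + h))"
  shows "\<exists>L. has_cderiv X Cspace (\<lambda>y. integral {0..1} (\<lambda>t. F t y)) x L"
proof -
  have r: "r > 0" "M > 0" using b[of 0] by (auto simp: bounded_at_def)
  have lin: "has_cderiv X Cspace (F t) x (cdir (F t) x)" if "t \<in> {0..1}" for t
    using bounded_at_deriv[OF b[OF that]] .
  have cont: "continuous_on {0..1} (\<lambda>t. cdir (F t) x h)" if h: "h \<in> carr X" for h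
  proof -
    obtain \<rho> where rho: "\<rho> > 0" "\<rho> * nrm X h \<le> r/2" using ex_scale[OF _ h, of "r/2"] r by auto
    note q = cdir_uniform_quotient[where S = "{0..1}" and F = F and y = "\<lambda>_. x", OF b h rho]
    show ?thesis
    proof (rule uniform_limit_theorem[OF always_eventually q(1)], rule allI)
      fix n
      have "continuous_on {0..1} (\<lambda>t. F t (x + smul X (of_real (\<rho> * inverse (real (Suc n)))) h))"
        using c[OF carr_smul[OF h], of "of_real (\<rho> * inverse (real (Suc n)))"] q(3)[where n = n] r by linarith
      moreover have "continuous_on {0..1} (\<lambda>t. F t x)" using c[of 0] r by simp
      ultimately show "continuous_on {0..1} (\<lambda>t. (F t (x + smul X (of_real (\<rho> * inverse (real (Suc n)))) h) - F t x) / of_real (\<rho> * inverse (real (Suc n))))"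
        using q(2)[where n = n] by (intro continuous_intros) (auto simp del: of_nat_Suc)
    qed auto
  qed
  define L where "L = (\<lambda>h. integral {0..1} (\<lambda>t. cdir (F t) x h))"
  have int: "(\<lambda>t. cdir (F t) x h) integrable_on {0..1}" if "h \<in> carr X" for h
    using cont[OF that] by (rule integrable_continuous_real)
  have intF: "(\<lambda>t. F t (x + h)) integrable_on {0..1}" if "h \<in> carr X" "nrm X h < r" for h
    using c[OF that] by (rule integrable_continuous_real)
  have bc: "bounded_clin X Cspace L"
    unfolding bounded_clin_def
  proof (intro conjI ballI allI)
    fix h k assume h: "h \<in> carr X" and k: "k \<in> carr X"
    have "L (h + k) = integral {0..1} (\<lambda>t. cdir (F t) x h + cdir (F t) x k)"
      unfolding L_def by (rule integral_cong) (use cdir_linear(1)[OF lin] h k in auto)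
    then show "L (h + k) = L h + L k" unfolding L_def by (simp add: integral_add int h k)
  next
    fix c h assume h: "h \<in> carr X"
    have "L (smul X c h) = integral {0..1} (\<lambda>t. c * cdir (F t) x h)"
      unfolding L_def by (rule integral_cong) (use cdir_linear(2)[OF lin] h in auto)
    then show "L (smul X c h) = smul Cspace c (L h)" unfolding L_def by simp
  next
    have "norm (L h) \<le> 16 * M / r * nrm X h" if h: "h \<in> carr X" for h
    proof -
      have "norm (L h) \<le> integral {0..1::real} (\<lambda>t. 16 * M / r * nrm X h)"
        unfolding L_def
        by (rule integral_norm_bound_integral) (use int h cdir_bound[OF b h] in auto)
      then show ?thesis by simp
    qed
    then show "\<exists>K. \<forall>h\<in>carr X. nrm Cspace (L h) \<le> K * nrm X h"
      unfolding Cspace_simps by blast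
  qed simp
  have "\<exists>d>0. \<forall>h\<in>carr X. nrm X h < d \<longrightarrow>
      norm (integral {0..1} (\<lambda>t. F t (x + h)) - integral {0..1} (\<lambda>t. F t x) - L h) \<le> e * nrm X h"
    if e: "e > 0" for e
  proof -
    define d where "d = min (r/2) (e / (64 * M / r\<^sup>2))"
    have d: "d > 0" "d \<le> r/2" "64 * M / r\<^sup>2 * d \<le> e" using e r by (auto simp: d_def min_def field_simps)
    have "norm (integral {0..1} (\<lambda>t. F t (x + h)) - integral {0..1} (\<lambda>t. F t x) - L h) \<le> e * nrm X h"
      if h: "h \<in> carr X" "nrm X h < d" for h
    proof -
      have ih: "(\<lambda>t. F t (x + h)) integrable_on {0..1}" using intF h d r by auto
      have i0: "(\<lambda>t. F t x) integrable_on {0..1}" using intF[of 0] r by simp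
      have "integral {0..1} (\<lambda>t. F t (x + h)) - integral {0..1} (\<lambda>t. F t x) - L h
        = integral {0..1} (\<lambda>t. F t (x + h) - F t x - cdir (F t) x h)"
        unfolding L_def by (simp add: integral_diff ih i0 int[OF h(1)] integrable_diff)
      also have "norm \<dots> \<le> integral {0..1::real} (\<lambda>t. 64 * M / r\<^sup>2 * (nrm X h)\<^sup>2)"
        by (rule integral_norm_bound_integral)
          (use ih i0 int[OF h(1)] cdir_remainder[OF b h(1)] h d in \<open>auto intro!: integrable_diff\<close>)
      also have "\<dots> = 64 * M / r\<^sup>2 * nrm X h * nrm X h" by (simp add: power2_eq_square)
      also have "\<dots> \<le> 64 * M / r\<^sup>2 * d * nrm X h"
        using h r by (intro mult_right_mono mult_left_mono) auto
      also have "\<dots> \<le> e * nrm X h" using d by (intro mult_right_mono) auto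
      finally show ?thesis .
    qed
    then show ?thesis using d by blast
  qed
  then have "has_cderiv X Cspace (\<lambda>y. integral {0..1} (\<lambda>t. F t y)) x L"
    unfolding has_cderiv_Cspace using bc by blast
  then show ?thesis by blast
qed

end

lemma analytic_compose_functional:
  assumes an: "analytic_map X Y V f" and l: "bounded_clin Y Cspace l" and X: "cnorm X" and Y: "cnorm Y"
  shows "analytic_map X Cspace V (\<lambda>x. l (f x))"
    and "\<And>x L. x \<in> V \<Longrightarrow> has_cderiv X Y f x L \<Longrightarrow> has_cderiv X Cspace (\<lambda>x. l (f x)) x (\<lambda>h. l (L h))"
proof -
  have V: "open_in X V" "V \<subseteq> carr X" "\<And>x. x \<in> V \<Longrightarrow> f x \<in> carr Y" using an by (auto simp: analytic_map_def open_in_def)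
  show der: "has_cderiv X Cspace (\<lambda>x. l (f x)) x (\<lambda>h. l (L h))" if x: "x \<in> V" and d: "has_cderiv X Y f x L" for x L
    by (rule has_cderiv_chain[OF X Y cnorm_Cspace d has_cderiv_linear[OF Y cnorm_Cspace l V(3)[OF x]]])
  show "analytic_map X Cspace V (\<lambda>x. l (f x))"
    using an der unfolding analytic_map_def by auto blast
qed

section \<open>Weighted square summable sequences\<close>

definition wl2 :: "('i \<Rightarrow> real) \<Rightarrow> ('i \<Rightarrow> complex) \<Rightarrow> bool" where
  "wl2 a x \<longleftrightarrow> (\<lambda>n. (a n * norm (x n))\<^sup>2) summable_on UNIV"

definition wn :: "('i \<Rightarrow> real) \<Rightarrow> ('i \<Rightarrow> complex) \<Rightarrow> real" where
  "wn a x = sqrt (\<Sum>\<^sub>\<infinity>n. (a n * norm (x n))\<^sup>2)"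

lemma wn_nonneg [simp]: "0 \<le> wn a x"
  by (simp add: wn_def infsum_nonneg)

lemma L2_set_sq: "(L2_set f F)\<^sup>2 = (\<Sum>i\<in>F. (f i)\<^sup>2)"
  by (simp add: L2_set_def sum_nonneg)

lemma wl2_boundI:
  assumes "\<And>F. finite F \<Longrightarrow> L2_set (\<lambda>n. a n * norm (x n)) F \<le> C"
  shows "wl2 a x" "wn a x \<le> C"
proof -
  have C: "C \<ge> 0" using assms[of "{}"] by simp
  have b: "(\<Sum>n\<in>F. (a n * norm (x n))\<^sup>2) \<le> C\<^sup>2" if "finite F" for F
    using power_mono[OF assms[OF that], of 2] by (simp add: L2_set_sq)
  show 1: "wl2 a x"
    unfolding wl2_def using b
    by (intro nonneg_bdd_above_summable_on) (auto simp: bdd_above_def)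
  have "(\<Sum>\<^sub>\<infinity>n. (a n * norm (x n))\<^sup>2) \<le> C\<^sup>2"
    using 1 b unfolding wl2_def by (intro infsum_le_finite_sums) auto
  then show "wn a x \<le> C"
    unfolding wn_def using C by (metis real_sqrt_abs abs_of_nonneg real_sqrt_le_mono)
qed

lemma wl2_L2_set_le:
  assumes "wl2 a x" "finite F"
  shows "L2_set (\<lambda>n. a n * norm (x n)) F \<le> wn a x"
  unfolding L2_set_def wn_def using assms
  by (intro real_sqrt_le_mono finite_sum_le_infsum) (auto simp: wl2_def)

lemma wl2_le:
  assumes y: "wl2 b y" and K: "0 \<le> K" and le: "\<And>n. norm (a n * norm (x n)) \<le> K * (b n * norm (y n))"
  shows "wl2 a x" "wn a x \<le> K * wn b y"
proof -
  have "L2_set (\<lambda>n. a n * norm (x n)) F \<le> K * wn b y" if "finite F" for F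
  proof -
    have "L2_set (\<lambda>n. a n * norm (x n)) F \<le> L2_set (\<lambda>n. \<bar>a n * norm (x n)\<bar>) F"
      by (simp add: L2_set_def)
    also have "\<dots> \<le> L2_set (\<lambda>n. K * (b n * norm (y n))) F"
      using le by (intro L2_set_mono) auto
    also have "\<dots> = K * L2_set (\<lambda>n. b n * norm (y n)) F"
      using K by (simp add: L2_set_right_distrib)
    also have "\<dots> \<le> K * wn b y" using wl2_L2_set_le[OF y that] K by (intro mult_left_mono) auto
    finally show ?thesis .
  qed
  from wl2_boundI[OF this] show "wl2 a x" "wn a x \<le> K * wn b y" by auto
qed

lemma wl2_add:
  assumes "wl2 a x" "wl2 a y" and a: "\<And>n. a n \<ge> 0"
  shows "wl2 a (x + y)" "wn a (x + y) \<le> wn a x + wn a y"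
proof -
  have "L2_set (\<lambda>n. a n * norm ((x + y) n)) F \<le> wn a x + wn a y" if "finite F" for F
  proof -
    have "L2_set (\<lambda>n. a n * norm ((x + y) n)) F \<le> L2_set (\<lambda>n. a n * norm (x n) + a n * norm (y n)) F"
      using a by (intro L2_set_mono) (auto simp: plus_fun_def norm_triangle_ineq mult_left_mono simp flip: distrib_left)
    also have "\<dots> \<le> L2_set (\<lambda>n. a n * norm (x n)) F + L2_set (\<lambda>n. a n * norm (y n)) F"
      by (rule L2_set_triangle_ineq)
    also have "\<dots> \<le> wn a x + wn a y" using wl2_L2_set_le assms that by (intro add_mono) auto
    finally show ?thesis .
  qed
  from wl2_boundI[OF this] show "wl2 a (x + y)" "wn a (x + y) \<le> wn a x + wn a y" by blast+
qed

lemma wl2_smul: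
  assumes "wl2 a x"
  shows "wl2 a (\<lambda>n. c * x n)" "wn a (\<lambda>n. c * x n) = norm c * wn a x"
proof -
  have *: "(\<lambda>n. (a n * norm (c * x n))\<^sup>2) = (\<lambda>n. (norm c)\<^sup>2 * (a n * norm (x n))\<^sup>2)"
    by (auto simp: norm_mult power_mult_distrib fun_eq_iff)
  show "wl2 a (\<lambda>n. c * x n)" using assms unfolding wl2_def * by (intro summable_on_cmult_right)
  show "wn a (\<lambda>n. c * x n) = norm c * wn a x"
    unfolding wn_def * infsum_cmult_right' by (simp add: real_sqrt_mult)
qed

lemma wl2_coord:
  assumes "wl2 a x" and "a n \<ge> 0"
  shows "a n * norm (x n) \<le> wn a x"
  using wl2_L2_set_le[OF assms(1), of "{n}"] assms(2) by simp

lemma wl2_pair: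
  assumes x: "wl2 a x" and y: "wl2 b y" and K: "0 \<le> K" and c: "\<And>n. norm (c n) \<le> K * (a n * b n)"
    and a: "\<And>n. 0 \<le> a n" and b: "\<And>n. 0 \<le> b n"
  shows "(\<lambda>n. norm (c n * x n * y n)) summable_on UNIV"
    "(\<Sum>\<^sub>\<infinity>n. norm (c n * x n * y n)) \<le> K * (wn a x * wn b y)"
    "(\<lambda>n. c n * x n * y n) summable_on UNIV"
    "norm (\<Sum>\<^sub>\<infinity>n. c n * x n * y n) \<le> K * (wn a x * wn b y)"
proof -
  have bd: "(\<Sum>n\<in>F. norm (c n * x n * y n)) \<le> K * (wn a x * wn b y)" if F: "finite F" for F
  proof -
    have "(\<Sum>n\<in>F. norm (c n * x n * y n)) \<le> (\<Sum>n\<in>F. K * (\<bar>a n * norm (x n)\<bar> * \<bar>b n * norm (y n)\<bar>))"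
    proof (rule sum_mono)
      fix n
      have "norm (c n * x n * y n) = norm (c n) * (norm (x n) * norm (y n))" by (simp add: norm_mult)
      also have "\<dots> \<le> K * (a n * b n) * (norm (x n) * norm (y n))" using c by (intro mult_right_mono) auto
      finally show "norm (c n * x n * y n) \<le> K * (\<bar>a n * norm (x n)\<bar> * \<bar>b n * norm (y n)\<bar>)"
        using a b by (simp add: abs_mult mult_ac)
    qed
    also have "\<dots> = K * (\<Sum>n\<in>F. \<bar>a n * norm (x n)\<bar> * \<bar>b n * norm (y n)\<bar>)" by (simp add: sum_distrib_left)
    also have "\<dots> \<le> K * (L2_set (\<lambda>n. a n * norm (x n)) F * L2_set (\<lambda>n. b n * norm (y n)) F)"
      using K by (intro mult_left_mono L2_set_mult_ineq)
    also have "\<dots> \<le> K * (wn a x * wn b y)"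
      using K wl2_L2_set_le[OF x F] wl2_L2_set_le[OF y F] by (intro mult_left_mono mult_mono) auto
    finally show ?thesis .
  qed
  show 1: "(\<lambda>n. norm (c n * x n * y n)) summable_on UNIV"
    using bd by (intro nonneg_bdd_above_summable_on) (auto simp: bdd_above_def)
  show 2: "(\<Sum>\<^sub>\<infinity>n. norm (c n * x n * y n)) \<le> K * (wn a x * wn b y)"
    using 1 bd by (intro infsum_le_finite_sums) auto
  show "(\<lambda>n. c n * x n * y n) summable_on UNIV" using 1 by (rule abs_summable_summable)
  show "norm (\<Sum>\<^sub>\<infinity>n. c n * x n * y n) \<le> K * (wn a x * wn b y)"
    using norm_infsum_bound[OF 1] 2 by linarith
qed

lemma wl2_finite_support:
  assumes "finite {n. x n \<noteq> 0}"
  shows "wl2 a x"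
  unfolding wl2_def
proof (rule summable_on_cong_neutral[THEN iffD2])
  show "(\<lambda>n. (a n * norm (x n))\<^sup>2) summable_on {n. x n \<noteq> 0}" using assms by simp
qed auto

definition restr :: "'i set \<Rightarrow> ('i \<Rightarrow> 'a::zero) \<Rightarrow> 'i \<Rightarrow> 'a" where
  "restr F x = (\<lambda>n. if n \<in> F then x n else 0)"

lemma wl2_restr: "wl2 a x \<Longrightarrow> wl2 a (restr F x)"
  by (rule wl2_le(1)[where K = 1 and b = "\<lambda>n. \<bar>a n\<bar>" and y = x]) (auto simp: restr_def wl2_def abs_mult power_mult_distrib)

lemma wn_tail:
  assumes x: "wl2 a x" and e: "e > 0"
  shows "\<exists>F. finite F \<and> (\<forall>F'. finite F' \<longrightarrow> F \<subseteq> F' \<longrightarrow> wn a (x - restr F' x) < e)"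
proof -
  define g where "g = (\<lambda>n. (a n * norm (x n))\<^sup>2)"
  have g: "g summable_on UNIV" using x by (simp add: wl2_def g_def)
  have "(sum g \<longlongrightarrow> infsum g UNIV) (finite_subsets_at_top UNIV)" by (rule infsum_tendsto[OF g])
  then have "\<forall>\<^sub>F F in finite_subsets_at_top UNIV. dist (sum g F) (infsum g UNIV) < e\<^sup>2"
    using e by (intro tendstoD) auto
  then obtain F where F: "finite F" "\<And>F'. finite F' \<Longrightarrow> F \<subseteq> F' \<Longrightarrow> dist (sum g F') (infsum g UNIV) < e\<^sup>2"
    unfolding eventually_finite_subsets_at_top by auto
  have "wn a (x - restr F' x) < e" if F': "finite F'" "F \<subseteq> F'" for F'
  proof -
    have "(\<lambda>n. (a n * norm ((x - restr F' x) n))\<^sup>2) = (\<lambda>n. if n \<in> - F' then g n else 0)"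
      by (auto simp: restr_def g_def fun_eq_iff)
    then have "(\<Sum>\<^sub>\<infinity>n. (a n * norm ((x - restr F' x) n))\<^sup>2) = infsum g (- F')"
      by (simp only:) (rule infsum_cong_neutral, auto)
    also have "\<dots> = infsum g UNIV - infsum g F'"
      using infsum_Diff[OF g, of F'] F' by (simp add: Compl_eq_Diff_UNIV)
    also have "\<dots> < e\<^sup>2" using F(2)[OF F'] F' by (simp add: dist_real_def abs_less_iff)
    finally have "sqrt (\<Sum>\<^sub>\<infinity>n. (a n * norm ((x - restr F' x) n))\<^sup>2) < sqrt (e\<^sup>2)" by (rule real_sqrt_less_mono)
    then show ?thesis using e by (simp add: wn_def)
  qed
  then show ?thesis using F(1) by blast
qed

definition wt :: "('i \<Rightarrow> real) \<Rightarrow> real \<Rightarrow> 'i \<Rightarrow> real" where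
  "wt w s n = w n powr s"

lemma wt_pos: "(\<And>n. w n > 0) \<Longrightarrow> wt w s n > 0"
  using less_imp_neq[of 0 "w n"] by (simp add: wt_def)

lemma weighted_lp_2:
  "carr (weighted_lp w s 2) = {x. x 0 = 0 \<and> wl2 (wt w s) x}"
  "smul (weighted_lp w s 2) = (\<lambda>c x n. c * x n)"
  "nrm (weighted_lp w s 2) = wn (wt w s)"
proof -
  have *: "w n powr (s * 2) * norm (x n) powr 2 = (wt w s n * norm (x n))\<^sup>2" for x :: "_ \<Rightarrow> complex" and n
  proof -
    have "w n powr (s * 2) = (w n powr s) powr 2" by (simp add: powr_powr)
    also have "\<dots> = (w n powr s)\<^sup>2" by simp
    finally show ?thesis by (simp add: wt_def power_mult_distrib)
  qed
  show "carr (weighted_lp w s 2) = {x. x 0 = 0 \<and> wl2 (wt w s) x}"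
    unfolding weighted_lp_def wl2_def by (simp only: * cspace.simps)
  show "smul (weighted_lp w s 2) = (\<lambda>c x n. c * x n)" by (simp add: weighted_lp_def)
  show "nrm (weighted_lp w s 2) = wn (wt w s)"
    unfolding weighted_lp_def wn_def by (simp only: * cspace.simps) (simp add: fun_eq_iff powr_half_sqrt infsum_nonneg)
qed

lemma cnorm_weighted: assumes "\<And>n. w n > 0" shows "cnorm (weighted_lp w s 2)"
proof
  have a: "wt w s n \<ge> 0" for n using wt_pos[of w s n, OF assms] by simp
  show "0 \<in> carr (weighted_lp w s 2)" by (simp add: weighted_lp_2 wl2_def)
  show "x \<in> carr (weighted_lp w s 2) \<Longrightarrow> y \<in> carr (weighted_lp w s 2) \<Longrightarrow> x + y \<in> carr (weighted_lp w s 2)" for x y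
    using wl2_add(1)[of "wt w s" x y] a by (simp add: weighted_lp_2)
  show "x \<in> carr (weighted_lp w s 2) \<Longrightarrow> smul (weighted_lp w s 2) c x \<in> carr (weighted_lp w s 2)" for c x
    using wl2_smul(1)[of "wt w s" x c] by (simp add: weighted_lp_2)
  show "x \<in> carr (weighted_lp w s 2) \<Longrightarrow> y \<in> carr (weighted_lp w s 2) \<Longrightarrow>
    nrm (weighted_lp w s 2) (x + y) \<le> nrm (weighted_lp w s 2) x + nrm (weighted_lp w s 2) y" for x y
    using wl2_add(2)[of "wt w s" x y] a by (simp add: weighted_lp_2)
  show "x \<in> carr (weighted_lp w s 2) \<Longrightarrow>
    nrm (weighted_lp w s 2) (smul (weighted_lp w s 2) c x) = norm c * nrm (weighted_lp w s 2) x" for c x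
    using wl2_smul(2)[of "wt w s" x c] by (simp add: weighted_lp_2)
qed (auto simp: weighted_lp_2 fun_eq_iff algebra_simps)

definition wi :: "real \<Rightarrow> int \<Rightarrow> real" where "wi = wt (\<lambda>n. 1 + real_of_int \<bar>n\<bar>)"
definition wj :: "real \<Rightarrow> nat \<Rightarrow> real" where "wj = wt (\<lambda>n. 1 + real n)"

lemma h0C_simps:
  "carr (h0C s) = {x. x 0 = 0 \<and> wl2 (wi s) x}"
  "smul (h0C s) = (\<lambda>c x n. c * x n)"
  "nrm (h0C s) = wn (wi s)"
  by (simp_all add: h0C_def wi_def weighted_lp_2)

lemma lC_simps:
  "carr (lC s 2) = {x. x 0 = 0 \<and> wl2 (wj s) x}"
  "smul (lC s 2) = (\<lambda>c x n. c * x n)"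
  "nrm (lC s 2) = wn (wj s)"
  by (simp_all add: lC_def wj_def weighted_lp_2)

lemma cnorm_h0C: "cnorm (h0C s)"
  unfolding h0C_def by (rule cnorm_weighted) auto

lemma cnorm_lC: "cnorm (lC s 2)"
  unfolding lC_def by (rule cnorm_weighted) auto

lemma wi_pos: "wi s n > 0" and wj_pos: "wj s m > 0"
  by (auto simp: wt_def wi_def wj_def)

lemma wi_nonneg [simp]: "0 \<le> wi s n" and wj_nonneg [simp]: "0 \<le> wj s m"
  using wi_pos[of s n] wj_pos[of s m] by simp_all

lemma wi_minus [simp]: "wi s (- n) = wi s n"
  by (simp add: wt_def wi_def wj_def)

lemma wi_int: "wi s (int n) = wj s n"
  by (simp add: wt_def wi_def wj_def)

lemma wi_mult: "wi s n * wi t n = wi (s + t) n" and wj_mult: "wj s m * wj t m = wj (s + t) m"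
  by (auto simp: wt_def wi_def wj_def powr_add)

lemma wi_0 [simp]: "wi 0 n = 1" and wj_0 [simp]: "wj 0 m = 1"
  by (auto simp: wt_def wi_def wj_def)

lemma wi_mono: "s \<le> t \<Longrightarrow> wi s n \<le> wi t n" and wj_mono: "s \<le> t \<Longrightarrow> wj s m \<le> wj t m"
  by (auto simp: wt_def wi_def wj_def intro!: powr_mono)

lemma h0C_mono:
  assumes "s \<le> t" "x \<in> carr (h0C t)"
  shows "x \<in> carr (h0C s)" "nrm (h0C s) x \<le> nrm (h0C t) x"
proof -
  have "norm (wi s n * norm (x n)) \<le> 1 * (wi t n * norm (x n))" for n
    using wi_mono[OF assms(1), of n] by (simp add: abs_mult mult_right_mono)
  from wl2_le[OF _ _ this] assms(2)
  show "x \<in> carr (h0C s)" "nrm (h0C s) x \<le> nrm (h0C t) x" by (auto simp: h0C_simps)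
qed

lemma h0_mono: "s \<le> t \<Longrightarrow> h0 t \<subseteq> h0 s"
  using h0C_mono(1) unfolding h0_def by blast

lemma h0C_flip:
  assumes "x \<in> carr (h0C s)"
  shows "(\<lambda>n. x (- n)) \<in> carr (h0C s)" "wl2 (wi s) (\<lambda>n. x (- n))" "wn (wi s) (\<lambda>n. x (- n)) = nrm (h0C s) x"
proof -
  have bij: "bij (uminus :: int \<Rightarrow> int)" by (rule bij_uminus)
  have x: "x 0 = 0" "wl2 (wi s) x" using assms by (auto simp: h0C_simps)
  have eq: "(\<lambda>n. (wi s n * norm (x (- n)))\<^sup>2) = (\<lambda>n. (wi s (- n) * norm (x (- n)))\<^sup>2)" by simp
  show 1: "wl2 (wi s) (\<lambda>n. x (- n))"
    using x(2) summable_on_reindex_bij_betw[OF bij, of "\<lambda>n. (wi s n * norm (x n))\<^sup>2"]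
    unfolding wl2_def eq by simp
  show "wn (wi s) (\<lambda>n. x (- n)) = nrm (h0C s) x"
    using infsum_reindex_bij_betw[OF bij, of "\<lambda>n. (wi s n * norm (x n))\<^sup>2"]
    unfolding wn_def eq h0C_simps by simp
  show "(\<lambda>n. x (- n)) \<in> carr (h0C s)" using 1 x by (simp add: h0C_simps)
qed

lemma infsum_flip: "(\<Sum>\<^sub>\<infinity>k::int. f (- k)) = (\<Sum>\<^sub>\<infinity>k. f k)" for f :: "int \<Rightarrow> complex"
  using infsum_reindex_bij_betw[OF bij_uminus, of f] by simp

definition unitv :: "'i \<Rightarrow> 'i \<Rightarrow> complex" where
  "unitv n = (\<lambda>k. if k = n then 1 else 0)"

lemma unitv_finite: "finite {k. unitv n k \<noteq> 0}"
  by (simp add: unitv_def)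

lemma unitv_h0C: "n \<noteq> 0 \<Longrightarrow> unitv n \<in> carr (h0C s)"
  using wl2_finite_support[OF unitv_finite[of n]] by (simp add: h0C_simps unitv_def)

lemma unitv_lC: "n \<noteq> 0 \<Longrightarrow> unitv n \<in> carr (lC s 2)"
  using wl2_finite_support[OF unitv_finite[of n]] by (simp add: lC_simps unitv_def)

lemma finite_support_h0C: "finite {n. x n \<noteq> 0} \<Longrightarrow> x 0 = 0 \<Longrightarrow> x \<in> carr (h0C s)"
  by (simp add: h0C_simps wl2_finite_support)

lemma finite_support_lC: "finite {n. x n \<noteq> 0} \<Longrightarrow> x 0 = 0 \<Longrightarrow> x \<in> carr (lC s 2)"
  by (simp add: lC_simps wl2_finite_support)

lemma coord_bounded_clin: "bounded_clin (h0C s) Cspace (\<lambda>x. x n)"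
proof -
  have "norm (x n) \<le> (1 / wi s n) * wn (wi s) x" if "wl2 (wi s) x" for x
    using wl2_coord[OF that, of n] wi_pos[of s n] by (simp add: field_simps)
  then have "\<exists>K. \<forall>x\<in>carr (h0C s). norm (x n) \<le> K * nrm (h0C s) x"
    unfolding h0C_simps by blast
  then show ?thesis unfolding bounded_clin_def by (auto simp: h0C_simps)
qed

lemma coord_bounded_clin_lC: "bounded_clin (lC s 2) Cspace (\<lambda>x. x n)"
proof -
  have "norm (x n) \<le> (1 / wj s n) * wn (wj s) x" if "wl2 (wj s) x" for x
    using wl2_coord[OF that, of n] wj_pos[of s n] by (simp add: field_simps)
  then have "\<exists>K. \<forall>x\<in>carr (lC s 2). norm (x n) \<le> K * nrm (lC s 2) x"
    unfolding lC_simps by blast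
  then show ?thesis unfolding bounded_clin_def by (auto simp: lC_simps)
qed

lemma dpair_bound:
  assumes "x \<in> carr (lC (- s) 2)" "y \<in> carr (lC s 2)"
  shows "(\<lambda>n. x n * y n) summable_on UNIV" "norm (dpair x y) \<le> nrm (lC (- s) 2) x * nrm (lC s 2) y"
  using wl2_pair(3,4)[of "wj (- s)" x "wj s" y 1 "\<lambda>_. 1"] assms
  by (auto simp: lC_simps dpair_def wj_mult)

lemma dpair_add_right:
  assumes "x \<in> carr (lC (- s) 2)" "y \<in> carr (lC s 2)" "z \<in> carr (lC s 2)"
  shows "dpair x (y + z) = dpair x y + dpair x z"
  unfolding dpair_def using dpair_bound(1)[OF assms(1,2)] dpair_bound(1)[OF assms(1,3)]
  by (simp add: distrib_left infsum_add)

lemma dpair_add_left: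
  assumes "x \<in> carr (lC (- s) 2)" "y \<in> carr (lC (- s) 2)" "z \<in> carr (lC s 2)"
  shows "dpair (x + y) z = dpair x z + dpair y z"
  unfolding dpair_def using dpair_bound(1)[OF assms(1,3)] dpair_bound(1)[OF assms(2,3)]
  by (simp add: distrib_right infsum_add)

lemma dpair_smul_right: "dpair x (\<lambda>n. c * y n) = c * dpair x y"
  unfolding dpair_def by (simp add: mult.left_commute infsum_cmult_right')

lemma dpair_smul_left: "dpair (\<lambda>n. c * x n) y = c * dpair x y"
  unfolding dpair_def by (simp add: mult.assoc infsum_cmult_right')

lemma dpair_diff_left:
  assumes "x \<in> carr (lC (- s) 2)" "y \<in> carr (lC (- s) 2)" "z \<in> carr (lC s 2)"
  shows "dpair (x - y) z = dpair x z - dpair y z"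
proof -
  interpret cnorm "lC (- s) 2" by (rule cnorm_lC)
  show ?thesis using dpair_add_left[of "x - y" s y z] assms carr_diff by simp
qed

lemma dpair_unitv: "dpair x (unitv n) = x n"
proof -
  have "dpair x (unitv n) = (\<Sum>\<^sub>\<infinity>k\<in>{n}. x k * unitv n k)"
    unfolding dpair_def by (rule infsum_cong_neutral) (auto simp: unitv_def)
  then show ?thesis by (simp add: unitv_def)
qed

lemma dpair_bounded_clin:
  assumes "x \<in> carr (lC (- s) 2)"
  shows "bounded_clin (lC s 2) Cspace (dpair x)"
  unfolding bounded_clin_def
proof (intro conjI ballI allI)
  show "\<exists>K. \<forall>y\<in>carr (lC s 2). nrm Cspace (dpair x y) \<le> K * nrm (lC s 2) y"
    unfolding Cspace_simps using dpair_bound(2)[OF assms] by blast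
qed (use dpair_add_right[OF assms] dpair_smul_right in \<open>auto simp: lC_simps\<close>)

lemma dpair_bounded_clin_left:
  assumes "y \<in> carr (lC s 2)"
  shows "bounded_clin (lC (- s) 2) Cspace (\<lambda>x. dpair x y)"
  unfolding bounded_clin_def
proof (intro conjI ballI allI)
  have "norm (dpair x y) \<le> nrm (lC s 2) y * nrm (lC (- s) 2) x" if "x \<in> carr (lC (- s) 2)" for x
    using dpair_bound(2)[OF that assms] by (simp add: mult.commute)
  then show "\<exists>K. \<forall>x\<in>carr (lC (- s) 2). nrm Cspace (dpair x y) \<le> K * nrm (lC (- s) 2) x"
    unfolding Cspace_simps by blast
qed (use dpair_add_left[OF _ _ assms] dpair_smul_left in \<open>auto simp: lC_simps\<close>)

lemma restr_tail_lC:
  assumes "x \<in> carr (lC s 2)" "e > 0"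
  shows "\<exists>F. finite F \<and> restr F x \<in> carr (lC s 2) \<and> nrm (lC s 2) (x - restr F x) < e"
  using wn_tail[of "wj s" x e] assms wl2_restr[of "wj s" x] by (fastforce simp: lC_simps restr_def)

text \<open>Truncations converge in norm, so a bounded functional is determined by its values on
  unit vectors. This is how identities verified mode by mode extend to the whole space. The
  coordinate 0 is cut out because \<open>unitv 0\<close> does not belong to the sequence
  spaces.\<close>

lemma bounded_clin_has_sum:
  fixes X :: "('i::zero \<Rightarrow> complex) cspace"
  assumes X: "cnorm X" and L: "bounded_clin X Cspace L" and x: "x \<in> carr X" "x 0 = 0"
    and smul: "\<And>c y. smul X c y = (\<lambda>n. c * y n)" and e: "\<And>n. n \<noteq> 0 \<Longrightarrow> unitv n \<in> carr X"
    and tail: "\<And>e. e > 0 \<Longrightarrow> \<exists>F. finite F \<and> (\<forall>F'. finite F' \<longrightarrow> F \<subseteq> F' \<longrightarrow> nrm X (x - restr F' x) < e)"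
  shows "((\<lambda>n. x n * (if n = 0 then 0 else L (unitv n))) has_sum L x) UNIV"
proof -
  interpret cnorm X by fact
  obtain K where K: "K > 0" "\<And>y. y \<in> carr X \<Longrightarrow> nrm Cspace (L y) \<le> K * nrm X y" by (rule bounded_clin_bound[OF X L]) (rule that)
  note l = bounded_clinD[OF L]
  have fin: "restr F x \<in> carr X \<and> L (restr F x) = (\<Sum>n\<in>F. x n * (if n = 0 then 0 else L (unitv n)))" if "finite F" for F
    using that
  proof (induction F rule: finite_induct)
    case empty
    have e: "restr {} x = 0" by (simp add: restr_def fun_eq_iff)
    show ?case unfolding e using l(2)[OF x(1), of 0] carr_0 by (simp add: zero_fun_def)
  next
    case (insert i F)
    show ?case
    proof (cases "i = 0")
      case True
      then have "restr (insert i F) x = restr F x" using x by (auto simp: restr_def)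
      then show ?thesis using insert True by simp
    next
      case False
      have eq: "restr (insert i F) x = smul X (x i) (unitv i) + restr F x"
        using insert.hyps by (auto simp: smul restr_def unitv_def fun_eq_iff)
      have c: "smul X (x i) (unitv i) \<in> carr X" "restr F x \<in> carr X" using e[OF False] insert by simp_all
      show ?thesis
        unfolding eq l(3)[OF c] using carr_add[OF c] insert False l(2)[OF e[OF False], of "x i"] by (simp add: plus_fun_def)
    qed
  qed
  show ?thesis
    unfolding has_sum_def
  proof (rule tendstoI)
    fix \<epsilon> :: real assume "\<epsilon> > 0"
    then obtain F where F: "finite F" "\<And>F'. finite F' \<Longrightarrow> F \<subseteq> F' \<Longrightarrow> nrm X (x - restr F' x) < \<epsilon> / K"
      using tail[of "\<epsilon> / K"] K(1) by auto
    have "dist (\<Sum>n\<in>F'. x n * (if n = 0 then 0 else L (unitv n))) (L x) < \<epsilon>" if F': "finite F'" "F \<subseteq> F'" for F'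
    proof -
      note r = fin[OF F'(1)]
      have d: "x - restr F' x \<in> carr X" using r x by simp
      have "L x = L (x - restr F' x) + L (restr F' x)" using l(3)[OF d, of "restr F' x"] r by simp
      then have "dist (\<Sum>n\<in>F'. x n * (if n = 0 then 0 else L (unitv n))) (L x) \<le> K * nrm X (x - restr F' x)"
        using r K(2)[OF d] by (simp add: dist_norm)
      also have "\<dots> < \<epsilon>" using F(2)[OF F'] K(1) by (simp add: pos_less_divide_eq mult.commute)
      finally show ?thesis .
    qed
    then show "\<forall>\<^sub>F F in finite_subsets_at_top UNIV. dist (\<Sum>n\<in>F. x n * (if n = 0 then 0 else L (unitv n))) (L x) < \<epsilon>"
      unfolding eventually_finite_subsets_at_top using F(1) by blast
  qed
qed

lemma bounded_clin_has_sum_lC: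
  assumes "bounded_clin (lC s 2) Cspace L" "x \<in> carr (lC s 2)"
  shows "((\<lambda>n. x n * (if n = 0 then 0 else L (unitv n))) has_sum L x) UNIV"
  by (rule bounded_clin_has_sum[OF cnorm_lC assms(1)])
    (use assms(2) wn_tail[of "wj s" x] unitv_lC in \<open>auto simp: lC_simps\<close>)

lemma bounded_clin_has_sum_h0C:
  assumes "bounded_clin (h0C s) Cspace L" "x \<in> carr (h0C s)"
  shows "((\<lambda>n. x n * (if n = 0 then 0 else L (unitv n))) has_sum L x) UNIV"
  by (rule bounded_clin_has_sum[OF cnorm_h0C assms(1)])
    (use assms(2) wn_tail[of "wi s" x] unitv_h0C in \<open>auto simp: h0C_simps\<close>)

section \<open>Fourier coefficients of square integrable functions\<close>

abbreviation I01 :: "real measure" where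
  "I01 \<equiv> restrict_space lborel {0..1}"

definition fe :: "int \<Rightarrow> real \<Rightarrow> complex" where
  "fe k x = exp (2 * of_real pi * \<i> * of_int k * of_real x)"

lemma I01_finite: "finite_measure I01"
  by (rule finite_measureI) (simp add: emeasure_restrict_space)

lemma LINT_unit: "(LINT x:{0..1}|lborel. f x) = (\<integral>x. f x \<partial>I01)"
  for f :: "real \<Rightarrow> 'b::{banach, second_countable_topology}"
  by (simp add: set_lebesgue_integral_def integral_restrict_space)

lemma set_integrable_unit: "set_integrable lborel {0..1} f \<longleftrightarrow> integrable I01 f"
  for f :: "real \<Rightarrow> 'b::{banach, second_countable_topology}"
  by (simp add: set_integrable_def integrable_restrict_space)

lemma borel_measurable_unit: "f \<in> borel_measurable borel \<Longrightarrow> f \<in> borel_measurable I01"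
  by (simp add: measurable_restrict_space1)

lemma fe_mult: "fe k x * fe l x = fe (k + l) x"
  by (simp add: fe_def algebra_simps flip: exp_add)

lemma fe_0 [simp]: "fe 0 x = 1"
  by (simp add: fe_def)

lemma norm_fe [simp]: "norm (fe k x) = 1"
proof -
  have "fe k x = exp (\<i> * of_real (2 * pi * of_int k * x))" by (simp add: fe_def mult_ac)
  then show ?thesis by (simp only: norm_exp_i_times)
qed

lemma cnj_fe: "cnj (fe k x) = fe (- k) x"
  by (simp add: fe_def exp_cnj flip: exp_minus)

lemma continuous_fe [continuous_intros]: "continuous_on A (fe k)"
  unfolding fe_def by (intro continuous_intros)

lemma measurable_fe [measurable]: "fe k \<in> borel_measurable borel"
  by (intro borel_measurable_continuous_onI continuous_fe)

lemma has_fourier_coeffs_unit: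
  "has_fourier_coeffs f a \<longleftrightarrow> f \<in> borel_measurable borel \<and> integrable I01 (\<lambda>x. (norm (f x))\<^sup>2) \<and>
    (\<forall>k. (\<integral>x. f x * fe (- k) x \<partial>I01) = a k)"
  unfolding has_fourier_coeffs_def LINT_unit set_integrable_unit fe_def by simp

lemma integrable_sq_bound:
  fixes f :: "real \<Rightarrow> complex"
  assumes f: "f \<in> borel_measurable I01" "integrable I01 (\<lambda>x. (norm (f x))\<^sup>2)"
  shows "integrable I01 f"
proof -
  interpret finite_measure I01 by (rule I01_finite)
  have i: "integrable I01 (\<lambda>x. 1 + (norm (f x))\<^sup>2)" using f by (intro Bochner_Integration.integrable_add) auto
  show ?thesis
  proof (rule Bochner_Integration.integrable_bound[OF i f(1)], rule AE_I2)
    fix x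
    have "norm (f x) \<le> 1 + (norm (f x))\<^sup>2"
      using zero_le_power2[of "norm (f x) - 1/2"] by (simp add: power2_eq_square algebra_simps)
    then show "norm (f x) \<le> norm (1 + (norm (f x))\<^sup>2)" by simp
  qed
qed

lemma integrable_mult_fe:
  fixes f :: "real \<Rightarrow> complex"
  assumes "integrable I01 f"
  shows "integrable I01 (\<lambda>x. f x * fe k x)"
  using assms borel_measurable_unit[OF measurable_fe]
  by (intro Bochner_Integration.integrable_bound[OF assms]) (auto simp: norm_mult)

lemma integral_fe: "(\<integral>x. fe k x \<partial>I01) = (if k = 0 then 1 else 0)"
proof (cases "k = 0")
  case True
  have "(\<integral>x. (1::complex) \<partial>I01) = 1"
    by (simp add: measure_restrict_space)
  then show ?thesis using True by simp
next
  case False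
  define c where "c = 2 * of_real pi * \<i> * of_int k"
  have c: "c \<noteq> 0" using False by (simp add: c_def)
  have fe: "fe k = (\<lambda>x. exp (c * of_real x))" by (simp add: fe_def c_def fun_eq_iff)
  have "((\<lambda>x::real. exp (c * of_real x) / c) has_vector_derivative exp (c * of_real x)) (at x within {0..1})" for x
  proof -
    have "((\<lambda>z. exp (c * z) / c) has_field_derivative exp (c * of_real x)) (at (of_real x))"
      using c by (auto intro!: derivative_eq_intros)
    then show ?thesis
      using has_vector_derivative_real_field has_vector_derivative_at_within by fast
  qed
  then have "((\<lambda>x::real. exp (c * of_real x)) has_integral (exp (c * of_real 1) / c - exp (c * of_real 0) / c)) {0..1}"
    by (intro fundamental_theorem_of_calculus) auto
  moreover have "exp (c * of_real 1) = 1"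
  proof -
    have "exp (c * of_real 1) = exp ((2 * of_int k * pi) * \<i>)" by (simp add: c_def mult_ac)
    also have "\<dots> = 1" by (rule exp_integer_2pi) auto
    finally show ?thesis .
  qed
  ultimately have "integral {0..1} (fe k) = 0" by (simp add: fe integral_unique)
  moreover have "set_integrable lborel {0..1} (fe k)"
    unfolding set_integrable_def by (intro borel_integrable_compact) (auto intro: continuous_fe)
  ultimately show ?thesis
    using set_borel_integral_eq_integral(2)[of "{0..1}" "fe k"] False by (simp add: LINT_unit)
qed

subsection \<open>Uniqueness\<close>

inductive trig_poly :: "(real \<Rightarrow> complex) \<Rightarrow> bool" where
  mono: "trig_poly (\<lambda>x. c * fe k x)"
| plus: "trig_poly f \<Longrightarrow> trig_poly g \<Longrightarrow> trig_poly (\<lambda>x. f x + g x)"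

lemma trig_poly_mult:
  assumes "trig_poly f" "trig_poly g"
  shows "trig_poly (\<lambda>x. f x * g x)"
  using assms(1)
proof induction
  case (mono c k)
  show ?case using assms(2)
  proof induction
    case (mono d l)
    have "(\<lambda>x. c * fe k x * (d * fe l x)) = (\<lambda>x. (c * d) * fe (k + l) x)"
      by (simp add: fun_eq_iff flip: fe_mult)
    then show ?case using trig_poly.mono by simp
  next
    case (plus f g)
    then show ?case using trig_poly.plus by (fastforce simp: distrib_left)
  qed
next
  case (plus f h)
  then show ?case using trig_poly.plus by (fastforce simp: distrib_right)
qed

text \<open>On the unit circle the conjugate of \<open>fe 1 x\<close> is \<open>fe (-1) x\<close>,
  so every real linear functional of \<open>fe 1 x\<close> is a combination of these two
  exponentials. Sums and products preserve \<open>trig_poly\<close>.\<close>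

lemma trig_poly_real_polynomial:
  fixes p :: "complex \<Rightarrow> real"
  assumes "real_polynomial_function p"
  shows "trig_poly (\<lambda>x. of_real (p (fe 1 x)))"
  using assms
proof induction
  case (linear p)
  interpret bounded_linear p by fact
  define a where "a = complex_of_real (p 1)"
  define b where "b = complex_of_real (p \<i>)"
  have "of_real (p (fe 1 x)) = ((a - \<i> * b) / 2) * fe 1 x + ((a + \<i> * b) / 2) * fe (-1) x" for x
  proof -
    define z where "z = fe 1 x"
    have "z = Re z *\<^sub>R 1 + Im z *\<^sub>R \<i>" by (simp add: complex_eq_iff)
    then have "p z = p (Re z *\<^sub>R 1 + Im z *\<^sub>R \<i>)" by (rule arg_cong)
    then have "p z = Re z * p 1 + Im z * p \<i>" by (simp only: add scaleR real_scaleR_def)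
    then have "of_real (p z) = of_real (Re z) * a + of_real (Im z) * b" by (simp add: a_def b_def)
    also have "\<dots> = ((a - \<i> * b) / 2) * z + ((a + \<i> * b) / 2) * cnj z"
      by (simp add: complex_eq_iff field_simps)
    finally show ?thesis by (simp add: z_def cnj_fe)
  qed
  then show ?case using trig_poly.plus[OF trig_poly.mono trig_poly.mono] by presburger
next
  case (const c)
  have "trig_poly (\<lambda>x. of_real c * fe 0 x)" by (rule trig_poly.mono)
  then show ?case by simp
qed (auto intro: trig_poly.plus trig_poly_mult)

lemma trig_poly_cmult: "trig_poly f \<Longrightarrow> trig_poly (\<lambda>x. c * f x)"
  using trig_poly_mult[OF trig_poly.mono[of c 0]] by simp

lemma fe_1_eq: "fe 1 x = fe 1 y \<Longrightarrow> x \<in> {0..1} \<Longrightarrow> y \<in> {0..1} \<Longrightarrow> x = y \<or> {x, y} = {0, 1}"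
proof -
  assume e: "fe 1 x = fe 1 y" and xy: "x \<in> {0..1}" "y \<in> {0..1}"
  obtain n :: int where n: "2 * of_real pi * \<i> * of_int 1 * of_real x = 2 * of_real pi * \<i> * of_int 1 * of_real y + (of_int (2 * n) * pi) * \<i>"
    using e unfolding fe_def exp_eq by auto
  then have "2 * pi * x = 2 * pi * y + of_int (2 * n) * pi"
    by (auto simp: complex_eq_iff)
  then have "2 * pi * (x - y - of_int n) = 0" by (simp add: algebra_simps)
  then have d: "x - y = of_int n" by simp
  then have "n = 0 \<or> n = 1 \<or> n = -1" using xy by auto
  then show ?thesis using d xy by auto
qed

text \<open>Equal end values let \<open>\<phi>\<close> descend to a function on the unit circle,
  where the Stone-Weierstrass theorem supplies a polynomial in the real and imaginary parts.\<close>

lemma trig_poly_dense: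
  fixes \<phi> :: "real \<Rightarrow> complex"
  assumes c: "continuous_on {0..1} \<phi>" and p: "\<phi> 0 = \<phi> 1" and e: "e > 0"
  shows "\<exists>g. trig_poly g \<and> (\<forall>x\<in>{0..1}. norm (\<phi> x - g x) < e)"
proof -
  define S where "S = fe 1 ` {0..1}"
  define \<psi> where "\<psi> = (\<lambda>z. \<phi> (SOME x. x \<in> {0..1} \<and> fe 1 x = z))"
  have psi: "\<psi> (fe 1 x) = \<phi> x" if x: "x \<in> {0..1}" for x
  proof -
    define y where "y = (SOME y. y \<in> {0..1} \<and> fe 1 y = fe 1 x)"
    have y: "y \<in> {0..1}" "fe 1 y = fe 1 x"
      unfolding y_def using someI[of "\<lambda>y. y \<in> {0..1} \<and> fe 1 y = fe 1 x" x] x by auto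
    have "\<phi> y = \<phi> x" using fe_1_eq[OF y(2) y(1) x] p by (auto simp: doubleton_eq_iff)
    then show ?thesis by (simp add: \<psi>_def y_def)
  qed
  have S: "compact S" unfolding S_def by (intro compact_continuous_image continuous_fe) auto
  \<comment> \<open>\<open>fe 1\<close> identifies 0 and 1 and has no continuous inverse on
    \<open>S\<close>. Closed preimages under \<open>\<psi>\<close> are nevertheless images of
    compact sets under \<open>fe 1\<close>, and therefore closed.\<close>
  have "continuous_on S \<psi>"
    unfolding continuous_on_closed_vimage[OF compact_imp_closed[OF S]]
  proof (intro allI impI)
    fix B :: "complex set" assume B: "closed B"
    have "\<psi> -` B \<inter> S = fe 1 ` (\<phi> -` B \<inter> {0..1})" using psi by (force simp: S_def)
    moreover have "compact (\<phi> -` B \<inter> {0..1})"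
      using continuous_on_closed_vimage[of "{0..1}" \<phi>] c B by (auto simp: compact_eq_bounded_closed intro: bounded_subset)
    ultimately show "closed (\<psi> -` B \<inter> S)"
      by (simp add: compact_imp_closed compact_continuous_image continuous_fe)
  qed
  from Stone_Weierstrass_polynomial_function[OF S this e]
  obtain g where g: "polynomial_function g" "\<And>z. z \<in> S \<Longrightarrow> norm (\<psi> z - g z) < e"
    by blast
  have "real_polynomial_function (\<lambda>z. Re (g z))" "real_polynomial_function (\<lambda>z. Im (g z))"
    using g(1) bounded_linear_Re bounded_linear_Im unfolding polynomial_function_def o_def by auto
  then have "trig_poly (\<lambda>x. of_real (Re (g (fe 1 x))) + \<i> * of_real (Im (g (fe 1 x))))"
    by (intro trig_poly.plus trig_poly_cmult) (auto intro: trig_poly_real_polynomial)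
  moreover have "(\<lambda>x. of_real (Re (g (fe 1 x))) + \<i> * of_real (Im (g (fe 1 x)))) = (\<lambda>x. g (fe 1 x))"
    by (simp add: complex_eq_iff fun_eq_iff)
  ultimately have "trig_poly (\<lambda>x. g (fe 1 x))" by simp
  moreover have "norm (\<phi> x - g (fe 1 x)) < e" if "x \<in> {0..1}" for x
    using g(2)[of "fe 1 x"] psi[OF that] that by (auto simp: S_def)
  ultimately show ?thesis by blast
qed

lemma integral_trig_poly_zero:
  assumes f: "integrable I01 f" and z: "\<And>k. (\<integral>x. f x * fe k x \<partial>I01) = 0"
    and g: "trig_poly g"
  shows "integrable I01 (\<lambda>x. f x * g x) \<and> (\<integral>x. f x * g x \<partial>I01) = 0"
  using g
proof induction
  case (mono c k)
  have "(\<lambda>x. f x * (c * fe k x)) = (\<lambda>x. c * (f x * fe k x))" by (auto simp: mult_ac)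
  then show ?case using z integrable_mult_fe[OF f] by simp
qed (auto simp: distrib_left)

lemma integral_continuous_zero:
  assumes f: "integrable I01 f" and z: "\<And>k. (\<integral>x. f x * fe k x \<partial>I01) = 0"
    and c: "continuous_on {0..1} \<phi>" and p: "\<phi> 0 = \<phi> 1" and i: "integrable I01 (\<lambda>x. f x * \<phi> x)"
  shows "(\<integral>x. f x * \<phi> x \<partial>I01) = 0"
proof -
  define I where "I = (\<integral>x. norm (f x) \<partial>I01)"
  have "norm (\<integral>x. f x * \<phi> x \<partial>I01) \<le> e * (I + 1)" if e: "e > 0" for e
  proof -
    obtain g where g: "trig_poly g" "\<And>x. x \<in> {0..1} \<Longrightarrow> norm (\<phi> x - g x) < e"
      using trig_poly_dense[OF c p e] by blast
    note gi = integral_trig_poly_zero[OF f z g(1)]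
    have "(\<integral>x. f x * \<phi> x \<partial>I01) = (\<integral>x. f x * \<phi> x - f x * g x \<partial>I01)"
      using i gi by simp
    also have "norm \<dots> \<le> (\<integral>x. norm (f x * \<phi> x - f x * g x) \<partial>I01)"
      by (rule integral_norm_bound)
    also have "\<dots> \<le> (\<integral>x. e * norm (f x) \<partial>I01)"
    proof (rule integral_mono)
      show "integrable I01 (\<lambda>x. norm (f x * \<phi> x - f x * g x))" using i gi by auto
      show "integrable I01 (\<lambda>x. e * norm (f x))" using f by auto
      fix x assume "x \<in> space I01"
      then have "norm (\<phi> x - g x) \<le> e" using g(2)[of x] by (auto simp: space_restrict_space)
      then have "norm (f x) * norm (\<phi> x - g x) \<le> norm (f x) * e" by (intro mult_left_mono) auto
      then show "norm (f x * \<phi> x - f x * g x) \<le> e * norm (f x)"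
        by (simp only: right_diff_distrib[symmetric] norm_mult mult.commute[of e])
    qed
    also have "\<dots> = e * I" by (simp add: I_def)
    also have "\<dots> \<le> e * (I + 1)" using e by simp
    finally show ?thesis .
  qed
  moreover have "I + 1 > 0" unfolding I_def by (intro add_nonneg_pos) auto
  ultimately have "norm (\<integral>x. f x * \<phi> x \<partial>I01) \<le> 0 + e" if "e > 0" for e
    using that by (metis add_0 divide_pos_pos nonzero_eq_divide_eq less_irrefl)
  then have "norm (\<integral>x. f x * \<phi> x \<partial>I01) \<le> 0" by (rule field_le_epsilon)
  then show ?thesis by simp
qed

text \<open>Testing f against the conjugate of its sign would give the integral of its modulus. The
  sign is only measurable, so it is approximated almost everywhere by bounded continuous functions
  with equal end values, to which density of trigonometric polynomials applies.\<close>

lemma fourier_unique: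
  assumes m: "f \<in> borel_measurable borel" and f: "integrable I01 f"
    and z: "\<And>k. (\<integral>x. f x * fe k x \<partial>I01) = 0"
  shows "AE x in I01. f x = 0"
proof -
  define s where "s = (\<lambda>x. cnj (sgn (f x)))"
  have s: "s \<in> borel_measurable borel"
  proof -
    have "(\<lambda>x. f x /\<^sub>R norm (f x)) \<in> borel_measurable borel" using m by measurable
    moreover have "cnj \<in> borel_measurable borel" by (intro borel_measurable_continuous_onI continuous_intros)
    ultimately show ?thesis unfolding s_def sgn_div_norm by (rule measurable_compose)
  qed
  have "s \<in> borel_measurable (lebesgue_on {0..1})"
    using s by (simp add: measurable_completion measurable_restrict_space1)
  then have "s measurable_on {0..1}" by (subst measurable_on_iff_borel_measurable) auto
  then obtain N g where N: "negligible N" and g: "\<And>n. continuous_on UNIV (g n)"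
    and lim: "\<And>x. x \<notin> N \<Longrightarrow> ((\<lambda>n. g n x) \<longlonglongrightarrow> (if x \<in> {0..1} then s x else 0))"
    unfolding measurable_on_def by blast
  \<comment> \<open>A cutoff that vanishes at 0 and 1 and tends to 1 in between: it makes the
    approximants periodic. Dividing by \<open>max 1 (norm (g n x))\<close> keeps them in the unit
    disc, which provides the majorant \<open>norm (f x)\<close>.\<close>
  define \<kappa> where "\<kappa> = (\<lambda>(n::nat) (x::real). min 1 (real n * min x (1 - x)))"
  define \<phi> where "\<phi> = (\<lambda>n x. of_real (\<kappa> n x) * (g n x / of_real (max 1 (norm (g n x)))))"
  have c: "continuous_on A (\<phi> n)" for n A
    unfolding \<phi>_def \<kappa>_def using continuous_on_subset[OF g[of n]]
    by (intro continuous_intros) (auto simp: max_def)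
  have p: "\<phi> n 0 = \<phi> n 1" for n by (simp add: \<phi>_def \<kappa>_def)
  have bd: "norm (\<phi> n x) \<le> 1" if x: "x \<in> {0..1}" for n x
  proof -
    have "0 \<le> \<kappa> n x" "\<kappa> n x \<le> 1" using x by (auto simp: \<kappa>_def)
    moreover have "norm (g n x / of_real (max 1 (norm (g n x)))) \<le> 1"
      by (simp add: norm_divide divide_le_eq_1 max_def)
    ultimately show ?thesis unfolding \<phi>_def norm_mult
      by (intro mult_le_one) auto
  qed
  have mphi: "\<phi> n \<in> borel_measurable I01" for n
    by (intro borel_measurable_unit borel_measurable_continuous_onI c)
  have fm: "f \<in> borel_measurable I01" using m by (rule borel_measurable_unit)
  have int: "integrable I01 (\<lambda>x. f x * \<phi> n x)" for n
    by (rule Bochner_Integration.integrable_bound[OF f])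
      (use fm mphi bd in \<open>auto simp: norm_mult space_restrict_space intro!: AE_I2 mult_left_le\<close>)
  have zero: "(\<integral>x. f x * \<phi> n x \<partial>I01) = 0" for n
    by (rule integral_continuous_zero[OF f z c p int])
  have tend: "(\<lambda>n. \<phi> n x) \<longlonglongrightarrow> s x" if x: "x \<in> {0..1}" "x \<noteq> 0" "x \<noteq> 1" "x \<notin> N" for x
  proof -
    have 1: "(\<lambda>n. g n x) \<longlonglongrightarrow> s x" using lim[OF x(4)] x by simp
    have ns: "norm (s x) \<le> 1" by (simp add: s_def norm_sgn)
    have 2: "(\<lambda>n. g n x / of_real (max 1 (norm (g n x)))) \<longlonglongrightarrow> s x / of_real (max 1 (norm (s x)))"
      by (intro tendsto_intros 1) (auto simp: max_def)
    have "(\<lambda>n. \<kappa> n x) \<longlonglongrightarrow> 1"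
    proof (rule tendsto_eventually)
      obtain n0 :: nat where n0: "real n0 * min x (1 - x) > 1"
      proof -
        have "min x (1 - x) > 0" using x by auto
        then show thesis using ex_less_of_nat_mult[of "min x (1 - x)" 1] that by blast
      qed
      have "\<kappa> n x = 1" if "n \<ge> n0" for n
      proof -
        have "real n0 * min x (1 - x) \<le> real n * min x (1 - x)"
          using that x by (intro mult_right_mono) (auto simp: min_def)
        then show ?thesis using n0 by (simp add: \<kappa>_def)
      qed
      then show "\<forall>\<^sub>F n in sequentially. \<kappa> n x = 1" using eventually_sequentially by blast
    qed
    then have 3: "(\<lambda>n. complex_of_real (\<kappa> n x)) \<longlonglongrightarrow> of_real 1" by (intro tendsto_of_real)
    have "max 1 (norm (s x)) = 1" using ns by simp
    then show ?thesis using tendsto_mult[OF 3 2] by (simp add: \<phi>_def)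
  qed
  have ae: "AE x in I01. x \<noteq> 0 \<and> x \<noteq> 1 \<and> x \<notin> N"
  proof -
    have "negligible (N \<union> {0, 1})" using N by auto
    then have "N \<union> {0,1} \<in> null_sets lebesgue" by (simp add: negligible_iff_null_sets)
    then have "AE x in lebesgue. x \<notin> N \<union> {0,1}" by (rule AE_not_in)
    then have "AE x in lborel. x \<notin> N \<union> {0,1}" by (simp add: AE_completion_iff)
    then show ?thesis by (subst AE_restrict_space_iff) (auto elim: eventually_mono)
  qed
  have "(\<lambda>n. \<integral>x. f x * \<phi> n x \<partial>I01) \<longlonglongrightarrow> (\<integral>x. f x * s x \<partial>I01)"
  proof (rule integral_dominated_convergence)
    show "(\<lambda>x. f x * s x) \<in> borel_measurable I01" using fm borel_measurable_unit[OF s] by measurable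
    show "integrable I01 (\<lambda>x. norm (f x))" using f by auto
    show "AE x in I01. (\<lambda>n. f x * \<phi> n x) \<longlonglongrightarrow> f x * s x"
      using ae AE_space by eventually_elim (auto simp: space_restrict_space intro!: tendsto_mult tend)
    show "AE x in I01. norm (f x * \<phi> n x) \<le> norm (f x)" for n
      using bd by (auto simp: norm_mult space_restrict_space intro!: AE_I2 mult_left_le)
  qed (use fm mphi in auto)
  then have "(\<integral>x. f x * s x \<partial>I01) = 0"
    by (simp only: zero) (simp add: LIMSEQ_const_iff)
  moreover have fs: "f x * s x = of_real (norm (f x))" for x
  proof (cases "f x = 0")
    case False
    have "f x * cnj (f x) = of_real (norm (f x)) * of_real (norm (f x))"
      by (simp add: complex_norm_square[symmetric] power2_eq_square[symmetric])
    then show ?thesis using False by (simp add: s_def sgn_div_norm scaleR_conv_of_real field_simps)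
  qed (simp add: s_def)
  ultimately have "complex_of_real (\<integral>x. norm (f x) \<partial>I01) = 0"
    by simp
  then have "(\<integral>x. norm (f x) \<partial>I01) = 0" by simp
  then have "AE x in I01. norm (f x) = 0"
    using f by (subst (asm) integral_nonneg_eq_0_iff_AE) auto
  then show ?thesis by simp
qed

subsection \<open>Existence: the Riesz-Fischer theorem\<close>

definition fsum :: "int set \<Rightarrow> (int \<Rightarrow> complex) \<Rightarrow> real \<Rightarrow> complex" where
  "fsum F a x = (\<Sum>k\<in>F. a k * fe k x)"

lemma continuous_fsum [continuous_intros]: "continuous_on A (fsum F a)"
  unfolding fsum_def by (intro continuous_intros)

lemma measurable_fsum [measurable]: "fsum F a \<in> borel_measurable borel"
  by (intro borel_measurable_continuous_onI continuous_fsum)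

lemma integrable_continuous_unit:
  fixes f :: "real \<Rightarrow> 'b::{banach, second_countable_topology}"
  assumes "continuous_on {0..1} f"
  shows "integrable I01 f"
  using borel_integrable_compact[OF compact_Icc assms]
  by (simp add: integrable_restrict_space)

lemma integral_fsum_fe:
  assumes "finite F"
  shows "(\<integral>x. fsum F a x * fe (- k) x \<partial>I01) = (if k \<in> F then a k else 0)"
proof -
  have "(\<integral>x. fsum F a x * fe (- k) x \<partial>I01) = (\<integral>x. (\<Sum>l\<in>F. a l * fe (l - k) x) \<partial>I01)"
    unfolding fsum_def sum_distrib_right by (simp add: mult.assoc fe_mult)
  also have "\<dots> = (\<Sum>l\<in>F. a l * (\<integral>x. fe (l - k) x \<partial>I01))"
    by (subst Bochner_Integration.integral_sum)
      (auto intro!: integrable_continuous_unit continuous_intros)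
  also have "\<dots> = (\<Sum>l\<in>F. if l = k then a l else 0)"
    by (rule sum.cong) (auto simp: integral_fe)
  also have "\<dots> = (if k \<in> F then a k else 0)"
    using assms by simp
  finally show ?thesis .
qed

lemma integral_fsum_sq:
  assumes "finite F"
  shows "(\<integral>x. (norm (fsum F a x))\<^sup>2 \<partial>I01) = (\<Sum>k\<in>F. (norm (a k))\<^sup>2)"
proof -
  have eq: "complex_of_real ((norm (fsum F a x))\<^sup>2) = (\<Sum>k\<in>F. cnj (a k) * (fsum F a x * fe (- k) x))" for x
  proof -
    have "complex_of_real ((norm (fsum F a x))\<^sup>2) = fsum F a x * cnj (fsum F a x)"
      by (rule complex_norm_square)
    also have "cnj (fsum F a x) = (\<Sum>k\<in>F. cnj (a k) * fe (- k) x)" by (simp add: fsum_def cnj_fe)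
    finally show ?thesis by (simp add: sum_distrib_left mult_ac)
  qed
  have "complex_of_real (\<integral>x. (norm (fsum F a x))\<^sup>2 \<partial>I01) = (\<integral>x. complex_of_real ((norm (fsum F a x))\<^sup>2) \<partial>I01)"
    by (rule integral_complex_of_real[symmetric])
  also have "\<dots> = (\<integral>x. (\<Sum>k\<in>F. cnj (a k) * (fsum F a x * fe (- k) x)) \<partial>I01)"
    by (simp only: eq)
  also have "\<dots> = (\<Sum>k\<in>F. cnj (a k) * (\<integral>x. fsum F a x * fe (- k) x \<partial>I01))"
    by (subst Bochner_Integration.integral_sum)
      (auto intro!: integrable_continuous_unit continuous_intros)
  also have "\<dots> = (\<Sum>k\<in>F. cnj (a k) * a k)"
    by (rule sum.cong) (auto simp: integral_fsum_fe[OF assms])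
  also have "\<dots> = complex_of_real (\<Sum>k\<in>F. (norm (a k))\<^sup>2)"
    unfolding of_real_sum complex_norm_square by (simp add: mult.commute)
  finally show ?thesis using of_real_eq_iff by blast
qed

lemma finite_int_bounded:
  assumes "finite X"
  shows "\<exists>n::nat. X \<subseteq> {- int n..int n}"
proof -
  have "\<bar>k\<bar> \<le> int (nat (\<Sum>k\<in>X. \<bar>k\<bar>))" if "k \<in> X" for k
    using member_le_sum[of k X abs] that assms by (simp add: sum_nonneg)
  then show ?thesis by (intro exI[of _ "nat (\<Sum>k\<in>X. \<bar>k\<bar>)"]) (force simp: abs_le_iff)
qed

lemma infsum_int_tendsto:
  fixes f :: "int \<Rightarrow> 'b::banach"
  assumes f: "f summable_on UNIV" and M: "\<And>j::nat. j \<le> M j"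
  shows "(\<lambda>j. \<Sum>k\<in>{- int (M j)..int (M j)}. f k) \<longlonglongrightarrow> (\<Sum>\<^sub>\<infinity>k. f k)"
proof -
  have "filterlim (\<lambda>j. {- int (M j)..int (M j)}) (finite_subsets_at_top UNIV) sequentially"
    unfolding filterlim_finite_subsets_at_top
  proof (intro allI impI)
    fix X :: "int set" assume X: "finite X \<and> X \<subseteq> UNIV"
    obtain n where n: "X \<subseteq> {- int n..int n}" using finite_int_bounded X by blast
    have "{- int n..int n} \<subseteq> {- int (M j)..int (M j)}" if "j \<ge> n" for j using M[of j] that by auto
    then show "\<forall>\<^sub>F j in sequentially. finite {- int (M j)..int (M j)} \<and> X \<subseteq> {- int (M j)..int (M j)} \<and> {- int (M j)..int (M j)} \<subseteq> UNIV"
      unfolding eventually_sequentially using n by blast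
  qed
  then show ?thesis by (rule filterlim_compose[OF infsum_tendsto[OF f]])
qed

text \<open>Symmetric partial sums are taken along a subsequence \<open>M\<close> for which the j-th
  block has squared norm at most 4^-j; then the blocks are absolutely summable almost everywhere.
  The subsequence is part of the conclusion because \<open>fun_of_pairing\<close> integrates along
  it.\<close>

lemma riesz_fischer:
  assumes a: "wl2 (\<lambda>_. 1) a"
  shows "\<exists>f M. has_fourier_coeffs f a \<and> (\<forall>j. j \<le> M j) \<and>
    (AE x in I01. (\<lambda>j. fsum {- int (M j)..int (M j)} a x) \<longlonglongrightarrow> f x)"
proof -
  define A where "A = (\<Sum>\<^sub>\<infinity>k. (norm (a k))\<^sup>2)"
  have sm: "(\<lambda>k. (norm (a k))\<^sup>2) summable_on UNIV" using a by (simp add: wl2_def)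
  have A: "(\<Sum>k\<in>F. (norm (a k))\<^sup>2) \<le> A" if "finite F" for F
    unfolding A_def using that sm by (intro finite_sum_le_infsum) auto
  have "\<exists>n::nat. \<forall>F. finite F \<longrightarrow> F \<inter> {- int n..int n} = {} \<longrightarrow> (\<Sum>k\<in>F. (norm (a k))\<^sup>2) \<le> (1/4) ^ j" for j :: nat
  proof -
    have "\<forall>\<^sub>F n in sequentially. A - (1/4) ^ j < (\<Sum>k\<in>{- int n..int n}. (norm (a k))\<^sup>2)"
      by (rule order_tendstoD(1)[OF infsum_int_tendsto[OF sm]]) (auto simp: A_def)
    then obtain n where n: "A - (1/4) ^ j < (\<Sum>k\<in>{- int n..int n}. (norm (a k))\<^sup>2)"
      unfolding eventually_sequentially by blast
    have "(\<Sum>k\<in>F. (norm (a k))\<^sup>2) \<le> (1/4) ^ j" if F: "finite F" "F \<inter> {- int n..int n} = {}" for F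
      using A[of "F \<union> {- int n..int n}"] n F by (simp add: sum.union_disjoint)
    then show ?thesis by blast
  qed
  then obtain n :: "nat \<Rightarrow> nat" where n: "\<And>j F. finite F \<Longrightarrow> F \<inter> {- int (n j)..int (n j)} = {} \<Longrightarrow> (\<Sum>k\<in>F. (norm (a k))\<^sup>2) \<le> (1/4) ^ j"
    by metis
  define M where "M = (\<lambda>j. (\<Sum>i\<le>j. n i) + j)"
  have Mn: "n j \<le> M j" for j unfolding M_def by (intro trans_le_add1 member_le_sum) auto
  have Mj: "j \<le> M j" for j by (simp add: M_def)
  have Mmono: "M j \<le> M (Suc j)" for j by (simp add: M_def)
  define F where "F = (\<lambda>j. {- int (M j)..int (M j)})"
  define g where "g = (\<lambda>j. fsum (F (Suc j) - F j) a)"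
  have Fsub: "F j \<subseteq> F (Suc j)" for j using Mmono[of j] by (auto simp: F_def)
  have Ffin: "finite (F j)" for j by (simp add: F_def)
  have gS: "g j x = fsum (F (Suc j)) a x - fsum (F j) a x" for j x
    unfolding g_def fsum_def using Fsub Ffin by (simp add: sum_diff)
  have g2: "(\<integral>x. (norm (g j x))\<^sup>2 \<partial>I01) \<le> (1/4) ^ j" for j
    unfolding g_def
    by (subst integral_fsum_sq) (use Mn[of j] Ffin in \<open>auto intro!: n simp: F_def\<close>)
  have gi: "integrable I01 (g j)" for j
    unfolding g_def by (intro integrable_continuous_unit continuous_intros)
  have g1: "(\<integral>x. norm (g j x) \<partial>I01) \<le> (1/2) ^ j" for j
  proof -
    have i2: "integrable I01 (\<lambda>x. (norm (g j x))\<^sup>2)"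
      unfolding g_def by (intro integrable_continuous_unit continuous_intros)
    \<comment> \<open>The arithmetic-geometric mean inequality with weights 2^-j and 2^j converts
      the bound 4^-j on the squared norm into the bound 2^-j on the integral of the modulus.\<close>
    have "(\<integral>x. norm (g j x) \<partial>I01) \<le> (\<integral>x. ((1/2) ^ j + 2 ^ j * (norm (g j x))\<^sup>2) / 2 \<partial>I01)"
    proof (rule integral_mono)
      show "integrable I01 (\<lambda>x. norm (g j x))" using gi by auto
      show "integrable I01 (\<lambda>x. ((1/2) ^ j + 2 ^ j * (norm (g j x))\<^sup>2) / 2)"
        unfolding g_def by (intro integrable_continuous_unit continuous_intros) auto
      fix x
      have "0 \<le> 2 ^ j * (norm (g j x) - (1/2) ^ j)\<^sup>2" by simp
      also have "\<dots> = 2 ^ j * (norm (g j x))\<^sup>2 - 2 * norm (g j x) + (1/2) ^ j"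
        by (simp add: power2_eq_square algebra_simps power_one_over)
      finally show "norm (g j x) \<le> ((1/2) ^ j + 2 ^ j * (norm (g j x))\<^sup>2) / 2" by simp
    qed
    also have "\<dots> = ((1/2) ^ j + 2 ^ j * (\<integral>x. (norm (g j x))\<^sup>2 \<partial>I01)) / 2"
    proof -
      interpret finite_measure I01 by (rule I01_finite)
      show ?thesis using i2 by (simp add: measure_restrict_space)
    qed
    also have "\<dots> \<le> ((1/2) ^ j + 2 ^ j * (1/4) ^ j) / 2"
      using g2[of j] by simp
    also have "\<dots> = (1/2) ^ j" by (simp flip: power_mult_distrib)
    finally show ?thesis .
  qed
  have geo: "summable (\<lambda>j. (1/2::real) ^ j)" by (rule summable_geometric) auto
  have sumI: "summable (\<lambda>j. \<integral>x. norm (g j x) \<partial>I01)"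
    by (rule summable_comparison_test_ev[OF _ geo]) (use g1 in auto)
  have aesum: "AE x in I01. summable (\<lambda>j. norm (g j x))"
  proof -
    have "(\<integral>\<^sup>+x. (\<Sum>j. ennreal (norm (g j x))) \<partial>I01) = (\<Sum>j. \<integral>\<^sup>+x. ennreal (norm (g j x)) \<partial>I01)"
      using gi by (intro nn_integral_suminf) auto
    also have "\<dots> = (\<Sum>j. ennreal (\<integral>x. norm (g j x) \<partial>I01))"
      using gi by (intro arg_cong[where f = suminf] ext nn_integral_eq_integral) auto
    finally have eq: "(\<integral>\<^sup>+x. (\<Sum>j. ennreal (norm (g j x))) \<partial>I01) = (\<Sum>j. ennreal (\<integral>x. norm (g j x) \<partial>I01))" .
    have "(\<Sum>j. ennreal (\<integral>x. norm (g j x) \<partial>I01)) \<noteq> top"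
      by (rule ennreal_suminf_neq_top[OF sumI]) auto
    then have "(\<integral>\<^sup>+x. (\<Sum>j. ennreal (norm (g j x))) \<partial>I01) \<noteq> \<infinity>"
      unfolding eq infinity_ennreal_def .
    then have "AE x in I01. (\<Sum>j. ennreal (norm (g j x))) \<noteq> \<infinity>"
      by (intro nn_integral_PInf_AE) (use gi in measurable)
    then show ?thesis by eventually_elim (auto intro: summable_suminf_not_top)
  qed
  \<comment> \<open>Where the blocks do not sum, \<open>suminf\<close> has an unspecified value; by
    \<open>aesum\<close> this happens only on a null set.\<close>
  define f where "f = (\<lambda>x. fsum (F 0) a x + (\<Sum>j. g j x))"
  have gm: "g j \<in> borel_measurable borel" for j unfolding g_def by measurable
  have fm: "f \<in> borel_measurable borel" unfolding f_def using gm by measurable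
  have part: "(\<Sum>j<m. g j x) = fsum (F m) a x - fsum (F 0) a x" for m x
    unfolding gS by (rule sum_lessThan_telescope)
  have lim: "AE x in I01. (\<lambda>j. fsum (F j) a x) \<longlonglongrightarrow> f x"
    using aesum
  proof eventually_elim
    case (elim x)
    then have "summable (\<lambda>j. g j x)" by (rule summable_norm_cancel)
    then have "(\<lambda>m. \<Sum>j<m. g j x) \<longlonglongrightarrow> (\<Sum>j. g j x)" by (rule summable_LIMSEQ)
    then have "(\<lambda>m. fsum (F 0) a x + (fsum (F m) a x - fsum (F 0) a x)) \<longlonglongrightarrow> f x"
      unfolding f_def part by (intro tendsto_intros)
    then show ?case by simp
  qed
  \<comment> \<open>Fatou's lemma along the partial sums, whose squared norms are at most
    \<open>A\<close>.\<close>
  have sq: "integrable I01 (\<lambda>x. (norm (f x))\<^sup>2)"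
    unfolding integrable_iff_bounded
  proof
    show "(\<lambda>x. (norm (f x))\<^sup>2) \<in> borel_measurable I01"
      using borel_measurable_unit[OF fm] by measurable
    have "(\<integral>\<^sup>+x. ennreal (norm ((norm (f x))\<^sup>2)) \<partial>I01)
        = (\<integral>\<^sup>+x. liminf (\<lambda>j. ennreal ((norm (fsum (F j) a x))\<^sup>2)) \<partial>I01)"
    proof (rule nn_integral_cong_AE)
      show "AE x in I01. ennreal (norm ((norm (f x))\<^sup>2)) = liminf (\<lambda>j. ennreal ((norm (fsum (F j) a x))\<^sup>2))"
        using lim
      proof eventually_elim
        case (elim x)
        then have "(\<lambda>j. ennreal ((norm (fsum (F j) a x))\<^sup>2)) \<longlonglongrightarrow> ennreal ((norm (f x))\<^sup>2)"
          by (intro tendsto_ennrealI tendsto_intros)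
        then have "liminf (\<lambda>j. ennreal ((norm (fsum (F j) a x))\<^sup>2)) = ennreal ((norm (f x))\<^sup>2)"
          by (intro lim_imp_Liminf) auto
        then show ?case by simp
      qed
    qed
    also have "\<dots> \<le> liminf (\<lambda>j. \<integral>\<^sup>+x. ennreal ((norm (fsum (F j) a x))\<^sup>2) \<partial>I01)"
      by (rule nn_integral_liminf) (intro borel_measurable_unit, measurable)
    also have "\<dots> \<le> liminf (\<lambda>j. ennreal A)"
    proof (rule Liminf_mono, rule always_eventually, rule allI)
      fix j
      have "(\<integral>\<^sup>+x. ennreal ((norm (fsum (F j) a x))\<^sup>2) \<partial>I01) = ennreal (\<Sum>k\<in>F j. (norm (a k))\<^sup>2)"
        unfolding integral_fsum_sq[OF Ffin, symmetric]
        by (intro nn_integral_eq_integral integrable_continuous_unit continuous_intros) auto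
      also have "\<dots> \<le> ennreal A" using A[OF Ffin] by (rule ennreal_leI)
      finally show "(\<integral>\<^sup>+x. ennreal ((norm (fsum (F j) a x))\<^sup>2) \<partial>I01) \<le> ennreal A" .
    qed
    also have "\<dots> < \<infinity>" by (simp add: Liminf_const)
    finally show "(\<integral>\<^sup>+x. ennreal (norm ((norm (f x))\<^sup>2)) \<partial>I01) < \<infinity>" .
  qed
  have coef: "(\<integral>x. f x * fe (- k) x \<partial>I01) = a k" for k
  proof (rule LIMSEQ_unique)
    show "(\<lambda>j. \<integral>x. fsum (F j) a x * fe (- k) x \<partial>I01) \<longlonglongrightarrow> (\<integral>x. f x * fe (- k) x \<partial>I01)"
    proof (rule integral_dominated_convergence)
      show "integrable I01 (\<lambda>x. norm (fsum (F 0) a x) + (\<Sum>j. norm (g j x)))"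
        by (rule Bochner_Integration.integrable_add[OF integrable_continuous_unit integrable_suminf], intro continuous_intros)
          (use gi aesum sumI in auto)
      show "AE x in I01. (\<lambda>j. fsum (F j) a x * fe (- k) x) \<longlonglongrightarrow> f x * fe (- k) x"
        using lim by eventually_elim (intro tendsto_intros)
      show "AE x in I01. norm (fsum (F m) a x * fe (- k) x) \<le> norm (fsum (F 0) a x) + (\<Sum>j. norm (g j x))" for m
        using aesum
      proof eventually_elim
        case (elim x)
        have "norm (fsum (F m) a x) \<le> norm (fsum (F 0) a x) + norm (\<Sum>j<m. g j x)"
          unfolding part using norm_triangle_ineq[of "fsum (F 0) a x"] by (metis add_diff_cancel_left' add_diff_eq)
        also have "norm (\<Sum>j<m. g j x) \<le> (\<Sum>j<m. norm (g j x))" by (rule norm_sum)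
        also have "\<dots> \<le> (\<Sum>j. norm (g j x))" by (rule sum_le_suminf[OF elim]) auto
        finally show ?case by (simp add: norm_mult)
      qed
    qed (intro borel_measurable_unit; use fm in measurable)+
    have "k \<in> F j" if "j \<ge> nat \<bar>k\<bar>" for j using that Mj[of j] by (auto simp: F_def)
    then show "(\<lambda>j. \<integral>x. fsum (F j) a x * fe (- k) x \<partial>I01) \<longlonglongrightarrow> a k"
      by (intro tendsto_eventually) (auto simp: integral_fsum_fe[OF Ffin] eventually_sequentially)
  qed
  have "has_fourier_coeffs f a" unfolding has_fourier_coeffs_unit using fm sq coef by blast
  then show ?thesis using Mj lim unfolding F_def by blast
qed

lemma fourier_coeffD:
  assumes "has_fourier_coeffs f a"
  shows "f \<in> borel_measurable borel" "f \<in> borel_measurable I01" "integrable I01 f"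
    "(\<integral>x. f x * fe (- k) x \<partial>I01) = a k" "(\<integral>x. f x * fe k x \<partial>I01) = a (- k)"
proof -
  have *: "f \<in> borel_measurable borel" "integrable I01 (\<lambda>x. (norm (f x))\<^sup>2)"
    and c: "\<forall>k. (\<integral>x. f x * fe (- k) x \<partial>I01) = a k"
    using assms unfolding has_fourier_coeffs_unit by auto
  show "f \<in> borel_measurable borel" by fact
  then show m: "f \<in> borel_measurable I01" by (rule borel_measurable_unit)
  show "integrable I01 f" by (rule integrable_sq_bound[OF m *(2)])
  show "(\<integral>x. f x * fe (- k) x \<partial>I01) = a k" using c by (rule spec)
  show "(\<integral>x. f x * fe k x \<partial>I01) = a (- k)" using spec[OF c, of "- k"] by simp
qed

lemma has_fourier_coeffs_AE_unique:
  assumes f: "has_fourier_coeffs f a" and g: "has_fourier_coeffs g a"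
  shows "AE x in I01. f x = g x"
proof -
  have "AE x in I01. f x - g x = 0"
  proof (rule fourier_unique)
    show "(\<lambda>x. f x - g x) \<in> borel_measurable borel"
      using fourier_coeffD(1)[OF f] fourier_coeffD(1)[OF g] by measurable
    note i = fourier_coeffD(3)[OF f] fourier_coeffD(3)[OF g]
    show "integrable I01 (\<lambda>x. f x - g x)" using i by (rule Bochner_Integration.integrable_diff)
    fix k
    have "(\<integral>x. (f x - g x) * fe k x \<partial>I01) = (\<integral>x. f x * fe k x \<partial>I01) - (\<integral>x. g x * fe k x \<partial>I01)"
      unfolding left_diff_distrib using i by (intro Bochner_Integration.integral_diff integrable_mult_fe)
    then show "(\<integral>x. (f x - g x) * fe k x \<partial>I01) = 0"
      by (simp add: fourier_coeffD(5)[OF f] fourier_coeffD(5)[OF g])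
  qed
  then show ?thesis by simp
qed

lemma fun_of_coeffs: "wl2 (\<lambda>_. 1) a \<Longrightarrow> has_fourier_coeffs (fun_of a) a"
  unfolding fun_of_def using riesz_fischer someI_ex by metis

lemma fun_of_AE:
  assumes "has_fourier_coeffs f a"
  shows "AE x in I01. fun_of a x = f x"
  using has_fourier_coeffs_AE_unique[OF someI[of "\<lambda>f. has_fourier_coeffs f a", OF assms] assms]
  by (simp add: fun_of_def)

lemma fsum_coeffs:
  assumes "finite F" "\<And>k. k \<notin> F \<Longrightarrow> a k = 0"
  shows "has_fourier_coeffs (fsum F a) a"
  unfolding has_fourier_coeffs_unit using assms
  by (auto simp: integral_fsum_fe intro!: integrable_continuous_unit continuous_intros)

lemma fun_of_finite_AE:
  assumes "finite F" "\<And>k. k \<notin> F \<Longrightarrow> a k = 0"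
  shows "AE x in I01. fun_of a x = fsum F a x"
  by (rule fun_of_AE[OF fsum_coeffs[OF assms]])

text \<open>Parseval's identity for an absolutely summable g: its partial sums are uniformly bounded
  by \<open>B\<close>, so dominated convergence applies with the majorant
  \<open>B * norm (h x)\<close>. Gradients lie in h^1 and meet the condition, see
  \<open>h0C_1_abs_summable\<close>.\<close>

lemma fun_of_pairing:
  assumes g: "(\<lambda>k. norm (g k)) summable_on UNIV" and b: "wl2 (\<lambda>_. 1) b" and g2: "wl2 (\<lambda>_. 1) g"
  shows "(LINT x:{0..1}|lborel. fun_of g x * fun_of b x) = (\<Sum>\<^sub>\<infinity>k. g k * b (- k))"
proof -
  obtain f M where f: "has_fourier_coeffs f g" "\<And>j. j \<le> M j"
    and lim: "AE x in I01. (\<lambda>j. fsum {- int (M j)..int (M j)} g x) \<longlonglongrightarrow> f x"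
    using riesz_fischer[OF g2] by blast
  define F where "F = (\<lambda>j. {- int (M j)..int (M j)})"
  define h where "h = fun_of b"
  have h: "has_fourier_coeffs h b" unfolding h_def by (rule fun_of_coeffs[OF b])
  note hi = fourier_coeffD(3)[OF h] and hm = fourier_coeffD(2)[OF h] and hc = fourier_coeffD(4)[OF h]
  note fm = fourier_coeffD(2)[OF f(1)] fourier_coeffD(2)[OF fun_of_coeffs[OF g2]]
  define B where "B = (\<Sum>\<^sub>\<infinity>k. norm (g k))"
  have B: "norm (fsum G g x) \<le> B" if "finite G" for G x
  proof -
    have "norm (fsum G g x) \<le> (\<Sum>k\<in>G. norm (g k))"
      unfolding fsum_def by (rule norm_sum[THEN order_trans]) (simp add: norm_mult)
    also have "\<dots> \<le> B" unfolding B_def using that g by (intro finite_sum_le_infsum) auto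
    finally show ?thesis .
  qed
  have eq: "(LINT x:{0..1}|lborel. fun_of g x * h x) = (\<integral>x. f x * h x \<partial>I01)"
    unfolding LINT_unit
    by (rule integral_cong_AE) (use fm hm fun_of_AE[OF f(1)] in \<open>auto elim!: eventually_mono\<close>)
  have l1: "(\<lambda>j. \<integral>x. fsum (F j) g x * h x \<partial>I01) \<longlonglongrightarrow> (\<integral>x. f x * h x \<partial>I01)"
  proof (rule integral_dominated_convergence)
    show "integrable I01 (\<lambda>x. B * norm (h x))" using hi by auto
    show "AE x in I01. (\<lambda>j. fsum (F j) g x * h x) \<longlonglongrightarrow> f x * h x"
      using lim unfolding F_def by eventually_elim (intro tendsto_intros)
    show "AE x in I01. norm (fsum (F j) g x * h x) \<le> B * norm (h x)" for j
      unfolding norm_mult using B by (intro AE_I2 mult_right_mono) (auto simp: F_def)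
  qed (use fm hm borel_measurable_unit[OF measurable_fsum] in \<open>auto intro!: borel_measurable_times\<close>)
  have fin: "(\<integral>x. fsum (F j) g x * h x \<partial>I01) = (\<Sum>k\<in>F j. g k * b (- k))" for j
  proof -
    have "(\<integral>x. fsum (F j) g x * h x \<partial>I01) = (\<integral>x. (\<Sum>k\<in>F j. g k * (h x * fe k x)) \<partial>I01)"
      by (simp add: fsum_def sum_distrib_left sum_distrib_right mult_ac)
    also have "\<dots> = (\<Sum>k\<in>F j. g k * (\<integral>x. h x * fe (- (- k)) x \<partial>I01))"
      using integrable_mult_fe[OF hi] by (subst Bochner_Integration.integral_sum) auto
    finally show ?thesis by (simp only: hc)
  qed
  have l2: "(\<lambda>j. \<Sum>k\<in>F j. g k * b (- k)) \<longlonglongrightarrow> (\<Sum>\<^sub>\<infinity>k. g k * b (- k))"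
  proof -
    have bb: "norm (b k) \<le> wn (\<lambda>_. 1) b" for k using wl2_coord[OF b, of k] by simp
    have "(\<lambda>k. norm (g k * b (- k))) summable_on UNIV"
    proof (rule summable_on_comparison_test)
      show "(\<lambda>k. norm (g k) * wn (\<lambda>_. 1) b) summable_on UNIV"
        using g by (rule summable_on_cmult_left)
      show "norm (g k * b (- k)) \<le> norm (g k) * wn (\<lambda>_. 1) b" for k
        using mult_left_mono[OF bb[of "- k"], of "norm (g k)"] by (simp add: norm_mult)
    qed auto
    then have "(\<lambda>k. g k * b (- k)) summable_on UNIV" by (rule abs_summable_summable)
    then show ?thesis unfolding F_def by (rule infsum_int_tendsto) (rule f(2))
  qed
  show ?thesis
    using LIMSEQ_unique[OF l1[unfolded fin] l2] eq by (simp add: h_def)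
qed

section \<open>Hamiltonians and brackets in Fourier coordinates\<close>

abbreviation sym_int :: "nat \<Rightarrow> int set" where "sym_int N \<equiv> {- int N..int N}"

definition supported :: "nat \<Rightarrow> (int \<Rightarrow> complex) \<Rightarrow> bool" where
  "supported N u \<longleftrightarrow> u 0 = 0 \<and> (\<forall>k. k \<notin> sym_int N \<longrightarrow> u k = 0)"

text \<open>The Fourier symbol of d/dx. Additivity in k turns the product rule and integration by
  parts into algebra.\<close>

definition kap :: "int \<Rightarrow> complex" where
  "kap k = 2 * of_real pi * \<i> * of_int k"

lemma kap_add: "kap (a + b) = kap a + kap b"
  by (simp add: kap_def algebra_simps)

lemma kap_minus: "kap (- a) = - kap a"
  by (simp add: kap_def)

lemma kap_0 [simp]: "kap 0 = 0"
  by (simp add: kap_def)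

lemma kap_eq_0_iff [simp]: "kap a = 0 \<longleftrightarrow> a = 0"
  by (simp add: kap_def)

lemma dx_kap: "dx a = (\<lambda>k. kap k * a k)"
  by (simp add: dx_def kap_def)

lemma supported_dx: "supported N u \<Longrightarrow> supported N (dx u)"
  by (auto simp: supported_def dx_kap)

lemma supported_h0C: "supported N u \<Longrightarrow> u \<in> carr (h0C s)"
proof (rule finite_support_h0C)
  assume u: "supported N u"
  then have "{k. u k \<noteq> 0} \<subseteq> sym_int N" unfolding supported_def by blast
  then show "finite {k. u k \<noteq> 0}" by (rule finite_subset) simp
  show "u 0 = 0" using u by (simp add: supported_def)
qed

lemma supported_AE: "supported N u \<Longrightarrow> AE x in I01. fun_of u x = fsum (sym_int N) u x"
  by (rule fun_of_finite_AE) (auto simp: supported_def)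

lemma supported_fun_of_measurable: "supported N u \<Longrightarrow> fun_of u \<in> borel_measurable I01"
proof (rule fourier_coeffD(2)[OF fun_of_coeffs])
  assume "supported N u"
  from supported_h0C[OF this, of 0] have "wl2 (wi 0) u" by (simp add: h0C_simps)
  then show "wl2 (\<lambda>_. 1) u" unfolding wi_0[abs_def] by (simp add: wl2_def)
qed

lemma fsum_mult_integral:
  assumes "finite F"
  shows "(\<integral>x. fsum F a x * fsum F b x * fe k x \<partial>I01) =
    (\<Sum>i\<in>F. \<Sum>j\<in>F. if i + j = - k then a i * b j else 0)"
proof -
  have "(\<integral>x. fsum F a x * fsum F b x * fe k x \<partial>I01) =
    (\<integral>x. (\<Sum>i\<in>F. \<Sum>j\<in>F. a i * b j * fe (i + j + k) x) \<partial>I01)"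
    unfolding fsum_def sum_product unfolding sum_distrib_right
    by (intro Bochner_Integration.integral_cong sum.cong refl) (simp add: mult_ac flip: fe_mult)
  also have "\<dots> = (\<Sum>i\<in>F. \<Sum>j\<in>F. a i * b j * (\<integral>x. fe (i + j + k) x \<partial>I01))"
    by (subst Bochner_Integration.integral_sum, auto intro!: integrable_continuous_unit continuous_intros,
      rule sum.cong, simp, subst Bochner_Integration.integral_sum) (auto intro!: integrable_continuous_unit continuous_intros)
  also have "\<dots> = (\<Sum>i\<in>F. \<Sum>j\<in>F. if i + j = - k then a i * b j else 0)"
    by (intro sum.cong refl) (auto simp: integral_fe)
  finally show ?thesis .
qed

lemma fsum_mult3_integral:
  assumes "finite F"
  shows "(\<integral>x. fsum F a x * fsum F b x * fsum F c x * fe k x \<partial>I01) =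
    (\<Sum>i\<in>F. \<Sum>j\<in>F. \<Sum>l\<in>F. if i + j + l = - k then a i * b j * c l else 0)"
proof -
  have "(\<integral>x. fsum F a x * fsum F b x * fsum F c x * fe k x \<partial>I01) =
    (\<integral>x. (\<Sum>l\<in>F. c l * (fsum F a x * fsum F b x * fe (k + l) x)) \<partial>I01)"
    unfolding fsum_def[of F c] sum_distrib_left sum_distrib_right by (simp add: mult_ac flip: fe_mult)
  also have "\<dots> = (\<Sum>l\<in>F. c l * (\<integral>x. fsum F a x * fsum F b x * fe (k + l) x \<partial>I01))"
    by (subst Bochner_Integration.integral_sum) (auto intro!: integrable_continuous_unit continuous_intros)
  also have "\<dots> = (\<Sum>l\<in>F. \<Sum>i\<in>F. \<Sum>j\<in>F. if i + j + l = - k then a i * b j * c l else 0)"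
    unfolding fsum_mult_integral[OF assms] sum_distrib_left
    by (intro sum.cong refl) (auto simp: algebra_simps)
  also have "\<dots> = (\<Sum>i\<in>F. \<Sum>l\<in>F. \<Sum>j\<in>F. if i + j + l = - k then a i * b j * c l else 0)"
    by (rule sum.swap)
  also have "\<dots> = (\<Sum>i\<in>F. \<Sum>j\<in>F. \<Sum>l\<in>F. if i + j + l = - k then a i * b j * c l else 0)"
    by (intro sum.cong refl sum.swap)
  finally show ?thesis .
qed

lemma H0_supported:
  assumes "supported N u"
  shows "H0 u = 1/2 * (\<Sum>k\<in>sym_int N. u k * u (- k))"
proof -
  have "(\<integral>x. (fun_of u x)^2 \<partial>I01) = (\<integral>x. fsum (sym_int N) u x * fsum (sym_int N) u x * fe 0 x \<partial>I01)"
    by (rule integral_cong_AE)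
      (use supported_AE[OF assms] supported_fun_of_measurable[OF assms]
        borel_measurable_unit[OF measurable_fsum] in \<open>auto elim!: eventually_mono simp: power2_eq_square\<close>)
  also have "\<dots> = (\<Sum>i\<in>sym_int N. \<Sum>j\<in>sym_int N. if i + j = - 0 then u i * u j else 0)"
    by (rule fsum_mult_integral) simp
  also have "\<dots> = (\<Sum>i\<in>sym_int N. u i * u (- i))"
  proof (rule sum.cong[OF refl])
    fix i assume i: "i \<in> sym_int N"
    have "(\<Sum>j\<in>sym_int N. if i + j = - 0 then u i * u j else 0) = (\<Sum>j\<in>sym_int N. if j = - i then u i * u j else 0)"
      by (rule sum.cong) auto
    then show "(\<Sum>j\<in>sym_int N. if i + j = - 0 then u i * u j else 0) = u i * u (- i)"
      using i by simp
  qed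
  finally show ?thesis unfolding H0_def LINT_unit by simp
qed

text \<open>The Fourier coefficients of the \<open>L\<^sup>2\<close>-gradient
  \<open>u\<^sub>x\<^sub>x\<^sub>x\<^sub>x - 10 u u\<^sub>x\<^sub>x - 5 u\<^sub>x\<^sup>2 + 10 u\<^sup>3\<close> of \<open>H2\<close>, split by degree; the quadratic and cubic parts are
  polarised.\<close>

definition gr2 :: "nat \<Rightarrow> (int \<Rightarrow> complex) \<Rightarrow> (int \<Rightarrow> complex) \<Rightarrow> int \<Rightarrow> complex" where
  "gr2 N u v k = (\<Sum>i\<in>sym_int N. \<Sum>j\<in>sym_int N. if i + j = k
     then -5 * ((kap i)\<^sup>2 + kap i * kap j + (kap j)\<^sup>2) * (u i * v j) else 0)"

definition gr3 :: "nat \<Rightarrow> (int \<Rightarrow> complex) \<Rightarrow> (int \<Rightarrow> complex) \<Rightarrow> (int \<Rightarrow> complex) \<Rightarrow> int \<Rightarrow> complex" where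
  "gr3 N u v w k = (\<Sum>i\<in>sym_int N. \<Sum>j\<in>sym_int N. \<Sum>l\<in>sym_int N. if i + j + l = k
     then 10 * (u i * v j * w l) else 0)"

definition grH2 :: "nat \<Rightarrow> (int \<Rightarrow> complex) \<Rightarrow> int \<Rightarrow> complex" where
  "grH2 N u k = (kap k) ^ 4 * u k + gr2 N u u k + gr3 N u u u k"

text \<open>Integration by parts on the Fourier side: under i + j = - k one has
  \<open>kap k = - kap i - kap j\<close>, and the two pure squares agree after exchanging i and j.
  The right-hand side is the form in which the variation of \<open>10 * u * u_x^2\<close> first
  appears.\<close>

lemma gr2_alt:
  "gr2 N u u (- k) = (\<Sum>i\<in>sym_int N. \<Sum>j\<in>sym_int N. if i + j = - k
     then 5 * (kap i * u i * (kap j * u j)) else 0)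
   + 10 * kap k * (\<Sum>i\<in>sym_int N. \<Sum>j\<in>sym_int N. if i + j = - k then u i * (kap j * u j) else 0)"
proof -
  let ?S = "sym_int N"
  have sw: "(\<Sum>i\<in>?S. \<Sum>j\<in>?S. if i + j = - k then (kap i)\<^sup>2 * (u i * u j) else 0)
     = (\<Sum>i\<in>?S. \<Sum>j\<in>?S. if i + j = - k then (kap j)\<^sup>2 * (u i * u j) else 0)"
    by (subst sum.swap, intro sum.cong refl) (auto simp: algebra_simps)
  have "gr2 N u u (- k) = (\<Sum>i\<in>?S. \<Sum>j\<in>?S.
      - 5 * (if i + j = - k then (kap i)\<^sup>2 * (u i * u j) else 0)
      - 5 * (if i + j = - k then kap i * kap j * (u i * u j) else 0)
      - 5 * (if i + j = - k then (kap j)\<^sup>2 * (u i * u j) else 0))"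
    unfolding gr2_def by (intro sum.cong refl) (auto simp: algebra_simps)
  also have "\<dots> = - 5 * (\<Sum>i\<in>?S. \<Sum>j\<in>?S. if i + j = - k then (kap i)\<^sup>2 * (u i * u j) else 0)
      - 5 * (\<Sum>i\<in>?S. \<Sum>j\<in>?S. if i + j = - k then kap i * kap j * (u i * u j) else 0)
      - 5 * (\<Sum>i\<in>?S. \<Sum>j\<in>?S. if i + j = - k then (kap j)\<^sup>2 * (u i * u j) else 0)"
    by (simp only: sum_subtractf sum_distrib_left)
  also have "\<dots> = - 5 * (\<Sum>i\<in>?S. \<Sum>j\<in>?S. if i + j = - k then kap i * kap j * (u i * u j) else 0)
      - 10 * (\<Sum>i\<in>?S. \<Sum>j\<in>?S. if i + j = - k then (kap j)\<^sup>2 * (u i * u j) else 0)"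
    unfolding sw by simp
  also have "\<dots> = (\<Sum>i\<in>?S. \<Sum>j\<in>?S.
      - 5 * (if i + j = - k then kap i * kap j * (u i * u j) else 0)
      - 10 * (if i + j = - k then (kap j)\<^sup>2 * (u i * u j) else 0))"
    by (simp only: sum_subtractf sum_distrib_left)
  also have "\<dots> = (\<Sum>i\<in>?S. \<Sum>j\<in>?S.
      (if i + j = - k then 5 * (kap i * u i * (kap j * u j)) else 0)
      + 10 * kap k * (if i + j = - k then u i * (kap j * u j) else 0))"
  proof (intro sum.cong refl)
    fix i j
    have kk: "kap k = - kap i - kap j" if "i + j = - k"
    proof -
      have "kap (i + j) = - kap k" using that kap_minus by simp
      then show ?thesis unfolding kap_add by (simp add: algebra_simps eq_neg_iff_add_eq_0)
    qed
    then show "- 5 * (if i + j = - k then kap i * kap j * (u i * u j) else 0)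
      - 10 * (if i + j = - k then (kap j)\<^sup>2 * (u i * u j) else 0) =
      (if i + j = - k then 5 * (kap i * u i * (kap j * u j)) else 0)
      + 10 * kap k * (if i + j = - k then u i * (kap j * u j) else 0)"
    proof (cases "i + j = - k")
      case True
      show ?thesis unfolding kk[OF True] using True by (simp add: power2_eq_square algebra_simps)
    qed simp
  qed
  finally show ?thesis by (simp only: sum.distrib sum_distrib_left)
qed

lemma H2_supported:
  assumes "supported N u"
  defines "p \<equiv> fsum (sym_int N) u" and "p1 \<equiv> fsum (sym_int N) (dx u)" and "p2 \<equiv> fsum (sym_int N) (dx (dx u))"
  shows "H2 u = 1/2 * (\<integral>x. (p2 x)^2 + 10 * p x * (p1 x)^2 + 5 * (p x)^4 \<partial>I01)"
proof -
  note s = assms(1) supported_dx[OF assms(1)] supported_dx[OF supported_dx[OF assms(1)]]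
  have "(\<integral>x. (fun_of (dx (dx u)) x)^2 + 10 * fun_of u x * (fun_of (dx u) x)^2 + 5 * (fun_of u x)^4 \<partial>I01)
    = (\<integral>x. (p2 x)^2 + 10 * p x * (p1 x)^2 + 5 * (p x)^4 \<partial>I01)"
  proof (rule integral_cong_AE)
    show "(\<lambda>x. (fun_of (dx (dx u)) x)^2 + 10 * fun_of u x * (fun_of (dx u) x)^2 + 5 * (fun_of u x)^4) \<in> borel_measurable I01"
      using supported_fun_of_measurable[OF s(1)] supported_fun_of_measurable[OF s(2)] supported_fun_of_measurable[OF s(3)]
      by measurable
    show "(\<lambda>x. (p2 x)^2 + 10 * p x * (p1 x)^2 + 5 * (p x)^4) \<in> borel_measurable I01"
      unfolding p_def p1_def p2_def by (intro borel_measurable_unit) measurable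
    show "AE x in I01. (fun_of (dx (dx u)) x)^2 + 10 * fun_of u x * (fun_of (dx u) x)^2 + 5 * (fun_of u x)^4
      = (p2 x)^2 + 10 * p x * (p1 x)^2 + 5 * (p x)^4"
      using supported_AE[OF s(1)] supported_AE[OF s(2)] supported_AE[OF s(3)]
      by eventually_elim (simp add: p_def p1_def p2_def)
  qed
  then show ?thesis unfolding H2_def LINT_unit by simp
qed

lemma integral_quartic:
  fixes A0 A1 A2 A3 A4 :: "real \<Rightarrow> complex"
  assumes "continuous_on {0..1} A0" "continuous_on {0..1} A1" "continuous_on {0..1} A2"
    "continuous_on {0..1} A3" "continuous_on {0..1} A4"
  shows "((\<lambda>t. \<integral>x. A0 x + of_real t * A1 x + of_real t ^ 2 * A2 x + of_real t ^ 3 * A3 x + of_real t ^ 4 * A4 x \<partial>I01)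
     has_vector_derivative (\<integral>x. A1 x \<partial>I01)) (at (0::real))"
proof -
  note i = assms[THEN integrable_continuous_unit]
  define I where "I = (\<lambda>A::real \<Rightarrow> complex. \<integral>x. A x \<partial>I01)"
  have eq: "(\<integral>x. A0 x + of_real t * A1 x + of_real t ^ 2 * A2 x + of_real t ^ 3 * A3 x + of_real t ^ 4 * A4 x \<partial>I01)
    = I A0 + of_real t * I A1 + of_real t ^ 2 * I A2 + of_real t ^ 3 * I A3 + of_real t ^ 4 * I A4" for t :: real
    using i by (simp add: I_def)
  have "((\<lambda>z::complex. I A0 + z * I A1 + z ^ 2 * I A2 + z ^ 3 * I A3 + z ^ 4 * I A4) has_field_derivative I A1) (at (of_real 0))"
    by (auto intro!: derivative_eq_intros)
  from has_vector_derivative_real_field[OF this] show ?thesis unfolding eq I_def by simp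
qed

lemma fsum_add: "fsum F (\<lambda>k. a k + c * b k) x = fsum F a x + c * fsum F b x"
  by (simp add: fsum_def algebra_simps sum.distrib sum_distrib_left)

text \<open>On a line the Hamiltonian is a polynomial of degree four in t, with coefficients given
  by integrals of \<open>A0\<close>, ..., \<open>A4\<close>; the derivative at 0 reads off the
  integral of \<open>A1\<close>. Expanding the direction v into modes produces the Fourier
  coefficients of the gradient.\<close>

lemma H2_derivative:
  assumes u: "supported N u" and v: "supported N v"
  shows "((\<lambda>t. H2 (\<lambda>k. u k + of_real t * v k)) has_vector_derivative
    (\<Sum>k\<in>sym_int N. grH2 N u (- k) * v k)) (at (0::real))"
proof -
  let ?S = "sym_int N"
  define p p1 p2 where "p = fsum ?S u" and "p1 = fsum ?S (dx u)" and "p2 = fsum ?S (dx (dx u))"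
  define q q1 q2 where "q = fsum ?S v" and "q1 = fsum ?S (dx v)" and "q2 = fsum ?S (dx (dx v))"
  have c: "continuous_on A p" "continuous_on A p1" "continuous_on A p2" "continuous_on A q" "continuous_on A q1" "continuous_on A q2" for A
    unfolding p_def p1_def p2_def q_def q1_def q2_def by (intro continuous_fsum)+
  define A0 where "A0 = (\<lambda>x. (p2 x)^2 + 10 * p x * (p1 x)^2 + 5 * (p x)^4)"
  define A1 where "A1 = (\<lambda>x. 2 * p2 x * q2 x + 10 * (q x * (p1 x)^2 + 2 * p x * p1 x * q1 x) + 20 * (p x)^3 * q x)"
  define A2 where "A2 = (\<lambda>x. (q2 x)^2 + 10 * (2 * q x * p1 x * q1 x + p x * (q1 x)^2) + 30 * (p x)^2 * (q x)^2)"
  define A3 where "A3 = (\<lambda>x. 10 * q x * (q1 x)^2 + 20 * p x * (q x)^3)"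
  define A4 where "A4 = (\<lambda>x. 5 * (q x)^4)"
  have H: "H2 (\<lambda>k. u k + of_real t * v k) = 1/2 * (\<integral>x. A0 x + of_real t * A1 x + of_real t ^ 2 * A2 x + of_real t ^ 3 * A3 x + of_real t ^ 4 * A4 x \<partial>I01)" for t :: real
  proof -
    have s: "supported N (\<lambda>k. u k + of_real t * v k)" using u v by (auto simp: supported_def)
    have d: "dx (\<lambda>k. u k + of_real t * v k) = (\<lambda>k. dx u k + of_real t * dx v k)"
      "dx (\<lambda>k. dx u k + of_real t * dx v k) = (\<lambda>k. dx (dx u) k + of_real t * dx (dx v) k)"
      by (auto simp: dx_def fun_eq_iff algebra_simps)
    show ?thesis
      unfolding H2_supported[OF s] d fsum_add
      unfolding p_def[symmetric] p1_def[symmetric] p2_def[symmetric] q_def[symmetric] q1_def[symmetric] q2_def[symmetric]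
      unfolding A0_def A1_def A2_def A3_def A4_def
      by (intro arg_cong[where f = "\<lambda>f. 1/2 * integral\<^sup>L I01 f"] ext)
        (simp add: power2_eq_square power3_eq_cube power4_eq_xxxx algebra_simps)
  qed
  have "((\<lambda>t. 1/2 * (\<integral>x. A0 x + of_real t * A1 x + of_real t ^ 2 * A2 x + of_real t ^ 3 * A3 x + of_real t ^ 4 * A4 x \<partial>I01))
     has_vector_derivative 1/2 * (\<integral>x. A1 x \<partial>I01)) (at (0::real))"
    unfolding A0_def A1_def A2_def A3_def A4_def
    by (rule has_vector_derivative_mult_right, rule integral_quartic) (intro continuous_intros c)+
  moreover have "1/2 * (\<integral>x. A1 x \<partial>I01) = (\<Sum>k\<in>?S. grH2 N u (- k) * v k)"
  proof -
    define B where "B = (\<lambda>k x. (kap k)^2 * (p2 x * fe k x) + 5 * (p1 x * p1 x * fe k x) + 10 * kap k * (p x * p1 x * fe k x)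
        + 10 * (p x * p x * p x * fe k x))"
    have "1/2 * A1 x = (\<Sum>k\<in>?S. v k * B k x)" for x
    proof -
      have q: "q x = (\<Sum>k\<in>?S. v k * fe k x)" "q1 x = (\<Sum>k\<in>?S. v k * (kap k * fe k x))"
        "q2 x = (\<Sum>k\<in>?S. v k * ((kap k)^2 * fe k x))"
        by (auto simp: q_def q1_def q2_def fsum_def dx_kap power2_eq_square mult_ac)
      have "1/2 * A1 x = p2 x * q2 x + (5 * p1 x * p1 x) * q x + (10 * p x * p1 x) * q1 x + (10 * p x * p x * p x) * q x"
        by (simp add: A1_def power2_eq_square power3_eq_cube algebra_simps)
      also have "\<dots> = (\<Sum>k\<in>?S. v k * B k x)"
        unfolding q sum_distrib_left sum.distrib[symmetric] by (intro sum.cong refl) (simp add: B_def algebra_simps)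
      finally show ?thesis .
    qed
    then have "1/2 * (\<integral>x. A1 x \<partial>I01) = (\<integral>x. (\<Sum>k\<in>?S. v k * B k x) \<partial>I01)"
      by (metis (no_types, lifting) Bochner_Integration.integral_cong integral_mult_right_zero)
    also have "\<dots> = (\<Sum>k\<in>?S. v k * (\<integral>x. B k x \<partial>I01))"
      unfolding B_def
      by (subst Bochner_Integration.integral_sum)
        (auto intro!: integrable_continuous_unit continuous_intros c)
    also have "\<dots> = (\<Sum>k\<in>?S. v k * grH2 N u (- k))"
    proof (intro sum.cong refl arg_cong2[where f = "(*)"])
      fix k assume k: "k \<in> ?S"
      have i: "integrable I01 (\<lambda>x. p2 x * fe k x)" "integrable I01 (\<lambda>x. p1 x * p1 x * fe k x)"
        "integrable I01 (\<lambda>x. p x * p1 x * fe k x)" "integrable I01 (\<lambda>x. p x * p x * p x * fe k x)"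
        by (intro integrable_continuous_unit continuous_intros c)+
      have "(\<integral>x. B k x \<partial>I01) = (kap k)^2 * (\<integral>x. p2 x * fe k x \<partial>I01) + 5 * (\<integral>x. p1 x * p1 x * fe k x \<partial>I01)
        + 10 * kap k * (\<integral>x. p x * p1 x * fe k x \<partial>I01) + 10 * (\<integral>x. p x * p x * p x * fe k x \<partial>I01)"
        unfolding B_def using i by simp
      moreover have "(\<integral>x. p2 x * fe k x \<partial>I01) = (kap k)^2 * u (- k)"
        using integral_fsum_fe[of ?S "dx (dx u)" "- k"] k by (simp add: p2_def dx_kap kap_minus power2_eq_square)
      moreover have "(\<integral>x. p1 x * p1 x * fe k x \<partial>I01) = (\<Sum>i\<in>?S. \<Sum>j\<in>?S. if i + j = - k then kap i * u i * (kap j * u j) else 0)"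
        unfolding p1_def by (simp add: fsum_mult_integral dx_kap)
      moreover have "(\<integral>x. p x * p1 x * fe k x \<partial>I01) = (\<Sum>i\<in>?S. \<Sum>j\<in>?S. if i + j = - k then u i * (kap j * u j) else 0)"
        unfolding p_def p1_def by (simp add: fsum_mult_integral dx_kap)
      moreover have "(\<integral>x. p x * p x * p x * fe k x \<partial>I01) = (\<Sum>i\<in>?S. \<Sum>j\<in>?S. \<Sum>l\<in>?S. if i + j + l = - k then u i * u j * u l else 0)"
        unfolding p_def by (simp add: fsum_mult3_integral)
      moreover have "(kap k)^2 * ((kap k)^2 * u (- k)) = (kap (- k)) ^ 4 * u (- k)"
        by (simp add: kap_minus power2_eq_square power4_eq_xxxx)
      ultimately show "(\<integral>x. B k x \<partial>I01) = grH2 N u (- k)"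
        unfolding grH2_def gr2_alt gr3_def by (simp only: sum_distrib_left if_distrib[of "(*) 5"] if_distrib[of "(*) 10"] mult_zero_right add.assoc)
    qed
    finally show ?thesis by (simp add: mult.commute)
  qed
  ultimately show ?thesis unfolding H by simp
qed

section \<open>Gradients, and the Gardner bracket as a directional derivative\<close>

lemma riesz_h0C:
  assumes L: "bounded_clin (h0C s) Cspace L"
  defines "g \<equiv> \<lambda>k. if k = 0 then 0 else L (unitv (- k))"
  shows "g \<in> carr (h0C (- s))" and "v \<in> carr (h0C s) \<Longrightarrow> L v = (\<Sum>\<^sub>\<infinity>k. g (- k) * v k)"
proof -
  interpret cnorm "h0C s" by (rule cnorm_h0C)
  obtain K where K: "K > 0" "\<And>v. v \<in> carr (h0C s) \<Longrightarrow> nrm Cspace (L v) \<le> K * nrm (h0C s) v"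
    by (rule bounded_clin_bound[OF cnorm_h0C L]) (rule that)
  define b where "b = (\<lambda>k. if k = 0 then 0 else L (unitv k))"
  have hs: "((\<lambda>k. v k * b k) has_sum L v) UNIV" if "v \<in> carr (h0C s)" for v
    using bounded_clin_has_sum_h0C[OF L that] by (simp add: b_def)
  have b: "wl2 (wi (- s)) b"
  proof (rule wl2_boundI(1)[where C = K])
    fix F :: "int set" assume F: "finite F"
    define S where "S = L2_set (\<lambda>k. wi (- s) k * norm (b k)) F"
    \<comment> \<open>The extremal vector of the duality estimate: L takes the value
      \<open>S\<^sup>2\<close> on it while its norm is at most \<open>S\<close>, which forces
      \<open>S\<close> below the bound K of L.\<close>
    define v where "v = restr F (\<lambda>k. of_real (wi (- s) k ^ 2) * cnj (b k))"
    have S2: "S\<^sup>2 = (\<Sum>k\<in>F. (wi (- s) k * norm (b k))\<^sup>2)" by (simp add: S_def L2_set_sq)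
    have v0: "v 0 = 0" by (simp add: v_def restr_def b_def)
    have vc: "v \<in> carr (h0C s)" by (rule finite_support_h0C) (use F v0 in \<open>auto simp: v_def restr_def intro: finite_subset[of _ F]\<close>)
    have "((\<lambda>k. v k * b k) has_sum (\<Sum>k\<in>F. v k * b k)) UNIV"
      by (rule has_sum_finite_neutralI[OF F]) (auto simp: v_def restr_def)
    then have "L v = (\<Sum>k\<in>F. v k * b k)" by (rule has_sum_unique[OF hs[OF vc]])
    also have "\<dots> = (\<Sum>k\<in>F. of_real ((wi (- s) k * norm (b k))\<^sup>2))"
    proof (rule sum.cong[OF refl])
      fix k assume k: "k \<in> F"
      have "complex_of_real ((norm (b k))\<^sup>2) = b k * cnj (b k)" by (rule complex_norm_square)
      then show "v k * b k = of_real ((wi (- s) k * norm (b k))\<^sup>2)"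
        using k by (simp add: v_def restr_def power_mult_distrib mult_ac)
    qed
    also have "\<dots> = of_real (S\<^sup>2)" by (simp add: S2)
    finally have Lv: "norm (L v) = S\<^sup>2" by (simp add: norm_power)
    have "wn (wi s) v \<le> S"
    proof (rule wl2_boundI(2))
      fix F' :: "int set" assume F': "finite F'"
      have "L2_set (\<lambda>k. wi s k * norm (v k)) F' \<le> L2_set (\<lambda>k. wi (- s) k * norm (b k)) F"
      proof -
        have "(\<Sum>k\<in>F'. (wi s k * norm (v k))\<^sup>2) = (\<Sum>k\<in>F' \<inter> F. (wi s k * norm (v k))\<^sup>2)"
          by (rule sum.mono_neutral_right) (use F' in \<open>auto simp: v_def restr_def\<close>)
        also have "\<dots> = (\<Sum>k\<in>F' \<inter> F. (wi (- s) k * norm (b k))\<^sup>2)"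
        proof (rule sum.cong[OF refl])
          fix k assume "k \<in> F' \<inter> F"
          moreover have "wi s k * (wi (- s) k ^ 2) = wi (- s) k"
            using wi_mult[of s k "- s"] by (simp add: power2_eq_square flip: mult.assoc)
          ultimately show "(wi s k * norm (v k))\<^sup>2 = (wi (- s) k * norm (b k))\<^sup>2"
            by (simp add: v_def restr_def norm_mult norm_power flip: mult.assoc)
        qed
        also have "\<dots> \<le> (\<Sum>k\<in>F. (wi (- s) k * norm (b k))\<^sup>2)" by (rule sum_mono2) (use F in auto)
        finally show ?thesis by (simp add: L2_set_def)
      qed
      then show "L2_set (\<lambda>k. wi s k * norm (v k)) F' \<le> S" by (simp add: S_def)
    qed
    then have n: "nrm (h0C s) v \<le> S" by (simp add: h0C_simps)
    have "S * S \<le> K * S"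
      using K(2)[OF vc] Lv mult_left_mono[OF n less_imp_le[OF K(1)]] by (simp add: power2_eq_square)
    moreover have "S \<ge> 0" by (simp add: S_def)
    ultimately have "S \<le> K" using K(1) by (cases "S = 0") auto
    then show "L2_set (\<lambda>k. wi (- s) k * norm (b k)) F \<le> K" by (simp add: S_def)
  qed
  then have bc: "b \<in> carr (h0C (- s))" by (simp add: h0C_simps b_def)
  have gb: "g = (\<lambda>k. b (- k))" by (auto simp: g_def b_def)
  show "g \<in> carr (h0C (- s))" unfolding gb by (rule h0C_flip(1)[OF bc])
  show "v \<in> carr (h0C s) \<Longrightarrow> L v = (\<Sum>\<^sub>\<infinity>k. g (- k) * v k)"
  proof -
    assume v: "v \<in> carr (h0C s)"
    have "(\<Sum>\<^sub>\<infinity>k. b k * v k) = (\<Sum>\<^sub>\<infinity>k. v k * b k)" by (rule infsum_cong) (rule mult.commute)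
    then show ?thesis using infsumI[OF hs[OF v]] by (simp add: gb)
  qed
qed

lemma gradient_props:
  assumes d: "has_cderiv (h0C (-1)) Cspace F u L"
  shows "gradient F u \<in> carr (h0C 1)"
    and "v \<in> carr (h0C (-1)) \<Longrightarrow> L v = (\<Sum>\<^sub>\<infinity>k. gradient F u (- k) * v k)"
proof -
  interpret cnorm "h0C (-1)" by (rule cnorm_h0C)
  define g where "g = (\<lambda>k. if k = 0 then 0 else L (unitv (- k)))"
  have L: "bounded_clin (h0C (-1)) Cspace L" using d by (simp add: has_cderiv_def)
  have g: "g \<in> carr (h0C 1)" "\<And>v. v \<in> carr (h0C (-1)) \<Longrightarrow> L v = (\<Sum>\<^sub>\<infinity>k. g (- k) * v k)"
    using riesz_h0C[OF L] by (auto simp: g_def)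
  have gd: "has_cderiv (h0C (-1)) Cspace F u (\<lambda>v. \<Sum>\<^sub>\<infinity>k. g (- k) * v k)"
    by (rule has_cderiv_cong[OF d g(2)])
  have "gradient F u = g"
    unfolding gradient_def
  proof (rule the_equality)
    show "g \<in> carr (h0C 1) \<and> has_cderiv (h0C (-1)) Cspace F u (\<lambda>v. \<Sum>\<^sub>\<infinity>k. g (- k) * v k)"
      using g gd by blast
    fix g' assume g': "g' \<in> carr (h0C 1) \<and> has_cderiv (h0C (-1)) Cspace F u (\<lambda>v. \<Sum>\<^sub>\<infinity>k. g' (- k) * v k)"
    have ev: "(\<Sum>\<^sub>\<infinity>k. h (- k) * unitv n k) = h (- n)" for h :: "int \<Rightarrow> complex" and n
    proof -
      have "(\<Sum>\<^sub>\<infinity>k. h (- k) * unitv n k) = (\<Sum>\<^sub>\<infinity>k\<in>{n}. h (- k) * unitv n k)"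
        by (rule infsum_cong_neutral) (auto simp: unitv_def)
      then show ?thesis by (simp add: unitv_def)
    qed
    show "g' = g"
    proof
      fix n
      show "g' n = g n"
      proof (cases "n = 0")
        case True then show ?thesis using g g' by (simp add: h0C_simps)
      next
        case False
        then have u: "unitv (- n) \<in> carr (h0C (-1))" by (intro unitv_h0C) simp
        have "(\<Sum>\<^sub>\<infinity>k. g' (- k) * unitv (- n) k) = (\<Sum>\<^sub>\<infinity>k. g (- k) * unitv (- n) k)"
          using cdir_eq[OF conjunct2[OF g'] u] cdir_eq[OF gd u] by simp
        then show ?thesis by (simp add: ev)
      qed
    qed
  qed
  then show "gradient F u \<in> carr (h0C 1)" "v \<in> carr (h0C (-1)) \<Longrightarrow> L v = (\<Sum>\<^sub>\<infinity>k. gradient F u (- k) * v k)"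
    using g by auto
qed

lemma dx_carr: "g \<in> carr (h0C (s + 1)) \<Longrightarrow> dx g \<in> carr (h0C s)"
proof -
  assume g: "g \<in> carr (h0C (s + 1))"
  have "wl2 (wi s) (dx g)"
  proof (rule wl2_le(1)[of "wi (s + 1)" g "2 * pi"])
    fix k
    have "norm (dx g k) = 2 * pi * real_of_int \<bar>k\<bar> * norm (g k)" by (simp add: dx_def norm_mult)
    also have "\<dots> \<le> 2 * pi * wi 1 k * norm (g k)" by (intro mult_right_mono mult_left_mono) (auto simp: wi_def wt_def)
    finally have "wi s k * norm (dx g k) \<le> wi s k * (2 * pi * wi 1 k * norm (g k))" by (intro mult_left_mono) auto
    also have "\<dots> = 2 * pi * (wi (s + 1) k * norm (g k))" by (simp add: mult_ac flip: wi_mult)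
    finally show "norm (wi s k * norm (dx g k)) \<le> 2 * pi * (wi (s + 1) k * norm (g k))" by (simp add: abs_mult)
  qed (use g in \<open>auto simp: h0C_simps\<close>)
  then show ?thesis by (simp add: h0C_simps dx_def)
qed

text \<open>The Cauchy-Schwarz inequality against the sequence 1 / (1 + |k|), which is square
  summable over the integers.\<close>

lemma h0C_1_abs_summable:
  assumes "g \<in> carr (h0C 1)"
  shows "(\<lambda>k. norm (g k)) summable_on UNIV"
proof -
  have "wl2 (wi 0) (\<lambda>k. of_real (wi (-1) k))"
    unfolding wl2_def
  proof -
    have e: "(\<lambda>k. (wi 0 k * norm (complex_of_real (wi (-1) k)))\<^sup>2) = (\<lambda>k. inverse ((1 + real_of_int \<bar>k\<bar>)\<^sup>2))"
    proof
      fix k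
      have "wi (-1) k = inverse (1 + real_of_int \<bar>k\<bar>)" by (simp add: wi_def wt_def powr_minus)
      then show "(wi 0 k * norm (complex_of_real (wi (-1) k)))\<^sup>2 = inverse ((1 + real_of_int \<bar>k\<bar>)\<^sup>2)"
        by (simp only: wi_0 norm_of_real power_inverse mult_1 power2_abs)
    qed
    have "summable (\<lambda>n. inverse (real n ^ 2))" by (rule inverse_power_summable) simp
    then have "summable (\<lambda>n. inverse (real (Suc n) ^ 2))"
      by (rule summable_Suc_iff[where f = "\<lambda>n. inverse (real n ^ 2)", THEN iffD2])
    then have "summable (\<lambda>n. norm (inverse ((1 + real n)\<^sup>2)))" by simp
    then have sn: "(\<lambda>n::nat. inverse ((1 + real n)\<^sup>2)) summable_on UNIV"
      by (rule norm_summable_imp_summable_on)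
    have r1: "(\<lambda>k. inverse ((1 + real_of_int \<bar>k\<bar>)\<^sup>2)) summable_on range int"
      using sn by (subst summable_on_reindex) (simp_all add: o_def)
    have r2: "(\<lambda>k. inverse ((1 + real_of_int \<bar>k\<bar>)\<^sup>2)) summable_on range (\<lambda>n. - int n)"
      using sn by (subst summable_on_reindex) (simp_all add: o_def inj_on_def)
    have "(\<lambda>k. inverse ((1 + real_of_int \<bar>k\<bar>)\<^sup>2)) summable_on (range int \<union> range (\<lambda>n. - int n))"
      by (rule summable_on_union[OF r1 r2])
    moreover have "range int \<union> range (\<lambda>n. - int n) = UNIV"
      by (auto simp: image_def) (metis int_cases2)
    ultimately show "(\<lambda>k. (wi 0 k * norm (complex_of_real (wi (-1) k)))\<^sup>2) summable_on UNIV" unfolding e by simp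
  qed
  from wl2_pair(1)[OF this, of "wi 1" g 1 "\<lambda>k. of_real (wi 1 k)"]
  have "(\<lambda>k. norm (of_real (wi 1 k) * of_real (wi (-1) k) * g k)) summable_on UNIV"
    using assms by (simp add: h0C_simps)
  moreover have "of_real (wi 1 k) * of_real (wi (-1) k) * g k = g k" for k
    using wi_mult[of 1 k "-1"] by (simp flip: of_real_mult)
  ultimately show ?thesis by simp
qed

text \<open>The integral becomes the pairing of the gradient of F with
  \<open>dx (gradient G u)\<close>. The latter is in h^0, so it is an admissible direction in h^-1
  and the pairing is the derivative of F along the Hamiltonian vector field of G.\<close>

lemma gardner_bracket_eq:
  assumes F: "has_cderiv (h0C (-1)) Cspace F u LF" and G: "has_cderiv (h0C (-1)) Cspace G u LG"
  shows "gardner_bracket F G u = LF (dx (gradient G u))"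
proof -
  note g = gradient_props[OF F]
  have d0: "dx (gradient G u) \<in> carr (h0C 0)" using dx_carr[of _ 0] gradient_props(1)[OF G] by simp
  then have d: "dx (gradient G u) \<in> carr (h0C (-1))" by (rule h0C_mono(1)[rotated]) simp
  have w: "wl2 (\<lambda>_. 1) x" if "x \<in> carr (h0C 0)" for x using that unfolding h0C_simps wl2_def by simp
  have g0: "gradient F u \<in> carr (h0C 0)" by (rule h0C_mono(1)[OF _ g(1)]) simp
  have "gardner_bracket F G u = (\<Sum>\<^sub>\<infinity>k. gradient F u k * dx (gradient G u) (- k))"
    unfolding gardner_bracket_def by (rule fun_of_pairing[OF h0C_1_abs_summable[OF g(1)] w[OF d0] w[OF g0]])
  also have "\<dots> = (\<Sum>\<^sub>\<infinity>k. gradient F u (- k) * dx (gradient G u) k)"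
    using infsum_flip[of "\<lambda>k. gradient F u (- k) * dx (gradient G u) k"] by simp
  also have "\<dots> = LF (dx (gradient G u))" using g(2)[OF d] by simp
  finally show ?thesis .
qed

section \<open>A primitive of the renormalised frequencies\<close>

lemma holomorphic_zero_ray:
  assumes "f holomorphic_on A" "open A" "connected A" "0 \<in> A" "\<delta> > 0"
    and z: "\<And>t. 0 < t \<Longrightarrow> t < \<delta> \<Longrightarrow> f (complex_of_real t) = 0" and w: "w \<in> A"
  shows "f w = 0"
proof -
  obtain \<epsilon> where e: "\<epsilon> > 0" "ball 0 \<epsilon> \<subseteq> A" using assms by (meson open_contains_ball)
  define U where "U = complex_of_real ` {0<..<min \<delta> \<epsilon>}"
  have "U \<subseteq> A" using e by (force simp: U_def)
  moreover have "0 islimpt U"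
    unfolding islimpt_approachable
  proof (intro allI impI)
    fix d :: real assume d: "d > 0"
    define t where "t = min (d/2) (min \<delta> \<epsilon> / 2)"
    have "t > 0" "t < d" "t < min \<delta> \<epsilon>" using d e assms by (auto simp: t_def)
    then show "\<exists>x'\<in>U. x' \<noteq> 0 \<and> dist x' 0 < d"
      by (intro bexI[of _ "of_real t"]) (auto simp: U_def)
  qed
  moreover have "f x = 0" if "x \<in> U" for x using that z by (auto simp: U_def)
  ultimately show ?thesis
    using analytic_continuation[of f A U 0 w] assms by blast
qed

lemma carr_lC_51:
  "x \<in> carr (lC 5 1) \<longleftrightarrow> x 0 = 0 \<and> (\<lambda>n. (1 + real n) ^ 5 * norm (x n)) summable_on UNIV"
proof -
  have "(1 + real n) powr (5 * 1) * norm (x n) powr 1 = (1 + real n) ^ 5 * norm (x n)" for n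
    by simp
  then show ?thesis unfolding lC_def weighted_lp_def by (simp only: cspace.simps mem_Collect_eq)
qed

lemma lplus_51_summable:
  assumes "I \<in> lplus 5 1" "\<And>n. norm (c n) \<le> C * (1 + real n) ^ 5"
  shows "(\<lambda>n. norm (c n * I n)) summable_on UNIV" "(\<lambda>n. c n * I n) summable_on UNIV"
proof -
  have s: "(\<lambda>n. C * ((1 + real n) ^ 5 * norm (I n))) summable_on UNIV"
    using assms(1) by (intro summable_on_cmult_right) (simp add: lplus_def lreal_def carr_lC_51)
  show 1: "(\<lambda>n. norm (c n * I n)) summable_on UNIV"
  proof (rule summable_on_comparison_test[OF s])
    show "norm (c n * I n) \<le> C * ((1 + real n) ^ 5 * norm (I n))" for n
      using mult_right_mono[OF assms(2)[of n], of "norm (I n)"] by (simp add: norm_mult)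
  qed auto
  then show "(\<lambda>n. c n * I n) summable_on UNIV" by (rule abs_summable_summable)
qed

lemma wj_nat: "wj (of_nat m) n = (1 + real n) ^ m"
  by (simp add: wj_def wt_def powr_realpow)

lemma l51_subset_h1: "x \<in> carr (lC 5 1) \<Longrightarrow> x \<in> carr (lC 1 2)"
  and l51_norm_le: "x \<in> carr (lC 5 1) \<Longrightarrow> nrm (lC 1 2) x \<le> (\<Sum>\<^sub>\<infinity>n. (1 + real n) ^ 5 * norm (x n))"
proof -
  assume x: "x \<in> carr (lC 5 1)"
  define S where "S = (\<Sum>\<^sub>\<infinity>n. (1 + real n) ^ 5 * norm (x n))"
  have sm: "(\<lambda>n. (1 + real n) ^ 5 * norm (x n)) summable_on UNIV" "x 0 = 0" using x by (auto simp: carr_lC_51)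
  have "L2_set (\<lambda>n. wj 1 n * norm (x n)) F \<le> S" if "finite F" for F
  proof -
    have "L2_set (\<lambda>n. wj 1 n * norm (x n)) F \<le> (\<Sum>n\<in>F. wj 1 n * norm (x n))"
      by (rule L2_set_le_sum) auto
    also have "\<dots> \<le> (\<Sum>n\<in>F. (1 + real n) ^ 5 * norm (x n))"
      using wj_mono[of 1 "of_nat 5"] unfolding wj_nat by (intro sum_mono mult_right_mono) auto
    also have "\<dots> \<le> S" unfolding S_def using that sm by (intro finite_sum_le_infsum) auto
    finally show ?thesis .
  qed
  from wl2_boundI[OF this] sm(2)
  show "x \<in> carr (lC 1 2)" "nrm (lC 1 2) x \<le> (\<Sum>\<^sub>\<infinity>n. (1 + real n) ^ 5 * norm (x n))"
    by (auto simp: lC_simps S_def)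
qed

lemma lplus_51_h1: "I \<in> lplus 5 1 \<Longrightarrow> I \<in> lplus 1 2"
  using l51_subset_h1 by (auto simp: lplus_def lreal_def)

definition kn :: "nat \<Rightarrow> real" where "kn n = 2 * real n * pi"

lemma kn_bound: "norm (of_real (kn n ^ 5) :: complex) \<le> (2 * pi) ^ 5 * (1 + real n) ^ 5"
  "norm (of_real (kn n) :: complex) \<le> (2 * pi) * (1 + real n) ^ 5"
proof -
  have "kn n \<ge> 0" "kn n \<le> 2 * pi * (1 + real n)" by (auto simp: kn_def)
  then have "kn n ^ 5 \<le> (2 * pi * (1 + real n)) ^ 5" by (intro power_mono)
  then show "norm (of_real (kn n ^ 5) :: complex) \<le> (2 * pi) ^ 5 * (1 + real n) ^ 5"
    using \<open>kn n \<ge> 0\<close> by (simp add: power_mult_distrib norm_power)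
  have "1 + real n \<le> (1 + real n) ^ 5" using power_increasing[of 1 5 "1 + real n"] by simp
  then have "2 * pi * (1 + real n) \<le> 2 * pi * (1 + real n) ^ 5" by (intro mult_left_mono) auto
  then show "norm (of_real (kn n) :: complex) \<le> (2 * pi) * (1 + real n) ^ 5"
    using \<open>kn n \<ge> 0\<close> \<open>kn n \<le> 2 * pi * (1 + real n)\<close> by (simp only: norm_of_real abs_of_nonneg)
qed

definition S5 :: "(nat \<Rightarrow> complex) \<Rightarrow> complex" where
  "S5 I = (\<Sum>\<^sub>\<infinity>n. of_real (kn n ^ 5) * I n)"

lemma H0_act_kn: "H0_act I = (\<Sum>\<^sub>\<infinity>n. of_real (kn n) * I n)"
  by (simp add: H0_act_def kn_def)

lemma H2_star_eq: "H2_star \<Phi> I = H2_act \<Phi> I - S5 I - 10 * (H0_act I)^2"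
  by (simp add: H2_star_def S5_def kn_def)

lemma infsum_upd:
  fixes c I :: "nat \<Rightarrow> complex"
  assumes "(\<lambda>n. c n * I n) summable_on UNIV"
  shows "(\<Sum>\<^sub>\<infinity>m. c m * (I(n := t)) m) = (\<Sum>\<^sub>\<infinity>m. c m * I m) + c n * (t - I n)"
proof -
  have "(\<Sum>\<^sub>\<infinity>m. c m * (I(n := t)) m) = (\<Sum>\<^sub>\<infinity>m. c m * I m + c m * ((t - I n) * unitv n m))"
    by (intro infsum_cong) (auto simp: unitv_def algebra_simps)
  also have "\<dots> = (\<Sum>\<^sub>\<infinity>m. c m * I m) + (\<Sum>\<^sub>\<infinity>m. c m * ((t - I n) * unitv n m))"
  proof (rule infsum_add[OF assms])
    show "(\<lambda>m. c m * ((t - I n) * unitv n m)) summable_on UNIV"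
      by (rule summable_on_cong_neutral[THEN iffD1, of _ "{n}" _ "\<lambda>m. c m * ((t - I n) * unitv n m)"])
        (auto simp: unitv_def)
  qed
  also have "(\<Sum>\<^sub>\<infinity>m. c m * ((t - I n) * unitv n m)) = (\<Sum>\<^sub>\<infinity>m\<in>{n}. c m * ((t - I n) * unitv n m))"
    by (rule infsum_cong_neutral) (auto simp: unitv_def)
  finally show ?thesis by (simp add: unitv_def)
qed

lemma lplus_51_upd:
  assumes "I \<in> lplus 5 1" "n \<noteq> 0" "t \<ge> 0"
  shows "I(n := of_real t) \<in> lplus 5 1"
proof -
  have s: "(\<lambda>m. (1 + real m) ^ 5 * norm (I m)) summable_on UNIV" "I 0 = 0"
    using assms(1) by (auto simp: lplus_def lreal_def carr_lC_51)
  have "(\<lambda>m. (1 + real m) ^ 5 * norm ((I(n := of_real t)) m)) summable_on (UNIV - {n})"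
    by (rule summable_on_cong[THEN iffD2, OF _ summable_on_subset_banach[OF s(1)]]) auto
  then have "(\<lambda>m. (1 + real m) ^ 5 * norm ((I(n := of_real t)) m)) summable_on ((UNIV - {n}) \<union> {n})"
    by (rule summable_on_union) simp
  moreover have "(UNIV - {n}) \<union> {n} = UNIV" by auto
  ultimately show ?thesis using assms s by (auto simp: lplus_def lreal_def carr_lC_51)
qed

lemma lplus_51_scale:
  assumes "I \<in> lplus 5 1" "t \<ge> 0"
  shows "(\<lambda>n. of_real t * I n) \<in> lplus 5 1"
proof -
  have s: "(\<lambda>m. (1 + real m) ^ 5 * norm (I m)) summable_on UNIV" "I 0 = 0"
    using assms(1) by (auto simp: lplus_def lreal_def carr_lC_51)
  have "(\<lambda>m. t * ((1 + real m) ^ 5 * norm (I m))) summable_on UNIV" using s by (intro summable_on_cmult_right)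
  then have "(\<lambda>m. (1 + real m) ^ 5 * norm (of_real t * I m)) summable_on UNIV"
    using assms by (simp add: norm_mult mult_ac)
  then show ?thesis using assms s by (auto simp: lplus_def lreal_def carr_lC_51)
qed

text \<open>Applied to \<open>sqrt_seq I\<close> this is the real point with actions I and all
  angles zero, a section of the map from coordinates to actions.\<close>

definition even_ext :: "(nat \<Rightarrow> complex) \<Rightarrow> int \<Rightarrow> complex" where
  "even_ext x k = x (nat \<bar>k\<bar>)"

lemma even_ext_carr:
  assumes "x \<in> carr (lC s 2)"
  shows "even_ext x \<in> carr (h0C s)" "nrm (h0C s) (even_ext x) \<le> 2 * nrm (lC s 2) x"
proof -
  have x: "x 0 = 0" "wl2 (wj s) x" using assms by (auto simp: lC_simps)
  define N where "N = wn (wj s) x"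
  have "L2_set (\<lambda>k. wi s k * norm (even_ext x k)) F \<le> 2 * N" if F: "finite F" for F
  proof -
    define f where "f = (\<lambda>n. (wj s n * norm (x n))\<^sup>2)"
    have bd: "sum f A \<le> N\<^sup>2" if "finite A" for A
      using power_mono[OF wl2_L2_set_le[OF x(2) that], of 2] by (simp add: L2_set_sq f_def N_def)
    have eq: "(wi s k * norm (even_ext x k))\<^sup>2 = f (nat \<bar>k\<bar>)" for k
      by (simp add: f_def even_ext_def wi_def wj_def wt_def)
    have "(\<Sum>k\<in>F. (wi s k * norm (even_ext x k))\<^sup>2) = (\<Sum>k\<in>F \<inter> {0..}. f (nat \<bar>k\<bar>)) + (\<Sum>k\<in>F - {0..}. f (nat \<bar>k\<bar>))"
      unfolding eq using F by (rule sum.Int_Diff)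
    also have "(\<Sum>k\<in>F \<inter> {0..}. f (nat \<bar>k\<bar>)) = sum f ((\<lambda>k. nat \<bar>k\<bar>) ` (F \<inter> {0..}))"
      by (subst sum.reindex) (auto simp: inj_on_def)
    also have "\<dots> \<le> N\<^sup>2" using F by (intro bd) auto
    also have "(\<Sum>k\<in>F - {0..}. f (nat \<bar>k\<bar>)) = sum f ((\<lambda>k. nat \<bar>k\<bar>) ` (F - {0..}))"
      by (subst sum.reindex) (auto simp: inj_on_def)
    also have "\<dots> \<le> N\<^sup>2" using F by (intro bd) auto
    finally have "(L2_set (\<lambda>k. wi s k * norm (even_ext x k)) F)\<^sup>2 \<le> N\<^sup>2 + N\<^sup>2" by (simp add: L2_set_sq)
    also have "\<dots> \<le> (2 * N)\<^sup>2" by (simp add: power_mult_distrib)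
    finally show ?thesis by (rule power2_le_imp_le) (simp add: N_def)
  qed
  from wl2_boundI[OF this] have "wl2 (wi s) (even_ext x)" "wn (wi s) (even_ext x) \<le> 2 * N" by blast+
  moreover have "even_ext x 0 = 0" using x by (simp add: even_ext_def)
  ultimately show "even_ext x \<in> carr (h0C s)" "nrm (h0C s) (even_ext x) \<le> 2 * nrm (lC s 2) x"
    by (auto simp: h0C_simps lC_simps N_def)
qed

definition sqrt_seq :: "(nat \<Rightarrow> complex) \<Rightarrow> nat \<Rightarrow> complex" where
  "sqrt_seq I n = of_real (sqrt (Re (I n)))"

text \<open>Summability of n^5 I_n is square summability of n^(5/2) times the root of I_n, so
  \<open>lplus 5 1\<close> corresponds to h^(5/2), the space on which H2 is analytic in Birkhoff
  coordinates.\<close>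

lemma sqrt_seq_carr:
  assumes "I \<in> lplus 5 1"
  shows "sqrt_seq I \<in> carr (lC (5/2) 2)"
proof -
  have I: "(\<lambda>m. (1 + real m) ^ 5 * norm (I m)) summable_on UNIV" "I 0 = 0" "\<And>n. I n \<in> \<real>" "\<And>n. 0 \<le> Re (I n)"
    using assms by (auto simp: lplus_def lreal_def carr_lC_51)
  have "(wj (5/2) n * norm (sqrt_seq I n))\<^sup>2 = (1 + real n) ^ 5 * norm (I n)" for n
  proof -
    have "(wj (5/2) n)\<^sup>2 = wj 5 n" using wj_mult[of "5/2" n "5/2"] by (simp add: power2_eq_square)
    moreover have "wj 5 n = (1 + real n) ^ 5" using wj_nat[of 5 n] by simp
    moreover have "norm (I n) = Re (I n)" using I(3)[of n] I(4)[of n] by (auto elim!: Reals_cases)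
    ultimately show ?thesis using I(4)[of n] by (simp add: power_mult_distrib sqrt_seq_def)
  qed
  then show ?thesis using I by (simp add: lC_simps wl2_def sqrt_seq_def)
qed

lemma even_ext_h0: "sqrt_seq I \<in> carr (lC s 2) \<Longrightarrow> even_ext (sqrt_seq I) \<in> h0 s"
  using even_ext_carr(1)[of "sqrt_seq I" s] by (auto simp: h0_def even_ext_def sqrt_seq_def)

lemma actions_sqrt:
  assumes "I \<in> lplus 5 1"
  shows "actions (even_ext (sqrt_seq I)) = I"
proof
  fix n
  have "I n = of_real (Re (I n))" "0 \<le> Re (I n)" using assms by (auto simp: lplus_def lreal_def elim!: Reals_cases)
  then show "actions (even_ext (sqrt_seq I)) n = I n"
    by (simp add: actions_def even_ext_def sqrt_seq_def flip: of_real_mult)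
qed

text \<open>The product rule. The mixed term pairs h with \<open>g (y + h) - g y\<close>, and it is
  o(|h|) because g is continuous at y.\<close>

lemma has_cderiv_dpair_diag:
  assumes d: "has_cderiv (lC 1 2) (lC (-1) 2) g y L" and y: "y \<in> carr (lC 1 2)" and gy: "g y \<in> carr (lC (-1) 2)"
  shows "has_cderiv (lC 1 2) Cspace (\<lambda>y. dpair (g y) y) y (\<lambda>h. dpair (L h) y + dpair (g y) h)" (is "has_cderiv ?X _ _ _ ?L")
proof -
  let ?Y = "lC (-1) 2" and ?f = "\<lambda>y. dpair (g y) y"
  interpret X: cnorm ?X by (rule cnorm_lC)
  interpret Y: cnorm ?Y by (rule cnorm_lC)
  have 1: "has_cderiv ?X Cspace (\<lambda>x. dpair (g x) y) y (\<lambda>h. dpair (L h) y)"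
    using has_cderiv_chain[OF cnorm_lC cnorm_lC cnorm_Cspace d has_cderiv_linear[OF cnorm_lC cnorm_Cspace dpair_bounded_clin_left[of y 1]]] y gy by simp
  have "has_cderiv ?X Cspace (dpair (g y)) y (dpair (g y))"
    using has_cderiv_linear[OF cnorm_lC cnorm_Cspace dpair_bounded_clin[of "g y" 1] y] gy by simp
  note L = has_cderiv_clin[OF has_cderiv_add[OF cnorm_lC cnorm_Cspace 1 this]]
  show ?thesis
  proof (rule has_cderivI[OF L])
    fix e :: real assume "e > 0"
    then have e: "e / 2 > 0" by simp
    obtain d1 where d1: "0 < d1" "\<And>h. h \<in> carr ?X \<Longrightarrow> nrm ?X h < d1 \<Longrightarrow>
      nrm Cspace (rmd (\<lambda>x. dpair (g x) y) y (\<lambda>h. dpair (L h) y) h) \<le> e / 2 * nrm ?X h" by (rule has_cderivE[OF 1 e]) (rule that)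
    obtain d2 where d2: "0 < d2" "\<And>h. h \<in> carr ?X \<Longrightarrow> nrm ?X h < d2 \<Longrightarrow> g (y + h) - g y \<in> carr ?Y"
      "\<And>h. h \<in> carr ?X \<Longrightarrow> nrm ?X h < d2 \<Longrightarrow> nrm ?Y (g (y + h) - g y) \<le> e / 2"
      by (rule has_cderiv_continuous[OF cnorm_lC cnorm_lC d e]) (rule that)
    have "norm (rmd ?f y ?L h) \<le> e * nrm ?X h" if h: "h \<in> carr ?X" "nrm ?X h < min d1 d2" for h
    proof -
      have c: "g (y + h) - g y \<in> carr ?Y" using d2(2)[OF h(1)] h(2) by simp
      then have gh: "g (y + h) \<in> carr ?Y" using Y.carr_add[OF c gy] by simp
      have "rmd ?f y ?L h = rmd (\<lambda>x. dpair (g x) y) y (\<lambda>h. dpair (L h) y) h + dpair (g (y + h) - g y) h"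
        using dpair_add_right[of "g (y + h)" 1 y h] dpair_diff_left[of "g (y + h)" 1 "g y" h] gh gy y h by (simp add: rmd_def)
      also have "norm \<dots> \<le> e / 2 * nrm ?X h + e / 2 * nrm ?X h"
      proof (rule norm_triangle_mono)
        show "norm (rmd (\<lambda>x. dpair (g x) y) y (\<lambda>h. dpair (L h) y) h) \<le> e / 2 * nrm ?X h" using d1(2)[OF h(1)] h(2) by simp
        have "norm (dpair (g (y + h) - g y) h) \<le> nrm ?Y (g (y + h) - g y) * nrm ?X h" using dpair_bound(2)[of _ 1 h] c h by simp
        also have "\<dots> \<le> e / 2 * nrm ?X h" using d2(3)[OF h(1)] h(2) by (intro mult_right_mono) auto
        finally show "norm (dpair (g (y + h) - g y) h) \<le> e / 2 * nrm ?X h" .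
      qed
      finally show ?thesis by simp
    qed
    then show "\<exists>d>0. \<forall>h\<in>carr ?X. nrm ?X h < d \<longrightarrow> rmd ?f y ?L h \<in> carr Cspace \<and> nrm Cspace (rmd ?f y ?L h) \<le> e * nrm ?X h"
      using d1(1) d2(1) by (intro exI[of _ "min d1 d2"]) auto
  qed
qed

lemma has_cderiv_scale:
  assumes X: "cnorm X" and Y: "cnorm Y" and d: "has_cderiv X Y g (smul X t y) L" and y: "y \<in> carr X"
  shows "has_cderiv X Y (\<lambda>y. g (smul X t y)) y (\<lambda>h. L (smul X t h))"
proof -
  interpret cnorm X by fact
  have "bounded_clin X X (smul X t)"
    by (rule bounded_clinI[where K = "norm t"]) (auto simp: smul_add_right nrm_smul mult.commute)
  from has_cderiv_chain[OF X X Y has_cderiv_linear[OF X X this y] d] show ?thesis .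
qed

lemma sqrt_derivative: "t > 0 \<Longrightarrow> (sqrt has_real_derivative 1 / (2 * sqrt t)) (at t)"
  using DERIV_real_sqrt[of t] by (simp add: inverse_eq_divide mult.commute)

text \<open>\<open>K\<close> extends \<open>H2 \<circ> \<Phi>\<^sup>-\<^sup>1\<close> and \<open>g\<close> extends the frequency map.\<close>

locale kdv2 =
  fixes W :: "(int \<Rightarrow> complex) set"
    and \<Phi> :: "(int \<Rightarrow> complex) \<Rightarrow> (int \<Rightarrow> complex)"
    and \<omega> :: "(nat \<Rightarrow> complex) \<Rightarrow> (nat \<Rightarrow> complex)"
    and VK :: "(int \<Rightarrow> complex) set" and K :: "(int \<Rightarrow> complex) \<Rightarrow> complex"
    and V0 :: "(nat \<Rightarrow> complex) set" and g :: "(nat \<Rightarrow> complex) \<Rightarrow> (nat \<Rightarrow> complex)"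
  assumes birkhoff: "birkhoff_map W \<Phi>"
    and omega_extends: "\<forall>I\<in>lplus 5 1. \<omega> I = omega2_star \<Phi> I"
    and omega_real: "\<omega> ` lplus 1 2 \<subseteq> lreal (-1) 2"
    and VK: "h0 (5/2) \<subseteq> VK" and K_analytic: "analytic_map (h0C (5/2)) Cspace VK K"
    and K_eq: "\<And>z. z \<in> h0 (5/2) \<Longrightarrow> K z = H2 (inv_into (h0 (-1)) \<Phi> z)"
    and V0: "lplus 1 2 \<subseteq> V0" and g_analytic: "analytic_map (lC 1 2) (lC (-1) 2) V0 g"
    and g_eq: "\<And>I. I \<in> lplus 1 2 \<Longrightarrow> g I = \<omega> I"
begin

lemma Phi_bij: "s \<ge> -1 \<Longrightarrow> bij_betw \<Phi> (h0 s) (h0 (s + 1/2))"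
  using birkhoff by (simp add: birkhoff_map_def)

lemma Phi_mem: "s \<ge> -1 \<Longrightarrow> u \<in> h0 s \<Longrightarrow> \<Phi> u \<in> h0 (s + 1/2)"
  using bij_betwE[OF Phi_bij] by blast

lemma inv_Phi: "u \<in> h0 (-1) \<Longrightarrow> inv_into (h0 (-1)) \<Phi> (\<Phi> u) = u"
  using Phi_bij[of "-1"] by (simp add: bij_betw_def)

lemma inv_Phi_mem:
  assumes "s \<ge> -1" "z \<in> h0 (s + 1/2)"
  shows "inv_into (h0 (-1)) \<Phi> z \<in> h0 s" "\<Phi> (inv_into (h0 (-1)) \<Phi> z) = z"
proof -
  have "z \<in> \<Phi> ` h0 s" using Phi_bij[OF assms(1)] assms(2) by (simp add: bij_betw_def)
  then obtain u where u: "u \<in> h0 s" "z = \<Phi> u" by blast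
  have "u \<in> h0 (-1)" using u(1) h0_mono[OF assms(1)] by blast
  then show "inv_into (h0 (-1)) \<Phi> z \<in> h0 s" "\<Phi> (inv_into (h0 (-1)) \<Phi> z) = z"
    using u inv_Phi by auto
qed

text \<open>\<open>H2_act\<close> evaluates H2 at a potential picked by \<open>SOME\<close>. The
  choice is harmless because H2 in Birkhoff coordinates depends on the actions alone.\<close>

lemma H2_act_actions:
  assumes z: "z \<in> h0 (5/2)"
  shows "H2_act \<Phi> (actions z) = K z"
proof -
  define u' where "u' = (SOME u. u \<in> h0 2 \<and> actions (\<Phi> u) = actions z)"
  have z': "z \<in> h0 (2 + 1/2)" using z by simp
  have "\<exists>u. u \<in> h0 2 \<and> actions (\<Phi> u) = actions z"
    using inv_Phi_mem[OF _ z'] by (intro exI[of _ "inv_into (h0 (-1)) \<Phi> z"]) simp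
  then have "u' \<in> h0 2 \<and> actions (\<Phi> u') = actions z" unfolding u'_def by (rule someI_ex)
  then have u': "u' \<in> h0 2" "actions (\<Phi> u') = actions z" by auto
  have Pu: "\<Phi> u' \<in> h0 (5/2)" using Phi_mem[of 2 u'] u'(1) by simp
  have um: "u' \<in> h0 (-1)" using u'(1) h0_mono[of "-1" 2] by auto
  have "analytic_function_of_actions \<Phi> H2 (5/2)" using birkhoff by (simp add: birkhoff_map_def)
  then have "H2 (inv_into (h0 (-1)) \<Phi> (\<Phi> u')) = H2 (inv_into (h0 (-1)) \<Phi> z)"
    using Pu z u'(2) unfolding analytic_function_of_actions_def by blast
  then show ?thesis using K_eq[OF z] inv_Phi[OF um] by (simp add: H2_act_def u'_def)
qed

lemma H2_act_Phi: "u \<in> h0 2 \<Longrightarrow> H2_act \<Phi> (actions (\<Phi> u)) = H2 u"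
  using H2_act_actions[of "\<Phi> u"] Phi_mem[of 2 u] K_eq[of "\<Phi> u"] inv_Phi[of u] h0_mono[of "-1" 2]
  by auto

lemma sqrt_h0: "I \<in> lplus 5 1 \<Longrightarrow> even_ext (sqrt_seq I) \<in> h0 (5/2)"
  by (rule even_ext_h0[OF sqrt_seq_carr])

lemma H2_act_sqrt: "I \<in> lplus 5 1 \<Longrightarrow> H2_act \<Phi> I = K (even_ext (sqrt_seq I))"
  using H2_act_actions[OF sqrt_h0] actions_sqrt by simp

abbreviation Kdir where "Kdir \<equiv> cnorm.cdir (h0C (5/2)) K"

lemma K_deriv: "z \<in> h0 (5/2) \<Longrightarrow> has_cderiv (h0C (5/2)) Cspace K z (Kdir z)"
  using cnorm.analytic_has_cderiv[OF cnorm_h0C K_analytic] VK by blast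

lemma K_line:
  assumes "z + smul (h0C (5/2)) t d \<in> h0 (5/2)" "d \<in> carr (h0C (5/2))"
  shows "((\<lambda>s. K (z + smul (h0C (5/2)) s d)) has_field_derivative Kdir (z + smul (h0C (5/2)) t d) d) (at t)"
  by (rule cnorm.has_cderiv_line[OF cnorm_h0C K_deriv[OF assms(1)] assms(2)])

lemma even_unit_carr: "n \<noteq> 0 \<Longrightarrow> even_ext (unitv n) \<in> carr (h0C s)"
  by (rule even_ext_carr(1)[OF unitv_lC])

text \<open>The chain rule through t |-> sqrt t, which requires \<open>I n > 0\<close>. At such a
  point the derivative within \<open>{0..}\<close> in \<open>partial_action\<close> is an ordinary
  two-sided one.\<close>

lemma H2_act_partial:
  assumes I: "I \<in> lplus 5 1" and n: "n \<noteq> 0" and pos: "Re (I n) > 0"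
  defines "z \<equiv> even_ext (sqrt_seq I)"
  shows "((\<lambda>t. H2_act \<Phi> (I(n := of_real t))) has_vector_derivative
      Kdir z (even_ext (unitv n)) / of_real (2 * sqrt (Re (I n)))) (at (Re (I n)))"
    and "partial_action n (H2_act \<Phi>) I = Kdir z (even_ext (unitv n)) / of_real (2 * sqrt (Re (I n)))"
proof -
  let ?d = "even_ext (unitv n)" and ?X = "h0C (5/2)"
  define t0 where "t0 = Re (I n)"
  have zh: "z \<in> h0 (5/2)" unfolding z_def by (rule sqrt_h0[OF I])
  \<comment> \<open>The base point 0 is written as \<open>sqrt t0 - sqrt t0\<close>, the value at t0
    of the inner function in the chain rule below.\<close>
  have "((\<lambda>s. K (z + smul ?X s ?d)) has_field_derivative Kdir (z + smul ?X 0 ?d) ?d) (at (of_real (sqrt t0 - sqrt t0)))"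
    using K_line[of z 0 ?d] even_unit_carr[OF n] zh cnorm.smul_0_left[OF cnorm_h0C] by simp
  then have 1: "((\<lambda>s::real. K (z + smul ?X (of_real s) ?d)) has_vector_derivative Kdir z ?d) (at (sqrt t0 - sqrt t0))"
    using has_vector_derivative_real_field[of "\<lambda>s. K (z + smul ?X s ?d)" "Kdir z ?d" "sqrt t0 - sqrt t0"]
      cnorm.smul_0_left[OF cnorm_h0C] by simp
  have 2: "((\<lambda>t. sqrt t - sqrt t0) has_real_derivative 1 / (2 * sqrt t0)) (at t0)"
    using DERIV_diff[OF sqrt_derivative DERIV_const, of t0 "sqrt t0"] pos by (simp add: t0_def)
  have 3: "((\<lambda>t. K (z + smul ?X (of_real (sqrt t - sqrt t0)) ?d)) has_vector_derivative (1 / (2 * sqrt t0)) *\<^sub>R Kdir z ?d) (at t0)"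
    using vector_diff_chain_at[OF has_real_derivative_iff_has_vector_derivative[THEN iffD1, OF 2] 1]
    by (simp add: o_def)
  have eq: "H2_act \<Phi> (I(n := of_real t)) = K (z + smul ?X (of_real (sqrt t - sqrt t0)) ?d)" if t: "t > 0" for t
  proof -
    have "even_ext (sqrt_seq (I(n := of_real t))) = z + smul ?X (of_real (sqrt t - sqrt t0)) ?d"
      by (auto simp: even_ext_def sqrt_seq_def z_def h0C_simps unitv_def t0_def fun_eq_iff)
    then show ?thesis using H2_act_sqrt[OF lplus_51_upd[OF I n, of t]] t by simp
  qed
  have val: "(1 / (2 * sqrt t0)) *\<^sub>R Kdir z ?d = Kdir z ?d / of_real (2 * sqrt t0)"
    by (simp add: scaleR_conv_of_real)
  have "((\<lambda>t. H2_act \<Phi> (I(n := of_real t))) has_vector_derivative (1 / (2 * sqrt t0)) *\<^sub>R Kdir z ?d) (at t0)"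
    by (rule has_vector_derivative_transform_within_open[OF 3, of "{0<..}"]) (use pos eq in \<open>auto simp: t0_def\<close>)
  then show *: "((\<lambda>t. H2_act \<Phi> (I(n := of_real t))) has_vector_derivative
      Kdir z ?d / of_real (2 * sqrt (Re (I n)))) (at (Re (I n)))"
    unfolding val unfolding t0_def .
  have "at (Re (I n)) within {0..} = at (Re (I n))" using pos by (intro at_within_interior) auto
  then show "partial_action n (H2_act \<Phi>) I = Kdir z (even_ext (unitv n)) / of_real (2 * sqrt (Re (I n)))"
    unfolding partial_action_def using vector_derivative_at[OF *] by simp
qed

lemma omega_eq:
  assumes "I \<in> lplus 5 1" "n \<noteq> 0"
  shows "\<omega> I n = partial_action n (H2_act \<Phi>) I - of_real (kn n ^ 5) - 20 * of_real (kn n) * H0_act I"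
  using omega_extends assms by (simp add: omega2_star_def kn_def)

lemma H2_star_partial:
  assumes I: "I \<in> lplus 5 1" and n: "n \<noteq> 0" and pos: "Re (I n) > 0"
  shows "((\<lambda>t. H2_star \<Phi> (I(n := of_real t))) has_vector_derivative \<omega> I n) (at (Re (I n)))"
proof -
  have In: "I n = of_real (Re (I n))" using I by (auto simp: lplus_def lreal_def elim!: Reals_cases)
  have s5: "S5 (I(n := of_real t)) = S5 I + of_real (kn n ^ 5) * (of_real t - I n)" for t
    unfolding S5_def by (rule infsum_upd[OF lplus_51_summable(2)[OF I kn_bound(1)]])
  have h0: "H0_act (I(n := of_real t)) = H0_act I + of_real (kn n) * (of_real t - I n)" for t
    unfolding H0_act_kn by (rule infsum_upd[OF lplus_51_summable(2)[OF I kn_bound(2)]])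
  have "((\<lambda>s. S5 I + of_real (kn n ^ 5) * (s - I n) + 10 * (H0_act I + of_real (kn n) * (s - I n))^2)
      has_field_derivative of_real (kn n ^ 5) + 20 * of_real (kn n) * H0_act I) (at (of_real (Re (I n))))"
    using In by (auto intro!: derivative_eq_intros)
  from has_vector_derivative_real_field[OF this]
  have "((\<lambda>t. S5 (I(n := of_real t)) + 10 * (H0_act (I(n := of_real t)))^2)
      has_vector_derivative of_real (kn n ^ 5) + 20 * of_real (kn n) * H0_act I) (at (Re (I n)))"
    unfolding s5 h0 .
  from has_vector_derivative_diff[OF H2_act_partial(1)[OF I n pos] this]
  show ?thesis
    unfolding H2_star_eq omega_eq[OF I n] H2_act_partial(2)[OF I n pos] by (simp add: diff_diff_eq)
qed

lemma g_carr: "x \<in> V0 \<Longrightarrow> g x \<in> carr (lC (-1) 2)"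
  using g_analytic by (auto simp: analytic_map_def)

lemma omega_carr: "I \<in> lplus 1 2 \<Longrightarrow> \<omega> I \<in> carr (lC (-1) 2)"
  using g_carr g_eq V0 by force

lemma lplus_carr: "I \<in> lplus 1 2 \<Longrightarrow> I \<in> carr (lC 1 2)"
  by (simp add: lplus_def lreal_def)

lemma H0_act_scale: "H0_act (\<lambda>n. of_real t * I n) = of_real t * H0_act I"
  unfolding H0_act_def by (simp add: mult.left_commute infsum_cmult_right')

lemma S5_scale: "S5 (\<lambda>n. of_real t * I n) = of_real t * S5 I"
  unfolding S5_def by (simp add: mult.left_commute infsum_cmult_right')

lemma sqrt_scale: "t \<ge> 0 \<Longrightarrow> even_ext (sqrt_seq (\<lambda>n. of_real t * I n)) = smul (h0C (5/2)) (of_real (sqrt t)) (even_ext (sqrt_seq I))"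
  by (auto simp: even_ext_def sqrt_seq_def h0C_simps fun_eq_iff real_sqrt_mult)

text \<open>The derivative of K is a bounded functional, so its value on the radial vector is the
  sum over unit vectors, and each summand is a partial derivative in an action. Summands with
  \<open>I n = 0\<close> vanish on both sides, which avoids partial derivatives at the
  boundary.\<close>

lemma Kdir_radial:
  assumes I: "I \<in> lplus 5 1" and t: "t > 0"
  defines "z \<equiv> even_ext (sqrt_seq I)" and "J \<equiv> \<lambda>n. of_real t * I n"
  shows "Kdir (smul (h0C (5/2)) (of_real (sqrt t)) z) z
    = 2 * of_real (sqrt t) * (dpair (\<omega> J) I + S5 I + 20 * H0_act J * H0_act I)"
proof -
  let ?X = "h0C (5/2)"
  define y where "y = smul ?X (of_real (sqrt t)) z"
  have J: "J \<in> lplus 5 1" unfolding J_def using lplus_51_scale[OF I] t by simp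
  have y: "y = even_ext (sqrt_seq J)" unfolding y_def z_def J_def using sqrt_scale t by simp
  have yh: "y \<in> h0 (5/2)" unfolding y by (rule sqrt_h0[OF J])
  have bK: "bounded_clin ?X Cspace (Kdir y)" using K_deriv[OF yh] by (simp add: has_cderiv_def)
  have "bounded_clin (lC (5/2) 2) ?X even_ext"
    by (rule bounded_clinI[where K = 2]) (auto simp: even_ext_carr, auto simp: even_ext_def lC_simps h0C_simps fun_eq_iff)
  from bounded_clin_compose[OF cnorm_lC cnorm_h0C this bK]
  have "bounded_clin (lC (5/2) 2) Cspace (\<lambda>x. Kdir y (even_ext x))" .
  from bounded_clin_has_sum_lC[OF this sqrt_seq_carr[OF I]]
  have hs: "((\<lambda>n. sqrt_seq I n * (if n = 0 then 0 else Kdir y (even_ext (unitv n)))) has_sum Kdir y z) UNIV"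
    by (simp add: z_def)
  have term_eq: "sqrt_seq I n * (if n = 0 then 0 else Kdir y (even_ext (unitv n)))
    = 2 * of_real (sqrt t) * (\<omega> J n * I n + of_real (kn n ^ 5) * I n + 20 * H0_act J * (of_real (kn n) * I n))" for n
  proof (cases "I n = 0")
    case True
    then show ?thesis by (simp add: sqrt_seq_def)
  next
    case False
    have Ir: "I n = of_real (Re (I n))" "Re (I n) \<ge> 0" "I 0 = 0"
      using I by (auto simp: lplus_def lreal_def carr_lC_51 elim!: Reals_cases)
    have n: "n \<noteq> 0" using False Ir by (intro notI) auto
    have pos: "Re (I n) > 0" using False Ir by (metis less_eq_real_def of_real_0)
    have posJ: "Re (J n) > 0" using pos t by (simp add: J_def)
    have "Kdir y (even_ext (unitv n)) = of_real (2 * sqrt (Re (J n))) * partial_action n (H2_act \<Phi>) J"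
      using H2_act_partial(2)[OF J n posJ] posJ unfolding y by simp
    moreover have "sqrt (Re (J n)) = sqrt t * sqrt (Re (I n))" by (simp add: J_def real_sqrt_mult)
    moreover have "of_real (sqrt (Re (I n))) * of_real (sqrt (Re (I n))) = I n"
      using Ir by (simp flip: of_real_mult)
    moreover have "partial_action n (H2_act \<Phi>) J = \<omega> J n + of_real (kn n ^ 5) + 20 * of_real (kn n) * H0_act J"
      using omega_eq[OF J n] by simp
    ultimately have "sqrt_seq I n * (if n = 0 then 0 else Kdir y (even_ext (unitv n)))
      = 2 * of_real (sqrt t) * (of_real (sqrt (Re (I n))) * of_real (sqrt (Re (I n)))) * (\<omega> J n + of_real (kn n ^ 5) + 20 * of_real (kn n) * H0_act J)"
      using n by (simp add: sqrt_seq_def)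
    also have "of_real (sqrt (Re (I n))) * of_real (sqrt (Re (I n))) = I n"
      using Ir by (simp flip: of_real_mult)
    finally show ?thesis by (simp add: algebra_simps)
  qed
  have s1: "(\<lambda>n. \<omega> J n * I n) summable_on UNIV"
    using dpair_bound(1)[of "\<omega> J" 1 I] omega_carr[OF lplus_51_h1[OF J]] lplus_carr[OF lplus_51_h1[OF I]] by simp
  note s2 = lplus_51_summable(2)[OF I kn_bound(1)] and s3 = lplus_51_summable(2)[OF I kn_bound(2)]
  have "((\<lambda>n. 2 * of_real (sqrt t) * (\<omega> J n * I n + of_real (kn n ^ 5) * I n + 20 * H0_act J * (of_real (kn n) * I n)))
     has_sum 2 * of_real (sqrt t) * (dpair (\<omega> J) I + S5 I + 20 * H0_act J * H0_act I)) UNIV"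
    unfolding dpair_def S5_def H0_act_kn[of I]
    by (intro has_sum_cmult_right has_sum_add has_sum_infsum s1 s2 s3)
  from has_sum_unique[OF hs[unfolded term_eq] this] show ?thesis unfolding y_def .
qed

lemma H2_star_ray:
  assumes I: "I \<in> lplus 5 1" and t: "t > 0"
  shows "((\<lambda>t. H2_star \<Phi> (\<lambda>n. of_real t * I n)) has_vector_derivative dpair (\<omega> (\<lambda>n. of_real t * I n)) I) (at t)"
proof -
  let ?X = "h0C (5/2)"
  define z where "z = even_ext (sqrt_seq I)"
  have zc: "z \<in> carr ?X" unfolding z_def using sqrt_h0[OF I] by (simp add: h0_def)
  have y: "0 + smul ?X (of_real (sqrt t)) z \<in> h0 (5/2)"
    using sqrt_h0[OF lplus_51_scale[OF I, of t]] sqrt_scale[of t I] t by (simp add: z_def)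
  have 1: "((\<lambda>s::real. K (smul ?X (of_real s) z)) has_vector_derivative Kdir (smul ?X (of_real (sqrt t)) z) z) (at (sqrt t))"
    using has_vector_derivative_real_field[OF K_line[OF y zc]] by simp
  have 2: "(sqrt has_real_derivative 1 / (2 * sqrt t)) (at t)"
    by (rule sqrt_derivative[OF t])
  have 3: "((\<lambda>t. K (smul ?X (of_real (sqrt t)) z)) has_vector_derivative
      (1 / (2 * sqrt t)) *\<^sub>R Kdir (smul ?X (of_real (sqrt t)) z) z) (at t)"
    using vector_diff_chain_at[OF has_real_derivative_iff_has_vector_derivative[THEN iffD1, OF 2] 1]
    by (simp add: o_def)
  have "((\<lambda>s. s * S5 I + 10 * (s * H0_act I)^2) has_field_derivative S5 I + 20 * (of_real t * H0_act I) * H0_act I) (at (of_real t))"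
    by (auto intro!: derivative_eq_intros)
  note 4 = has_vector_derivative_real_field[OF this]
  have 5: "((\<lambda>t. K (smul ?X (of_real (sqrt t)) z) - (of_real t * S5 I + 10 * (of_real t * H0_act I)^2)) has_vector_derivative
      dpair (\<omega> (\<lambda>n. of_real t * I n)) I) (at t)"
  proof -
    have "(1 / (2 * sqrt t)) *\<^sub>R Kdir (smul ?X (of_real (sqrt t)) z) z - (S5 I + 20 * (of_real t * H0_act I) * H0_act I)
        = dpair (\<omega> (\<lambda>n. of_real t * I n)) I"
      unfolding z_def Kdir_radial[OF I t] H0_act_scale using t by (simp add: scaleR_conv_of_real)
    then show ?thesis using has_vector_derivative_diff[OF 3 4] by simp
  qed
  show ?thesis
  proof (rule has_vector_derivative_transform_within_open[OF 5, of "{0<..}"])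
    fix s :: real assume s: "s \<in> {0<..}"
    then show "K (smul ?X (of_real (sqrt s)) z) - (of_real s * S5 I + 10 * (of_real s * H0_act I)^2) = H2_star \<Phi> (\<lambda>n. of_real s * I n)"
      using H2_act_sqrt[OF lplus_51_scale[OF I, of s]] sqrt_scale[of s I]
      by (simp add: H2_star_eq S5_scale H0_act_scale z_def)
  qed (use t in auto)
qed

text \<open>The derivative along the ray is computed through sqrt t and is known only for t > 0.
  Continuity at t = 0 supplies the end point for the fundamental theorem on the open
  interval.\<close>

lemma H2_star_ray_continuous:
  assumes I: "I \<in> lplus 5 1"
  shows "continuous_on {0..1} (\<lambda>t. H2_star \<Phi> (\<lambda>n. of_real t * I n))"
proof -
  let ?X = "h0C (5/2)"
  define z where "z = even_ext (sqrt_seq I)"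
  have zc: "z \<in> carr ?X" unfolding z_def using sqrt_h0[OF I] by (simp add: h0_def)
  have ic: "isCont (\<lambda>s. K (smul ?X s z)) (of_real (sqrt t))" if "t \<ge> 0" for t
  proof -
    have y: "0 + smul ?X (of_real (sqrt t)) z \<in> h0 (5/2)"
      using sqrt_h0[OF lplus_51_scale[OF I, of t]] sqrt_scale[of t I] that by (simp add: z_def)
    show ?thesis using DERIV_isCont[OF K_line[OF y zc]] by simp
  qed
  have "continuous_on {0..1} (\<lambda>t. K (smul ?X (of_real (sqrt t)) z))"
    unfolding continuous_on_eq_continuous_within
  proof
    fix t :: real assume "t \<in> {0..1}"
    then have t: "t \<ge> 0" by simp
    have "continuous (at t within {0..1}) (\<lambda>t. complex_of_real (sqrt t))" by (intro continuous_intros)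
    from continuous_within_compose3[OF ic[OF t] this]
    show "continuous (at t within {0..1}) (\<lambda>t. K (smul ?X (of_real (sqrt t)) z))" .
  qed
  then have "continuous_on {0..1} (\<lambda>t. K (smul ?X (of_real (sqrt t)) z) - (of_real t * S5 I + 10 * (of_real t * H0_act I)^2))"
    by (intro continuous_intros)
  moreover have "K (smul ?X (of_real (sqrt s)) z) - (of_real s * S5 I + 10 * (of_real s * H0_act I)^2) = H2_star \<Phi> (\<lambda>n. of_real s * I n)"
    if "s \<in> {0..1}" for s
    using H2_act_sqrt[OF lplus_51_scale[OF I, of s]] sqrt_scale[of s I] that
    by (simp add: H2_star_eq S5_scale H0_act_scale z_def)
  ultimately show ?thesis by (rule continuous_on_eq)
qed

lemma Phi_0: "\<Phi> 0 = 0"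
  using birkhoff by (simp add: birkhoff_map_def)

lemma H2_star_0: "H2_star \<Phi> (\<lambda>n. 0) = 0"
proof -
  have s0: "supported 0 (\<lambda>_. 0)" by (simp add: supported_def)
  have "fsum F (\<lambda>k. 0) = (\<lambda>x. 0)" for F by (simp add: fsum_def fun_eq_iff)
  moreover have "dx (\<lambda>_. 0) = (\<lambda>_. 0)" by (simp add: dx_def)
  ultimately have "H2 (\<lambda>_. 0) = 0" using H2_supported[OF s0] by simp
  then have H0: "H2 0 = 0" by (simp add: zero_fun_def)
  have z: "0 \<in> h0 s" for s
    using cnorm.carr_0[OF cnorm_h0C[of s]] by (simp add: h0_def)
  have "H2_act \<Phi> (actions (\<Phi> 0)) = H2 0" by (rule H2_act_Phi[OF z])
  then have "H2_act \<Phi> (\<lambda>n. 0) = 0" unfolding Phi_0 H0 by (simp add: actions_def)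
  then show ?thesis by (simp add: H2_star_eq S5_def H0_act_def)
qed

lemma H2_star_integral:
  assumes I: "I \<in> lplus 5 1"
  shows "((\<lambda>t. dpair (\<omega> (\<lambda>n. of_real t * I n)) I) has_integral H2_star \<Phi> I) {0..1}"
proof -
  have "((\<lambda>t. dpair (\<omega> (\<lambda>n. of_real t * I n)) I) has_integral
      H2_star \<Phi> (\<lambda>n. of_real 1 * I n) - H2_star \<Phi> (\<lambda>n. of_real 0 * I n)) {0..1}"
    by (rule fundamental_theorem_of_calculus_interior) (use H2_star_ray[OF I] H2_star_ray_continuous[OF I] in auto)
  then show ?thesis using H2_star_0 by simp
qed

end

lemma (in cnorm) convex_line_ball:
  assumes "x \<in> carr X" "k \<in> carr X"
  shows "convex {t. nrm X (x + smul X t k) < r}"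
proof (rule convexI)
  fix s t :: complex and a b :: real
  assume s: "s \<in> {t. nrm X (x + smul X t k) < r}" and t: "t \<in> {t. nrm X (x + smul X t k) < r}" and ab: "0 \<le> a" "0 \<le> b" "a + b = 1"
  have "x + smul X (a *\<^sub>R s + b *\<^sub>R t) k = smul X (of_real a) (x + smul X s k) + smul X (of_real b) (x + smul X t k)"
  proof -
    have "x = smul X (of_real a + of_real b) x" using ab by (simp flip: of_real_add)
    then have "x = smul X (of_real a) x + smul X (of_real b) x" by (simp only: smul_add_left)
    then show ?thesis by (simp add: smul_add_right smul_add_left scaleR_conv_of_real algebra_simps)
  qed
  then have "nrm X (x + smul X (a *\<^sub>R s + b *\<^sub>R t) k) \<le> a * nrm X (x + smul X s k) + b * nrm X (x + smul X t k)"
    using nrm_triangle[of "smul X (of_real a) (x + smul X s k)" "smul X (of_real b) (x + smul X t k)"] assms ab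
    by (simp add: nrm_smul)
  also have "\<dots> < r" using s t ab convex_bound_lt[of "nrm X (x + smul X s k)" r "nrm X (x + smul X t k)" a b] by simp
  finally show "a *\<^sub>R s + b *\<^sub>R t \<in> {t. nrm X (x + smul X t k) < r}" by simp
qed

lemma (in cnorm) open_in_ball: "open_in X {x \<in> carr X. nrm X x < r}"
  unfolding open_in_def
proof (intro conjI ballI)
  fix x assume x: "x \<in> {x \<in> carr X. nrm X x < r}"
  have "y \<in> {x \<in> carr X. nrm X x < r}" if "y \<in> carr X" "nrm X (y - x) < r - nrm X x" for y
    using nrm_triangle[of x "y - x"] that x by simp
  then show "\<exists>d>0. \<forall>y\<in>carr X. nrm X (y - x) < d \<longrightarrow> y \<in> {x \<in> carr X. nrm X x < r}"
    using x by (intro exI[of _ "r - nrm X x"]) auto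
qed auto

lemma finite_real_part:
  assumes "x \<in> carr (lC s 2)"
  shows "(\<lambda>n. of_real (Re (x n))) \<in> carr (lC s 2)" "nrm (lC s 2) (\<lambda>n. of_real (Re (x n))) \<le> nrm (lC s 2) x"
    "(\<lambda>n. of_real (Im (x n))) \<in> carr (lC s 2)" "nrm (lC s 2) (\<lambda>n. of_real (Im (x n))) \<le> nrm (lC s 2) x"
proof -
  have x: "x 0 = 0" "wl2 (wj s) x" using assms by (auto simp: lC_simps)
  have 1: "norm (wj s n * norm (complex_of_real (Re (x n)))) \<le> 1 * (wj s n * norm (x n))" for n
    by (simp add: abs_mult mult_left_mono abs_Re_le_cmod)
  have 2: "norm (wj s n * norm (complex_of_real (Im (x n)))) \<le> 1 * (wj s n * norm (x n))" for n
    by (simp add: abs_mult mult_left_mono abs_Im_le_cmod)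
  show "(\<lambda>n. of_real (Re (x n))) \<in> carr (lC s 2)" "nrm (lC s 2) (\<lambda>n. of_real (Re (x n))) \<le> nrm (lC s 2) x"
    using wl2_le[OF x(2) _ 1] x by (auto simp: lC_simps)
  show "(\<lambda>n. of_real (Im (x n))) \<in> carr (lC s 2)" "nrm (lC s 2) (\<lambda>n. of_real (Im (x n))) \<le> nrm (lC s 2) x"
    using wl2_le[OF x(2) _ 2] x by (auto simp: lC_simps)
qed

lemma finite_lplus_51:
  assumes "finite {n. x n \<noteq> 0}" "x 0 = 0" "\<And>n. x n \<in> \<real>" "\<And>n. 0 \<le> Re (x n)"
  shows "x \<in> lplus 5 1"
proof -
  have "(\<lambda>n. (1 + real n) ^ 5 * norm (x n)) summable_on UNIV"
    by (rule summable_on_cong_neutral[THEN iffD1, of _ "{n. x n \<noteq> 0}" _ "\<lambda>n. (1 + real n) ^ 5 * norm (x n)"])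
      (use assms(1) in auto)
  then show ?thesis using assms by (auto simp: lplus_def lreal_def carr_lC_51)
qed

section \<open>The ray integral and its gradient\<close>

context kdv2
begin

abbreviation "X1 \<equiv> lC 1 2"
abbreviation "Y1 \<equiv> lC (-1) 2"

sublocale X1: cnorm "lC 1 2" by (rule cnorm_lC)
sublocale Y1: cnorm "lC (-1) 2" by (rule cnorm_lC)

text \<open>The star-shaped core of \<open>V0\<close>: the ray integral \<open>G\<close> needs the
  whole segment from 0 inside the domain of g. The cone \<open>lplus 1 2\<close> remains inside
  because it is closed under scaling by t >= 0.\<close>

definition V :: "(nat \<Rightarrow> complex) set" where
  "V = {x \<in> carr X1. \<forall>t\<in>{0..1::real}. smul X1 (of_real t) x \<in> V0}"

definition G :: "(nat \<Rightarrow> complex) \<Rightarrow> complex" where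
  "G x = integral {0..1} (\<lambda>t. dpair (g (smul X1 (of_real t) x)) x)"

lemma V0_carr: "V0 \<subseteq> carr X1" and V0_open: "open_in X1 V0"
  using g_analytic by (auto simp: analytic_map_def open_in_def)

lemma V_carr: "x \<in> V \<Longrightarrow> x \<in> carr X1"
  by (simp add: V_def)

lemma V_subset_V0: "V \<subseteq> V0"
  unfolding V_def by (auto dest!: bspec[of _ _ 1])

lemma lplus_scale: "I \<in> lplus 1 2 \<Longrightarrow> 0 \<le> t \<Longrightarrow> smul X1 (of_real t) I \<in> lplus 1 2"
  using X1.carr_smul[of I "of_real t"] by (auto simp: lplus_def lreal_def lC_simps)

lemma lplus_V: "lplus 1 2 \<subseteq> V"
  using lplus_scale V0 lplus_carr by (fastforce simp: V_def)

lemma g_deriv: "x \<in> V0 \<Longrightarrow> \<exists>L. has_cderiv X1 Y1 g x L"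
  using g_analytic by (simp add: analytic_map_def)

text \<open>Each point of the segment has a ball on which g is defined and bounded; compactness of
  [0, 1] leaves finitely many of them, hence a common radius and a common bound.\<close>

lemma segment_uniform:
  assumes x: "x \<in> V"
  shows "\<exists>r>0. \<exists>M>0. \<forall>t\<in>{0..1::real}. \<forall>h\<in>carr X1. nrm X1 h < r \<longrightarrow>
    smul X1 (of_real t) (x + h) \<in> V0 \<and> nrm Y1 (g (smul X1 (of_real t) (x + h))) \<le> M"
proof -
  have xc: "x \<in> carr X1" using x by (rule V_carr)
  have "\<exists>\<rho>>0. \<exists>M>0. \<forall>h\<in>carr X1. nrm X1 h < \<rho> \<longrightarrow> smul X1 (of_real t) x + h \<in> V0 \<and>
      nrm Y1 (g (smul X1 (of_real t) x + h)) \<le> M" if t: "t \<in> {0..1}" for t :: real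
  proof -
    define y where "y = smul X1 (of_real t) x"
    have y: "y \<in> V0" using x t by (simp add: V_def y_def)
    obtain L where "has_cderiv X1 Y1 g y L" using g_deriv[OF y] by blast
    from has_cderiv_bounded_near[OF X1.cnorm_axioms Y1.cnorm_axioms this] g_carr[OF y]
    obtain r M where r: "r > 0" "M > 0" "\<And>h. h \<in> carr X1 \<Longrightarrow> nrm X1 h < r \<Longrightarrow> nrm Y1 (g (y + h)) \<le> M" by blast
    obtain s where s: "s > 0" "\<And>z. z \<in> carr X1 \<Longrightarrow> nrm X1 (z - y) < s \<Longrightarrow> z \<in> V0"
      using V0_open y unfolding open_in_def by blast
    have "y + h \<in> V0 \<and> nrm Y1 (g (y + h)) \<le> M" if "h \<in> carr X1" "nrm X1 h < min r s" for h
      using r(3)[of h] s(2)[of "y + h"] that V0_carr y by auto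
    then show ?thesis using r s unfolding y_def by (intro exI[of _ "min r s"]) auto
  qed
  then obtain \<rho> M where rM: "\<And>t. t \<in> {0..1::real} \<Longrightarrow> \<rho> t > 0 \<and> M t > (0::real) \<and> (\<forall>h\<in>carr X1. nrm X1 h < \<rho> t \<longrightarrow>
      smul X1 (of_real t) x + h \<in> V0 \<and> nrm Y1 (g (smul X1 (of_real t) x + h)) \<le> M t)"
    by metis
  define N where "N = nrm X1 x + 1"
  have N: "N > 0" "nrm X1 x \<le> N" using X1.nrm_nonneg[of x] by (simp_all add: N_def add_nonneg_pos)
  \<comment> \<open>One half of the radius \<open>\<rho> t\<close> pays for moving along the
    segment, by at most \<open>\<eta> t * N\<close>; the other half is left for the perturbation
    h.\<close>
  define \<eta> where "\<eta> = (\<lambda>t. \<rho> t / (2 * N))"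
  have cover: "{0..1} \<subseteq> (\<Union>t\<in>{0..1}. ball t (\<eta> t))"
    using rM N by (auto simp: \<eta>_def intro!: bexI)
  obtain T where T: "T \<subseteq> {0..1}" "finite T" "{0..1} \<subseteq> (\<Union>t\<in>T. ball t (\<eta> t))"
    using compactE_image[OF compact_Icc[of 0 1], of "{0..1}" "\<lambda>t. ball t (\<eta> t)"] cover by auto
  have Tne: "T \<noteq> {}" using T(3) by fastforce
  define r where "r = Min (\<rho> ` T) / 2"
  define M' where "M' = Max (M ` T)"
  have "\<forall>s\<in>\<rho> ` T. s > 0" using rM T(1) by auto
  then have r: "r > 0" using T(2) Tne by (simp add: r_def)
  have Mx: "M t \<le> M'" "\<rho> t / 2 \<ge> r" if "t \<in> T" for t
    using that T(2) by (auto simp: M'_def r_def intro!: divide_right_mono)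
  obtain t1 where t1: "t1 \<in> T" using Tne by blast
  have M': "M' > 0" using Mx(1)[OF t1] rM[of t1] T(1) t1 by force
  have "smul X1 (of_real t) (x + h) \<in> V0 \<and> nrm Y1 (g (smul X1 (of_real t) (x + h))) \<le> M'"
    if t: "t \<in> {0..1}" and h: "h \<in> carr X1" "nrm X1 h < r" for t :: real and h
  proof -
    obtain t0 where t0: "t0 \<in> T" "\<bar>t - t0\<bar> < \<eta> t0" using T(3) t by (force simp: dist_real_def)
    define k where "k = smul X1 (of_real (t - t0)) x + smul X1 (of_real t) h"
    have k: "k \<in> carr X1" using xc h by (simp add: k_def)
    have "nrm X1 k \<le> \<bar>t - t0\<bar> * nrm X1 x + \<bar>t\<bar> * nrm X1 h"
      using X1.nrm_triangle[of "smul X1 (of_real (t - t0)) x" "smul X1 (of_real t) h"] xc h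
      unfolding k_def by (simp add: X1.nrm_smul del: of_real_diff)
    also have "\<dots> \<le> \<eta> t0 * N + 1 * nrm X1 h"
      using t0 t N by (intro add_mono mult_mono) auto
    also have "\<dots> < \<rho> t0 / 2 + \<rho> t0 / 2" using h Mx(2)[OF t0(1)] N by (simp add: \<eta>_def)
    finally have kn: "nrm X1 k < \<rho> t0" by simp
    have "smul X1 (of_real t) (x + h) = smul X1 (of_real t0) x + k"
      by (simp add: k_def X1.smul_add_right X1.smul_diff_left)
    then show ?thesis using rM[of t0] t0 T(1) k kn Mx(1)[OF t0(1)] by force
  qed
  then show ?thesis using r M' by blast
qed

lemma V_open: "open_in X1 V"
  unfolding open_in_def
proof (intro conjI ballI)
  show "V \<subseteq> carr X1" using V_carr by blast
  fix x assume x: "x \<in> V"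
  obtain r where r: "r > 0" "\<And>t h. t \<in> {0..1::real} \<Longrightarrow> h \<in> carr X1 \<Longrightarrow> nrm X1 h < r \<Longrightarrow> smul X1 (of_real t) (x + h) \<in> V0"
    using segment_uniform[OF x] by blast
  have "y \<in> V" if "y \<in> carr X1" "nrm X1 (y - x) < r" for y
    using r(2)[of _ "y - x"] that V_carr[OF x] by (auto simp: V_def)
  then show "\<exists>r>0. \<forall>y\<in>carr X1. nrm X1 (y - x) < r \<longrightarrow> y \<in> V" using r(1) by blast
qed

lemma V_star: "x \<in> V \<Longrightarrow> t \<in> {0..1} \<Longrightarrow> smul X1 (of_real t) x \<in> V"
  unfolding V_def by (auto simp flip: of_real_mult intro!: mult_le_one)

lemma dpair_g_analytic: "h \<in> carr X1 \<Longrightarrow> analytic_map X1 Cspace V0 (\<lambda>x. dpair (g x) h)"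
  using analytic_compose_functional(1)[OF g_analytic dpair_bounded_clin_left[of h 1] cnorm_lC cnorm_lC] by simp

lemma coord_g_analytic: "analytic_map X1 Cspace V0 (\<lambda>x. g x n)"
  using analytic_compose_functional(1)[OF g_analytic coord_bounded_clin_lC cnorm_lC cnorm_lC] .

lemma radial_continuous:
  assumes y: "y \<in> carr X1" "\<And>t. t \<in> {0..1::real} \<Longrightarrow> smul X1 (of_real t) y \<in> V0"
  shows "continuous_on {0..1} (\<lambda>t. dpair (g (smul X1 (of_real t) y)) y)"
  unfolding continuous_on_eq_continuous_within
proof
  fix t :: real assume t: "t \<in> {0..1}"
  have "has_cderiv X1 Cspace (\<lambda>x. dpair (g x) y) (0 + smul X1 (of_real t) y) (X1.cdir (\<lambda>x. dpair (g x) y) (0 + smul X1 (of_real t) y))"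
    using X1.analytic_has_cderiv[OF dpair_g_analytic[OF y(1)] y(2)[OF t]] by simp
  from DERIV_isCont[OF X1.has_cderiv_line[OF this y(1)]]
  have ic: "isCont (\<lambda>s. dpair (g (smul X1 s y)) y) (complex_of_real t)" by simp
  have "continuous (at t within {0..1}) (\<lambda>t. complex_of_real t)" by (intro continuous_intros)
  from continuous_within_compose3[OF ic this]
  show "continuous (at t within {0..1}) (\<lambda>t. dpair (g (smul X1 (of_real t) y)) y)" .
qed

lemma G_analytic: "analytic_map X1 Cspace V G"
  unfolding analytic_map_def
proof (intro conjI ballI V_open)
  fix x assume x: "x \<in> V"
  have xc: "x \<in> carr X1" using x by (rule V_carr)
  obtain r M where r: "r > 0" "M > 0" and rM: "\<And>t h. t \<in> {0..1::real} \<Longrightarrow> h \<in> carr X1 \<Longrightarrow> nrm X1 h < r \<Longrightarrow>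
      smul X1 (of_real t) (x + h) \<in> V0 \<and> nrm Y1 (g (smul X1 (of_real t) (x + h))) \<le> M"
    using segment_uniform[OF x] by blast
  define B where "B = M * (nrm X1 x + r)"
  have B: "B > 0" unfolding B_def using r X1.nrm_nonneg[of x] by (intro mult_pos_pos add_nonneg_pos) auto
  show "\<exists>L. has_cderiv X1 Cspace G x L"
    unfolding G_def
  proof (rule X1.has_cderiv_integral[where r = r and M = B])
    fix t :: real assume t: "t \<in> {0..1}"
    show "X1.bounded_at (\<lambda>y. dpair (g (smul X1 (of_real t) y)) y) x r B"
      unfolding X1.bounded_at_def
    proof (intro conjI ballI impI r B xc)
      fix h assume h: "h \<in> carr X1" "nrm X1 h < r"
      note rh = rM[OF t h]
      have yc: "x + h \<in> carr X1" using xc h by simp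
      have "norm (dpair (g (smul X1 (of_real t) (x + h))) (x + h)) \<le> nrm Y1 (g (smul X1 (of_real t) (x + h))) * nrm X1 (x + h)"
        using dpair_bound(2)[of "g (smul X1 (of_real t) (x + h))" 1 "x + h"] g_carr rh yc by simp
      also have "\<dots> \<le> M * (nrm X1 x + r)"
        using rh X1.nrm_triangle[OF xc h(1)] h(2) r by (intro mult_mono) auto
      finally show "norm (dpair (g (smul X1 (of_real t) (x + h))) (x + h)) \<le> B" by (simp add: B_def)
      obtain L where L: "has_cderiv X1 Y1 g (smul X1 (of_real t) (x + h)) L" using g_deriv rh by blast
      have "g (smul X1 (of_real t) (x + h)) \<in> carr Y1" using g_carr rh by blast
      from has_cderiv_dpair_diag[OF has_cderiv_scale[OF cnorm_lC cnorm_lC L yc] yc this]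
      show "\<exists>L. has_cderiv X1 Cspace (\<lambda>y. dpair (g (smul X1 (of_real t) y)) y) (x + h) L" by blast
    qed
  next
    fix h assume h: "h \<in> carr X1" "nrm X1 h < r"
    show "continuous_on {0..1} (\<lambda>t. dpair (g (smul X1 (of_real t) (x + h))) (x + h))"
      by (rule radial_continuous) (use xc h rM[OF _ h] in auto)
  qed
qed simp

lemma G_eq_H2_star:
  assumes I: "I \<in> lplus 5 1"
  shows "G I = H2_star \<Phi> I"
proof -
  have "integral {0..1} (\<lambda>t. dpair (\<omega> (\<lambda>n. of_real t * I n)) I) = H2_star \<Phi> I"
    using H2_star_integral[OF I] by (rule integral_unique)
  moreover have "G I = integral {0..1} (\<lambda>t. dpair (\<omega> (\<lambda>n. of_real t * I n)) I)"
    unfolding G_def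
  proof (rule integral_cong)
    fix t :: real assume "t \<in> {0..1}"
    then show "dpair (g (smul X1 (of_real t) I)) I = dpair (\<omega> (\<lambda>n. of_real t * I n)) I"
      using g_eq[OF lplus_scale[OF lplus_51_h1[OF I], of t]] by (simp add: lC_simps)
  qed
  ultimately show ?thesis by simp
qed

text \<open>The failure of g to be the gradient of \<open>G\<close> in coordinate n. It is
  holomorphic along complex lines inside \<open>V\<close>, so zeros on a real interval spread over
  the connected set of admissible parameters.\<close>

definition defect :: "nat \<Rightarrow> (nat \<Rightarrow> complex) \<Rightarrow> complex" where
  "defect n x = X1.cdir G x (unitv n) - g x n"

lemma defect_holomorphic:
  assumes n: "n \<noteq> 0" and k: "k \<in> carr X1" and O: "open O'" "\<And>t. t \<in> O' \<Longrightarrow> x + smul X1 t k \<in> V"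
  shows "(\<lambda>t. defect n (x + smul X1 t k)) holomorphic_on O'"
  unfolding defect_def
proof (intro holomorphic_intros)
  show "(\<lambda>t. X1.cdir G (x + smul X1 t k) (unitv n)) holomorphic_on O'"
    by (rule X1.cdir_line_holomorphic[OF G_analytic unitv_lC[OF n] k O])
  show "(\<lambda>t. g (x + smul X1 t k) n) holomorphic_on O'"
    by (rule X1.analytic_line_holomorphic[OF coord_g_analytic k]) (use O V_subset_V0 in blast)
qed

lemma defect_positive:
  assumes I: "I \<in> lplus 5 1" and n: "n \<noteq> 0" and pos: "Re (I n) > 0"
  shows "defect n I = 0"
proof -
  define t0 where "t0 = Re (I n)"
  have In: "I n = of_real t0" using I by (auto simp: lplus_def lreal_def t0_def elim!: Reals_cases)
  have IV: "I \<in> V" using lplus_V lplus_51_h1[OF I] by blast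
  have "has_cderiv X1 Cspace G (I + smul X1 0 (unitv n)) (X1.cdir G I)"
    using X1.analytic_has_cderiv[OF G_analytic IV] by simp
  from X1.has_cderiv_line[OF this unitv_lC[OF n]]
  have "((\<lambda>s. G (I + smul X1 s (unitv n))) has_field_derivative X1.cdir G I (unitv n)) (at (of_real t0 - of_real t0))"
    by simp
  from DERIV_chain2[OF this DERIV_diff[OF DERIV_ident DERIV_const]]
  have "((\<lambda>s. G (I + smul X1 (s - of_real t0) (unitv n))) has_field_derivative X1.cdir G I (unitv n)) (at (of_real t0))"
    by simp
  from has_vector_derivative_real_field[OF this]
  have 1: "((\<lambda>t. G (I + smul X1 (of_real t - of_real t0) (unitv n))) has_vector_derivative X1.cdir G I (unitv n)) (at t0)" .
  have "G (I + smul X1 (of_real t - of_real t0) (unitv n)) = H2_star \<Phi> (I(n := of_real t))" if "t \<in> {0<..}" for t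
  proof -
    have "I + smul X1 (of_real t - of_real t0) (unitv n) = I(n := of_real t)"
      using In by (auto simp: lC_simps unitv_def fun_eq_iff)
    then show ?thesis using G_eq_H2_star[OF lplus_51_upd[OF I n, of t]] that by simp
  qed
  then have "((\<lambda>t. H2_star \<Phi> (I(n := of_real t))) has_vector_derivative X1.cdir G I (unitv n)) (at t0)"
    by (intro has_vector_derivative_transform_within_open[OF 1, of "{0<..}"]) (use pos in \<open>auto simp: t0_def\<close>)
  moreover have "((\<lambda>t. H2_star \<Phi> (I(n := of_real t))) has_vector_derivative \<omega> I n) (at t0)"
    using H2_star_partial[OF I n pos] by (simp add: t0_def)
  ultimately have "X1.cdir G I (unitv n) = \<omega> I n" by (rule vector_derivative_unique_at)
  then show ?thesis using g_eq[OF lplus_51_h1[OF I]] by (simp add: defect_def)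
qed

lemma zero_ball: "\<exists>r>0. \<forall>h\<in>carr X1. nrm X1 h < r \<longrightarrow> h \<in> V"
proof -
  have "0 \<in> lplus 1 2" by (simp add: lplus_def lreal_def)
  then have "0 \<in> V" using lplus_V by blast
  then have "\<exists>r>0. \<forall>y\<in>carr X1. nrm X1 (y - 0) < r \<longrightarrow> y \<in> V"
    using V_open unfolding open_in_def by blast
  then show ?thesis by simp
qed

text \<open>The line to p starts at a point b with equal positive entries on 1, ..., N. Near b all
  these entries stay positive, so the defect vanishes there, and the parameters for which the line
  stays in the ball form a convex set.\<close>

lemma defect_finite_real:
  assumes r: "r > 0" "\<And>h. h \<in> carr X1 \<Longrightarrow> nrm X1 h < r \<Longrightarrow> h \<in> V"
    and n: "n \<noteq> 0" and p: "p \<in> carr X1" "nrm X1 p < r" "finite {j. p j \<noteq> 0}" "\<And>j. p j \<in> \<real>"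
  shows "defect n p = 0"
proof -
  obtain N where N: "n \<le> N" "{j. p j \<noteq> 0} \<subseteq> {..N}"
  proof -
    have "finite ({j. p j \<noteq> 0} \<union> {n})" using p(3) by simp
    then obtain N where "\<forall>j\<in>{j. p j \<noteq> 0} \<union> {n}. j \<le> N"
      unfolding finite_nat_set_iff_bounded_le by (rule exE)
    then show thesis using that[of N] by auto
  qed
  \<comment> \<open>N bounds both the support of p and the index n, so that entry n is positive near
    b as \<open>defect_positive\<close> requires.\<close>
  define e where "e = (\<lambda>j. if 1 \<le> j \<and> j \<le> N then 1 else (0::complex))"
  have e: "e \<in> carr X1" by (rule finite_support_lC) (auto simp: e_def intro: finite_subset[of _ "{..N}"])
  obtain \<epsilon> where eps: "\<epsilon> > 0" "\<epsilon> * nrm X1 e \<le> r / 2" using X1.ex_scale[OF _ e, of "r/2"] r by auto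
  define b where "b = smul X1 (of_real \<epsilon>) e"
  have b: "b \<in> carr X1" "nrm X1 b < r" using e eps r by (auto simp: b_def X1.nrm_smul)
  define A where "A = {t. nrm X1 (b + smul X1 t (p - b)) < r}"
  have Aeq: "A = {t. b + smul X1 t (p - b) \<in> {x \<in> carr X1. nrm X1 x < r}}"
    using b p by (auto simp: A_def)
  have A: "open A" unfolding Aeq by (rule X1.open_line_preimage[OF X1.open_in_ball]) (use b p in auto)
  have Ac: "connected A" unfolding A_def using X1.convex_line_ball[of b "p - b" r] b p by (intro convex_connected) auto
  have p0: "p 0 = 0" using p(1) by (simp add: lC_simps)
  define P where "P = (\<Sum>j\<le>N. norm (p j)) + 1"
  have P: "P > 0" "norm (p j) \<le> P" for j
  proof -
    show "P > 0" by (simp add: P_def add_nonneg_pos sum_nonneg)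
    show "norm (p j) \<le> P"
    proof (cases "j \<le> N")
      case True
      then show ?thesis using member_le_sum[of j "{..N}" "\<lambda>j. norm (p j)"] by (simp add: P_def)
    next
      case False
      then have "p j = 0" using N by auto
      then show ?thesis using \<open>P > 0\<close> by simp
    qed
  qed
  \<comment> \<open>For t below \<open>\<delta>\<close> the term (1 - t) eps exceeds eps / 2, while
    t p_j has modulus below eps / 2.\<close>
  define \<delta> where "\<delta> = min (1/2) (\<epsilon> / (2 * P))"
  have del: "\<delta> > 0" using eps P by (simp add: \<delta>_def)
  have "defect n (b + smul X1 1 (p - b)) = 0"
  proof (rule holomorphic_zero_ray[of "\<lambda>t. defect n (b + smul X1 t (p - b))" A \<delta>])
    show "(\<lambda>t. defect n (b + smul X1 t (p - b))) holomorphic_on A"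
      by (rule defect_holomorphic[OF n _ A]) (use b p r in \<open>auto simp: A_def\<close>)
    show "0 \<in> A" using b by (simp add: A_def)
    show "1 \<in> A" using p by (simp add: A_def)
    fix t :: real assume t: "0 < t" "t < \<delta>"
    define y where "y = b + smul X1 (of_real t) (p - b)"
    define q where "q = (\<lambda>j. Re (p j))"
    have q: "p j = of_real (q j)" for j using p(4)[of j] by (auto simp: q_def elim!: Reals_cases)
    have yj: "y j = of_real ((1 - t) * (if 1 \<le> j \<and> j \<le> N then \<epsilon> else 0) + t * q j)" for j
      by (simp add: y_def b_def e_def lC_simps q algebra_simps)
    have pos: "(1 - t) * \<epsilon> + t * q j > 0" for j
    proof -
      have "t < 1/2" "t * P < \<epsilon> / 2"
        using t P eps by (auto simp: \<delta>_def min_less_iff_conj pos_less_divide_eq mult_ac)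
      moreover have "t * \<bar>q j\<bar> \<le> t * P" using t P(2)[of j] by (intro mult_left_mono) (auto simp: q)
      moreover have "t * q j \<ge> - (t * \<bar>q j\<bar>)" using t by (simp add: abs_if mult_nonneg_nonneg)
      moreover have "(1 - t) * \<epsilon> \<ge> \<epsilon> / 2" using \<open>t < 1/2\<close> eps mult_right_mono[of "1/2" "1 - t" \<epsilon>] by simp
      ultimately show ?thesis by linarith
    qed
    have qz: "q j = 0" if "\<not> (1 \<le> j \<and> j \<le> N)" for j
    proof -
      have "p j = 0" using that N p0 by (cases "j = 0") auto
      then show ?thesis using q[of j] by simp
    qed
    have "y \<in> lplus 5 1"
    proof (rule finite_lplus_51)
      show "finite {n. y n \<noteq> 0}" by (rule finite_subset[of _ "{..N}"]) (use qz yj in auto)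
      show "y 0 = 0" using yj qz by simp
      show "y j \<in> \<real>" for j unfolding yj by simp
      show "0 \<le> Re (y j)" for j using pos[of j] qz[of j] unfolding yj by auto
    qed
    moreover have "Re (y n) > 0" using pos[of n] n N unfolding yj by auto
    ultimately show "defect n (b + smul X1 (of_real t) (p - b)) = 0"
      using defect_positive n by (simp add: y_def)
  qed (use A Ac del in auto)
  then show ?thesis by simp
qed

text \<open>With p and q the real and imaginary parts of x, the line p + t q consists of real
  sequences for real t and passes through x at t = i.\<close>

lemma defect_finite_small:
  assumes r: "r > 0" "\<And>h. h \<in> carr X1 \<Longrightarrow> nrm X1 h < r \<Longrightarrow> h \<in> V"
    and n: "n \<noteq> 0" and x: "x \<in> carr X1" "nrm X1 x < r" "finite {j. x j \<noteq> 0}"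
  shows "defect n x = 0"
proof -
  define p where "p = (\<lambda>j. complex_of_real (Re (x j)))"
  define q where "q = (\<lambda>j. complex_of_real (Im (x j)))"
  note pq = finite_real_part[OF x(1), folded p_def q_def]
  define A where "A = {t. nrm X1 (p + smul X1 t q) < r}"
  have Aeq: "A = {t. p + smul X1 t q \<in> {x \<in> carr X1. nrm X1 x < r}}"
    using pq by (auto simp: A_def)
  have A: "open A" unfolding Aeq by (rule X1.open_line_preimage[OF X1.open_in_ball]) (use pq in auto)
  have Ac: "connected A" unfolding A_def using X1.convex_line_ball[of p q r] pq by (intro convex_connected) auto
  have xe: "p + smul X1 \<i> q = x" by (auto simp: p_def q_def lC_simps fun_eq_iff complex_eq_iff)
  have p0: "0 \<in> A" using pq x by (simp add: A_def)
  obtain \<delta> where del: "\<delta> > 0" "ball 0 \<delta> \<subseteq> A" using A p0 open_contains_ball by blast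
  have "defect n (p + smul X1 \<i> q) = 0"
  proof (rule holomorphic_zero_ray[of "\<lambda>t. defect n (p + smul X1 t q)" A \<delta>])
    show "(\<lambda>t. defect n (p + smul X1 t q)) holomorphic_on A"
      by (rule defect_holomorphic[OF n _ A]) (use pq r in \<open>auto simp: A_def\<close>)
    show "\<i> \<in> A" using x xe by (simp add: A_def)
    fix t :: real assume t: "0 < t" "t < \<delta>"
    then have tA: "of_real t \<in> A" using del by auto
    show "defect n (p + smul X1 (of_real t) q) = 0"
    proof (rule defect_finite_real[OF r n])
      show "nrm X1 (p + smul X1 (of_real t) q) < r" using tA by (simp add: A_def)
      show "finite {j. (p + smul X1 (of_real t) q) j \<noteq> 0}"
        by (rule finite_subset[OF _ x(3)]) (auto simp: p_def q_def lC_simps)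
      show "(p + smul X1 (of_real t) q) j \<in> \<real>" for j by (auto simp: p_def q_def lC_simps)
    qed (use pq in auto)
  qed (use A Ac p0 del in auto)
  then show ?thesis by (simp add: xe)
qed

text \<open>The complex line through 0 and x enters the small ball near 0, where the defect is known
  to vanish.\<close>

lemma defect_finite:
  assumes n: "n \<noteq> 0" and x: "x \<in> V" "finite {j. x j \<noteq> 0}"
  shows "defect n x = 0"
proof -
  obtain r where r: "r > 0" "\<And>h. h \<in> carr X1 \<Longrightarrow> nrm X1 h < r \<Longrightarrow> h \<in> V" using zero_ball by blast
  have xc: "x \<in> carr X1" using x(1) by (rule V_carr)
  define A0 where "A0 = {t. 0 + smul X1 t x \<in> V}"
  have A0: "open A0" unfolding A0_def by (rule X1.open_line_preimage[OF V_open]) (use xc in auto)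
  \<comment> \<open>The parameters that keep the line inside \<open>V\<close> may form a
    disconnected set. The component of 0 contains the parameter 1, because \<open>V\<close> is
    star-shaped.\<close>
  define A where "A = connected_component_set A0 0"
  have seg: "complex_of_real ` {0..1} \<subseteq> A0" using V_star[OF x(1)] by (auto simp: A0_def)
  have A: "open A" unfolding A_def by (rule open_connected_component[OF A0])
  have Ac: "connected A" unfolding A_def by (rule connected_connected_component)
  have "connected (complex_of_real ` {0..1})"
    by (intro connected_continuous_image continuous_intros) auto
  from connected_component_maximal[OF _ this seg, of 0] have sA: "complex_of_real ` {0..1} \<subseteq> A"
    by (force simp: A_def image_iff)
  have sub: "A \<subseteq> A0" unfolding A_def by (rule connected_component_subset)
  obtain \<delta> where del: "\<delta> > 0" "\<delta> * nrm X1 x \<le> r / 2" using X1.ex_scale[OF _ xc, of "r/2"] r by auto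
  have "defect n (0 + smul X1 1 x) = 0"
  proof (rule holomorphic_zero_ray[of "\<lambda>t. defect n (0 + smul X1 t x)" A \<delta>])
    show "(\<lambda>t. defect n (0 + smul X1 t x)) holomorphic_on A"
      by (rule defect_holomorphic[OF n xc A]) (use sub in \<open>auto simp: A0_def\<close>)
    show "0 \<in> A" using sA by force
    show "1 \<in> A" using sA by force
    fix t :: real assume t: "0 < t" "t < \<delta>"
    show "defect n (0 + smul X1 (of_real t) x) = 0"
    proof (rule defect_finite_small[OF r n])
      have "t * nrm X1 x \<le> \<delta> * nrm X1 x" using t by (intro mult_right_mono) auto
      then show "nrm X1 (0 + smul X1 (of_real t) x) < r" using del r t xc by (simp add: X1.nrm_smul)
      show "finite {j. (0 + smul X1 (of_real t) x) j \<noteq> 0}"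
        by (rule finite_subset[OF _ x(2)]) (auto simp: lC_simps)
    qed (use xc in auto)
  qed (use A Ac del in auto)
  then show ?thesis by simp
qed

text \<open>Truncations of x have finite support and converge to x in h^1. Both terms of the defect
  are continuous at x, the derivative of \<open>G\<close> by Cauchy's estimates.\<close>

lemma defect_zero:
  assumes n: "n \<noteq> 0" and x: "x \<in> V"
  shows "defect n x = 0"
proof (rule ccontr)
  assume ne: "defect n x \<noteq> 0"
  define e where "e = norm (defect n x) / 4"
  have e: "e > 0" using ne by (simp add: e_def)
  have xc: "x \<in> carr X1" using x by (rule V_carr)
  obtain r M where b1: "X1.bounded_at G x r M" using X1.analytic_bounded_at[OF G_analytic x] by blast
  obtain d1 where d1: "d1 > 0" "\<And>k. k \<in> carr X1 \<Longrightarrow> nrm X1 k < d1 \<Longrightarrow> norm (X1.cdir G (x + k) (unitv n) - X1.cdir G x (unitv n)) \<le> e"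
    using X1.cdir_continuous[OF b1 unitv_lC[OF n] e] by blast
  obtain d2 where d2: "d2 > 0" "\<And>k. k \<in> carr X1 \<Longrightarrow> nrm X1 k < d2 \<Longrightarrow> norm (g (x + k) n - g x n) \<le> e"
    by (rule has_cderiv_continuous[OF X1.cnorm_axioms cnorm_Cspace X1.analytic_has_cderiv[OF coord_g_analytic] e, of x n])
      (use x V_subset_V0 that in auto)
  obtain d3 where d3: "d3 > 0" "\<And>y. y \<in> carr X1 \<Longrightarrow> nrm X1 (y - x) < d3 \<Longrightarrow> y \<in> V"
    using V_open x unfolding open_in_def by blast
  obtain F where F: "finite F" "restr F x \<in> carr X1" "nrm X1 (x - restr F x) < min d1 (min d2 d3)"
    using restr_tail_lC[OF xc, of "min d1 (min d2 d3)"] d1(1) d2(1) d3(1) by auto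
  define k where "k = restr F x - x"
  have k: "k \<in> carr X1" using F xc by (simp add: k_def)
  have kn: "nrm X1 k < min d1 (min d2 d3)"
    using F(3) X1.nrm_diff_commute[OF xc F(2)] by (simp add: k_def)
  have yk: "x + k = restr F x" by (simp add: k_def)
  have "restr F x \<in> V" using d3(2)[OF F(2)] kn by (simp add: k_def)
  moreover have "finite {j. restr F x j \<noteq> 0}" by (rule finite_subset[OF _ F(1)]) (auto simp: restr_def)
  ultimately have "defect n (x + k) = 0" unfolding yk using defect_finite[OF n] by blast
  then have dn: "defect n x = - ((X1.cdir G (x + k) (unitv n) - X1.cdir G x (unitv n)) - (g (x + k) n - g x n))"
    by (simp add: defect_def)
  then have "norm (defect n x) \<le> e + e"
    unfolding dn norm_minus_cancel
    using norm_triangle_ineq4[of "X1.cdir G (x + k) (unitv n) - X1.cdir G x (unitv n)" "g (x + k) n - g x n"]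
      d1(2)[OF k] d2(2)[OF k] kn by linarith
  then show False using e by (simp add: e_def)
qed

lemma G_gradient:
  assumes x: "x \<in> V"
  shows "has_cderiv X1 Cspace G x (dpair (g x))"
proof (rule X1.has_cderiv_cong[OF X1.analytic_has_cderiv[OF G_analytic x]])
  fix h assume h: "h \<in> carr X1"
  have gx: "g x \<in> carr Y1" using g_carr x V_subset_V0 by blast
  have "bounded_clin X1 Cspace (dpair (g x))" using dpair_bounded_clin[of "g x" 1] gx by simp
  note s = bounded_clin_has_sum_lC[OF this h]
  have "(if n = 0 then 0 else X1.cdir G x (unitv n)) = (if n = 0 then 0 else dpair (g x) (unitv n))" for n
    using defect_zero[OF _ x, of n] by (simp add: defect_def dpair_unitv)
  note s' = bounded_clin_has_sum_lC[OF has_cderiv_clin[OF X1.analytic_has_cderiv[OF G_analytic x]] h, unfolded this]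
  show "X1.cdir G x h = dpair (g x) h" by (rule has_sum_unique[OF s' s])
qed

lemma G_real:
  assumes I: "I \<in> lplus 1 2"
  shows "G I \<in> \<real>"
proof -
  define f where "f = (\<lambda>t::real. dpair (g (smul X1 (of_real t) I)) I)"
  have c: "continuous_on {0..1} f" unfolding f_def
    by (rule radial_continuous) (use lplus_carr[OF I] lplus_scale[OF I] V0 in auto)
  have fr: "Im (f t) = 0" if t: "t \<in> {0..1}" for t
  proof -
    have l: "smul X1 (of_real t) I \<in> lplus 1 2" using lplus_scale[OF I] t by simp
    have "\<omega> (smul X1 (of_real t) I) n \<in> \<real>" for n using omega_real l by (auto simp: lreal_def)
    moreover have "I n \<in> \<real>" for n using I by (auto simp: lplus_def lreal_def)
    ultimately have im: "Im (g (smul X1 (of_real t) I) n * I n) = 0" for n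
      unfolding g_eq[OF l] using Reals_mult complex_is_Real_iff by blast
    have s: "(\<lambda>n. g (smul X1 (of_real t) I) n * I n) summable_on UNIV"
      using dpair_bound(1)[of "g (smul X1 (of_real t) I)" 1 I] g_carr l V0 lplus_carr[OF I] by auto
    show ?thesis unfolding f_def dpair_def using infsum_Im[OF s] im by simp
  qed
  have "Im (integral {0..1} f) = integral {0..1} (\<lambda>t. Im (f t))"
    using integral_linear[OF integrable_continuous_real[OF c] bounded_linear_Im] by (simp add: o_def)
  also have "\<dots> = integral {0..1} (\<lambda>t::real. 0::real)" by (rule integral_cong) (use fr in auto)
  finally show ?thesis by (simp add: G_def f_def complex_is_Real_iff)
qed

end

section \<open>The evolution of the Birkhoff coordinates\<close>

lemma wl2_int_nat:
  assumes "a \<in> carr (h0C s)"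
  shows "wl2 (wj s) (\<lambda>n. a (int n))" "wn (wj s) (\<lambda>n. a (int n)) \<le> nrm (h0C s) a"
    "wl2 (wj s) (\<lambda>n. a (- int n))" "wn (wj s) (\<lambda>n. a (- int n)) \<le> nrm (h0C s) a"
proof -
  have gen: "wl2 (wj s) (\<lambda>n. b (int n)) \<and> wn (wj s) (\<lambda>n. b (int n)) \<le> wn (wi s) b" if b: "wl2 (wi s) b" for b
  proof -
    have "L2_set (\<lambda>n. wj s n * norm (b (int n))) F \<le> wn (wi s) b" if F: "finite F" for F
    proof -
      have "(\<Sum>n\<in>F. (wj s n * norm (b (int n)))\<^sup>2) = (\<Sum>k\<in>int ` F. (wi s k * norm (b k))\<^sup>2)"
        by (subst sum.reindex) (auto simp: wi_int)
      then have "L2_set (\<lambda>n. wj s n * norm (b (int n))) F = L2_set (\<lambda>k. wi s k * norm (b k)) (int ` F)"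
        by (simp add: L2_set_def)
      also have "\<dots> \<le> wn (wi s) b" by (rule wl2_L2_set_le[OF b]) (use F in auto)
      finally show ?thesis .
    qed
    from wl2_boundI[OF this] show ?thesis by blast
  qed
  have a: "wl2 (wi s) a" "wn (wi s) a = nrm (h0C s) a" using assms by (auto simp: h0C_simps)
  show "wl2 (wj s) (\<lambda>n. a (int n))" "wn (wj s) (\<lambda>n. a (int n)) \<le> nrm (h0C s) a"
    using gen[OF a(1)] a(2) by auto
  show "wl2 (wj s) (\<lambda>n. a (- int n))" "wn (wj s) (\<lambda>n. a (- int n)) \<le> nrm (h0C s) a"
    using gen[OF h0C_flip(2)[OF assms]] h0C_flip(3)[OF assms] by auto
qed

text \<open>Weights of order n^5, the growth of the KdV2 frequencies, are shared between two factors
  whose regularities add up to 5. The splittings in use are 5/2 + 5/2, and 11/2 - 1/2 when one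
  factor is only the image of a direction in h^-1.\<close>

lemma product_bound:
  assumes a: "a \<in> carr (h0C s)" and b: "b \<in> carr (h0C t)" and c: "\<And>n. norm (c n) \<le> C * (1 + real n) ^ 5"
    and st: "s + t = 5" and C: "C \<ge> 0"
  shows "(\<lambda>n. norm (c n * (a (int n) * b (- int n)))) summable_on UNIV"
    "(\<Sum>\<^sub>\<infinity>n. norm (c n * (a (int n) * b (- int n)))) \<le> C * (nrm (h0C s) a * nrm (h0C t) b)"
    "norm (\<Sum>\<^sub>\<infinity>n. c n * (a (int n) * b (- int n))) \<le> C * (nrm (h0C s) a * nrm (h0C t) b)"
    "(\<lambda>n. c n * (a (int n) * b (- int n))) summable_on UNIV"
    "(\<lambda>n. norm (c n * (a (- int n) * b (int n)))) summable_on UNIV"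
    "norm (\<Sum>\<^sub>\<infinity>n. c n * (a (- int n) * b (int n))) \<le> C * (nrm (h0C s) a * nrm (h0C t) b)"
    "(\<lambda>n. c n * (a (- int n) * b (int n))) summable_on UNIV"
proof -
  have c': "norm (c n) \<le> C * (wj s n * wj t n)" for n
    using c[of n] wj_nat[of 5 n] by (simp add: wj_mult st)
  note p = wl2_pair[OF wl2_int_nat(1)[OF a] wl2_int_nat(3)[OF b] C c' wj_nonneg wj_nonneg, unfolded mult.assoc]
  note q = wl2_pair[OF wl2_int_nat(3)[OF a] wl2_int_nat(1)[OF b] C c' wj_nonneg wj_nonneg, unfolded mult.assoc]
  have le1: "C * (wn (wj s) (\<lambda>n. a (int n)) * wn (wj t) (\<lambda>n. b (- int n))) \<le> C * (nrm (h0C s) a * nrm (h0C t) b)"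
    using wl2_int_nat[OF a] wl2_int_nat[OF b] C by (intro mult_left_mono mult_mono) (auto simp: h0C_simps)
  have le2: "C * (wn (wj s) (\<lambda>n. a (- int n)) * wn (wj t) (\<lambda>n. b (int n))) \<le> C * (nrm (h0C s) a * nrm (h0C t) b)"
    using wl2_int_nat[OF a] wl2_int_nat[OF b] C by (intro mult_left_mono mult_mono) (auto simp: h0C_simps)
  show "(\<lambda>n. norm (c n * (a (int n) * b (- int n)))) summable_on UNIV"
    "(\<Sum>\<^sub>\<infinity>n. norm (c n * (a (int n) * b (- int n)))) \<le> C * (nrm (h0C s) a * nrm (h0C t) b)"
    "norm (\<Sum>\<^sub>\<infinity>n. c n * (a (int n) * b (- int n))) \<le> C * (nrm (h0C s) a * nrm (h0C t) b)"
    "(\<lambda>n. c n * (a (int n) * b (- int n))) summable_on UNIV"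
    using p le1 by auto
  show "(\<lambda>n. norm (c n * (a (- int n) * b (int n)))) summable_on UNIV"
    "norm (\<Sum>\<^sub>\<infinity>n. c n * (a (- int n) * b (int n))) \<le> C * (nrm (h0C s) a * nrm (h0C t) b)"
    "(\<lambda>n. c n * (a (- int n) * b (int n))) summable_on UNIV"
    using q le2 by auto
qed

definition act_diff :: "(int \<Rightarrow> complex) \<Rightarrow> (int \<Rightarrow> complex) \<Rightarrow> nat \<Rightarrow> complex" where
  "act_diff z w n = z (int n) * w (- int n) + z (- int n) * w (int n)"

lemma actions_expand: "actions (z + w) - actions z - act_diff z w = actions w"
  by (auto simp: actions_def act_diff_def fun_eq_iff algebra_simps)

text \<open>Quadratic expressions in h^(5/2) land in \<open>lC 5 1\<close> and thus in h^1, the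
  space on which \<open>G\<close> is differentiable.\<close>

lemma product_l51:
  assumes a: "a \<in> carr (h0C (5/2))" and b: "b \<in> carr (h0C (5/2))"
  shows "(\<lambda>n. a (int n) * b (- int n)) \<in> carr (lC 5 1)"
    "nrm (lC 1 2) (\<lambda>n. a (int n) * b (- int n)) \<le> nrm (h0C (5/2)) a * nrm (h0C (5/2)) b"
proof -
  have n: "norm (complex_of_real ((1 + real n) ^ 5)) = (1 + real n) ^ 5" for n
    by (simp only: norm_of_real) simp
  have e: "norm (complex_of_real ((1 + real n) ^ 5) * (a (int n) * b (- int n))) = (1 + real n) ^ 5 * norm (a (int n) * b (- int n))" for n
    unfolding norm_mult n ..
  have c: "norm (complex_of_real ((1 + real n) ^ 5)) \<le> 1 * (1 + real n) ^ 5" for n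
    unfolding n by simp
  note p = product_bound(1,2)[OF a b c, unfolded e]
  have a0: "a 0 = 0" using a by (simp add: h0C_simps)
  show 1: "(\<lambda>n. a (int n) * b (- int n)) \<in> carr (lC 5 1)"
    unfolding carr_lC_51 using p(1) a0 by simp
  show "nrm (lC 1 2) (\<lambda>n. a (int n) * b (- int n)) \<le> nrm (h0C (5/2)) a * nrm (h0C (5/2)) b"
    using l51_norm_le[OF 1] p(2) by simp
qed

lemma l51_add: "x \<in> carr (lC 5 1) \<Longrightarrow> y \<in> carr (lC 5 1) \<Longrightarrow> x + y \<in> carr (lC 5 1)"
proof -
  assume x: "x \<in> carr (lC 5 1)" and y: "y \<in> carr (lC 5 1)"
  have "(\<lambda>n. (1 + real n) ^ 5 * norm (x n) + (1 + real n) ^ 5 * norm (y n)) summable_on UNIV"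
    using x y by (intro summable_on_add) (auto simp: carr_lC_51)
  then have "(\<lambda>n. (1 + real n) ^ 5 * norm ((x + y) n)) summable_on UNIV"
    by (rule summable_on_comparison_test)
      (auto simp: norm_triangle_ineq mult_left_mono simp flip: distrib_left)
  then show ?thesis using x y by (simp add: carr_lC_51)
qed

lemma act_diff_l51:
  assumes "a \<in> carr (h0C (5/2))" "b \<in> carr (h0C (5/2))"
  shows "act_diff a b \<in> carr (lC 5 1)" "nrm (lC 1 2) (act_diff a b) \<le> 2 * nrm (h0C (5/2)) a * nrm (h0C (5/2)) b"
proof -
  interpret cnorm "lC 1 2" by (rule cnorm_lC)
  have e: "act_diff a b = (\<lambda>n. a (int n) * b (- int n)) + (\<lambda>n. b (int n) * a (- int n))"
    by (auto simp: act_diff_def fun_eq_iff)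
  note p = product_l51[OF assms] product_l51[OF assms(2,1)]
  show "act_diff a b \<in> carr (lC 5 1)" unfolding e by (rule l51_add[OF p(1,3)])
  show "nrm (lC 1 2) (act_diff a b) \<le> 2 * nrm (h0C (5/2)) a * nrm (h0C (5/2)) b"
    unfolding e using nrm_triangle[OF l51_subset_h1[OF p(1)] l51_subset_h1[OF p(3)]] p(2)
      p(4)[unfolded mult.commute[of "nrm (h0C (5/2)) b"]]
    by linarith
qed

lemma actions_l51: "z \<in> carr (h0C (5/2)) \<Longrightarrow> actions z \<in> carr (lC 5 1)"
  "z \<in> carr (h0C (5/2)) \<Longrightarrow> nrm (lC 1 2) (actions z) \<le> (nrm (h0C (5/2)) z)\<^sup>2"
  using product_l51[of z z] by (simp_all add: actions_def power2_eq_square)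

lemma actions_lplus: "z \<in> h0 (5/2) \<Longrightarrow> actions z \<in> lplus 5 1"
proof -
  assume z: "z \<in> h0 (5/2)"
  have "actions z n = of_real ((norm (z (int n)))\<^sup>2)" for n
  proof -
    have "z (- int n) = cnj (z (int n))" using z by (simp add: h0_def)
    then show ?thesis unfolding actions_def by (simp only: complex_norm_square)
  qed
  moreover have "actions z \<in> carr (lC 5 1)" using actions_l51 z by (simp add: h0_def)
  ultimately show ?thesis by (auto simp: lplus_def lreal_def)
qed

lemma act_diff_add: "act_diff z (v + w) = act_diff z v + act_diff z w"
  by (auto simp: act_diff_def fun_eq_iff algebra_simps)

lemma act_diff_smul: "act_diff z (smul (h0C s) c w) = (\<lambda>n. c * act_diff z w n)"
  by (auto simp: act_diff_def h0C_simps fun_eq_iff algebra_simps)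

lemma has_cderiv_actions:
  assumes z: "z \<in> carr (h0C (5/2))"
  shows "has_cderiv (h0C (5/2)) (lC 1 2) actions z (act_diff z)"
proof (rule has_cderiv_quadratic[OF cnorm_h0C, where C = 1])
  show "bounded_clin (h0C (5/2)) (lC 1 2) (act_diff z)"
    by (rule bounded_clinI[where K = "2 * nrm (h0C (5/2)) z"])
      (auto simp: act_diff_add act_diff_smul lC_simps(2) l51_subset_h1[OF act_diff_l51(1)[OF z]] act_diff_l51(2)[OF z])
  fix h assume h: "h \<in> carr (h0C (5/2))"
  show "rmd actions z (act_diff z) h \<in> carr (lC 1 2)" "nrm (lC 1 2) (rmd actions z (act_diff z) h) \<le> 1 * (nrm (h0C (5/2)) h)\<^sup>2"
    unfolding rmd_def actions_expand using l51_subset_h1[OF actions_l51(1)[OF h]] actions_l51(2)[OF h] by simp_all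
qed simp

lemma act_diff_bounded:
  assumes z: "z \<in> carr (h0C s)" and c: "\<And>n. norm (c n :: complex) \<le> C * (1 + real n) ^ 5" and C: "C \<ge> 0" and st: "s + t = 5"
  shows "bounded_clin (h0C t) Cspace (\<lambda>w. \<Sum>\<^sub>\<infinity>n. c n * act_diff z w n)"
    and "w \<in> carr (h0C t) \<Longrightarrow> (\<lambda>n. c n * act_diff z w n) summable_on UNIV"
proof -
  have sm: "(\<lambda>n. c n * act_diff z w n) summable_on UNIV"
    and bd: "norm (\<Sum>\<^sub>\<infinity>n. c n * act_diff z w n) \<le> (2 * C * nrm (h0C s) z) * nrm (h0C t) w" if w: "w \<in> carr (h0C t)" for w
  proof -
    note p = product_bound[OF z w c st C]
    have e: "(\<lambda>n. c n * act_diff z w n) = (\<lambda>n. c n * (z (int n) * w (- int n)) + c n * (z (- int n) * w (int n)))"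
      by (simp add: act_diff_def distrib_left)
    show "(\<lambda>n. c n * act_diff z w n) summable_on UNIV" unfolding e by (rule summable_on_add[OF p(4) p(7)])
    show "norm (\<Sum>\<^sub>\<infinity>n. c n * act_diff z w n) \<le> (2 * C * nrm (h0C s) z) * nrm (h0C t) w"
      unfolding e infsum_add[OF p(4) p(7)] using norm_triangle_mono[OF p(3) p(6)] by (simp add: algebra_simps)
  qed
  show "w \<in> carr (h0C t) \<Longrightarrow> (\<lambda>n. c n * act_diff z w n) summable_on UNIV" by (rule sm)
  show "bounded_clin (h0C t) Cspace (\<lambda>w. \<Sum>\<^sub>\<infinity>n. c n * act_diff z w n)"
  proof (rule bounded_clinI)
    show "(\<Sum>\<^sub>\<infinity>n. c n * act_diff z (v + w) n) = (\<Sum>\<^sub>\<infinity>n. c n * act_diff z v n) + (\<Sum>\<^sub>\<infinity>n. c n * act_diff z w n)"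
      if "v \<in> carr (h0C t)" "w \<in> carr (h0C t)" for v w
      unfolding act_diff_add using sm[OF that(1)] sm[OF that(2)] by (simp add: distrib_left infsum_add)
    show "(\<Sum>\<^sub>\<infinity>n. c n * act_diff z (smul (h0C t) d w) n) = smul Cspace d (\<Sum>\<^sub>\<infinity>n. c n * act_diff z w n)" for d w
      unfolding act_diff_smul by (simp add: mult.left_commute infsum_cmult_right')
    show "nrm Cspace (\<Sum>\<^sub>\<infinity>n. c n * act_diff z w n) \<le> (2 * C * nrm (h0C s) z) * nrm (h0C t) w" if "w \<in> carr (h0C t)" for w
      using bd[OF that] by simp
  qed simp
qed

lemma has_cderiv_weighted_actions:
  assumes z: "z \<in> carr (h0C (5/2))" and c: "\<And>n. norm (c n :: complex) \<le> C * (1 + real n) ^ 5" and C: "C \<ge> 0"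
  shows "has_cderiv (h0C (5/2)) Cspace (\<lambda>z. \<Sum>\<^sub>\<infinity>n. c n * actions z n) z (\<lambda>w. \<Sum>\<^sub>\<infinity>n. c n * act_diff z w n)"
    (is "has_cderiv ?X _ ?f _ ?L")
proof (rule has_cderiv_quadratic[OF cnorm_h0C _ C])
  have st: "(5/2::real) + 5/2 = 5" by simp
  show "bounded_clin ?X Cspace ?L" by (rule act_diff_bounded(1)[OF z c C st])
  fix h assume h: "h \<in> carr ?X"
  have s: "(\<lambda>n. c n * actions w n) summable_on UNIV" if "w \<in> carr ?X" for w
    using product_bound(4)[OF that that c st C] by (simp add: actions_def)
  note sa = act_diff_bounded(2)[OF z c C st h]
  have "c n * actions (z + h) n = c n * actions z n + c n * act_diff z h n + c n * actions h n" for n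
    by (simp add: actions_def act_diff_def algebra_simps)
  then have "?f (z + h) = ?f z + ?L h + ?f h"
    using infsum_add[OF summable_on_add[OF s[OF z] sa] s[OF h]] infsum_add[OF s[OF z] sa] by simp
  then have "rmd ?f z ?L h = ?f h" by (simp add: rmd_def)
  then show "nrm Cspace (rmd ?f z ?L h) \<le> C * (nrm ?X h)\<^sup>2"
    using product_bound(3)[OF h h c st C] by (simp add: actions_def power2_eq_square)
qed simp

section \<open>Real trigonometric polynomials and the differential of H2 in Birkhoff
  coordinates\<close>

definition rtrig :: "nat \<Rightarrow> (int \<Rightarrow> complex) \<Rightarrow> bool" where
  "rtrig N u \<longleftrightarrow> supported N u \<and> (\<forall>k. u (- k) = cnj (u k))"

lemma rtrig_h0: "rtrig N u \<Longrightarrow> u \<in> h0 s"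
  using supported_h0C[of N u s] by (simp add: rtrig_def h0_def)

lemma rtrig_add: "rtrig N u \<Longrightarrow> rtrig N v \<Longrightarrow> rtrig N (\<lambda>k. u k + of_real t * v k)"
  by (auto simp: rtrig_def supported_def)

lemma rtrig_mono: "rtrig N u \<Longrightarrow> N \<le> N' \<Longrightarrow> rtrig N' u"
  by (force simp: rtrig_def supported_def)

lemma grH2_mono:
  assumes u: "supported N u" and le: "N \<le> N'"
  shows "grH2 N' u = grH2 N u"
proof
  fix k
  have z: "u i = 0" if "i \<in> sym_int N' - sym_int N" for i using u that by (auto simp: supported_def)
  have sub: "sym_int N \<subseteq> sym_int N'" using le by auto
  have "gr2 N' u u k = gr2 N u u k"
    unfolding gr2_def
    by (rule sum.mono_neutral_cong_right, simp, rule sub)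
      (use z in \<open>auto intro!: sum.neutral sum.mono_neutral_cong_right[OF _ sub]\<close>)
  moreover have "gr3 N' u u u k = gr3 N u u u k"
    unfolding gr3_def
    by (rule sum.mono_neutral_cong_right, simp, rule sub)
      (use z in \<open>auto intro!: sum.neutral sum.mono_neutral_cong_right[OF _ sub]\<close>)
  ultimately show "grH2 N' u k = grH2 N u k" by (simp add: grH2_def)
qed

lemma gr2_support: "\<bar>k\<bar> > 2 * int N \<Longrightarrow> gr2 N u v k = 0"
  unfolding gr2_def by (intro sum.neutral ballI) auto

lemma gr3_support: "\<bar>k\<bar> > 3 * int N \<Longrightarrow> gr3 N u v w k = 0"
  unfolding gr3_def by (intro sum.neutral ballI) auto

lemma grH2_support:
  assumes "supported N u" "\<bar>k\<bar> > 3 * int N"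
  shows "grH2 N u k = 0"
proof -
  have "k \<notin> sym_int N" using assms(2) by auto
  then have "u k = 0" using assms(1) unfolding supported_def by blast
  then show ?thesis using assms(2) gr2_support[of N k u u] gr3_support[of N k u u u] by (simp add: grH2_def)
qed

context kdv2
begin

abbreviation zd :: "int \<Rightarrow> (int \<Rightarrow> complex) \<Rightarrow> (int \<Rightarrow> complex) \<Rightarrow> complex" where
  "zd n \<equiv> cnorm.cdir (h0C (-1)) (\<lambda>v. \<Phi> v n)"

lemma Phi_analytic: "analytic_map (h0C (-1)) (h0C (-1/2)) W \<Phi>" and h0_W: "h0 (-1) \<subseteq> W"
  using birkhoff by (simp_all add: birkhoff_map_def)

lemma coord_analytic: "analytic_map (h0C (-1)) Cspace W (\<lambda>v. \<Phi> v n)"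
  using analytic_compose_functional(1)[OF Phi_analytic coord_bounded_clin cnorm_h0C cnorm_h0C] .

lemma coord_deriv: "u \<in> h0 (-1) \<Longrightarrow> has_cderiv (h0C (-1)) Cspace (\<lambda>v. \<Phi> v n) u (zd n u)"
  using cnorm.analytic_has_cderiv[OF cnorm_h0C coord_analytic] h0_W by blast

lemma Phi_deriv:
  assumes u: "u \<in> h0 (-1)"
  shows "\<exists>L. bounded_clin (h0C (-1)) (h0C (-1/2)) L \<and> (\<forall>v\<in>carr (h0C (-1)). \<forall>n. zd n u v = L v n)"
proof -
  obtain L where L: "has_cderiv (h0C (-1)) (h0C (-1/2)) \<Phi> u L"
    using Phi_analytic u h0_W unfolding analytic_map_def by blast
  have uW: "u \<in> W" using u h0_W by blast
  have "zd n u v = L v n" if "v \<in> carr (h0C (-1))" for v n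
    using cnorm.cdir_eq[OF cnorm_h0C analytic_compose_functional(2)[OF Phi_analytic coord_bounded_clin cnorm_h0C cnorm_h0C uW L] that] .
  then show ?thesis using L by (auto simp: has_cderiv_def)
qed

lemma Phi_smooth: "s \<ge> -1 \<Longrightarrow> real_analytic_map (h0C s) (h0C (s + 1/2)) (h0 s) (h0 (s + 1/2)) \<Phi>"
  using birkhoff by (simp add: birkhoff_map_def)

text \<open>The full KdV2 frequency, the derivative of H2 in the n-th action, reassembled from
  \<open>\<omega>\<close> by undoing the renormalisation. In this form it has a meaning at vanishing
  actions too.\<close>

definition freq :: "(int \<Rightarrow> complex) \<Rightarrow> nat \<Rightarrow> complex" where
  "freq u n = \<omega> (actions (\<Phi> u)) n + of_real (kn n ^ 5) + 20 * H0 u * of_real (kn n)"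

lemma H0_act_Phi: "u \<in> h0 0 \<Longrightarrow> H0_act (actions (\<Phi> u)) = H0 u"
  using birkhoff by (simp add: birkhoff_map_def)

lemma actions_Phi: "u \<in> h0 2 \<Longrightarrow> actions (\<Phi> u) \<in> lplus 5 1"
  using actions_lplus[of "\<Phi> u"] Phi_mem[of 2 u] by simp

lemma H2_decomposition:
  assumes u: "u \<in> h0 2"
  shows "H2 u = G (actions (\<Phi> u)) + (S5 (actions (\<Phi> u)) + 10 * (H0_act (actions (\<Phi> u)))^2)"
  using G_eq_H2_star[OF actions_Phi[OF u]] H2_act_Phi[OF u] by (simp add: H2_star_eq)

lemma freq_bound:
  assumes u: "u \<in> h0 2"
  shows "\<exists>C\<ge>0. \<forall>n. norm (freq u n) \<le> C * (1 + real n) ^ 5"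
proof -
  define w where "w = \<omega> (actions (\<Phi> u))"
  have "w \<in> carr (lC (-1) 2)" unfolding w_def by (rule omega_carr[OF lplus_51_h1[OF actions_Phi[OF u]]])
  then have wl: "wl2 (wj (-1)) w" by (simp add: lC_simps)
  define N where "N = wn (wj (-1)) w"
  have N: "N \<ge> 0" by (simp add: N_def)
  have wb: "norm (w n) \<le> N * (1 + real n) ^ 5" for n
  proof -
    have 1: "wj 1 n * wj (-1) n = 1" by (simp add: wj_mult)
    have "norm (w n) = wj 1 n * (wj (-1) n * norm (w n))" by (simp add: 1 flip: mult.assoc)
    also have "\<dots> \<le> wj 1 n * N" unfolding N_def by (intro mult_left_mono wl2_coord[OF wl]) auto
    also have "\<dots> \<le> wj (of_nat 5) n * N" using N by (intro mult_right_mono wj_mono) auto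
    finally show ?thesis unfolding wj_nat by (simp add: mult.commute)
  qed
  define C where "C = N + (2 * pi) ^ 5 + 20 * norm (H0 u) * (2 * pi)"
  have "norm (freq u n) \<le> C * (1 + real n) ^ 5" for n
  proof -
    have "norm (freq u n) \<le> norm (w n) + norm (complex_of_real (kn n ^ 5)) + norm (20 * H0 u * of_real (kn n))"
      unfolding freq_def w_def by (rule norm_triangle_le[OF add_mono[OF norm_triangle_ineq order_refl]])
    also have "norm (20 * H0 u * of_real (kn n)) = 20 * norm (H0 u) * norm (complex_of_real (kn n))" by (simp add: norm_mult)
    also have "norm (w n) + norm (complex_of_real (kn n ^ 5)) + 20 * norm (H0 u) * norm (complex_of_real (kn n))
      \<le> N * (1 + real n) ^ 5 + (2 * pi) ^ 5 * (1 + real n) ^ 5 + 20 * norm (H0 u) * ((2 * pi) * (1 + real n) ^ 5)"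
      using wb kn_bound by (intro add_mono mult_left_mono) auto
    finally show ?thesis by (simp add: C_def distrib_right mult.assoc)
  qed
  moreover have "C \<ge> 0" using N by (simp add: C_def)
  ultimately show ?thesis by blast
qed

text \<open>The Birkhoff map is differentiable both from h^-1 to h^(-1/2) and from h^2 to h^(5/2).
  The extension \<open>g2\<close> agrees with \<open>\<Phi>\<close> on real points, so the two
  derivatives are compared along real curves, where vector derivatives are unique.\<close>

lemma Phi_smooth_deriv:
  assumes u: "rtrig N u"
  obtains g2 L where "\<And>x. x \<in> h0 2 \<Longrightarrow> g2 x = \<Phi> x" "has_cderiv (h0C 2) (h0C (5/2)) g2 u L" "\<And>v k. rtrig N v \<Longrightarrow> L v k = zd k u v"
proof -
  let ?X2 = "h0C 2" and ?Z = "h0C (5/2)"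
  have "real_analytic_map ?X2 ?Z (h0 2) (h0 (5/2)) \<Phi>" using Phi_smooth[of 2] by simp
  then obtain V2 g2 where V2: "h0 2 \<subseteq> V2" and g2: "analytic_map ?X2 ?Z V2 g2" and g2e: "\<forall>x\<in>h0 2. g2 x = \<Phi> x"
    unfolding real_analytic_map_def by (elim conjE exE)
  have uV: "u \<in> V2" using V2 rtrig_h0[OF u] by blast
  then obtain L where L: "has_cderiv ?X2 ?Z g2 u L" using g2 unfolding analytic_map_def by blast
  have "L v k = zd k u v" if v: "rtrig N v" for v k
  proof -
    have vc: "v \<in> carr (h0C s)" for s using v supported_h0C[of N v s] by (simp add: rtrig_def)
    have "u + smul ?X2 (of_real t) v \<in> h0 s" for t s
      using rtrig_h0[OF rtrig_add[OF u v, of t]] by (simp add: h0C_simps plus_fun_def)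
    then have e: "g2 (u + smul ?X2 (of_real t) v) = \<Phi> (u + smul ?X2 (of_real t) v)" for t using g2e by blast
    have "has_cderiv ?X2 Cspace (\<lambda>x. g2 x k) (u + smul ?X2 (of_real 0) v) (\<lambda>v. L v k)"
      using analytic_compose_functional(2)[OF g2 coord_bounded_clin cnorm_h0C cnorm_h0C uV L] by (simp add: h0C_simps plus_fun_def)
    from has_vector_derivative_real_field[OF cnorm.has_cderiv_line[OF cnorm_h0C this vc]]
    have 1: "((\<lambda>t. \<Phi> (u + smul ?X2 (of_real t) v) k) has_vector_derivative L v k) (at 0)" unfolding e .
    have "has_cderiv (h0C (-1)) Cspace (\<lambda>x. \<Phi> x k) (u + smul (h0C (-1)) (of_real 0) v) (zd k u)"
      using coord_deriv[OF rtrig_h0[OF u]] by (simp add: cnorm.smul_0_left[OF cnorm_h0C])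
    from has_vector_derivative_real_field[OF cnorm.has_cderiv_line[OF cnorm_h0C this vc]]
    show ?thesis using vector_derivative_unique_at[OF 1] by (simp add: h0C_simps)
  qed
  then show thesis using that[of g2 L] g2e L by blast
qed

text \<open>Two computations of the same derivative of H2 along u + t v: one from its Fourier
  expansion, the other by the chain rule through the actions, where H2 equals \<open>G\<close> plus
  the terms removed by the renormalisation.\<close>

lemma dH2_trig:
  assumes u: "rtrig N u" and v: "rtrig N v"
  shows "(\<Sum>k\<in>sym_int N. grH2 N u (- k) * v k) = (\<Sum>\<^sub>\<infinity>n. freq u n * act_diff (\<Phi> u) (\<lambda>k. zd k u v) n)"
proof -
  let ?X2 = "h0C 2" and ?Z = "h0C (5/2)"
  interpret X2: cnorm ?X2 by (rule cnorm_h0C)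
  note uh = rtrig_h0[OF u]
  define z where "z = \<Phi> u"
  have z: "z \<in> h0 (5/2)" using Phi_mem[of 2 u] uh by (simp add: z_def)
  then have zc: "z \<in> carr ?Z" by (simp add: h0_def)
  have vc: "v \<in> carr (h0C s)" for s using v supported_h0C[of N v s] by (simp add: rtrig_def)
  obtain g2 L2 where g2e: "\<And>x. x \<in> h0 2 \<Longrightarrow> g2 x = \<Phi> x" and L2: "has_cderiv ?X2 ?Z g2 u L2" and wk': "\<And>v k. rtrig N v \<Longrightarrow> L2 v k = zd k u v"
    by (rule Phi_smooth_deriv[OF u]) (rule that)
  have gu: "g2 u = z" using g2e uh by (simp add: z_def)
  define I where "I = actions z"
  have I: "I \<in> lplus 5 1" unfolding I_def by (rule actions_lplus[OF z])
  have IV: "I \<in> V" using lplus_V lplus_51_h1[OF I] by blast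
  define w where "w = L2 v"
  have w: "w \<in> carr ?Z" using L2 vc unfolding w_def has_cderiv_def bounded_clin_def by blast
  have line: "(\<lambda>k. u k + of_real t * v k) = u + smul ?X2 (of_real t) v" for t
    by (auto simp: h0C_simps fun_eq_iff)
  have lineh: "u + smul ?X2 (of_real t) v \<in> h0 s" for t s
    using rtrig_h0[OF rtrig_add[OF u v, of t]] unfolding line .
  have wk: "w k = zd k u v" for k using wk'[OF v] by (simp add: w_def)
  define \<Psi> where "\<Psi> = (\<lambda>z. G (actions z) + (S5 (actions z) + 10 * (H0_act (actions z))^2))"
  have d1: "has_cderiv ?Z Cspace (\<lambda>z. G (actions z)) z (\<lambda>w. dpair (g I) (act_diff z w))"
    by (rule has_cderiv_chain[OF cnorm_h0C cnorm_lC cnorm_Cspace has_cderiv_actions[OF zc]])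
      (use G_gradient[OF IV] in \<open>simp add: I_def\<close>)
  have d2: "has_cderiv ?Z Cspace (\<lambda>z. S5 (actions z)) z (\<lambda>w. S5 (act_diff z w))"
    unfolding S5_def by (rule has_cderiv_weighted_actions[OF zc kn_bound(1)]) simp
  have d3: "has_cderiv ?Z Cspace (\<lambda>z. H0_act (actions z)) z (\<lambda>w. H0_act (act_diff z w))"
    unfolding H0_act_kn by (rule has_cderiv_weighted_actions[OF zc kn_bound(2)]) simp
  have "((\<lambda>y. 10 * y^2) has_field_derivative 20 * H0_act (actions z)) (at (H0_act (actions z)))"
    by (auto intro!: derivative_eq_intros)
  then have d4: "has_cderiv ?Z Cspace (\<lambda>z. 10 * (H0_act (actions z))^2) z
      (\<lambda>w. 20 * H0_act (actions z) * H0_act (act_diff z w))"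
    unfolding has_cderiv_Cspace_iff[symmetric] by (rule has_cderiv_chain[OF cnorm_h0C cnorm_Cspace cnorm_Cspace d3])
  have d5: "has_cderiv ?Z Cspace \<Psi> (g2 u)
      (\<lambda>w. dpair (g I) (act_diff z w) + (S5 (act_diff z w) + 20 * H0_act I * H0_act (act_diff z w)))"
    unfolding gu using has_cderiv_add[OF cnorm_h0C cnorm_Cspace d1 has_cderiv_add[OF cnorm_h0C cnorm_Cspace d2 d4]] by (simp add: \<Psi>_def I_def)
  have d6: "has_cderiv ?X2 Cspace (\<lambda>x. \<Psi> (g2 x)) u
      (\<lambda>v. dpair (g I) (act_diff z (L2 v)) + (S5 (act_diff z (L2 v)) + 20 * H0_act I * H0_act (act_diff z (L2 v))))"
    by (rule has_cderiv_chain[OF cnorm_h0C cnorm_h0C cnorm_Cspace L2]) (rule d5)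
  have "u + smul ?X2 (of_real 0) v = u" by simp
  with d6 have "has_cderiv ?X2 Cspace (\<lambda>x. \<Psi> (g2 x)) (u + smul ?X2 (of_real 0) v)
      (\<lambda>v. dpair (g I) (act_diff z (L2 v)) + (S5 (act_diff z (L2 v)) + 20 * H0_act I * H0_act (act_diff z (L2 v))))"
    by (simp only:)
  from has_vector_derivative_real_field[OF X2.has_cderiv_line[OF this vc]]
  have v1: "((\<lambda>t. \<Psi> (g2 (u + smul ?X2 (of_real t) v))) has_vector_derivative
      dpair (g I) (act_diff z w) + (S5 (act_diff z w) + 20 * H0_act I * H0_act (act_diff z w))) (at 0)"
    by (simp add: w_def)
  have "H2 (\<lambda>k. u k + of_real t * v k) = \<Psi> (g2 (u + smul ?X2 (of_real t) v))" for t
    unfolding line using H2_decomposition[OF lineh] g2e[OF lineh] by (simp add: \<Psi>_def)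
  then have v2: "((\<lambda>t. \<Psi> (g2 (u + smul ?X2 (of_real t) v))) has_vector_derivative
      (\<Sum>k\<in>sym_int N. grH2 N u (- k) * v k)) (at 0)"
    using H2_derivative[of N u v] u v by (simp add: rtrig_def)
  have eq: "(\<Sum>k\<in>sym_int N. grH2 N u (- k) * v k)
      = dpair (g I) (act_diff z w) + (S5 (act_diff z w) + 20 * H0_act I * H0_act (act_diff z w))"
    by (rule vector_derivative_unique_at[OF v2 v1])
  have AD: "act_diff z w \<in> carr X1" using l51_subset_h1[OF act_diff_l51(1)[OF zc w]] .
  have s1: "(\<lambda>n. g I n * act_diff z w n) summable_on UNIV"
    using dpair_bound(1)[of "g I" 1 "act_diff z w"] AD g_carr IV V_subset_V0 by auto
  have st: "(5/2::real) + 5/2 = 5" by simp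
  note s2 = act_diff_bounded(2)[OF zc kn_bound(1) _ st w] and s3 = act_diff_bounded(2)[OF zc kn_bound(2) _ st w]
  have s3': "(\<lambda>n. 20 * H0_act I * (of_real (kn n) * act_diff z w n)) summable_on UNIV"
    by (rule summable_on_cmult_right[OF s3]) simp
  have "(\<Sum>\<^sub>\<infinity>n. freq u n * act_diff z w n) = (\<Sum>\<^sub>\<infinity>n. g I n * act_diff z w n
      + (of_real (kn n ^ 5) * act_diff z w n + 20 * H0_act I * (of_real (kn n) * act_diff z w n)))"
  proof (rule infsum_cong)
    fix n
    have "freq u n = g I n + of_real (kn n ^ 5) + 20 * H0_act I * of_real (kn n)"
      using H0_act_Phi[OF uh] g_eq[OF lplus_51_h1[OF I]] by (simp add: freq_def I_def z_def)
    then show "freq u n * act_diff z w n = g I n * act_diff z w n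
      + (of_real (kn n ^ 5) * act_diff z w n + 20 * H0_act I * (of_real (kn n) * act_diff z w n))"
      by (simp only: distrib_right mult.assoc add.assoc)
  qed
  also have "\<dots> = dpair (g I) (act_diff z w) + (S5 (act_diff z w) + 20 * H0_act I * H0_act (act_diff z w))"
    unfolding dpair_def S5_def H0_act_kn[of "act_diff z w"] infsum_cmult_right'[symmetric]
    by (subst infsum_add, rule s1, rule summable_on_add[OF s2 s3'], simp, subst infsum_add[OF s2 s3'], simp_all)
  finally show ?thesis unfolding eq z_def[symmetric] wk[symmetric] by (simp add: eta_contract_eq)
qed

end

lemma pairing_bounded_clin:
  assumes b: "wl2 (wi (- s)) b"
  shows "bounded_clin (h0C s) Cspace (\<lambda>v. \<Sum>\<^sub>\<infinity>k. b k * v k)"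
proof -
  have pr: "(\<lambda>k. b k * v k) summable_on UNIV" "norm (\<Sum>\<^sub>\<infinity>k. b k * v k) \<le> wn (wi (- s)) b * nrm (h0C s) v"
    if "v \<in> carr (h0C s)" for v
    using wl2_pair(3,4)[OF b, of "wi s" v 1 "\<lambda>_. 1"] that by (auto simp: h0C_simps wi_mult)
  show ?thesis
  proof (rule bounded_clinI)
    show "(\<Sum>\<^sub>\<infinity>k. b k * (x + y) k) = (\<Sum>\<^sub>\<infinity>k. b k * x k) + (\<Sum>\<^sub>\<infinity>k. b k * y k)"
      if "x \<in> carr (h0C s)" "y \<in> carr (h0C s)" for x y
      using pr(1)[OF that(1)] pr(1)[OF that(2)] by (simp add: distrib_left infsum_add)
  qed (use pr(2) in \<open>simp_all add: h0C_simps mult.left_commute infsum_cmult_right'\<close>)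
qed

lemma rtrig_pair:
  assumes "k \<noteq> 0" "\<bar>k\<bar> \<le> int N"
  shows "rtrig N (unitv k + unitv (- k))" "rtrig N (\<lambda>j. - \<i> * (unitv k j - unitv (- k) j))"
  using assms by (auto simp: rtrig_def supported_def unitv_def)

context kdv2
begin

text \<open>The Hamiltonian vector field of H2, that is d/dx of its gradient, in Fourier
  coefficients. For u supported in degree N the sums behind \<open>grH2 N\<close> are complete
  convolutions, and the field is supported in degree 3 N.\<close>

definition energy_flow :: "nat \<Rightarrow> (int \<Rightarrow> complex) \<Rightarrow> int \<Rightarrow> complex" where
  "energy_flow N u k = kap k * grH2 N u k"

lemma energy_flow_carr: "supported N u \<Longrightarrow> energy_flow N u \<in> carr (h0C s)"
proof (rule finite_support_h0C)
  assume u: "supported N u"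
  have "{k. energy_flow N u k \<noteq> 0} \<subseteq> sym_int (3 * N)"
    using grH2_support[OF u] by (force simp: energy_flow_def)
  then show "finite {k. energy_flow N u k \<noteq> 0}" by (rule finite_subset) simp
qed (simp add: energy_flow_def)

text \<open>The direction of interest, d/dx of the gradient of a coordinate, is no trigonometric
  polynomial. Both sides are bounded functionals on h^-1, and they agree on unit vectors because
  these are complex combinations of the real pairs in \<open>rtrig_pair\<close>.\<close>

lemma dH2_pairing:
  assumes u: "rtrig N u" and v: "v \<in> carr (h0C (-1))"
  shows "(\<Sum>\<^sub>\<infinity>k. grH2 N u (- k) * v k) = (\<Sum>\<^sub>\<infinity>n. freq u n * act_diff (\<Phi> u) (\<lambda>k. zd k u v) n)"
proof -
  let ?X = "h0C (-1)"
  have us: "supported N u" using u by (simp add: rtrig_def)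
  define A where "A = (\<lambda>v. \<Sum>\<^sub>\<infinity>k. grH2 N u (- k) * v k)"
  define R where "R = (\<lambda>v. \<Sum>\<^sub>\<infinity>n. freq u n * act_diff (\<Phi> u) (\<lambda>k. zd k u v) n)"
  have "{k. grH2 N u (- k) \<noteq> 0} \<subseteq> sym_int (3 * N)" using grH2_support[OF us] by force
  then have "finite {k. grH2 N u (- k) \<noteq> 0}" by (rule finite_subset) simp
  then have bA: "bounded_clin ?X Cspace A"
    unfolding A_def by (intro pairing_bounded_clin wl2_finite_support)
  obtain C where C: "C \<ge> 0" "\<And>n. norm (freq u n) \<le> C * (1 + real n) ^ 5" using freq_bound[OF rtrig_h0[OF u]] by blast
  obtain L where L: "bounded_clin ?X (h0C (-1/2)) L" "\<And>v n. v \<in> carr ?X \<Longrightarrow> zd n u v = L v n"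
    using Phi_deriv[OF rtrig_h0[OF u]] by blast
  \<comment> \<open>A trigonometric polynomial is smooth, so its coordinates are as regular as
    desired; 11/2 is the exponent that complements -1/2 for weights of order n^5.\<close>
  have z: "\<Phi> u \<in> carr (h0C (11/2))" using Phi_mem[of 5 u] rtrig_h0[OF u] by (simp add: h0_def)
  have "bounded_clin (h0C (-1/2)) Cspace (\<lambda>w. \<Sum>\<^sub>\<infinity>n. freq u n * act_diff (\<Phi> u) w n)"
    by (rule act_diff_bounded(1)[OF z C(2) C(1)]) simp
  from bounded_clin_compose[OF cnorm_h0C cnorm_h0C L(1) this]
  have bR0: "bounded_clin ?X Cspace (\<lambda>v. \<Sum>\<^sub>\<infinity>n. freq u n * act_diff (\<Phi> u) (L v) n)" .
  have eqR: "R v = (\<Sum>\<^sub>\<infinity>n. freq u n * act_diff (\<Phi> u) (L v) n)" if "v \<in> carr ?X" for v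
    unfolding R_def using L(2)[OF that] by (simp add: eta_contract_eq)
  have bD: "bounded_clin ?X Cspace (\<lambda>v. A v - (\<Sum>\<^sub>\<infinity>n. freq u n * act_diff (\<Phi> u) (L v) n))" (is "bounded_clin _ _ ?D")
    by (rule bounded_clin_diff[OF cnorm_h0C bA bR0])
  have Dr: "?D r = 0" if r: "rtrig N' r" and N': "N \<le> N'" for r N'
  proof -
    have rs: "supported N' r" using r by (simp add: rtrig_def)
    have "A r = (\<Sum>\<^sub>\<infinity>k\<in>sym_int N'. grH2 N u (- k) * r k)"
      unfolding A_def by (rule infsum_cong_neutral) (use rs in \<open>auto simp: supported_def\<close>)
    also have "\<dots> = (\<Sum>k\<in>sym_int N'. grH2 N' u (- k) * r k)" by (simp add: grH2_mono[OF us N'])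
    also have "\<dots> = R r" unfolding R_def by (rule dH2_trig[OF rtrig_mono[OF u N'] r])
    finally show ?thesis using eqR[OF supported_h0C[OF rs]] by simp
  qed
  have z: "?D (unitv k) = 0" if k: "k \<noteq> 0" for k
  proof -
    define N' where "N' = max N (nat \<bar>k\<bar>)"
    have kN: "\<bar>k\<bar> \<le> int N'" "N \<le> N'" by (auto simp: N'_def)
    define r1 where "r1 = unitv k + unitv (- k)"
    define r2 where "r2 = (\<lambda>j. - \<i> * (unitv k j - unitv (- k) j))"
    note r = rtrig_pair[OF k kN(1), folded r1_def r2_def]
    have rc: "r1 \<in> carr ?X" "r2 \<in> carr ?X" using r supported_h0C by (auto simp: rtrig_def)
    have e: "unitv k = smul ?X (1/2) r1 + smul ?X (\<i>/2) r2"
      by (auto simp: r1_def r2_def h0C_simps fun_eq_iff field_simps)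
    have rc': "smul ?X (1/2) r1 \<in> carr ?X" "smul ?X (\<i>/2) r2 \<in> carr ?X"
      using rc cnorm.carr_smul[OF cnorm_h0C] by blast+
    have "?D (smul ?X (1/2) r1 + smul ?X (\<i>/2) r2) = ?D (smul ?X (1/2) r1) + ?D (smul ?X (\<i>/2) r2)"
      using bounded_clinD(3)[OF bD] rc' by blast
    also have "?D (smul ?X (1/2) r1) = smul Cspace (1/2) (?D r1)" by (rule bounded_clinD(2)[OF bD rc(1)])
    also have "?D (smul ?X (\<i>/2) r2) = smul Cspace (\<i>/2) (?D r2)" by (rule bounded_clinD(2)[OF bD rc(2)])
    finally show ?thesis unfolding e[symmetric] using Dr[OF r(1) kN(2)] Dr[OF r(2) kN(2)] by simp
  qed
  have "((\<lambda>k. v k * (if k = 0 then 0 else ?D (unitv k))) has_sum 0) UNIV" by (rule has_sum_0) (use z in auto)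
  from has_sum_unique[OF bounded_clin_has_sum_h0C[OF bD v] this] have "?D v = 0" .
  then show ?thesis using eqR[OF v] by (simp add: A_def R_def)
qed

lemma bracket_coords:
  assumes "u \<in> W" "n \<noteq> 0" "m \<noteq> 0"
  shows "gardner_bracket (\<lambda>v. \<Phi> v n) (\<lambda>v. \<Phi> v m) u = (if m = - n then of_int (sgn n) * \<i> else 0)"
proof -
  have "\<forall>u\<in>W. \<forall>n m. n \<noteq> 0 \<longrightarrow> m \<noteq> 0 \<longrightarrow>
        gardner_bracket (\<lambda>v. \<Phi> v n) (\<lambda>v. \<Phi> v m) u = (if m = - n then of_int (sgn n) * \<i> else 0)"
    using birkhoff by (simp add: birkhoff_map_def)
  then show ?thesis using assms by blast
qed

text \<open>Hamilton's equation for the n-th coordinate. The differential of H2 is evaluated on the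
  Hamiltonian vector field of that coordinate, where the canonical brackets leave the single summand
  m = n. Antisymmetry of d/dx exchanges the two roles.\<close>

lemma evolution:
  assumes u: "rtrig N u" and n: "n > 0"
  shows "zd (int n) u (energy_flow N u) = \<i> * freq u n * \<Phi> u (int n)"
proof -
  let ?X = "h0C (-1)"
  have us: "supported N u" using u by (simp add: rtrig_def)
  have uh: "u \<in> h0 (-1)" by (rule rtrig_h0[OF u])
  have uW: "u \<in> W" using uh h0_W by blast
  define \<gamma> where "\<gamma> = gradient (\<lambda>v. \<Phi> v (int n)) u"
  note gr = gradient_props[OF coord_deriv[OF uh, of "int n"], folded \<gamma>_def]
  have "dx \<gamma> \<in> carr (h0C 0)" using dx_carr[of \<gamma> 0] gr(1) by simp
  then have w: "dx \<gamma> \<in> carr ?X" by (rule h0C_mono(1)[rotated]) simp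
  have z0: "\<Phi> u 0 = 0" using Phi_mem[of 0 u] rtrig_h0[OF u] by (simp add: h0_def h0C_simps)
  have zb: "zd m u (dx \<gamma>) = (if int n = - m then of_int (sgn m) * \<i> else 0)" if "m \<noteq> 0" for m
    using gardner_bracket_eq[OF coord_deriv[OF uh, of m] coord_deriv[OF uh, of "int n"]]
      bracket_coords[OF uW that, of "int n"] n by (simp add: \<gamma>_def)
  have "(\<Sum>\<^sub>\<infinity>k. grH2 N u (- k) * dx \<gamma> k) = (\<Sum>\<^sub>\<infinity>m. freq u m * act_diff (\<Phi> u) (\<lambda>k. zd k u (dx \<gamma>)) m)"
    by (rule dH2_pairing[OF u w])
  also have "\<dots> = (\<Sum>\<^sub>\<infinity>m\<in>{n}. freq u m * act_diff (\<Phi> u) (\<lambda>k. zd k u (dx \<gamma>)) m)"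
  proof (rule infsum_cong_neutral)
    fix m assume m: "m \<in> UNIV - {n}"
    show "freq u m * act_diff (\<Phi> u) (\<lambda>k. zd k u (dx \<gamma>)) m = 0"
      using m zb[of "int m"] zb[of "- int m"] z0 by (cases "m = 0") (auto simp: act_diff_def)
  qed auto
  also have "\<dots> = freq u n * (\<Phi> u (int n) * (- \<i>))"
    using n zb[of "int n"] zb[of "- int n"] by (simp add: act_diff_def)
  finally have 1: "(\<Sum>\<^sub>\<infinity>k. grH2 N u (- k) * dx \<gamma> k) = - (\<i> * freq u n * \<Phi> u (int n))" by simp
  have "zd (int n) u (energy_flow N u) = (\<Sum>\<^sub>\<infinity>k. \<gamma> (- k) * energy_flow N u k)"
    by (rule gr(2)[OF energy_flow_carr[OF us]])
  also have "\<dots> = (\<Sum>\<^sub>\<infinity>k. \<gamma> k * energy_flow N u (- k))"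
    using infsum_flip[of "\<lambda>k. \<gamma> k * energy_flow N u (- k)"] by simp
  also have "\<dots> = (\<Sum>\<^sub>\<infinity>k. (-1) * (grH2 N u (- k) * dx \<gamma> k))"
    by (rule infsum_cong) (simp add: energy_flow_def dx_kap kap_minus)
  also have "\<dots> = (-1) * (\<Sum>\<^sub>\<infinity>k. grH2 N u (- k) * dx \<gamma> k)" by (rule infsum_cmult_right')
  finally show ?thesis unfolding 1 by simp
qed

section \<open>Expansion at the origin\<close>

abbreviation "M1 \<equiv> h0C (-1)"

sublocale M1: cnorm "h0C (-1)" by (rule cnorm_h0C)

definition lam :: "int \<Rightarrow> real" where
  "lam k = (2 * real_of_int \<bar>k\<bar> * pi) powr (-1/2)"

text \<open>The second derivative of the n-th coordinate at the origin: the quadratic part of the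
  Birkhoff map, unknown until \<open>B_unitv\<close>.\<close>

abbreviation B :: "int \<Rightarrow> (int \<Rightarrow> complex) \<Rightarrow> (int \<Rightarrow> complex) \<Rightarrow> complex" where
  "B n \<equiv> M1.cdir2 (\<lambda>v. \<Phi> v n)"

lemma zero_h0: "0 \<in> h0 s"
  using cnorm.carr_0[OF cnorm_h0C[of s]] by (simp add: h0_def)

lemma Phi_deriv_0: "has_cderiv M1 (h0C (-1/2)) \<Phi> 0 (\<lambda>u k. of_real (lam k) * u k)"
  using birkhoff by (simp add: birkhoff_map_def lam_def)

lemma zd_0:
  assumes v: "v \<in> carr M1"
  shows "zd k 0 v = of_real (lam k) * v k"
proof -
  have "0 \<in> W" using h0_W zero_h0 by blast
  from analytic_compose_functional(2)[OF Phi_analytic coord_bounded_clin cnorm_h0C cnorm_h0C this Phi_deriv_0]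
  show ?thesis using M1.cdir_eq[OF _ v] by blast
qed

lemma coord_bounded_at: "\<exists>r M. M1.bounded_at (\<lambda>v. \<Phi> v n) 0 r M"
  using M1.analytic_bounded_at[OF coord_analytic, of 0] h0_W zero_h0 by blast

lemma B_bilinear:
  assumes "u \<in> carr M1" "v \<in> carr M1" "w \<in> carr M1"
  shows "B n (u + v) w = B n u w + B n v w" "B n u (v + w) = B n u v + B n u w"
    "B n (smul M1 c u) v = c * B n u v" "B n u (smul M1 c v) = c * B n u v" "B n u v = B n v u"
proof -
  obtain r M where b: "M1.bounded_at (\<lambda>v. \<Phi> v n) 0 r M" using coord_bounded_at by blast
  show "B n (u + v) w = B n u w + B n v w" by (rule M1.cdir2_add_left[OF b assms])
  show "B n u (v + w) = B n u v + B n u w" by (rule M1.cdir2_add_right[OF b assms])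
  show "B n (smul M1 c u) v = c * B n u v" by (rule M1.cdir2_smul_left[OF b assms(1,2)])
  show "B n u (smul M1 c v) = c * B n u v" by (rule M1.cdir2_smul_right[OF b assms(1,2)])
  show "B n u v = B n v u" by (rule M1.cdir2_commute[OF b assms(1,2)])
qed

lemma zd_expansion:
  "\<exists>r>0. \<exists>C>0. \<forall>u\<in>carr M1. \<forall>v\<in>carr M1. nrm M1 u \<le> r \<longrightarrow>
    norm (zd n u v - of_real (lam n) * v n - B n u v) \<le> C * (nrm M1 u)\<^sup>2 * (nrm M1 v + 1)"
proof -
  obtain r M where b: "M1.bounded_at (\<lambda>v. \<Phi> v n) 0 r M" using coord_bounded_at by blast
  have "r / 4 > 0" using b by (simp add: M1.bounded_at_def)
  moreover obtain C where "C > 0" "\<forall>u\<in>carr M1. \<forall>v\<in>carr M1. nrm M1 u \<le> r / 4 \<longrightarrow>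
    norm (zd n u v - zd n 0 v - B n u v) \<le> C * (nrm M1 u)\<^sup>2 * (nrm M1 v + 1)"
    using M1.cdir_expansion[OF b] by blast
  ultimately show ?thesis using zd_0 by (intro exI[of _ "r/4"] conjI exI[of _ C]) simp_all
qed

lemma coord_expansion:
  "\<exists>r>0. \<exists>C>0. \<forall>u\<in>carr M1. \<forall>s. norm s * nrm M1 u \<le> r \<longrightarrow>
    norm (\<Phi> (smul M1 s u) n - s * (of_real (lam n) * u n) - s\<^sup>2 * B n u u / 2) \<le> C * (norm s * (nrm M1 u + 1)) ^ 3"
proof -
  obtain r M where b: "M1.bounded_at (\<lambda>v. \<Phi> v n) 0 r M" using coord_bounded_at by blast
  have "r / 4 > 0" using b by (simp add: M1.bounded_at_def)
  moreover obtain C where "C > 0" "\<forall>u\<in>carr M1. \<forall>s. norm s * nrm M1 u \<le> r / 4 \<longrightarrow>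
    norm (\<Phi> (smul M1 s u) n - \<Phi> 0 n - s * zd n 0 u - s\<^sup>2 * B n u u / 2) \<le> C * (norm s * (nrm M1 u + 1)) ^ 3"
    using M1.value_expansion[OF b] by blast
  ultimately show ?thesis using zd_0 Phi_0 by (intro exI[of _ "r/4"] conjI exI[of _ C]) simp_all
qed

text \<open>Row n of the second differential of H2_star at the origin, once \<open>g\<close> is
  known to be the gradient. Computing its entries is the goal up to \<open>a0_unitv\<close>.\<close>

definition a0 :: "nat \<Rightarrow> (nat \<Rightarrow> complex) \<Rightarrow> complex" where
  "a0 n = X1.cdir (\<lambda>x. g x n) 0"

lemma zero_V0: "0 \<in> V0"
proof -
  have "0 \<in> lplus 1 2" by (simp add: lplus_def lreal_def)
  then show ?thesis using V0 by blast
qed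

lemma a0_deriv: "has_cderiv X1 Cspace (\<lambda>x. g x n) 0 (a0 n)"
  unfolding a0_def by (rule X1.analytic_has_cderiv[OF coord_g_analytic zero_V0])

lemma a0_bounded: "bounded_clin X1 Cspace (a0 n)"
  using a0_deriv by (simp add: has_cderiv_def)

text \<open>The actions of u computed with the differential of the Birkhoff map at 0 in place of the
  map itself.\<close>

definition lin_act :: "(int \<Rightarrow> complex) \<Rightarrow> nat \<Rightarrow> complex" where
  "lin_act u m = of_real ((lam (int m))\<^sup>2) * actions u m"

text \<open>The actions of \<open>\<Phi> u\<close> differ from \<open>lin_act u\<close> by o(|u|^2)
  in h^1: the linearisation error of the map from h^2 to h^(5/2) is o(|u|), and it enters multiplied
  by a factor O(|u|). Differentiability of g at 0 does the rest.\<close>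

lemma rho_expansion:
  assumes e: "e > 0"
  shows "\<exists>d>0. \<forall>u. rtrig N u \<longrightarrow> nrm (h0C 2) u < d \<longrightarrow>
    norm (\<omega> (actions (\<Phi> u)) n - g 0 n - a0 n (lin_act u)) \<le> e * (nrm (h0C 2) u)\<^sup>2"
proof -
  let ?X2 = "h0C 2" and ?Z = "h0C (5/2)"
  interpret X2: cnorm ?X2 by (rule cnorm_h0C)
  interpret Z: cnorm ?Z by (rule cnorm_h0C)
  have "rtrig N 0" by (simp add: rtrig_def supported_def)
  then obtain g2 L2 where g2e: "\<And>x. x \<in> h0 2 \<Longrightarrow> g2 x = \<Phi> x" and L2: "has_cderiv ?X2 ?Z g2 0 L2" and Lz: "\<And>v k. rtrig N v \<Longrightarrow> L2 v k = zd k 0 v"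
    by (rule Phi_smooth_deriv) (rule that)
  note bL2 = has_cderiv_clin[OF L2]
  have L2k: "L2 v k = of_real (lam k) * v k" if v: "rtrig N v" for v k
    using zd_0[of v k] supported_h0C[of N v "-1"] v unfolding Lz[OF v] rtrig_def by blast
  obtain K where K: "K > 0" and KL: "\<And>v. v \<in> carr ?X2 \<Longrightarrow> nrm ?Z (L2 v) \<le> K * nrm ?X2 v"
    by (rule bounded_clin_bound[OF cnorm_h0C bL2]) (rule that)
  obtain A where A: "A > 0" and Aa': "\<And>x. x \<in> carr X1 \<Longrightarrow> nrm Cspace (a0 n x) \<le> A * nrm X1 x"
    by (rule bounded_clin_bound[OF cnorm_lC a0_bounded]) (rule that)
  have Aa: "norm (a0 n x) \<le> A * nrm X1 x" if "x \<in> carr X1" for x using Aa'[OF that] by simp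
  define e1 where "e1 = min 1 (e / (2 * A * (2 * K + 1)))"
  have pos: "A * (2 * K + 1) > 0" using A K by simp
  have e1: "e1 > 0" "e1 \<le> 1" "e1 * (A * (2 * K + 1)) \<le> e / 2"
  proof -
    show "e1 > 0" "e1 \<le> 1" using e pos by (auto simp: e1_def)
    have h: "e / (2 * y) * y = e / 2" if "y > 0" for y :: real using that by (simp add: field_simps)
    have "e1 * (A * (2 * K + 1)) \<le> e / (2 * (A * (2 * K + 1))) * (A * (2 * K + 1))"
      using pos by (intro mult_right_mono) (auto simp: e1_def mult.assoc)
    also have "\<dots> = e / 2" by (rule h[OF pos])
    finally show "e1 * (A * (2 * K + 1)) \<le> e / 2" .
  qed
  obtain d1 where d1: "d1 > 0" "\<And>v. v \<in> carr ?X2 \<Longrightarrow> nrm ?X2 v < d1 \<Longrightarrow> rmd g2 0 L2 v \<in> carr ?Z"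
    "\<And>v. v \<in> carr ?X2 \<Longrightarrow> nrm ?X2 v < d1 \<Longrightarrow> nrm ?Z (rmd g2 0 L2 v) \<le> e1 * nrm ?X2 v" by (rule has_cderivE[OF L2 e1(1)]) (rule that)
  define e2 where "e2 = e / (2 * (K + 1)\<^sup>2)"
  have e2: "e2 > 0" using e K by (simp add: e2_def)
  obtain d2 where d2: "d2 > 0" "\<And>x. x \<in> carr X1 \<Longrightarrow> nrm X1 x < d2 \<Longrightarrow> nrm Cspace (rmd (\<lambda>x. g x n) 0 (a0 n) x) \<le> e2 * nrm X1 x"
    by (rule has_cderivE[OF a0_deriv e2]) (rule that)
  define d where "d = min d1 (min 1 (d2 / (K + 1)\<^sup>2))"
  have d: "d > 0" using d1 d2 K by (simp add: d_def)
  have "norm (\<omega> (actions (\<Phi> u)) n - g 0 n - a0 n (lin_act u)) \<le> e * (nrm ?X2 u)\<^sup>2"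
    if u: "rtrig N u" "nrm ?X2 u < d" for u
  proof -
    define U where "U = nrm ?X2 u"
    have U: "0 \<le> U" "U < d1" "U < 1" "U < d2 / (K + 1)\<^sup>2" using u(2) by (auto simp: U_def d_def)
    have uc: "u \<in> carr ?X2" using u(1) supported_h0C[of N u 2] by (simp add: rtrig_def)
    note uh = rtrig_h0[OF u(1)]
    define R where "R = \<Phi> u - L2 u"
    have "g2 0 = 0" using g2e[OF zero_h0] Phi_0 by simp
    then have R: "R \<in> carr ?Z" "nrm ?Z R \<le> e1 * U"
      using d1(2,3)[OF uc] U(2) g2e[OF uh] by (auto simp: R_def U_def rmd_def)
    have Lc: "L2 u \<in> carr ?Z" using bL2 uc unfolding bounded_clin_def by blast
    have Ln: "nrm ?Z (L2 u) \<le> K * U" using KL[OF uc] by (simp add: U_def)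
    have P: "\<Phi> u = L2 u + R" by (simp add: R_def)
    define x where "x = actions (\<Phi> u)"
    have xl: "x \<in> lplus 5 1" unfolding x_def by (rule actions_Phi[OF uh])
    then have xc: "x \<in> carr X1" using lplus_carr lplus_51_h1 by blast
    have Pn: "nrm ?Z (\<Phi> u) \<le> (K + 1) * U"
    proof -
      have "e1 * U \<le> 1 * U" using e1 U by (intro mult_right_mono) auto
      then show ?thesis unfolding P using Z.nrm_triangle[OF Lc R(1)] Ln R(2) by (simp add: distrib_right)
    qed
    have "nrm X1 x \<le> (nrm ?Z (\<Phi> u))\<^sup>2"
      unfolding x_def P using actions_l51(2)[OF Z.carr_add[OF Lc R(1)]] .
    also have "\<dots> \<le> ((K + 1) * U)\<^sup>2" using Pn by (intro power_mono) auto
    finally have xn: "nrm X1 x \<le> (K + 1)\<^sup>2 * U\<^sup>2" by (simp add: power_mult_distrib)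
    also have "\<dots> \<le> (K + 1)\<^sup>2 * U"
    proof -
      have "U\<^sup>2 \<le> U" using U mult_left_le[of U U] by (simp add: power2_eq_square)
      then show ?thesis by (intro mult_left_mono) auto
    qed
    also have "\<dots> < (K + 1)\<^sup>2 * (d2 / (K + 1)\<^sup>2)" using U(4) K by (intro mult_strict_left_mono) auto
    also have "\<dots> = d2" using K by simp
    finally have xd: "nrm X1 x < d2" .
    have la: "actions (L2 u) = lin_act u"
      by (auto simp: actions_def lin_act_def L2k[OF u(1)] fun_eq_iff lam_def power2_eq_square)
    have xe: "x - lin_act u = act_diff (L2 u) R + actions R"
      using actions_expand[of "L2 u" R] unfolding x_def P la[symmetric] by (simp add: algebra_simps)
    have dc: "act_diff (L2 u) R \<in> carr X1" "actions R \<in> carr X1"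
      using l51_subset_h1 act_diff_l51(1)[OF Lc R(1)] actions_l51(1)[OF R(1)] by auto
    have lc: "lin_act u \<in> carr X1" unfolding la[symmetric] using l51_subset_h1[OF actions_l51(1)[OF Lc]] .
    have xln: "nrm X1 (x - lin_act u) \<le> e1 * (2 * K + 1) * U\<^sup>2"
    proof -
      have "nrm X1 (x - lin_act u) \<le> nrm X1 (act_diff (L2 u) R) + nrm X1 (actions R)"
        unfolding xe by (rule X1.nrm_triangle[OF dc])
      also have "\<dots> \<le> 2 * nrm ?Z (L2 u) * nrm ?Z R + (nrm ?Z R)\<^sup>2"
        using act_diff_l51(2)[OF Lc R(1)] actions_l51(2)[OF R(1)] by linarith
      also have "\<dots> \<le> 2 * (K * U) * (e1 * U) + (e1 * U)\<^sup>2"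
        using Ln R(2) K U by (intro add_mono mult_mono power_mono) auto
      also have "(e1 * U)\<^sup>2 \<le> e1 * U\<^sup>2"
        using e1 mult_left_le[of e1 e1] mult_right_mono[of "e1 * e1" e1 "U\<^sup>2"] by (simp add: power_mult_distrib power2_eq_square[of e1])
      finally show ?thesis by (simp add: power2_eq_square algebra_simps)
    qed
    have "a0 n (x - lin_act u + lin_act u) = a0 n (x - lin_act u) + a0 n (lin_act u)"
      using a0_bounded xc lc X1.carr_diff[OF xc lc] unfolding bounded_clin_def by blast
    then have ax: "a0 n x = a0 n (x - lin_act u) + a0 n (lin_act u)" by simp
    have "\<omega> x n - g 0 n - a0 n (lin_act u) = (g (0 + x) n - g 0 n - a0 n x) + a0 n (x - lin_act u)"
      using g_eq[OF lplus_51_h1[OF xl]] ax by simp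
    also have "norm \<dots> \<le> e2 * nrm X1 x + A * nrm X1 (x - lin_act u)"
      using norm_triangle_mono[OF d2(2)[OF xc xd, unfolded rmd_def Cspace_simps] Aa[OF X1.carr_diff[OF xc lc]]] .
    also have "\<dots> \<le> e2 * ((K + 1)\<^sup>2 * U\<^sup>2) + A * (e1 * (2 * K + 1) * U\<^sup>2)"
      using xn xln e2 A by (intro add_mono mult_left_mono) auto
    also have "\<dots> = (e2 * (K + 1)\<^sup>2) * U\<^sup>2 + (e1 * (A * (2 * K + 1))) * U\<^sup>2" by (simp only: mult_ac)
    also have "e2 * (K + 1)\<^sup>2 = e / 2"
    proof -
      have "(K + 1)\<^sup>2 > 0" using K by simp
      moreover have "e / (2 * y) * y = e / 2" if "y > 0" for y :: real using that by simp
      ultimately show ?thesis unfolding e2_def by blast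
    qed
    also have "e / 2 * U\<^sup>2 + (e1 * (A * (2 * K + 1))) * U\<^sup>2 \<le> e / 2 * U\<^sup>2 + e / 2 * U\<^sup>2"
      using e1(3) by (intro add_left_mono mult_right_mono) auto
    also have "\<dots> = e * U\<^sup>2" by simp
    finally show ?thesis unfolding x_def U_def .
  qed
  then show ?thesis using d by blast
qed

section \<open>The linear fifth order flow\<close>

definition om :: "int \<Rightarrow> real" where "om k = (2 * pi * of_int k) ^ 5"

text \<open>The solution of the linear equation u_t = d^5 u / dx^5, the linearisation of KdV2 at 0;
  by \<open>om_kap\<close> the exponent is \<open>kap k ^ 5 * t\<close>. It preserves all norms in
  use and all actions of the Fourier coefficients.\<close>

definition flow :: "real \<Rightarrow> (int \<Rightarrow> complex) \<Rightarrow> int \<Rightarrow> complex" where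
  "flow t u k = exp (\<i> * of_real (om k * t)) * u k"

text \<open>A common period of all modes: \<open>om k * period\<close> equals 2 pi k^5. It is at
  most 1, so that one period fits into the interval of uniformity of the Landau symbols.\<close>

definition period :: real where "period = 1 / (2 * pi) ^ 4"

lemma om_kap: "\<i> * of_real (om k) = kap k ^ 5"
proof -
  have "kap k = \<i> * of_real (2 * pi * of_int k)" by (simp add: kap_def)
  then have "kap k ^ 5 = \<i> ^ 5 * of_real (2 * pi * of_int k) ^ 5" by (simp only: power_mult_distrib)
  moreover have "\<i> ^ 5 = \<i>" by (simp add: numeral_eq_Suc)
  ultimately show ?thesis by (simp add: om_def)
qed

lemma om_kn: "om (int n) = kn n ^ 5"
  by (simp add: om_def kn_def mult_ac)

lemma om_minus: "om (- k) = - om k"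
  by (simp add: om_def)

lemma norm_flow [simp]: "norm (flow t u k) = norm (u k)"
  by (simp add: flow_def norm_mult)

lemma nrm_flow: "nrm (h0C s) (flow t u) = nrm (h0C s) u"
  by (simp add: h0C_simps wn_def)

lemma rtrig_flow: "rtrig N u \<Longrightarrow> rtrig N (flow t u)"
proof -
  assume u: "rtrig N u"
  have "exp (\<i> * of_real (om (- k) * t)) = cnj (exp (\<i> * of_real (om k * t)))" for k
    by (simp add: om_minus exp_cnj)
  then show ?thesis using u by (auto simp: rtrig_def supported_def flow_def)
qed

lemma flow_period: "flow period u = u"
proof
  fix k
  have "om k * period = 2 * of_int (k ^ 5) * pi"
    by (simp add: om_def period_def power_mult_distrib eval_nat_numeral)
  then have "exp (\<i> * of_real (om k * period)) = exp ((2 * of_int (k ^ 5) * pi) * \<i>)"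
    by (simp add: mult.commute)
  also have "\<dots> = 1" by (rule exp_integer_2pi) auto
  finally show "flow period u k = u k" by (simp add: flow_def)
qed

lemma flow_0: "flow 0 u = u"
  by (simp add: flow_def fun_eq_iff)

lemma flow_scale: "flow t (\<lambda>k. c * u k) = (\<lambda>k. c * flow t u k)"
  by (simp add: flow_def fun_eq_iff)

text \<open>Only finitely many fixed modes move, so differentiability of each coefficient gives
  differentiability in norm, adding one mode at a time.\<close>

lemma has_cderiv_curve:
  assumes \<gamma>: "\<And>z. supported N (\<gamma> z)" "supported N v" and d: "\<And>k. ((\<lambda>z. \<gamma> z k) has_field_derivative v k) (at z)"
  shows "has_cderiv Cspace M1 \<gamma> z (\<lambda>w. smul M1 w v)"
proof -
  define r where "r = (\<lambda>I (u :: int \<Rightarrow> complex) k. if k \<in> I then u k else 0)"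
  have "has_cderiv Cspace M1 (\<lambda>z. r I (\<gamma> z)) z (\<lambda>w. smul M1 w (r I v))" if "finite I" "0 \<notin> I" for I
    using that
  proof (induction I rule: finite_induct)
    case empty
    have "bounded_clin Cspace M1 (\<lambda>w. smul M1 w 0)" by (rule bounded_clinI[where K = 0]) auto
    then show ?case unfolding r_def by (intro has_cderiv_affine[OF cnorm_Cspace cnorm_h0C]) (auto simp: h0C_simps zero_fun_def plus_fun_def)
  next
    case (insert i I)
    have e: "unitv i \<in> carr M1" using insert.prems by (intro unitv_h0C) auto
    have "bounded_clin Cspace M1 (\<lambda>w. smul M1 w (unitv i))"
      by (rule bounded_clinI[where K = "nrm M1 (unitv i)"]) (auto simp: e M1.smul_add_left M1.nrm_smul[OF e] mult.commute)
    from has_cderiv_chain[OF cnorm_Cspace cnorm_Cspace cnorm_h0C has_cderiv_Cspace_iff[THEN iffD2, OF d] has_cderiv_linear[OF cnorm_Cspace cnorm_h0C this]]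
    have 1: "has_cderiv Cspace M1 (\<lambda>z. smul M1 (\<gamma> z i) (unitv i)) z (\<lambda>w. smul M1 (v i * w) (unitv i))" by simp
    have 2: "has_cderiv Cspace M1 (\<lambda>z. r I (\<gamma> z)) z (\<lambda>w. smul M1 w (r I v))" using insert.IH insert.prems by simp
    have "(\<lambda>z. smul M1 (\<gamma> z i) (unitv i) + r I (\<gamma> z)) = (\<lambda>z. r (insert i I) (\<gamma> z))"
      "(\<lambda>w. smul M1 (v i * w) (unitv i) + smul M1 w (r I v)) = (\<lambda>w. smul M1 w (r (insert i I) v))"
      using insert.hyps by (auto simp: r_def h0C_simps unitv_def fun_eq_iff)
    then show ?case using has_cderiv_add[OF cnorm_Cspace cnorm_h0C 1 2] by simp
  qed
  from this[of "sym_int N - {0}"] have "has_cderiv Cspace M1 (\<lambda>z. r (sym_int N - {0}) (\<gamma> z)) z (\<lambda>w. smul M1 w (r (sym_int N - {0}) v))" by simp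
  moreover have "r (sym_int N - {0}) u = u" if "supported N u" for u using that by (auto simp: r_def supported_def fun_eq_iff)
  ultimately show ?thesis using \<gamma> by simp
qed

lemma flow_derivative:
  assumes u: "rtrig N u"
  shows "((\<lambda>t. \<Phi> (flow t u) n) has_vector_derivative zd n (flow t u) (\<lambda>k. kap k ^ 5 * flow t u k)) (at t)"
proof -
  define \<gamma> where "\<gamma> = (\<lambda>z k. exp (\<i> * of_real (om k) * z) * u k)"
  define v where "v = (\<lambda>k. kap k ^ 5 * flow t u k)"
  have g: "\<gamma> (of_real t) = flow t u" for t by (simp add: \<gamma>_def flow_def fun_eq_iff mult.assoc)
  have s: "supported N (\<gamma> z)" "supported N v" for z
    using u rtrig_flow[OF u, of t] by (auto simp: \<gamma>_def v_def rtrig_def supported_def)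
  have "((\<lambda>z. \<gamma> z k) has_field_derivative v k) (at (of_real t))" for k
    unfolding v_def g[symmetric] om_kap[symmetric] \<gamma>_def by (auto intro!: derivative_eq_intros)
  note c = has_cderiv_curve[OF s this]
  have "flow t u \<in> h0 (-1)" by (rule rtrig_h0[OF rtrig_flow[OF u]])
  note d = coord_deriv[OF this, of n]
  from has_cderiv_chain[OF cnorm_Cspace cnorm_h0C cnorm_Cspace c d[folded g]]
  have "has_cderiv Cspace Cspace (\<lambda>z. \<Phi> (\<gamma> z) n) (of_real t) (\<lambda>w. zd n (flow t u) v * w)"
    using M1.cdir_linear(2)[OF d supported_h0C[OF s(2)]] by (simp add: g mult.commute)
  from has_vector_derivative_real_field[OF this[unfolded has_cderiv_Cspace_iff]]
  show ?thesis by (simp add: g v_def)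
qed

end

section \<open>Uniform expansions along the linear flow\<close>

text \<open>Landau symbols along \<open>T\<close> are estimates as \<open>s \<rightarrow> 0+\<close> that are uniform in \<open>t \<in> [0,1]\<close>; \<open>sc k\<close> is \<open>s\<^sup>k\<close>.\<close>

abbreviation T :: "(real \<times> real) filter" where
  "T \<equiv> at_right 0 \<times>\<^sub>F principal {0..1}"

definition sc :: "nat \<Rightarrow> real \<times> real \<Rightarrow> complex" where
  "sc k p = of_real (fst p) ^ k"

lemma eventually_T: "eventually P T \<longleftrightarrow> (\<exists>d>0. \<forall>s t. 0 < s \<longrightarrow> s < d \<longrightarrow> t \<in> {0..1} \<longrightarrow> P (s, t))"
proof -
  have "eventually P T \<longleftrightarrow> eventually (\<lambda>s. \<forall>t\<in>{0..1}. P (s, t)) (at_right 0)"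
    unfolding eventually_prod_filter eventually_principal
  proof
    assume "\<exists>Pf Pg. eventually Pf (at_right 0) \<and> (\<forall>x\<in>{0..1}. Pg x) \<and> (\<forall>x y. Pf x \<longrightarrow> Pg y \<longrightarrow> P (x, y))"
    then obtain Pf where "eventually Pf (at_right 0)" "\<And>x y. Pf x \<Longrightarrow> y \<in> {0..1} \<Longrightarrow> P (x, y)" by blast
    then show "eventually (\<lambda>s. \<forall>t\<in>{0..1}. P (s, t)) (at_right 0)" by (auto elim: eventually_mono)
  next
    assume "eventually (\<lambda>s. \<forall>t\<in>{0..1}. P (s, t)) (at_right 0)"
    then show "\<exists>Pf Pg. eventually Pf (at_right 0) \<and> (\<forall>x\<in>{0..1}. Pg x) \<and> (\<forall>x y. Pf x \<longrightarrow> Pg y \<longrightarrow> P (x, y))"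
      by (intro exI[of _ "\<lambda>s. \<forall>t\<in>{0..1}. P (s, t)"] exI[of _ "\<lambda>t. t \<in> {0..1}"]) auto
  qed
  then show ?thesis unfolding eventually_at_right_field by blast
qed

lemma bigo_T:
  assumes "d > 0" "\<And>s t. 0 < s \<Longrightarrow> s < d \<Longrightarrow> t \<in> {0..1} \<Longrightarrow> norm (f (s, t)) \<le> C * s ^ k"
  shows "f \<in> O[T](sc k)"
proof (rule bigoI[of _ C])
  show "\<forall>\<^sub>F p in T. norm (f p) \<le> C * norm (sc k p)"
    unfolding eventually_T using assms by (auto intro!: exI[of _ d] simp: sc_def norm_power)
qed

lemma sc_mult: "(\<lambda>p. sc j p * sc k p) = sc (j + k)"
  by (simp add: sc_def power_add fun_eq_iff)

lemma sc_bigo: "k \<le> j \<Longrightarrow> sc j \<in> O[T](sc k)"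
  by (rule bigo_T[of 1 _ 1]) (auto simp: sc_def norm_power intro!: power_decreasing)

lemma sc_smallo: "k < j \<Longrightarrow> sc j \<in> o[T](sc k)"
proof -
  assume "k < j"
  have "sc (Suc k) \<in> o[T](sc k)"
  proof (rule landau_o.smallI)
    fix c :: real assume "c > 0"
    then show "\<forall>\<^sub>F p in T. norm (sc (Suc k) p) \<le> c * norm (sc k p)"
      unfolding eventually_T by (auto intro!: exI[of _ c] mult_right_mono simp: sc_def norm_power norm_mult)
  qed
  moreover have "sc j \<in> O[T](sc (Suc k))" using \<open>k < j\<close> by (intro sc_bigo) simp
  ultimately show ?thesis by (rule landau_o.big_small_trans[rotated])
qed

lemma bigo_sc_mult: "f \<in> O[T](sc j) \<Longrightarrow> h \<in> O[T](sc k) \<Longrightarrow> (\<lambda>p. f p * h p) \<in> O[T](sc (j + k))"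
  using landau_o.big.mult[of f T "sc j" h "sc k"] by (simp add: sc_mult)

lemma bigo_sc_0: "(\<And>s t. t \<in> {0..1} \<Longrightarrow> norm (f (s, t)) \<le> C) \<Longrightarrow> f \<in> O[T](sc 0)"
  by (rule bigo_T[of 1 _ C]) auto

lemma bigo_sc_const: "(\<lambda>_. c) \<in> O[T](sc 0)"
  by (rule bigo_sc_0[of _ "norm c"]) auto

lemma sc_coefficients:
  assumes "(\<lambda>p. a * sc 1 p + b * sc 2 p) \<in> o[T](sc 2)"
  shows "a = 0" "b = 0"
proof -
  have ev: "\<exists>d>0. \<forall>s. 0 < s \<longrightarrow> s < d \<longrightarrow> norm (a * of_real s + b * of_real s ^ 2) \<le> c * s ^ 2" if "c > 0" for c
    using landau_o.smallD[OF assms that] unfolding eventually_T by (fastforce simp: sc_def norm_power)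
  show a: "a = 0"
  proof (rule ccontr)
    assume a: "a \<noteq> 0"
    obtain d where d: "d > 0" "\<And>s. 0 < s \<Longrightarrow> s < d \<Longrightarrow> norm (a * of_real s + b * of_real s ^ 2) \<le> 1 * s ^ 2"
      using ev[of 1] by auto
    define s where "s = min (d / 2) (norm a / (2 * (1 + norm b)))"
    have n: "norm b \<ge> 0" by simp
    have s: "0 < s" "s < d" "s \<le> norm a / (2 * (1 + norm b))" using d(1) a n by (auto simp: s_def add_pos_nonneg)
    have "norm a * s = norm (a * of_real s + b * of_real s ^ 2 - b * of_real s ^ 2)" using s by (simp add: norm_mult)
    also have "\<dots> \<le> s ^ 2 + norm b * s ^ 2"
      using d(2)[OF s(1,2)] norm_triangle_ineq4[of "a * of_real s + b * of_real s ^ 2" "b * of_real s ^ 2"]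
      by (simp add: norm_mult norm_power)
    also have "\<dots> = ((1 + norm b) * s) * s" by (simp add: power2_eq_square algebra_simps)
    finally have "norm a \<le> (1 + norm b) * s" using s by simp
    moreover have "(1 + norm b) * s \<le> norm a / 2" using s(3) n by (simp add: field_simps add_pos_nonneg)
    moreover have "norm a > 0" using a by simp
    ultimately show False by linarith
  qed
  show "b = 0"
  proof (rule ccontr)
    assume b: "b \<noteq> 0"
    obtain d where d: "d > 0" "\<And>s. 0 < s \<Longrightarrow> s < d \<Longrightarrow> norm (a * of_real s + b * of_real s ^ 2) \<le> norm b / 2 * s ^ 2"
      using ev[of "norm b / 2"] b by auto
    from d(2)[of "d / 2"] d(1) have "norm b * (d / 2)\<^sup>2 \<le> norm b / 2 * (d / 2)\<^sup>2"
      by (simp add: a norm_mult norm_power)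
    then show False using b d(1) by simp
  qed
qed

section \<open>Expansion of the evolution equation in the amplitude\<close>

context kdv2
begin

abbreviation X1v :: "(int \<Rightarrow> complex) \<Rightarrow> int \<Rightarrow> complex" where
  "X1v u \<equiv> \<lambda>k. kap k ^ 5 * u k"

abbreviation X2v :: "nat \<Rightarrow> (int \<Rightarrow> complex) \<Rightarrow> (int \<Rightarrow> complex) \<Rightarrow> int \<Rightarrow> complex" where
  "X2v N u v \<equiv> \<lambda>k. kap k * gr2 N u v k"

abbreviation X3v :: "nat \<Rightarrow> (int \<Rightarrow> complex) \<Rightarrow> int \<Rightarrow> complex" where
  "X3v N u \<equiv> \<lambda>k. kap k * gr3 N u u u k"

lemma X2v_supported: "supported (2 * N) (X2v N u v)"
  using gr2_support[of N] by (auto simp: supported_def)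

lemma X3v_supported: "supported (3 * N) (X3v N u)"
  using gr3_support[of N] by (auto simp: supported_def)

lemma X1v_supported: "supported N u \<Longrightarrow> supported N (X1v u)"
  by (auto simp: supported_def)

lemma energy_flow_scale:
  "energy_flow N (smul M1 s u) = smul M1 s (X1v u) + smul M1 (s\<^sup>2) (X2v N u u) + smul M1 (s ^ 3) (X3v N u)"
proof
  fix k
  have "gr2 N (\<lambda>j. s * u j) (\<lambda>j. s * u j) k = s\<^sup>2 * gr2 N u u k"
    unfolding gr2_def sum_distrib_left by (intro sum.cong refl) (simp add: power2_eq_square)
  moreover have "gr3 N (\<lambda>j. s * u j) (\<lambda>j. s * u j) (\<lambda>j. s * u j) k = s ^ 3 * gr3 N u u u k"
    unfolding gr3_def sum_distrib_left by (intro sum.cong refl) (simp add: power3_eq_cube)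
  moreover have "c * (c ^ 4 * (s * x) + a + b) = s * (c ^ 5 * x) + c * a + c * b" for a b c x :: complex
    by (simp add: algebra_simps eval_nat_numeral)
  ultimately show "energy_flow N (smul M1 s u) k = (smul M1 s (X1v u) + smul M1 (s\<^sup>2) (X2v N u u) + smul M1 (s ^ 3) (X3v N u)) k"
    unfolding energy_flow_def grH2_def h0C_simps plus_fun_apply by (simp only: mult.left_commute)
qed

lemma nrm_le_majorant:
  assumes "supported N' v" "\<And>k. norm (u k) \<le> norm (v k)"
  shows "nrm (h0C s) u \<le> nrm (h0C s) v"
proof -
  have "wl2 (wi s) v" using supported_h0C[OF assms(1), of s] by (simp add: h0C_simps)
  from wl2_le(2)[OF this, of 1 "wi s" u] assms(2) show ?thesis
    by (simp add: h0C_simps abs_mult mult_left_mono)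
qed

text \<open>The flow changes only the phases of the coefficients, so replacing each summand by its
  modulus gives a majorant independent of t.\<close>

lemma X2v_flow_bound: "\<exists>Kb. \<forall>t. nrm M1 (X2v N (flow t u) (flow t u)) \<le> Kb"
proof -
  define m where "m = (\<lambda>k. complex_of_real (norm (kap k) * (\<Sum>i\<in>sym_int N. \<Sum>j\<in>sym_int N. if i + j = k
     then norm (-5 * ((kap i)\<^sup>2 + kap i * kap j + (kap j)\<^sup>2)) * (norm (u i) * norm (u j)) else 0)))"
  have "supported (2 * N) m"
    unfolding supported_def m_def by (auto intro!: sum.neutral)
  moreover have "norm (X2v N (flow t u) (flow t u) k) \<le> norm (m k)" for t k
  proof -
    have "norm (gr2 N (flow t u) (flow t u) k) \<le> (\<Sum>i\<in>sym_int N. \<Sum>j\<in>sym_int N. if i + j = k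
     then norm (-5 * ((kap i)\<^sup>2 + kap i * kap j + (kap j)\<^sup>2)) * (norm (u i) * norm (u j)) else 0)"
      unfolding gr2_def by (intro order_trans[OF norm_sum] sum_mono) (simp add: norm_mult)
    then show ?thesis unfolding m_def norm_mult norm_of_real by (simp add: abs_mult mult_left_mono)
  qed
  ultimately have "nrm M1 (X2v N (flow t u) (flow t u)) \<le> nrm M1 m" for t by (rule nrm_le_majorant)
  then show ?thesis by blast
qed

lemma X3v_flow_bound: "\<exists>Kb. \<forall>t. nrm M1 (X3v N (flow t u)) \<le> Kb"
proof -
  define m where "m = (\<lambda>k. complex_of_real (norm (kap k) * (\<Sum>i\<in>sym_int N. \<Sum>j\<in>sym_int N. \<Sum>l\<in>sym_int N. if i + j + l = k
     then 10 * (norm (u i) * norm (u j) * norm (u l)) else 0)))"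
  have "supported (3 * N) m"
    unfolding supported_def m_def by (auto intro!: sum.neutral)
  moreover have "norm (X3v N (flow t u) k) \<le> norm (m k)" for t k
  proof -
    have "norm (gr3 N (flow t u) (flow t u) (flow t u) k) \<le> (\<Sum>i\<in>sym_int N. \<Sum>j\<in>sym_int N. \<Sum>l\<in>sym_int N. if i + j + l = k
     then 10 * (norm (u i) * norm (u j) * norm (u l)) else 0)"
      unfolding gr3_def by (intro order_trans[OF norm_sum] sum_mono) (simp add: norm_mult)
    then show ?thesis unfolding m_def norm_mult norm_of_real by (simp add: abs_mult mult_left_mono)
  qed
  ultimately have "nrm M1 (X3v N (flow t u)) \<le> nrm M1 m" for t by (rule nrm_le_majorant)
  then show ?thesis by blast
qed

lemma zd_flow_expansion:
  assumes u: "rtrig N u" and v: "\<And>t. v t \<in> carr M1" "\<And>t. nrm M1 (v t) \<le> Kb"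
  shows "(\<lambda>(s, t). zd n (smul M1 (of_real s) (flow t u)) (v t) - of_real (lam n) * v t n - of_real s * B n (flow t u) (v t))
    \<in> O[T](sc 2)"
proof -
  obtain r C where r: "r > 0" "C > 0" "\<And>x y. x \<in> carr M1 \<Longrightarrow> y \<in> carr M1 \<Longrightarrow> nrm M1 x \<le> r \<Longrightarrow>
    norm (zd n x y - of_real (lam n) * y n - B n x y) \<le> C * (nrm M1 x)\<^sup>2 * (nrm M1 y + 1)"
    using zd_expansion[of n] by blast
  have uc: "flow t u \<in> carr M1" for t using rtrig_flow[OF u] supported_h0C unfolding rtrig_def by blast
  let ?M = "nrm M1 u"
  have M: "?M \<ge> 0" using uc[of 0] by (simp add: flow_0)
  show ?thesis
  proof (rule bigo_T[of "r / (?M + 1)" _ "C * ?M\<^sup>2 * (Kb + 1)"])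
    show "r / (?M + 1) > 0" by (rule divide_pos_pos[OF r(1) add_nonneg_pos[OF M zero_less_one]])
    fix s t :: real assume s: "0 < s" "s < r / (?M + 1)"
    have sn: "nrm M1 (smul M1 (of_real s) (flow t u)) = s * ?M" using s uc by (simp add: M1.nrm_smul nrm_flow)
    have "s * (?M + 1) < r" using s M by (simp add: pos_less_divide_eq)
    then have "s * ?M \<le> r" using s M by (simp add: distrib_left)
    then have "norm (zd n (smul M1 (of_real s) (flow t u)) (v t) - of_real (lam n) * v t n - B n (smul M1 (of_real s) (flow t u)) (v t))
        \<le> C * (s * ?M)\<^sup>2 * (nrm M1 (v t) + 1)"
      using r(3)[of "smul M1 (of_real s) (flow t u)" "v t"] sn uc v(1) by simp
    also have "\<dots> \<le> C * (s * ?M)\<^sup>2 * (Kb + 1)" using v(2) r by (intro mult_left_mono) auto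
    also have "\<dots> = C * ?M\<^sup>2 * (Kb + 1) * s ^ 2" by (simp add: power_mult_distrib)
    finally show "norm (case (s, t) of (s, t) \<Rightarrow> zd n (smul M1 (of_real s) (flow t u)) (v t) - of_real (lam n) * v t n
       - of_real s * B n (flow t u) (v t)) \<le> C * ?M\<^sup>2 * (Kb + 1) * s ^ 2"
      using B_bilinear(3)[OF uc v(1) uc] by simp
  qed
qed

lemma Phi_flow_expansion:
  assumes u: "rtrig N u"
  shows "(\<lambda>(s, t). \<Phi> (smul M1 (of_real s) (flow t u)) n - of_real s * (of_real (lam n) * flow t u n)
    - of_real s ^ 2 * B n (flow t u) (flow t u) / 2) \<in> O[T](sc 3)"
proof -
  obtain r C where r: "r > 0" "C > 0" "\<And>x s. x \<in> carr M1 \<Longrightarrow> norm s * nrm M1 x \<le> r \<Longrightarrow>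
    norm (\<Phi> (smul M1 s x) n - s * (of_real (lam n) * x n) - s\<^sup>2 * B n x x / 2) \<le> C * (norm s * (nrm M1 x + 1)) ^ 3"
    using coord_expansion[of n] by blast
  have uc: "flow t u \<in> carr M1" for t using rtrig_flow[OF u] supported_h0C unfolding rtrig_def by blast
  let ?M = "nrm M1 u"
  have M: "?M \<ge> 0" using uc[of 0] by (simp add: flow_0)
  show ?thesis
  proof (rule bigo_T[of "r / (?M + 1)" _ "C * (?M + 1) ^ 3"])
    show "r / (?M + 1) > 0" by (rule divide_pos_pos[OF r(1) add_nonneg_pos[OF M zero_less_one]])
    fix s t :: real assume s: "0 < s" "s < r / (?M + 1)"
    have "s * (?M + 1) < r" using s M by (simp add: pos_less_divide_eq)
    then have "s * ?M \<le> r" using s M by (simp add: distrib_left)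
    then show "norm (case (s, t) of (s, t) \<Rightarrow> \<Phi> (smul M1 (of_real s) (flow t u)) n - of_real s * (of_real (lam n) * flow t u n)
        - of_real s ^ 2 * B n (flow t u) (flow t u) / 2) \<le> C * (?M + 1) ^ 3 * s ^ 3"
      using r(3)[OF uc, of "of_real s" t] s by (simp add: nrm_flow power_mult_distrib mult_ac)
  qed
qed

lemma flow_actions: "actions (flow t u) = actions u"
  by (simp add: actions_def flow_def fun_eq_iff om_minus exp_minus field_simps)

text \<open>Mere Frechet differentiability gives a remainder o(s^2) here. In the evolution equation
  the frequency is multiplied by a coordinate of size O(s), so the error remains below the third
  order.\<close>

lemma freq_flow_expansion:
  assumes u: "rtrig N u"
  shows "(\<lambda>(s, t). freq (smul M1 (of_real s) (flow t u)) n - g 0 n - of_real (kn n ^ 5)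
    - of_real s ^ 2 * (a0 n (lin_act u) + 20 * H0 u * of_real (kn n))) \<in> o[T](sc 2)"
proof (rule landau_o.smallI)
  fix c :: real assume c: "c > 0"
  interpret X2: cnorm "h0C 2" by (rule cnorm_h0C)
  let ?M = "nrm (h0C 2) u"
  have us: "supported N u" using u by (simp add: rtrig_def)
  have uc: "u \<in> carr (h0C 2)" by (rule supported_h0C[OF us])
  have M: "?M \<ge> 0" using uc by simp
  have M2: "?M\<^sup>2 + 1 > 0" by (simp add: add_nonneg_pos)
  then have "c / (?M\<^sup>2 + 1) > 0" using c by simp
  from rho_expansion[OF this, of N n] obtain d where d: "d > 0" "\<And>x. rtrig N x \<Longrightarrow> nrm (h0C 2) x < d \<Longrightarrow>
    norm (\<omega> (actions (\<Phi> x)) n - g 0 n - a0 n (lin_act x)) \<le> c / (?M\<^sup>2 + 1) * (nrm (h0C 2) x)\<^sup>2" by blast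
  have lc: "lin_act u \<in> carr X1"
  proof (rule finite_support_lC)
    have "{m. lin_act u m \<noteq> 0} \<subseteq> {..N}" using us by (force simp: lin_act_def actions_def supported_def)
    then show "finite {m. lin_act u m \<noteq> 0}" by (rule finite_subset) simp
    show "lin_act u 0 = 0" using us by (simp add: lin_act_def actions_def supported_def)
  qed
  have "norm (freq (smul M1 (of_real s) (flow t u)) n - g 0 n - of_real (kn n ^ 5)
      - of_real s ^ 2 * (a0 n (lin_act u) + 20 * H0 u * of_real (kn n))) \<le> c * s ^ 2"
    if s: "0 < s" "s < d / (?M + 1)" for s t
  proof -
    define x where "x = smul M1 (of_real s) (flow t u)"
    have xf: "x = (\<lambda>k. of_real s * flow t u k)" by (simp add: x_def h0C_simps)
    have x: "rtrig N x" unfolding xf using rtrig_flow[OF u, of t] by (auto simp: rtrig_def supported_def)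
    have fs: "supported N (flow t u)" using rtrig_flow[OF u, of t] by (simp add: rtrig_def)
    have "nrm (h0C 2) x = s * ?M"
      using X2.nrm_smul[OF supported_h0C[OF fs], of "of_real s"] s by (simp add: xf h0C_simps(2) nrm_flow)
    moreover have "s * (?M + 1) < d" using s M by (simp add: pos_less_divide_eq)
    ultimately have xn: "nrm (h0C 2) x = s * ?M" "nrm (h0C 2) x < d" using s by (simp_all add: distrib_left)
    have ax: "actions x m = of_real s ^ 2 * actions u m" for m
      using flow_actions[of t u] unfolding xf by (simp add: actions_def fun_eq_iff power2_eq_square mult_ac)
    have "lin_act x = smul X1 (of_real s ^ 2) (lin_act u)" by (simp add: lin_act_def ax lC_simps fun_eq_iff mult_ac)
    moreover have "a0 n (smul X1 (of_real s ^ 2) (lin_act u)) = of_real s ^ 2 * a0 n (lin_act u)"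
      using a0_bounded lc unfolding bounded_clin_def Cspace_simps by blast
    ultimately have la: "a0 n (lin_act x) = of_real s ^ 2 * a0 n (lin_act u)" by simp
    have uu: "x k * x (- k) = of_real s ^ 2 * (u k * u (- k))" for k
      by (simp add: xf flow_def om_minus exp_minus power2_eq_square field_simps)
    have "supported N x" using x by (simp add: rtrig_def)
    then have H: "H0 x = of_real s ^ 2 * H0 u"
      unfolding H0_supported[OF us] H0_supported[OF \<open>supported N x\<close>] uu by (simp add: sum_distrib_left)
    have "freq x n - g 0 n - of_real (kn n ^ 5) - of_real s ^ 2 * (a0 n (lin_act u) + 20 * H0 u * of_real (kn n))
      = \<omega> (actions (\<Phi> x)) n - g 0 n - a0 n (lin_act x)"
      unfolding freq_def la H by (simp add: algebra_simps)
    also have "norm \<dots> \<le> c / (?M\<^sup>2 + 1) * (s * ?M)\<^sup>2" using d(2)[OF x xn(2)] xn(1) by simp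
    also have "\<dots> = (c / (?M\<^sup>2 + 1) * ?M\<^sup>2) * s ^ 2" by (simp add: power_mult_distrib)
    also have "\<dots> \<le> c * s ^ 2"
      using M2 c by (intro mult_right_mono) (auto simp: pos_divide_le_eq)
    finally show ?thesis by (simp add: x_def)
  qed
  then show "\<forall>\<^sub>F p in T. norm (case p of (s, t) \<Rightarrow> freq (smul M1 (of_real s) (flow t u)) n - g 0 n - of_real (kn n ^ 5)
    - of_real s ^ 2 * (a0 n (lin_act u) + 20 * H0 u * of_real (kn n))) \<le> c * norm (sc 2 p)"
    unfolding eventually_T using divide_pos_pos[OF d(1) add_nonneg_pos[OF M zero_less_one]]
    by (intro exI[of _ "d / (?M + 1)"]) (simp add: sc_def norm_power)
qed

lemma zd_linear:
  assumes "x \<in> h0 (-1)" "v \<in> carr M1"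
  shows "w \<in> carr M1 \<Longrightarrow> zd n x (v + w) = zd n x v + zd n x w" "zd n x (smul M1 c v) = c * zd n x v"
  using M1.cdir_linear[OF coord_deriv[OF assms(1)]] assms(2) by auto

lemma zd_energy_flow:
  assumes u: "rtrig N u" and x: "x \<in> h0 (-1)"
  shows "zd n x (energy_flow N (smul M1 s u)) = s * zd n x (X1v u) + s\<^sup>2 * zd n x (X2v N u u) + s ^ 3 * zd n x (X3v N u)"
proof -
  have "supported N u" using u by (simp add: rtrig_def)
  note c = supported_h0C[OF X1v_supported[OF this], of "-1"] supported_h0C[OF X2v_supported[of N u u], of "-1"]
    supported_h0C[OF X3v_supported[of N u], of "-1"]
  show ?thesis unfolding energy_flow_scale using c
    by (simp add: zd_linear[OF x] M1.carr_smul M1.carr_add)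
qed

text \<open>Expansions at a fixed potential are the instances at time 0 of those along the
  flow.\<close>

lemma bigo_freeze: "f \<in> O[T](sc k) \<Longrightarrow> (\<lambda>p. f (fst p, 0)) \<in> O[T](sc k)"
proof (elim landau_o.bigE)
  fix c assume "c > 0" "\<forall>\<^sub>F p in T. norm (f p) \<le> c * norm (sc k p)"
  then obtain d where "d > 0" "\<And>s. 0 < s \<Longrightarrow> s < d \<Longrightarrow> norm (f (s, 0)) \<le> c * norm (sc k (s, 0))"
    unfolding eventually_T by fastforce
  then show "(\<lambda>p. f (fst p, 0)) \<in> O[T](sc k)"
    by (intro bigo_T[of d _ c]) (auto simp: sc_def norm_power)
qed

lemma smul_rtrig: "rtrig N u \<Longrightarrow> rtrig N (smul M1 (of_real s) u)"
  by (auto simp: rtrig_def supported_def h0C_simps)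

text \<open>The evolution equation at s u, compared at the orders s and s^2. The frequency is
  constant up to O(s^2), so it contributes only \<open>c0\<close> at these orders, and the cubic
  part of the vector field does not yet appear.\<close>

lemma first_two_orders:
  assumes u: "rtrig N u" and n: "n > 0"
  defines "c0 \<equiv> g 0 n + of_real (kn n ^ 5)"
  shows "of_real (lam (int n)) * (X1v u (int n) - \<i> * c0 * u (int n)) = 0"
    and "of_real (lam (int n)) * X2v N u u (int n) + B (int n) u (X1v u) - \<i> * c0 * B (int n) u u / 2 = 0"
proof -
  let ?l = "int n" and ?L = "complex_of_real (lam (int n))"
  let ?x = "\<lambda>p. smul M1 (of_real (fst p :: real)) u"
  have us: "supported N u" using u by (simp add: rtrig_def)
  define a where "a = ?L * (X1v u ?l - \<i> * c0 * u ?l)"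
  define b where "b = ?L * X2v N u u ?l + B ?l u (X1v u) - \<i> * c0 * B ?l u u / 2"
  define e1 where "e1 = (\<lambda>p :: real \<times> real. zd ?l (?x p) (X1v u) - ?L * X1v u ?l - of_real (fst p) * B ?l u (X1v u))"
  define e2 where "e2 = (\<lambda>p :: real \<times> real. zd ?l (?x p) (X2v N u u) - ?L * X2v N u u ?l - of_real (fst p) * B ?l u (X2v N u u))"
  define e3 where "e3 = (\<lambda>p :: real \<times> real. zd ?l (?x p) (X3v N u) - ?L * X3v N u ?l - of_real (fst p) * B ?l u (X3v N u))"
  define ph where "ph = (\<lambda>p :: real \<times> real. \<Phi> (?x p) ?l - of_real (fst p) * (?L * u ?l) - of_real (fst p) ^ 2 * B ?l u u / 2)"
  define r where "r = (\<lambda>p :: real \<times> real. freq (?x p) n - c0)"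
  note ze = zd_flow_expansion[OF u, THEN bigo_freeze, of "\<lambda>_. _", simplified, unfolded flow_0]
  have e: "e1 \<in> O[T](sc 2)" "e2 \<in> O[T](sc 2)" "e3 \<in> O[T](sc 2)"
    unfolding e1_def e2_def e3_def
    by (rule ze[OF _ order_refl], rule supported_h0C, rule X1v_supported[OF us] X2v_supported X3v_supported)+
  have ph: "ph \<in> O[T](sc 3)"
    using bigo_freeze[OF Phi_flow_expansion[OF u, of ?l]] by (simp add: ph_def flow_0)
  have S: "(\<lambda>p. of_real (fst p) ^ k :: complex) \<in> O[T](sc k)" for k
    using landau_o.big_refl[of "sc k" T] by (simp add: sc_def[abs_def])
  have r: "r \<in> O[T](sc 2)"
  proof -
    let ?w = "a0 n (lin_act u) + 20 * H0 u * of_real (kn n)"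
    have "(\<lambda>(s, t). freq (smul M1 (of_real s) (flow t u)) n - g 0 n - of_real (kn n ^ 5) - of_real s ^ 2 * ?w) \<in> O[T](sc 2)"
      by (rule landau_o.small_imp_big[OF freq_flow_expansion[OF u]])
    from bigo_freeze[OF this] have "(\<lambda>p. r p - of_real (fst p) ^ 2 * ?w) \<in> O[T](sc 2)"
      by (simp add: r_def c0_def flow_0 diff_diff_eq)
    moreover have "(\<lambda>p. of_real (fst p) ^ 2 * ?w) \<in> O[T](sc 2)"
      using bigo_sc_mult[OF S[of 2] bigo_sc_const[of ?w]] by simp
    ultimately have "(\<lambda>p. (r p - of_real (fst p) ^ 2 * ?w) + of_real (fst p) ^ 2 * ?w) \<in> O[T](sc 2)" by (rule sum_in_bigo)
    then show ?thesis by simp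
  qed
  have lin: "(\<lambda>p :: real \<times> real. c + of_real (fst p) * d) \<in> O[T](sc 0)" for c d :: complex
    by (rule sum_in_bigo(1)[OF bigo_sc_const]) (use bigo_sc_mult[OF landau_o.big_trans[OF S[of 1] sc_bigo[of 0 1]] bigo_sc_const[of d]] in simp)
  define P where "P = (\<lambda>p :: real \<times> real. \<Phi> (?x p) ?l)"
  have P: "P \<in> O[T](sc 1)"
  proof -
    have "(\<lambda>p. of_real (fst p) ^ 1 * (?L * u ?l + of_real (fst p) * (B ?l u u / 2))) \<in> O[T](sc (1 + 0))"
      by (rule bigo_sc_mult[OF S lin])
    moreover have "ph \<in> O[T](sc (1 + 0))" by (rule landau_o.big_trans[OF ph sc_bigo]) simp
    ultimately have "(\<lambda>p. of_real (fst p) ^ 1 * (?L * u ?l + of_real (fst p) * (B ?l u u / 2)) + ph p) \<in> O[T](sc (1 + 0))"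
      by (rule sum_in_bigo)
    then show ?thesis by (simp add: P_def ph_def algebra_simps power2_eq_square)
  qed
  \<comment> \<open>A regrouping of the evolution equation in which every term on the right is of
    order s^3 by the expansions above.\<close>
  have ev: "a * sc 1 p + b * sc 2 p
    = \<i> * c0 * ph p + \<i> * (r p * P p) - sc 1 p * e1 p - sc 2 p * (e2 p + sc 1 p * B ?l u (X2v N u u))
      - sc 3 p * (e3 p + (?L * X3v N u ?l + of_real (fst p) * B ?l u (X3v N u)))" for p
  proof -
    have xr: "rtrig N (?x p)" by (rule smul_rtrig[OF u])
    have "of_real (fst p) * zd ?l (?x p) (X1v u) + of_real (fst p)^2 * zd ?l (?x p) (X2v N u u) + of_real (fst p) ^ 3 * zd ?l (?x p) (X3v N u)
      = \<i> * freq (?x p) n * P p"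
      using evolution[OF xr n] unfolding zd_energy_flow[OF u rtrig_h0[OF xr]] P_def .
    moreover have "\<Phi> (?x p) ?l = P p" by (simp add: P_def)
    ultimately show ?thesis
      unfolding a_def b_def e1_def e2_def e3_def ph_def r_def sc_def
      by (simp add: algebra_simps power2_eq_square power3_eq_cube)
  qed
  have "(\<lambda>p. a * sc 1 p + b * sc 2 p) \<in> O[T](sc 3)"
    unfolding ev
  proof (intro sum_in_bigo)
    show "(\<lambda>p. \<i> * c0 * ph p) \<in> O[T](sc 3)" using bigo_sc_mult[OF bigo_sc_const ph] by simp
    have "(\<lambda>p. \<i> * (r p * P p)) \<in> O[T](sc (0 + (2 + 1)))" by (intro bigo_sc_mult bigo_sc_const r P)
    then show "(\<lambda>p. \<i> * (r p * P p)) \<in> O[T](sc 3)" by (simp add: numeral_3_eq_3)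
    show "(\<lambda>p. sc 1 p * e1 p) \<in> O[T](sc 3)" using bigo_sc_mult[OF landau_o.big_refl e(1), of 1] by (simp add: numeral_3_eq_3)
    have "(\<lambda>p. e2 p + sc 1 p * B ?l u (X2v N u u)) \<in> O[T](sc 1)"
      using landau_o.big_trans[OF e(2) sc_bigo[of 1 2]] bigo_sc_mult[OF landau_o.big_refl bigo_sc_const, of 1]
      by (intro sum_in_bigo) simp_all
    from bigo_sc_mult[OF landau_o.big_refl this, of 2]
    show "(\<lambda>p. sc 2 p * (e2 p + sc 1 p * B ?l u (X2v N u u))) \<in> O[T](sc 3)" by (simp add: numeral_3_eq_3)
    have "(\<lambda>p. e3 p + (?L * X3v N u ?l + of_real (fst p) * B ?l u (X3v N u))) \<in> O[T](sc 0)"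
      by (rule sum_in_bigo(1)[OF landau_o.big_trans[OF e(3) sc_bigo[of 0 2]] lin]) simp
    from bigo_sc_mult[OF landau_o.big_refl this, of 3]
    show "(\<lambda>p. sc 3 p * (e3 p + (?L * X3v N u ?l + of_real (fst p) * B ?l u (X3v N u)))) \<in> O[T](sc 3)" by simp
  qed
  from landau_o.big_small_trans[OF this sc_smallo[of 2 3]] have "(\<lambda>p. a * sc 1 p + b * sc 2 p) \<in> o[T](sc 2)" by simp
  from sc_coefficients[OF this] show "?L * (X1v u ?l - \<i> * c0 * u ?l) = 0"
    "?L * X2v N u u ?l + B ?l u (X1v u) - \<i> * c0 * B ?l u u / 2 = 0"
    unfolding a_def b_def by auto
qed

lemma lam_pos: "k \<noteq> 0 \<Longrightarrow> lam k > 0"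
  by (simp add: lam_def)

text \<open>At first order the coordinate must rotate with the frequency of the linear flow, so
  \<open>kap n ^ 5\<close> equals \<open>\<i>\<close> times the full frequency at 0. The subtracted
  term \<open>kn n ^ 5\<close> already accounts for all of it.\<close>

lemma g_zero: "n > 0 \<Longrightarrow> g 0 n = 0"
proof -
  assume n: "n > 0"
  have r: "rtrig n (unitv (int n) + unitv (- int n))" using n by (intro rtrig_pair(1)) auto
  have "kap (int n) ^ 5 = \<i> * (g 0 n + of_real (kn n ^ 5))"
    using first_two_orders(1)[OF r n] lam_pos[of "int n"] n by (simp add: unitv_def)
  moreover have "\<i> * of_real (kn n ^ 5) = kap (int n) ^ 5" using om_kap[of "int n"] by (simp add: om_kn)
  ultimately show ?thesis by (simp add: distrib_left)
qed

text \<open>The homological equation for the quadratic part of the Birkhoff map.\<close>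

lemma second_order:
  assumes u: "rtrig N u" and n: "n > 0"
  shows "of_real (lam (int n)) * X2v N u u (int n) + B (int n) u (X1v u) - kap (int n) ^ 5 * B (int n) u u / 2 = 0"
  using first_two_orders(2)[OF u n] om_kap[of "int n"] g_zero[OF n] by (simp add: om_kn)

end

section \<open>Polarisation\<close>

definition lin_on :: "nat \<Rightarrow> ((int \<Rightarrow> complex) \<Rightarrow> complex) \<Rightarrow> bool" where
  "lin_on N F \<longleftrightarrow> (\<forall>a b c. supported N a \<longrightarrow> supported N b \<longrightarrow> F (\<lambda>k. a k + c * b k) = F a + c * F b)"

lemma lin_onD: "lin_on N F \<Longrightarrow> supported N a \<Longrightarrow> supported N b \<Longrightarrow> F (\<lambda>k. a k + c * b k) = F a + c * F b"
  by (simp add: lin_on_def)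

lemma supported_lincomb: "supported N a \<Longrightarrow> supported N b \<Longrightarrow> supported N (\<lambda>k. a k + c * b k)"
  by (simp add: supported_def)

lemma supported_unitv: "k \<noteq> 0 \<Longrightarrow> \<bar>k\<bar> \<le> int N \<Longrightarrow> supported N (unitv k)"
  by (auto simp: supported_def unitv_def)

lemma rtrig_supported: "rtrig N u \<Longrightarrow> supported N u"
  by (simp add: rtrig_def)

lemma rtrig_sum: "rtrig N u \<Longrightarrow> rtrig N v \<Longrightarrow> rtrig N (\<lambda>k. u k + 1 * v k)"
  by (auto simp: rtrig_def supported_def)

lemma lin_expand:
  assumes F: "lin_on N F" and x: "supported N x"
  shows "F x = (\<Sum>i\<in>sym_int N - {0}. x i * F (unitv i))"
proof -
  have "supported N (\<lambda>_. 0)" by (simp add: supported_def)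
  from lin_onD[OF F this this, of 1] have F0: "F (\<lambda>_. 0) = 0" by simp
  have "F (\<lambda>k. if k \<in> I then x k else 0) = (\<Sum>i\<in>I. x i * F (unitv i))" if "finite I" "I \<subseteq> sym_int N - {0}" for I
    using that
  proof (induction I rule: finite_induct)
    case (insert i I)
    have "(\<lambda>k. if k \<in> insert i I then x k else 0) = (\<lambda>k. (if k \<in> I then x k else 0) + x i * unitv i k)"
      using insert.hyps by (auto simp: unitv_def fun_eq_iff)
    moreover have "supported N (\<lambda>k. if k \<in> I then x k else 0)" using x by (auto simp: supported_def)
    moreover have "supported N (unitv i)" using insert.prems by (intro supported_unitv) auto
    ultimately show ?case using lin_onD[OF F] insert by simp
  qed (simp add: F0)
  from this[of "sym_int N - {0}"] have "F (\<lambda>k. if k \<in> sym_int N - {0} then x k else 0) = (\<Sum>i\<in>sym_int N - {0}. x i * F (unitv i))" by simp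
  moreover have "(\<lambda>k. if k \<in> sym_int N - {0} then x k else 0) = x" using x by (auto simp: supported_def fun_eq_iff)
  ultimately show ?thesis by simp
qed

lemma rtrig_decomposition:
  assumes "supported N a"
  obtains r s where "rtrig N r" "rtrig N s" "a = (\<lambda>k. r k + \<i> * s k)"
proof
  let ?r = "\<lambda>k. (a k + cnj (a (- k))) / 2" and ?s = "\<lambda>k. (a k - cnj (a (- k))) / (2 * \<i>)"
  have "- k \<notin> sym_int N" if "k \<notin> sym_int N" for k using that by auto
  then show "rtrig N ?r" "rtrig N ?s" using assms by (auto simp: rtrig_def supported_def field_simps)
  show "a = (\<lambda>k. ?r k + \<i> * ?s k)" by (auto simp: fun_eq_iff field_simps)
qed

text \<open>The expansions hold at real potentials only, where the coefficients at k and - k are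
  conjugate and cannot be varied separately. Polarising over real u and v first, and extending by
  complex linearity afterwards, makes single modes accessible.\<close>

lemma polarize2:
  assumes D: "\<And>b. supported N b \<Longrightarrow> lin_on N (\<lambda>a. D a b)" "\<And>a. supported N a \<Longrightarrow> lin_on N (D a)"
    and zero: "\<And>u. rtrig N u \<Longrightarrow> D u u = 0"
    and ab: "supported N a" "supported N b"
  shows "D a b + D b a = 0"
proof -
  define E where "E = (\<lambda>a b. D a b + D b a)"
  have E: "E (\<lambda>k. a k + c * a' k) b = E a b + c * E a' b" "E b (\<lambda>k. a k + c * a' k) = E b a + c * E b a'"
    if "supported N a" "supported N a'" "supported N b" for a a' b c
    unfolding E_def using lin_onD[OF D(1)[OF that(3)] that(1,2), of c] lin_onD[OF D(2)[OF that(3)] that(1,2), of c]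
    by (simp_all add: algebra_simps)
  have r: "E u v = 0" if u: "rtrig N u" and v: "rtrig N v" for u v
  proof -
    note s = rtrig_supported[OF u] rtrig_supported[OF v]
    have "D (\<lambda>k. u k + 1 * v k) (\<lambda>k. u k + 1 * v k) = 0" by (rule zero[OF rtrig_sum[OF u v]])
    then show ?thesis
      using zero[OF u] zero[OF v] lin_onD[OF D(1)[OF supported_lincomb[OF s]] s, of 1 1]
        lin_onD[OF D(2)[OF s(1)] s, of 1] lin_onD[OF D(2)[OF s(2)] s, of 1]
      by (simp add: E_def)
  qed
  obtain r1 s1 where a: "rtrig N r1" "rtrig N s1" "a = (\<lambda>k. r1 k + \<i> * s1 k)" using rtrig_decomposition[OF ab(1)] .
  obtain r2 s2 where b: "rtrig N r2" "rtrig N s2" "b = (\<lambda>k. r2 k + \<i> * s2 k)" using rtrig_decomposition[OF ab(2)] .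
  have "E a b = E r1 b + \<i> * E s1 b"
    unfolding a(3) by (rule E(1)) (use a b ab in \<open>auto intro: rtrig_supported\<close>)
  moreover have "E x b = E x r2 + \<i> * E x s2" if "rtrig N x" for x
    unfolding b(3) by (rule E(2)) (use that b in \<open>auto intro: rtrig_supported\<close>)
  ultimately show ?thesis using r a(1,2) b(1,2) by (simp add: E_def)
qed

text \<open>\<open>Z\<close> stands for any property closed under linear combinations; it is
  instantiated with a vanishing integral over a period. The six orders remain because D is not
  symmetric in its arguments.\<close>

lemma polarize3:
  fixes D :: "(int \<Rightarrow> complex) \<Rightarrow> (int \<Rightarrow> complex) \<Rightarrow> (int \<Rightarrow> complex) \<Rightarrow> real \<Rightarrow> complex"
  assumes D: "\<And>t b c. supported N b \<Longrightarrow> supported N c \<Longrightarrow> lin_on N (\<lambda>a. D a b c t)"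
      "\<And>t a c. supported N a \<Longrightarrow> supported N c \<Longrightarrow> lin_on N (\<lambda>b. D a b c t)"
      "\<And>t a b. supported N a \<Longrightarrow> supported N b \<Longrightarrow> lin_on N (\<lambda>c. D a b c t)"
    and Z: "\<And>f h c. Z f \<Longrightarrow> Z h \<Longrightarrow> Z (\<lambda>t. f t + c * h t)"
    and zero: "\<And>u. rtrig N u \<Longrightarrow> Z (D u u u)"
    and abc: "supported N a" "supported N b" "supported N c"
  shows "Z (\<lambda>t. D a b c t + D a c b t + D b a c t + D b c a t + D c a b t + D c b a t)"
proof -
  define E where "E = (\<lambda>a b c t. D a b c t + D a c b t + D b a c t + D b c a t + D c a b t + D c b a t)"
  have E1: "E (\<lambda>k. a k + s * a' k) b c = (\<lambda>t. E a b c t + s * E a' b c t)"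
    if "supported N a" "supported N a'" "supported N b" "supported N c" for a a' b c s
    unfolding E_def
    using lin_onD[OF D(1)[OF that(3,4)] that(1,2)] lin_onD[OF D(1)[OF that(4,3)] that(1,2)]
      lin_onD[OF D(2)[OF that(3,4)] that(1,2)] lin_onD[OF D(2)[OF that(4,3)] that(1,2)]
      lin_onD[OF D(3)[OF that(3,4)] that(1,2)] lin_onD[OF D(3)[OF that(4,3)] that(1,2)]
    by (simp add: fun_eq_iff algebra_simps)
  have Es: "E a b c = E b a c" "E a b c = E b c a" for a b c
    by (simp_all add: E_def fun_eq_iff algebra_simps)
  have r: "Z (E u v w)" if u: "rtrig N u" and v: "rtrig N v" and w: "rtrig N w" for u v w
  proof -
    note s = rtrig_supported[OF u] rtrig_supported[OF v] rtrig_supported[OF w]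
    define p where "p = (\<lambda>x :: int \<Rightarrow> complex. D x x x)"
    define uv where "uv = (\<lambda>k. u k + 1 * v k)"
    define uw where "uw = (\<lambda>k. u k + 1 * w k)"
    define vw where "vw = (\<lambda>k. v k + 1 * w k)"
    define uvw where "uvw = (\<lambda>k. uv k + 1 * w k)"
    have rt: "rtrig N uv" "rtrig N uw" "rtrig N vw" unfolding uv_def uw_def vw_def
      by (rule rtrig_sum[OF u v] rtrig_sum[OF u w] rtrig_sum[OF v w])+
    have rt3: "rtrig N uvw" unfolding uvw_def by (rule rtrig_sum[OF rt(1) w])
    note st = rtrig_supported[OF rt(1)] rtrig_supported[OF rt(2)] rtrig_supported[OF rt(3)] rtrig_supported[OF rt3]
    have z: "Z (p x)" if "rtrig N x" for x using zero[OF that] by (simp add: p_def)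
    have cube: "D (\<lambda>k. x k + 1 * y k) (\<lambda>k. x k + 1 * y k) (\<lambda>k. x k + 1 * y k) t =
      D x x x t + D x x y t + D x y x t + D x y y t + D y x x t + D y x y t + D y y x t + D y y y t"
      if "supported N x" "supported N y" for x y t
      using that supported_lincomb[OF that, of 1]
      by (simp only: lin_onD[OF D(1)] lin_onD[OF D(2)] lin_onD[OF D(3)]) simp
    have l: "D uv x y t = D u x y t + D v x y t" "D x uv y t = D x u y t + D x v y t" "D x y uv t = D x y u t + D x y v t"
      if "supported N x" "supported N y" for x y t
      unfolding uv_def using lin_onD[OF D(1)[OF that] s(1,2), where c=1] lin_onD[OF D(2)[OF that] s(1,2), where c=1]
        lin_onD[OF D(3)[OF that] s(1,2), where c=1] by simp_all
    have pe: "p uvw t = p uv t + (D uv uv w t + D uv w uv t + D uv w w t + D w uv uv t + D w uv w t + D w w uv t + D w w w t)" for t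
      unfolding p_def uvw_def by (subst cube[OF st(1) s(3)]) (simp add: add.assoc)
    \<comment> \<open>Inclusion and exclusion for cubes: the symmetrised form is an alternating sum
      of values on the diagonal at sums of u, v and w.\<close>
    have "E u v w t = ((((((p uvw t + (- 1) * p uv t) + (- 1) * p uw t) + (- 1) * p vw t) + 1 * p u t) + 1 * p v t) + 1 * p w t)" for t
      unfolding pe unfolding l[OF s(3) s(3)] l[OF st(1) s(3)] l[OF s(3) st(1)] l[OF s(1) s(3)] l[OF s(2) s(3)] l[OF s(3) s(1)] l[OF s(3) s(2)]
      unfolding p_def uw_def vw_def cube[OF s(1,3)] cube[OF s(2,3)] by (simp add: E_def)
    then have "E u v w = (\<lambda>t. ((((((p uvw t + (- 1) * p uv t) + (- 1) * p uw t) + (- 1) * p vw t) + 1 * p u t) + 1 * p v t) + 1 * p w t))"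
      by (rule ext)
    then show ?thesis using z u v w rt rt3 by (simp only:) (intro Z z)
  qed
  obtain r1 s1 where a: "rtrig N r1" "rtrig N s1" "a = (\<lambda>k. r1 k + \<i> * s1 k)" using rtrig_decomposition[OF abc(1)] .
  obtain r2 s2 where b: "rtrig N r2" "rtrig N s2" "b = (\<lambda>k. r2 k + \<i> * s2 k)" using rtrig_decomposition[OF abc(2)] .
  obtain r3 s3 where c: "rtrig N r3" "rtrig N s3" "c = (\<lambda>k. r3 k + \<i> * s3 k)" using rtrig_decomposition[OF abc(3)] .
  have 1: "Z (E a x y)" if "rtrig N x" "rtrig N y" for x y
    unfolding a(3) E1[OF rtrig_supported[OF a(1)] rtrig_supported[OF a(2)] rtrig_supported[OF that(1)] rtrig_supported[OF that(2)]]
    by (intro Z r a that)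
  have 2: "Z (E b a y)" if "rtrig N y" for y
    unfolding b(3) E1[OF rtrig_supported[OF b(1)] rtrig_supported[OF b(2)] abc(1) rtrig_supported[OF that]]
    by (intro Z) (simp_all only: Es(1)[of _ a] 1 b that)
  have "Z (E c b a)"
    unfolding c(3) E1[OF rtrig_supported[OF c(1)] rtrig_supported[OF c(2)] abc(2,1)]
    by (intro Z) (simp_all only: Es(2)[of _ b a] 2 c)
  then show ?thesis by (simp add: E_def add_ac)
qed

section \<open>Second order terms of the Birkhoff coordinates\<close>

lemma gr2_lin: "lin_on N (\<lambda>a. gr2 N a b k)" "lin_on N (\<lambda>b. gr2 N a b k)"
  unfolding lin_on_def gr2_def sum_distrib_left sum.distrib[symmetric]
  by (intro allI impI sum.cong refl; simp add: algebra_simps)+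

lemma gr3_lin: "lin_on N (\<lambda>a. gr3 N a b c k)" "lin_on N (\<lambda>b. gr3 N a b c k)" "lin_on N (\<lambda>c. gr3 N a b c k)"
  unfolding lin_on_def gr3_def sum_distrib_left sum.distrib[symmetric]
  by (intro allI impI sum.cong refl; simp add: algebra_simps)+

lemma gr2_unitv:
  assumes "\<bar>i\<bar> \<le> int N" "\<bar>j\<bar> \<le> int N"
  shows "gr2 N (unitv i) (unitv j) k = (if i + j = k then -5 * ((kap i)\<^sup>2 + kap i * kap j + (kap j)\<^sup>2) else 0)"
proof -
  have "gr2 N (unitv i) (unitv j) k = (\<Sum>a\<in>sym_int N. \<Sum>b\<in>sym_int N. if b = j then if a = i then
      if i + j = k then -5 * ((kap i)\<^sup>2 + kap i * kap j + (kap j)\<^sup>2) else 0 else 0 else 0)"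
    unfolding gr2_def by (intro sum.cong refl) (simp add: unitv_def)
  also have "\<dots> = (\<Sum>a\<in>sym_int N. if a = i then if i + j = k then -5 * ((kap i)\<^sup>2 + kap i * kap j + (kap j)\<^sup>2) else 0 else 0)"
    using assms(2) by (intro sum.cong refl, subst sum.delta) auto
  also have "\<dots> = (if i + j = k then -5 * ((kap i)\<^sup>2 + kap i * kap j + (kap j)\<^sup>2) else 0)"
    using assms(1) by (subst sum.delta) auto
  finally show ?thesis .
qed

lemma gr3_unitv:
  assumes "\<bar>i\<bar> \<le> int N" "\<bar>j\<bar> \<le> int N" "\<bar>l\<bar> \<le> int N" "i + j + l = k"
  shows "gr3 N (unitv i) (unitv j) (unitv l) k = 10"
proof -
  have "gr3 N (unitv i) (unitv j) (unitv l) k = (\<Sum>a\<in>sym_int N. \<Sum>b\<in>sym_int N. \<Sum>c\<in>sym_int N.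
      if c = l then if b = j then if a = i then 10 else 0 else 0 else 0)"
    unfolding gr3_def using assms(4) by (intro sum.cong refl) (auto simp: unitv_def)
  also have "\<dots> = (\<Sum>a\<in>sym_int N. \<Sum>b\<in>sym_int N. if b = j then if a = i then 10 else 0 else 0)"
    using assms(3) by (intro sum.cong refl, subst sum.delta) auto
  also have "\<dots> = (\<Sum>a\<in>sym_int N. if a = i then 10 else 0)"
    using assms(2) by (intro sum.cong refl, subst sum.delta) auto
  also have "\<dots> = 10" using assms(1) by (subst sum.delta) auto
  finally show ?thesis .
qed

context kdv2
begin

lemma B_lin: "v \<in> carr M1 \<Longrightarrow> lin_on N (\<lambda>u. B n u v)" "v \<in> carr M1 \<Longrightarrow> lin_on N (\<lambda>u. B n v u)"
proof -
  assume v: "v \<in> carr M1"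
  have eq: "(\<lambda>k. a k + c * b k) = a + smul M1 c b" for a b c by (simp add: h0C_simps fun_eq_iff)
  show "lin_on N (\<lambda>u. B n u v)" "lin_on N (\<lambda>u. B n v u)"
    unfolding lin_on_def eq using B_bilinear[OF supported_h0C M1.carr_smul[OF supported_h0C] v]
      B_bilinear[OF v supported_h0C M1.carr_smul[OF supported_h0C]] B_bilinear(3)[OF supported_h0C v v] B_bilinear(4)[OF v supported_h0C v]
    by simp_all
qed

lemma B_add_smul:
  assumes "supported N a" "supported N b" "v \<in> carr M1"
  shows "B n (\<lambda>k. a k + c * b k) v = B n a v + c * B n b v" "B n v (\<lambda>k. a k + c * b k) = B n v a + c * B n v b"
  using lin_onD[OF B_lin(1)[OF assms(3)] assms(1,2)] lin_onD[OF B_lin(2)[OF assms(3)] assms(1,2)] by auto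

lemma X2v_lincomb:
  "X2v N (\<lambda>k. a k + c * b k) v = (\<lambda>k. X2v N a v k + c * X2v N b v k)"
  "X2v N v (\<lambda>k. a k + c * b k) = (\<lambda>k. X2v N v a k + c * X2v N v b k)" if "supported N a" "supported N b"
  using lin_onD[OF gr2_lin(1) that] lin_onD[OF gr2_lin(2) that] by (simp_all add: fun_eq_iff algebra_simps)

text \<open>Solves the homological equation mode by mode. With i + j = n the divisor
  \<open>kap n ^ 5 - kap i ^ 5 - kap j ^ 5\<close> factors as
  \<open>5 * kap i * kap j * kap n\<close> times the quadratic form that also occurs in the source
  term, so everything but \<open>kap i * kap j\<close> cancels.\<close>

lemma B_unitv:
  assumes ij: "i + j = int n" "i \<noteq> 0" "j \<noteq> 0" and n: "n > 0"
  shows "B (int n) (unitv i) (unitv j) = - 2 * of_real (lam (int n)) / (kap i * kap j)"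
proof -
  define N where "N = nat (\<bar>i\<bar> + \<bar>j\<bar>)"
  let ?L = "complex_of_real (lam (int n))" and ?k = "kap (int n)"
  define D where "D = (\<lambda>a b. ?L * X2v N a b (int n) + B (int n) a (X1v b) - ?k ^ 5 * B (int n) a b / 2)"
  have N: "\<bar>i\<bar> \<le> int N" "\<bar>j\<bar> \<le> int N" by (auto simp: N_def)
  have X1l: "X1v (\<lambda>k. a k + c * b k) = (\<lambda>k. X1v a k + c * X1v b k)" for a b c by (simp add: fun_eq_iff algebra_simps)
  have "D (unitv i) (unitv j) + D (unitv j) (unitv i) = 0"
  proof (rule polarize2[of N D])
    show "D u u = 0" if "rtrig N u" for u unfolding D_def by (rule second_order[OF that n])
    show "lin_on N (\<lambda>a. D a b)" if b: "supported N b" for b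
      unfolding lin_on_def
    proof (intro allI impI)
      fix x y c assume xy: "supported N x" "supported N y"
      show "D (\<lambda>k. x k + c * y k) b = D x b + c * D y b"
        unfolding D_def lin_onD[OF gr2_lin(1) xy] B_add_smul(1)[OF xy supported_h0C[OF b]]
          B_add_smul(1)[OF xy supported_h0C[OF X1v_supported[OF b]]] by (simp add: algebra_simps add_divide_distrib diff_divide_distrib)
    qed
    show "lin_on N (D a)" if a: "supported N a" for a
      unfolding lin_on_def
    proof (intro allI impI)
      fix x y c assume xy: "supported N x" "supported N y"
      show "D a (\<lambda>k. x k + c * y k) = D a x + c * D a y"
        unfolding D_def lin_onD[OF gr2_lin(2) xy] X1l B_add_smul(2)[OF xy supported_h0C[OF a]]
          B_add_smul(2)[OF X1v_supported[OF xy(1)] X1v_supported[OF xy(2)] supported_h0C[OF a]]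
        by (simp add: algebra_simps add_divide_distrib diff_divide_distrib)
    qed
  qed (use N ij in \<open>auto intro: supported_unitv\<close>)
  moreover have "X1v (unitv j) = smul M1 (kap j ^ 5) (unitv j)" for j by (auto simp: h0C_simps unitv_def fun_eq_iff)
  moreover have B1: "B (int n) (unitv a) (smul M1 c (unitv b)) = c * B (int n) (unitv a) (unitv b)" if "a \<noteq> 0" "b \<noteq> 0" for a b c
    using B_bilinear(4)[OF unitv_h0C unitv_h0C unitv_h0C] that by blast
  moreover have "B (int n) (unitv j) (unitv i) = B (int n) (unitv i) (unitv j)"
    using B_bilinear(5)[OF unitv_h0C unitv_h0C unitv_h0C] ij by blast
  ultimately have f: "(?k ^ 5 - kap i ^ 5 - kap j ^ 5) * B (int n) (unitv i) (unitv j)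
      = - 10 * ?L * ?k * ((kap i)\<^sup>2 + kap i * kap j + (kap j)\<^sup>2)"
    using ij by (simp add: D_def gr2_unitv[OF N] gr2_unitv[OF N(2,1)] algebra_simps add_divide_distrib)
  have kn: "?k = kap i + kap j" using ij(1) by (metis kap_add)
  have r: "(a + b) ^ 5 - a ^ 5 - b ^ 5 = 5 * a * b * (a + b) * (a\<^sup>2 + a * b + b\<^sup>2)" for a b :: complex by algebra
  have e: "5 * kap i * kap j * ?k * ((kap i)\<^sup>2 + kap i * kap j + (kap j)\<^sup>2) * B (int n) (unitv i) (unitv j)
      = - 10 * ?L * ?k * ((kap i)\<^sup>2 + kap i * kap j + (kap j)\<^sup>2)"
    using f unfolding kn r .
  \<comment> \<open>The form i^2 + i j + j^2 is positive definite, hence no small or vanishing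
    divisors occur at second order.\<close>
  have q: "(kap i)\<^sup>2 + kap i * kap j + (kap j)\<^sup>2 \<noteq> 0"
  proof -
    have "i\<^sup>2 + i * j + j\<^sup>2 > 0"
    proof -
      have "2 * (i\<^sup>2 + i * j + j\<^sup>2) = (i + j)\<^sup>2 + i\<^sup>2 + j\<^sup>2" by (simp add: power2_eq_square algebra_simps)
      moreover have "(i + j)\<^sup>2 + i\<^sup>2 + j\<^sup>2 > 0" using ij(3) by (intro add_nonneg_pos) auto
      ultimately have "0 < 2 * (i\<^sup>2 + i * j + j\<^sup>2)" by (simp only:)
      then show ?thesis by simp
    qed
    moreover have "(kap i)\<^sup>2 + kap i * kap j + (kap j)\<^sup>2 = (2 * of_real pi * \<i>)\<^sup>2 * of_int (i\<^sup>2 + i * j + j\<^sup>2)"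
      by (simp add: kap_def power2_eq_square algebra_simps)
    ultimately show ?thesis by (simp only: mult_eq_0_iff of_int_eq_0_iff) simp
  qed
  have h: "b = - 2 * L / (x * y)" if "5 * x * y * k * q * b = - 10 * L * k * q" "k \<noteq> 0" "q \<noteq> 0" "x \<noteq> 0" "y \<noteq> 0" for b L x y k q :: complex
  proof -
    have "(k * q) * (x * y * b) = (k * q) * (- 2 * L)" using that(1) by (simp add: algebra_simps)
    then have "x * y * b = - 2 * L" using that(2,3) mult_left_cancel[of "k * q" "x * y * b" "- 2 * L"] by simp
    then show ?thesis using that(4,5) by (simp add: field_simps)
  qed
  show ?thesis by (rule h[OF e _ q]) (use n ij in auto)
qed

lemma X2v_unitv:
  assumes "\<bar>i\<bar> \<le> int N" "\<bar>j\<bar> \<le> int N"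
  shows "X2v N (unitv i) (unitv j) = smul M1 (- 5 * kap (i + j) * ((kap i)\<^sup>2 + kap i * kap j + (kap j)\<^sup>2)) (unitv (i + j))"
proof
  have e: "kap k * (if i + j = k then - 5 * q else 0) = - 5 * kap (i + j) * q * unitv (i + j) k" for k q by (simp add: unitv_def)
  show "X2v N (unitv i) (unitv j) k = smul M1 (- 5 * kap (i + j) * ((kap i)\<^sup>2 + kap i * kap j + (kap j)\<^sup>2)) (unitv (i + j)) k" for k
    unfolding gr2_unitv[OF assms] h0C_simps by (rule e)
qed

text \<open>The quadratic vector field sends the modes j and k to j + k, where
  \<open>B_unitv\<close> applies. If j + k = 0, the outer factor \<open>kap 0\<close> annihilates
  the product.\<close>

lemma B_X2v_unitv:
  assumes ijk: "i + j + k = int n" "i \<noteq> 0" "\<bar>j\<bar> \<le> int N" "\<bar>k\<bar> \<le> int N" and n: "n > 0"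
  shows "B (int n) (unitv i) (X2v N (unitv j) (unitv k)) = (if j + k = 0 then 0
    else 10 * of_real (lam (int n)) * ((kap j)\<^sup>2 + kap j * kap k + (kap k)\<^sup>2) / kap i)"
proof (cases "j + k = 0")
  case True
  have "B (int n) (unitv i) (smul M1 0 (unitv i)) = 0"
    using B_bilinear(4)[of "unitv i" "unitv i" "unitv i" "int n" 0] ijk(2) unitv_h0C by auto
  moreover have "X2v N (unitv j) (unitv k) = smul M1 0 (unitv i)" unfolding X2v_unitv[OF ijk(3,4)] using True by (simp add: h0C_simps)
  ultimately show ?thesis using True by simp
next
  case False
  have "B (int n) (unitv i) (unitv (j + k)) = - 2 * of_real (lam (int n)) / (kap i * kap (j + k))"
    using ijk n False by (intro B_unitv) auto
  moreover have "- 5 * y * q * (- 2 * L / (x * y)) = 10 * L * q / x" if "x \<noteq> 0" "y \<noteq> 0" for x y q L :: complex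
    using that by (simp add: field_simps)
  ultimately show ?thesis
    unfolding X2v_unitv[OF ijk(3,4)] using B_bilinear(4)[OF unitv_h0C unitv_h0C unitv_h0C, of i "j + k" 1] ijk(2) False
    by simp
qed

section \<open>Averaging along the linear flow\<close>

text \<open>\<open>w2\<close> is the polarised second order part of the frequency at \<open>u\<close>, and \<open>T0\<close> collects the third order
  terms of the evolution equation of the \<open>n\<close>-th coordinate.\<close>

definition w2 :: "nat \<Rightarrow> nat \<Rightarrow> (int \<Rightarrow> complex) \<Rightarrow> (int \<Rightarrow> complex) \<Rightarrow> complex" where
  "w2 n N a b = (\<Sum>m\<in>{1..N}. of_real ((lam (int m))\<^sup>2) * a0 n (unitv m) * (a (int m) * b (- int m)))
    + 10 * of_real (kn n) * (\<Sum>k\<in>sym_int N. a k * b (- k))"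

lemma a0_lin_act:
  assumes u: "supported N u"
  shows "a0 n (lin_act u) + 20 * H0 u * of_real (kn n) = w2 n N u u"
proof -
  have z: "lin_act u m = 0" if "m \<notin> {1..N}" for m using that u by (cases "m = 0") (auto simp: lin_act_def actions_def supported_def)
  have "lin_act u \<in> carr X1"
  proof (rule finite_support_lC)
    have "{m. lin_act u m \<noteq> 0} \<subseteq> {1..N}" using z by blast
    then show "finite {m. lin_act u m \<noteq> 0}" by (rule finite_subset) simp
  qed (rule z, simp)
  from bounded_clin_has_sum_lC[OF a0_bounded this]
  have "((\<lambda>m. lin_act u m * (if m = 0 then 0 else a0 n (unitv m))) has_sum a0 n (lin_act u)) UNIV" .
  moreover have "((\<lambda>m. lin_act u m * (if m = 0 then 0 else a0 n (unitv m))) has_sum (\<Sum>m\<in>{1..N}. lin_act u m * (if m = 0 then 0 else a0 n (unitv m)))) UNIV"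
    by (rule has_sum_finite_neutralI[of "{1..N}"]) (use z in auto)
  ultimately have "a0 n (lin_act u) = (\<Sum>m\<in>{1..N}. lin_act u m * (if m = 0 then 0 else a0 n (unitv m)))" by (rule has_sum_unique)
  also have "\<dots> = (\<Sum>m\<in>{1..N}. of_real ((lam (int m))\<^sup>2) * a0 n (unitv m) * (u (int m) * u (- int m)))"
    by (intro sum.cong refl) (auto simp: lin_act_def actions_def)
  finally show ?thesis by (simp add: w2_def H0_supported[OF u])
qed

lemma w2_lin: "lin_on N (\<lambda>a. w2 n N a b)" "lin_on N (w2 n N b)"
  unfolding lin_on_def w2_def sum_distrib_left distrib_left
  by (intro allI impI; simp add: algebra_simps sum.distrib sum_distrib_left)+

lemma w2_flow: "w2 n N (flow t u) (flow t u) = w2 n N u u"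
proof -
  have "flow t u k * flow t u (- k) = u k * u (- k)" for k
    by (simp add: flow_def om_minus exp_minus field_simps)
  then show ?thesis by (simp add: w2_def)
qed

definition T0 :: "nat \<Rightarrow> nat \<Rightarrow> (int \<Rightarrow> complex) \<Rightarrow> (int \<Rightarrow> complex) \<Rightarrow> (int \<Rightarrow> complex) \<Rightarrow> complex" where
  "T0 n N a b c = \<i> * of_real (lam (int n)) * w2 n N a b * c (int n)
    - of_real (lam (int n)) * kap (int n) * gr3 N a b c (int n) - B (int n) a (X2v N b c)"

lemma T0_lin:
  "supported N b \<Longrightarrow> supported N c \<Longrightarrow> lin_on N (\<lambda>a. T0 n N a b c)"
  "supported N a \<Longrightarrow> supported N c \<Longrightarrow> lin_on N (\<lambda>b. T0 n N a b c)"
  "supported N a \<Longrightarrow> supported N b \<Longrightarrow> lin_on N (\<lambda>c. T0 n N a b c)"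
proof -
  have X: "X2v N x y \<in> carr M1" for x y by (rule supported_h0C[OF X2v_supported])
  have comb: "lin_on N (\<lambda>a. p a - of_real (lam (int n)) * kap (int n) * q a - r a)"
    if "lin_on N p" "lin_on N q" "lin_on N r" for p q r :: "(int \<Rightarrow> complex) \<Rightarrow> complex"
    unfolding lin_on_def using that[THEN lin_onD] by (simp add: algebra_simps)
  note T = comb[OF _ gr3_lin(1)] comb[OF _ gr3_lin(2)] comb[OF _ gr3_lin(3)]
  show "lin_on N (\<lambda>a. T0 n N a b c)" if "supported N b" "supported N c"
    unfolding T0_def by (rule T(1)) (auto simp: lin_on_def lin_onD[OF w2_lin(1)] B_add_smul(1)[OF _ _ X] algebra_simps)
  show "lin_on N (\<lambda>b. T0 n N a b c)" if ac: "supported N a" "supported N c"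
    unfolding T0_def by (rule T(2)) (auto simp: lin_on_def lin_onD[OF w2_lin(2)] X2v_lincomb(1)
      B_add_smul(2)[OF X2v_supported X2v_supported supported_h0C[OF ac(1)]] algebra_simps)
  show "lin_on N (\<lambda>c. T0 n N a b c)" if ab: "supported N a" "supported N b"
    unfolding T0_def by (rule T(3)) (auto simp: lin_on_def X2v_lincomb(2)
      B_add_smul(2)[OF X2v_supported X2v_supported supported_h0C[OF ab(1)]] algebra_simps)
qed

lemma continuous_B:
  assumes "\<And>t. supported N (x t)" "\<And>t. supported N' (y t)"
    "\<And>k. continuous_on S (\<lambda>t. x t k)" "\<And>k. continuous_on S (\<lambda>t. y t k)"
  shows "continuous_on S (\<lambda>t. B n (x t) (y t))"
proof -
  have "B n (x t) (y t) = (\<Sum>i\<in>sym_int N - {0}. x t i * (\<Sum>j\<in>sym_int N' - {0}. y t j * B n (unitv i) (unitv j)))" for t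
    unfolding lin_expand[OF B_lin(1)[OF supported_h0C[OF assms(2)]] assms(1)]
    by (intro sum.cong refl, subst lin_expand[OF B_lin(2)[OF unitv_h0C] assms(2)]) auto
  then show ?thesis by (simp only:) (intro continuous_intros assms(3,4))
qed

lemma continuous_flow: "continuous_on S (\<lambda>t. flow t u k)"
  unfolding flow_def by (intro continuous_intros)

lemma continuous_X2v: "continuous_on S (\<lambda>t. X2v N (flow t u) (flow t u) k)"
proof -
  have "continuous_on S (\<lambda>t. if i + j = k then c * (flow t u i * flow t u j) else 0)" for i j and c :: complex
    by (cases "i + j = k") (auto intro!: continuous_intros continuous_flow)
  then show ?thesis unfolding gr2_def by (intro continuous_intros)
qed

lemma continuous_gr3: "continuous_on S (\<lambda>t. gr3 N (flow t u) (flow t u) (flow t u) k)"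
proof -
  have "continuous_on S (\<lambda>t. if i + j + l = k then c * (flow t u i * flow t u j * flow t u l) else 0)" for i j l and c :: complex
    by (cases "i + j + l = k") (auto intro!: continuous_intros continuous_flow)
  then show ?thesis unfolding gr3_def by (intro continuous_intros)
qed

lemma continuous_bigo: "continuous_on {0..1} f \<Longrightarrow> (\<lambda>(s, t). f t) \<in> O[T](sc 0)" for f :: "real \<Rightarrow> complex"
proof -
  assume "continuous_on {0..1} f"
  from compact_imp_bounded[OF compact_continuous_image[OF this]]
  obtain C where "\<forall>x\<in>f ` {0..1}. norm x \<le> C" unfolding bounded_iff by blast
  then show ?thesis by (intro bigo_sc_0[of _ C]) auto
qed

text \<open>Along the linear flow, the coordinate at amplitude s times
  \<open>exp (- \<i> * om n * t)\<close> is periodic, so its time derivative has integral 0. The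
  evolution equation trades the derivative along the linear field for the terms of
  \<open>br\<close>, none of which involves the third derivative of the coordinate up to order
  s^3.\<close>

lemma average:
  assumes u: "rtrig N u" and n: "n > 0"
  shows "((\<lambda>t. exp (- (\<i> * of_real (om (int n))) * of_real t) * T0 n N (flow t u) (flow t u) (flow t u)) has_integral 0) {0..period}"
proof -
  let ?l = "int n" and ?L = "complex_of_real (lam (int n))" and ?c = "- (\<i> * complex_of_real (om (int n)))"
  have us: "supported N (flow t u)" for t by (rule rtrig_supported[OF rtrig_flow[OF u]])
  have per: "0 \<le> period" "period \<le> 1"
  proof -
    have "1 \<le> (2 * pi) ^ 4" using pi_gt3 by (intro one_le_power) simp
    then show "0 \<le> period" "period \<le> 1" by (simp_all add: period_def divide_le_eq_1)
  qed
  define E where "E = (\<lambda>t. exp (?c * complex_of_real t))"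
  have En: "norm (E t) = 1" for t by (simp add: E_def)
  have E1: "E period = 1" "E 0 = 1"
  proof -
    have "exp (\<i> * of_real (om ?l * period)) = 1" using fun_cong[OF flow_period[of "unitv ?l"], of ?l] by (simp add: flow_def unitv_def)
    then show "E period = 1" by (simp add: E_def exp_minus mult.assoc)
    show "E 0 = 1" by (simp add: E_def)
  qed
  define y where "y = (\<lambda>s t. smul M1 (of_real s) (flow t u))"
  have yr: "rtrig N (y s t)" for s t unfolding y_def by (rule smul_rtrig[OF rtrig_flow[OF u]])
  have yf: "y s t = flow t (smul M1 (of_real s) u)" for s t by (simp add: y_def h0C_simps flow_scale)
  define fr where "fr = (\<lambda>s t. freq (y s t) n - of_real (om ?l))"
  define ph where "ph = (\<lambda>s t. \<Phi> (y s t) ?l)"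
  define z2 where "z2 = (\<lambda>s t. zd ?l (y s t) (X2v N (flow t u) (flow t u)))"
  define z3 where "z3 = (\<lambda>s t. zd ?l (y s t) (X3v N (flow t u)))"
  \<comment> \<open>The time derivative of \<open>E t * ph s t\<close> divided by
    \<open>E t\<close>: the linear part of the vector field is eliminated by the evolution equation,
    and \<open>om n\<close> is subtracted from the frequency by the factor E.\<close>
  define br where "br = (\<lambda>s t. \<i> * fr s t * ph s t - of_real s ^ 2 * z2 s t - of_real s ^ 3 * z3 s t)"
  have int0: "((\<lambda>t. E t * br s t) has_integral 0) {0..period}" for s
  proof -
    have v: "((\<lambda>t. E t * ph s t) has_vector_derivative E t * br s t) (at t)" for t
    proof -
      have dE: "(E has_vector_derivative ?c * E t) (at t)"
        unfolding E_def by (rule has_vector_derivative_real_field) (auto intro!: derivative_eq_intros)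
      have "((\<lambda>t. ph s t) has_vector_derivative zd ?l (y s t) (X1v (y s t))) (at t)"
        unfolding ph_def yf by (rule flow_derivative[OF smul_rtrig[OF u]])
      from has_vector_derivative_mult[OF dE this]
      have d: "((\<lambda>t. E t * ph s t) has_vector_derivative E t * zd ?l (y s t) (X1v (y s t)) + ?c * E t * ph s t) (at t)" .
      have "X1v (y s t) = smul M1 (of_real s) (X1v (flow t u))" by (simp add: y_def h0C_simps fun_eq_iff)
      then have "zd ?l (y s t) (X1v (y s t)) = of_real s * zd ?l (y s t) (X1v (flow t u))"
        using zd_linear(2)[OF rtrig_h0[OF yr] supported_h0C[OF X1v_supported[OF us]]] by simp
      moreover have "of_real s * zd ?l (y s t) (X1v (flow t u)) + of_real s ^ 2 * z2 s t + of_real s ^ 3 * z3 s t = \<i> * freq (y s t) n * ph s t"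
        using evolution[OF yr n, of s t] zd_energy_flow[OF rtrig_flow[OF u] rtrig_h0[OF yr], of ?l s t "of_real s" t]
        unfolding y_def[symmetric] z2_def z3_def ph_def by (simp add: y_def)
      ultimately have zz: "zd ?l (y s t) (X1v (y s t)) = \<i> * freq (y s t) n * ph s t - of_real s ^ 2 * z2 s t - of_real s ^ 3 * z3 s t"
        by (simp add: algebra_simps)
      have "E t * zd ?l (y s t) (X1v (y s t)) + ?c * E t * ph s t = E t * br s t"
        unfolding zz br_def fr_def by (simp add: algebra_simps)
      then show ?thesis using d by simp
    qed
    have "((\<lambda>t. E t * br s t) has_integral E period * ph s period - E 0 * ph s 0) {0..period}"
      by (rule fundamental_theorem_of_calculus[OF per(1)]) (rule has_vector_derivative_at_within[OF v])
    then show ?thesis by (simp add: E1 ph_def y_def flow_0 flow_period)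
  qed
  define A where "A = (\<lambda>t. ?L * X2v N (flow t u) (flow t u) ?l)"
  define Q where "Q = (\<lambda>t. T0 n N (flow t u) (flow t u) (flow t u))"
  have cE: "continuous_on S E" for S unfolding E_def by (intro continuous_intros)
  have cB2: "continuous_on S (\<lambda>t. B ?l (flow t u) (X2v N (flow t u) (flow t u)))" for S
    by (rule continuous_B[OF us X2v_supported continuous_flow continuous_X2v])
  have cB3: "continuous_on S (\<lambda>t. B ?l (flow t u) (X3v N (flow t u)))" for S
    by (rule continuous_B[OF us X3v_supported continuous_flow]) (intro continuous_intros continuous_gr3)
  have cB: "continuous_on S (\<lambda>t. B ?l (flow t u) (flow t u))" for S
    by (rule continuous_B[OF us us continuous_flow continuous_flow])
  have cQ: "continuous_on S Q" for S
    unfolding Q_def T0_def w2_flow by (intro continuous_intros continuous_flow continuous_gr3 cB2)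
  have cA: "continuous_on S A" for S
    unfolding A_def by (intro continuous_intros continuous_X2v)
  have iA: "((\<lambda>t. E t * A t) has_integral integral {0..period} (\<lambda>t. E t * A t)) {0..period}"
    by (intro integrable_integral integrable_continuous_real continuous_intros cE cA)
  have iQ: "((\<lambda>t. E t * Q t) has_integral integral {0..period} (\<lambda>t. E t * Q t)) {0..period}"
    by (intro integrable_integral integrable_continuous_real continuous_intros cE cQ)
  define w where "w = w2 n N u u"
  \<comment> \<open>To third order \<open>br\<close> is \<open>- s^2 * A t + s^3 * Q t\<close>. The
    quadratic part of the coordinate meets a frequency deviation of order s^2 and so contributes
    only at order s^4.\<close>
  define R where "R = (\<lambda>s t. br s t + of_real s ^ 2 * A t - of_real s ^ 3 * Q t)"
  have R: "(\<lambda>(s, t). R s t) \<in> o[T](sc 3)"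
  proof -
    define \<rho> where "\<rho> = (\<lambda>(s, t). fr s t - of_real s ^ 2 * w)"
    define e2 where "e2 = (\<lambda>(s, t). z2 s t - A t - of_real s * B ?l (flow t u) (X2v N (flow t u) (flow t u)))"
    define e3 where "e3 = (\<lambda>(s, t). z3 s t - ?L * X3v N (flow t u) ?l - of_real s * B ?l (flow t u) (X3v N (flow t u)))"
    define q where "q = (\<lambda>(s, t). ph s t - of_real s * (?L * flow t u ?l) - of_real s ^ 2 * B ?l (flow t u) (flow t u) / 2)"
    obtain K2 where K2: "\<And>t. nrm M1 (X2v N (flow t u) (flow t u)) \<le> K2" using X2v_flow_bound[of N u] by blast
    obtain K3 where K3: "\<And>t. nrm M1 (X3v N (flow t u)) \<le> K3" using X3v_flow_bound[of N u] by blast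
    have e: "e2 \<in> O[T](sc 2)" "e3 \<in> O[T](sc 2)" "q \<in> O[T](sc 3)"
      using zd_flow_expansion[OF u supported_h0C[OF X2v_supported] K2, of ?l] zd_flow_expansion[OF u supported_h0C[OF X3v_supported] K3, of ?l]
        Phi_flow_expansion[OF u, of ?l]
      by (simp_all add: e2_def e3_def q_def z2_def z3_def ph_def A_def y_def)
    have "\<rho> \<in> o[T](sc 2)"
      using freq_flow_expansion[OF u, of n] a0_lin_act[OF rtrig_supported[OF u], of n] g_zero[OF n]
      by (simp add: \<rho>_def fr_def y_def om_kn w_def)
    have S: "sc k \<in> O[T](sc k)" for k by simp
    note c = continuous_bigo[OF cB2] continuous_bigo[OF cB3] continuous_bigo[OF cB]
      continuous_bigo[OF continuous_flow[of _ u ?l]]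
    have ph: "(\<lambda>(s, t). ph s t) \<in> O[T](sc 1)"
    proof -
      have "(\<lambda>(s, t). ph s t) = (\<lambda>p. q p + (sc 1 p * (case p of (s, t) \<Rightarrow> flow t u ?l)) * ?L + (sc 2 p * (case p of (s, t) \<Rightarrow> B ?l (flow t u) (flow t u))) * (1 / 2))"
        by (auto simp: q_def sc_def fun_eq_iff)
      moreover have "(\<lambda>p. q p + (sc 1 p * (case p of (s, t) \<Rightarrow> flow t u ?l)) * ?L + (sc 2 p * (case p of (s, t) \<Rightarrow> B ?l (flow t u) (flow t u))) * (1 / 2)) \<in> O[T](sc 1)"
      proof (intro sum_in_bigo)
        show "q \<in> O[T](sc 1)" by (rule landau_o.big_trans[OF e(3) sc_bigo]) simp
        show "(\<lambda>p. (sc 1 p * (case p of (s, t) \<Rightarrow> flow t u ?l)) * ?L) \<in> O[T](sc 1)"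
          using bigo_sc_mult[OF bigo_sc_mult[OF S[of 1] c(4)] bigo_sc_const[of ?L]] by simp
        have "(\<lambda>p. (sc 2 p * (case p of (s, t) \<Rightarrow> B ?l (flow t u) (flow t u))) * (1 / 2)) \<in> O[T](sc 2)"
          using bigo_sc_mult[OF bigo_sc_mult[OF S[of 2] c(3)] bigo_sc_const[of "1 / 2"]] by simp
        then show "(\<lambda>p. (sc 2 p * (case p of (s, t) \<Rightarrow> B ?l (flow t u) (flow t u))) * (1 / 2)) \<in> O[T](sc 1)"
          by (rule landau_o.big_trans[OF _ sc_bigo]) simp
      qed
      ultimately show ?thesis by simp
    qed
    define d where "d = (\<lambda>p. \<i> * w * (sc 2 p * (q p + (sc 2 p * (case p of (s, t) \<Rightarrow> B ?l (flow t u) (flow t u))) * (1 / 2))) - sc 2 p * e2 p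
      - sc 3 p * (e3 p + sc 1 p * (case p of (s, t) \<Rightarrow> B ?l (flow t u) (X3v N (flow t u)))))"
    have "(\<lambda>(s, t). R s t) = (\<lambda>p. \<i> * (\<rho> p * (case p of (s, t) \<Rightarrow> ph s t)) + d p)"
      unfolding R_def br_def \<rho>_def d_def q_def e2_def e3_def sc_def Q_def T0_def w2_flow w_def[symmetric]
      by (auto simp: fun_eq_iff algebra_simps power2_eq_square power3_eq_cube)
    moreover have "(\<lambda>p. \<i> * (\<rho> p * (case p of (s, t) \<Rightarrow> ph s t))) \<in> o[T](sc 3)"
    proof -
      have "(\<lambda>p. \<rho> p * (case p of (s, t) \<Rightarrow> ph s t)) \<in> o[T](\<lambda>p. sc 2 p * sc 1 p)"
        by (rule landau_o.small_big_mult[OF \<open>\<rho> \<in> o[T](sc 2)\<close> ph])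
      then show ?thesis by (simp add: sc_mult numeral_3_eq_3)
    qed
    moreover have "d \<in> o[T](sc 3)"
    proof (rule landau_o.big_small_trans[OF _ sc_smallo[of 3 4]])
      show "d \<in> O[T](sc 4)"
        unfolding d_def
      proof (intro sum_in_bigo)
        have "(\<lambda>p. (sc 2 p * (case p of (s, t) \<Rightarrow> B ?l (flow t u) (flow t u))) * (1 / 2)) \<in> O[T](sc 2)"
          using bigo_sc_mult[OF bigo_sc_mult[OF S[of 2] c(3)] bigo_sc_const[of "1 / 2"]] by simp
        then have "(\<lambda>p. q p + (sc 2 p * (case p of (s, t) \<Rightarrow> B ?l (flow t u) (flow t u))) * (1 / 2)) \<in> O[T](sc 2)"
          using landau_o.big_trans[OF e(3) sc_bigo[of 2 3]] by (intro sum_in_bigo) simp_all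
        from bigo_sc_mult[OF bigo_sc_const bigo_sc_mult[OF S[of 2] this], of "\<i> * w"]
        show "(\<lambda>p. \<i> * w * (sc 2 p * (q p + (sc 2 p * (case p of (s, t) \<Rightarrow> B ?l (flow t u) (flow t u))) * (1 / 2)))) \<in> O[T](sc 4)"
          by simp
        show "(\<lambda>p. sc 2 p * e2 p) \<in> O[T](sc 4)" using bigo_sc_mult[OF S[of 2] e(1)] by simp
        have "(\<lambda>p. e3 p + sc 1 p * (case p of (s, t) \<Rightarrow> B ?l (flow t u) (X3v N (flow t u)))) \<in> O[T](sc 1)"
          using landau_o.big_trans[OF e(2) sc_bigo[of 1 2]] bigo_sc_mult[OF S[of 1] c(2)] by (intro sum_in_bigo) simp_all
        from bigo_sc_mult[OF S[of 3] this]
        show "(\<lambda>p. sc 3 p * (e3 p + sc 1 p * (case p of (s, t) \<Rightarrow> B ?l (flow t u) (X3v N (flow t u))))) \<in> O[T](sc 4)" by simp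
      qed
    qed simp
    ultimately show ?thesis by (simp only:) (rule sum_in_smallo)
  qed
  define IA where "IA = integral {0..period} (\<lambda>t. E t * A t)"
  define IQ where "IQ = integral {0..period} (\<lambda>t. E t * Q t)"
  \<comment> \<open>The integrated identity after division by s. Its two orders separate, and the
    second one is the claim.\<close>
  have "(\<lambda>p. IA * sc 1 p + (- IQ) * sc 2 p) \<in> o[T](sc 2)"
  proof (rule landau_o.smallI)
    fix c :: real assume c: "c > 0"
    obtain d where d: "d > 0" "\<And>s t. 0 < s \<Longrightarrow> s < d \<Longrightarrow> t \<in> {0..1} \<Longrightarrow> norm (R s t) \<le> c * s ^ 3"
      using landau_o.smallD[OF R c] unfolding eventually_T by (fastforce simp: sc_def norm_power)
    have "norm (IA * of_real s + - IQ * of_real s ^ 2) \<le> c * s ^ 2" if s: "0 < s" "s < d" for s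
    proof -
      have "((\<lambda>t. E t * br s t + (of_real s ^ 2 * (E t * A t) - of_real s ^ 3 * (E t * Q t))) has_integral
          0 + (of_real s ^ 2 * IA - of_real s ^ 3 * IQ)) {0..period}"
        unfolding IA_def IQ_def by (intro has_integral_add has_integral_diff has_integral_mult_right int0 iA iQ)
      moreover have "(\<lambda>t. E t * br s t + (of_real s ^ 2 * (E t * A t) - of_real s ^ 3 * (E t * Q t))) = (\<lambda>t. E t * R s t)"
        by (simp add: R_def algebra_simps)
      ultimately have i: "((\<lambda>t. E t * R s t) has_integral of_real s ^ 2 * IA - of_real s ^ 3 * IQ) {0..period}" by simp
      have "norm (of_real s ^ 2 * IA - of_real s ^ 3 * IQ) \<le> (c * s ^ 3) * Henstock_Kurzweil_Integration.content {0..period}"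
        by (rule has_integral_bound_real[OF _ finite.emptyI i]) (use c s d(2) per in \<open>auto simp: norm_mult En\<close>)
      also have "\<dots> \<le> c * s ^ 3" using c s per by (simp add: mult_left_le)
      finally have "s * norm (IA * of_real s + - IQ * of_real s ^ 2) \<le> s * (c * s ^ 2)"
      proof -
        have "of_real s ^ 2 * IA - of_real s ^ 3 * IQ = of_real s * (IA * of_real s + - IQ * of_real s ^ 2)"
          by (simp add: algebra_simps power2_eq_square power3_eq_cube)
        moreover assume "norm (of_real s ^ 2 * IA - of_real s ^ 3 * IQ) \<le> c * s ^ 3"
        ultimately show ?thesis using s by (simp add: norm_mult power3_eq_cube power2_eq_square mult_ac)
      qed
      then show ?thesis using s by simp
    qed
    then show "\<forall>\<^sub>F p in T. norm (IA * sc 1 p + - IQ * sc 2 p) \<le> c * norm (sc 2 p)"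
      unfolding eventually_T using d(1) by (auto intro!: exI[of _ d] simp: sc_def norm_power)
  qed
  from sc_coefficients(2)[OF this] have "IQ = 0" by simp
  then show ?thesis using iQ by (simp add: IQ_def E_def Q_def)
qed

end

lemma lin_on_smul:
  assumes F: "lin_on N F" and b: "supported N b"
  shows "F (\<lambda>k. c * b k) = c * F b"
proof -
  have "supported N (\<lambda>_. 0)" by (simp add: supported_def)
  from lin_onD[OF F this this, of 1] lin_onD[OF F this b, of c] show ?thesis by simp
qed

section \<open>Resonances and the differential of the frequencies at the origin\<close>

context kdv2
begin

text \<open>The modes n, m and - m satisfy om n + om m + om (- m) = om n, so in every order of the
  arguments the integrand of the average is constant in time. A constant with vanishing integral
  over a positive period is zero.\<close>

lemma resonant_triple:
  assumes n: "n > 0" and m: "m > 0"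
  defines "N \<equiv> n + m" and "e \<equiv> \<lambda>k :: int. unitv k"
  defines "i \<equiv> int n" and "j \<equiv> int m"
  shows "T0 n N (e i) (e j) (e (- j)) + T0 n N (e i) (e (- j)) (e j) + T0 n N (e j) (e i) (e (- j))
    + T0 n N (e j) (e (- j)) (e i) + T0 n N (e (- j)) (e i) (e j) + T0 n N (e (- j)) (e j) (e i) = 0"
    (is "?S = 0")
proof -
  define D where "D = (\<lambda>a b c t. exp (- (\<i> * of_real (om (int n))) * of_real t) * T0 n N (flow t a) (flow t b) (flow t c))"
  define Z where "Z = (\<lambda>f :: real \<Rightarrow> complex. (f has_integral 0) {0..period})"
  have fs: "supported N (flow t a)" if "supported N a" for t a using that by (simp add: supported_def flow_def)
  have fl: "flow t (\<lambda>k. a k + c * b k) = (\<lambda>k. flow t a k + c * flow t b k)" for t a b c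
    by (simp add: flow_def fun_eq_iff algebra_simps)
  have lin: "lin_on N (\<lambda>a. E * F (flow t a))" if "lin_on N F" for F E t
    unfolding lin_on_def fl using lin_onD[OF that fs fs] by (simp add: algebra_simps)
  have se: "supported N (e i)" "supported N (e j)" "supported N (e (- j))"
    using n m by (auto simp: e_def i_def j_def N_def intro!: supported_unitv)
  have "Z (\<lambda>t. D (e i) (e j) (e (- j)) t + D (e i) (e (- j)) (e j) t + D (e j) (e i) (e (- j)) t
    + D (e j) (e (- j)) (e i) t + D (e (- j)) (e i) (e j) t + D (e (- j)) (e j) (e i) t)"
  proof (rule polarize3[of N D Z])
    show "Z (\<lambda>t. f t + c * h t)" if "Z f" "Z h" for f h c
      using has_integral_add[OF that(1)[unfolded Z_def] has_integral_mult_right[OF that(2)[unfolded Z_def], of c]] by (simp add: Z_def)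
    show "Z (D u u u)" if "rtrig N u" for u unfolding Z_def D_def by (rule average[OF that n])
  qed (auto simp: D_def intro!: lin T0_lin fs se)
  \<comment> \<open>Single modes are eigenvectors of the flow: D equals T0 times a phase with
    frequency om a + om b + om c - om n, which is 0 at resonance.\<close>
  moreover have "D (e a) (e b) (e c) t = T0 n N (e a) (e b) (e c)"
    if "om a + om b + om c = om i" "supported N (e a)" "supported N (e b)" "supported N (e c)" for a b c t
  proof -
    have fe: "flow t (e a) = (\<lambda>k. exp (\<i> * of_real (om a * t)) * e a k)" for a
      by (auto simp: flow_def e_def unitv_def fun_eq_iff)
    have "T0 n N (flow t (e a)) (flow t (e b)) (flow t (e c)) = exp (\<i> * of_real (om a * t)) * (exp (\<i> * of_real (om b * t)) * (exp (\<i> * of_real (om c * t)) * T0 n N (e a) (e b) (e c)))"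
      unfolding fe[of a] lin_on_smul[OF T0_lin(1)[OF fs[OF that(3)] fs[OF that(4)]] that(2)]
      unfolding fe[of b] lin_on_smul[OF T0_lin(2)[OF that(2) fs[OF that(4)]] that(3)]
      unfolding fe[of c] lin_on_smul[OF T0_lin(3)[OF that(2,3)] that(4)] ..
    also have "\<dots> = exp (\<i> * of_real ((om a + om b + om c) * t)) * T0 n N (e a) (e b) (e c)"
      by (simp add: distrib_left distrib_right exp_add)
    finally show ?thesis unfolding that(1) D_def i_def by (simp add: exp_minus mult.assoc)
  qed
  ultimately have "((\<lambda>t. ?S) has_integral 0) {0..period}"
    using se by (simp add: om_minus Z_def)
  moreover have "((\<lambda>t. ?S) has_integral Henstock_Kurzweil_Integration.content {0..period} *\<^sub>R ?S) {0..period}" by (rule has_integral_const_real)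
  ultimately have "Henstock_Kurzweil_Integration.content {0..period} *\<^sub>R ?S = 0" by (rule has_integral_unique[rotated])
  then show ?thesis by (simp add: period_def)
qed

lemma T0_unitv:
  assumes n: "n > 0" and ijk: "i + j + k = int n" "i \<noteq> 0" "\<bar>i\<bar> \<le> int N" "\<bar>j\<bar> \<le> int N" "\<bar>k\<bar> \<le> int N"
  shows "T0 n N (unitv i) (unitv j) (unitv k) = of_real (lam (int n)) *
    (\<i> * (if k = int n then (if i > 0 then of_real ((lam i)\<^sup>2) * a0 n (unitv (nat i)) else 0) + 10 * of_real (kn n) else 0)
    - 10 * kap (int n) - (if j + k = 0 then 0 else 10 * ((kap j)\<^sup>2 + kap j * kap k + (kap k)\<^sup>2) / kap i))"
proof -
  have "w2 n N (unitv i) (unitv j) = (if i > 0 then of_real ((lam i)\<^sup>2) * a0 n (unitv (nat i)) else 0) + 10 * of_real (kn n)" if j: "j = - i"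
  proof -
    have "(\<Sum>m\<in>{1..N}. of_real ((lam (int m))\<^sup>2) * a0 n (unitv m) * (unitv i (int m) * unitv j (- int m)))
      = (\<Sum>m\<in>{1..N}. if m = nat i then (if i > 0 then of_real ((lam i)\<^sup>2) * a0 n (unitv (nat i)) else 0) else 0)"
      by (intro sum.cong refl) (auto simp: unitv_def j)
    also have "\<dots> = (if i > 0 then of_real ((lam i)\<^sup>2) * a0 n (unitv (nat i)) else 0)"
      using ijk(3) by (subst sum.delta) auto
    finally have 1: "(\<Sum>m\<in>{1..N}. of_real ((lam (int m))\<^sup>2) * a0 n (unitv m) * (unitv i (int m) * unitv j (- int m))) = \<dots>" .
    have "(\<Sum>k\<in>sym_int N. unitv i k * unitv j (- k) :: complex) = (\<Sum>k\<in>sym_int N. if k = i then 1 else 0)"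
      by (intro sum.cong refl) (auto simp: unitv_def j)
    also have "\<dots> = 1" using ijk(3) by (subst sum.delta) auto
    finally show ?thesis unfolding w2_def 1 by simp
  qed
  moreover have "unitv k (int n) = (if k = int n then 1 else 0)" by (simp add: unitv_def)
  moreover have "k = int n \<longleftrightarrow> j = - i" using ijk(1) by linarith
  ultimately show ?thesis
    unfolding T0_def gr3_unitv[OF ijk(3,4,5,1)] B_X2v_unitv[OF ijk(1,2,4,5) n]
    by (cases "k = int n") (simp_all add: algebra_simps)
qed

lemma kap_kn: "kap (int n) = \<i> * of_real (kn n)"
  by (simp add: kap_def kn_def)

lemma lam_sq: "n > 0 \<Longrightarrow> (lam (int n))\<^sup>2 = 1 / kn n"
proof -
  assume "n > 0"
  then have "(lam (int n))\<^sup>2 = kn n powr (- 1/2 + - 1/2)"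
    unfolding power2_eq_square powr_add by (simp add: lam_def kn_def)
  then show ?thesis using \<open>n > 0\<close> by (simp add: kn_def powr_minus_divide)
qed

text \<open>For m = n the six resonant terms form three pairs in which all known cubic and quadratic
  contributions cancel, leaving a0 / kn n = - 20 kn n. For m distinct from n the contribution 20
  \<open>kn n\<close> of H0 to the frequency balances the known terms exactly, so the entry is
  0.\<close>

lemma a0_unitv:
  assumes n: "n > 0" and m: "m > 0"
  shows "a0 n (unitv m) = (if m = n then - 20 * of_real ((kn n)\<^sup>2) else 0)"
proof -
  define N where "N = n + m"
  let ?L = "complex_of_real (lam (int n))" and ?a = "of_real ((lam (int m))\<^sup>2) * a0 n (unitv m)" and ?K = "complex_of_real (kn n)"
  have b: "\<bar>int n\<bar> \<le> int N" "\<bar>int m\<bar> \<le> int N" "\<bar>- int m\<bar> \<le> int N" by (auto simp: N_def)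
  note t = resonant_triple[OF n m, folded N_def]
  have L: "?L \<noteq> 0" using lam_pos[of "int n"] n by simp
  have km: "kap (int m) \<noteq> 0" using m by simp
  have m0: "int m \<noteq> 0" "- int m \<noteq> 0" "int n \<noteq> 0" using m n by auto
  let ?k = "kap (int n)" and ?m = "kap (int m)"
  have ev: "T0 n N (unitv i) (unitv j) (unitv k) = ?L * (\<i> * x - 10 * ?k - y)"
    if "i + j + k = int n" "i \<noteq> 0" "\<bar>i\<bar> \<le> int N" "\<bar>j\<bar> \<le> int N" "\<bar>k\<bar> \<le> int N"
      "(if k = int n then (if i > 0 then of_real ((lam i)\<^sup>2) * a0 n (unitv (nat i)) else 0) + 10 * ?K else 0) = x"
      "(if j + k = 0 then 0 else 10 * ((kap j)\<^sup>2 + kap j * kap k + (kap k)\<^sup>2) / kap i) = y" for i j k x y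
    using T0_unitv[OF n that(1-5)] unfolding that(6,7) .
  have la: "?a = a0 n (unitv m) / of_real (kn m)" using lam_sq[OF m] by simp
  have k0: "of_real (kn m) \<noteq> (0 :: complex)" using m by (simp add: kn_def)
  have k: "?k \<noteq> 0" using n by simp
  show ?thesis
  proof (cases "m = n")
    case True
    have e: "T0 n N (unitv (int n)) (unitv (int n)) (unitv (- int n)) = ?L * (\<i> * 0 - 10 * ?k - 0)"
      "T0 n N (unitv (int n)) (unitv (- int n)) (unitv (int n)) = ?L * (\<i> * (?a + 10 * ?K) - 10 * ?k - 0)"
      "T0 n N (unitv (- int n)) (unitv (int n)) (unitv (int n)) = ?L * (\<i> * (10 * ?K) - 10 * ?k - - (30 * ?k))"
      by (rule ev; use n b True k in \<open>simp add: kap_minus power2_eq_square\<close>)+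
    have "2 * ?L * (\<i> * (?a + 20 * ?K)) = 0"
      using t unfolding True e by (simp add: algebra_simps)
    then have "?a + 20 * ?K = 0" using L by simp
    then have "?a = - 20 * ?K" by (simp add: add_eq_0_iff2)
    then show ?thesis using True k0 unfolding la by (simp add: field_simps power2_eq_square)
  next
    case False
    let ?q = "?k\<^sup>2 - ?k * ?m + ?m\<^sup>2" and ?r = "?k\<^sup>2 + ?k * ?m + ?m\<^sup>2"
    have e: "T0 n N (unitv (int n)) (unitv (int m)) (unitv (- int m)) = ?L * (\<i> * 0 - 10 * ?k - 0)"
      "T0 n N (unitv (int n)) (unitv (- int m)) (unitv (int m)) = ?L * (\<i> * 0 - 10 * ?k - 0)"
      "T0 n N (unitv (int m)) (unitv (int n)) (unitv (- int m)) = ?L * (\<i> * 0 - 10 * ?k - 10 * ?q / ?m)"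
      "T0 n N (unitv (int m)) (unitv (- int m)) (unitv (int n)) = ?L * (\<i> * (?a + 10 * ?K) - 10 * ?k - 10 * ?q / ?m)"
      "T0 n N (unitv (- int m)) (unitv (int n)) (unitv (int m)) = ?L * (\<i> * 0 - 10 * ?k - - (10 * ?r / ?m))"
      "T0 n N (unitv (- int m)) (unitv (int m)) (unitv (int n)) = ?L * (\<i> * (10 * ?K) - 10 * ?k - - (10 * ?r / ?m))"
      by (rule ev; use n m b False in \<open>simp add: kap_minus algebra_simps\<close>)+
    \<comment> \<open>The modes m and - m in the first argument of B contribute quotients with
      \<open>?q\<close> and \<open>?r\<close>, which differ by 2 \<open>kap n * kap m\<close>. Hence
      their difference no longer depends on m.\<close>
    have r: "10 * ?r / ?m = 10 * ?q / ?m + 20 * ?k" using km by (simp add: field_simps)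
    have "?L * (\<i> * (?a + 20 * ?K) - 20 * ?k) = 0"
      using t unfolding e r by (simp add: algebra_simps)
    then have "\<i> * (?a + 20 * ?K) - 20 * ?k = 0" using L by simp
    then have "\<i> * ?a = 0" unfolding kap_kn by (simp add: algebra_simps)
    then have "?a = 0" by simp
    then show ?thesis using False k0 unfolding la by simp
  qed
qed

section \<open>Concavity near the origin\<close>

lemma g_dpair_deriv:
  assumes "x \<in> V0" "has_cderiv X1 Y1 g x L" "J \<in> carr X1" "h \<in> carr X1"
  shows "X1.cdir (\<lambda>x. dpair (g x) J) x h = dpair (L h) J"
  using X1.cdir_eq[OF analytic_compose_functional(2)[OF g_analytic dpair_bounded_clin_left[of J 1] cnorm_lC cnorm_lC] assms(4)] assms
  by simp

text \<open>For unit J, Cauchy's estimate bounds the change of the derivative of x |->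
  \<open>dpair (g x) J\<close> between 0 and x, with constants independent of J. Quadratic
  homogeneity then yields the bound for all J.\<close>

lemma hessian_continuous_0:
  "\<exists>\<eta>>0. \<forall>x L L0. x \<in> V0 \<longrightarrow> nrm X1 x \<le> \<eta> \<longrightarrow> has_cderiv X1 Y1 g x L \<longrightarrow> has_cderiv X1 Y1 g 0 L0 \<longrightarrow>
     (\<forall>J\<in>carr X1. norm (dpair (L J) J - dpair (L0 J) J) \<le> (nrm X1 J)\<^sup>2)"
proof -
  obtain L0 where L0: "has_cderiv X1 Y1 g 0 L0" using g_deriv[OF zero_V0] by blast
  obtain r1 M where r1: "r1 > 0" "M > 0" "\<And>h. h \<in> carr X1 \<Longrightarrow> nrm X1 h < r1 \<Longrightarrow> nrm Y1 (g (0 + h)) \<le> M"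
    using has_cderiv_bounded_near[where f = g, OF cnorm_lC cnorm_lC L0 g_carr[OF zero_V0]] by blast
  obtain r2 where r2: "r2 > 0" "\<And>h. h \<in> carr X1 \<Longrightarrow> nrm X1 h < r2 \<Longrightarrow> h \<in> V"
    using zero_ball by blast
  define r where "r = min r1 r2"
  have r: "r > 0" using r1 r2 by (simp add: r_def)
  have b: "X1.bounded_at (\<lambda>x. dpair (g x) J) 0 r M" if J: "J \<in> carr X1" "nrm X1 J \<le> 1" for J
    unfolding X1.bounded_at_def
  proof (intro conjI ballI impI r r1(2) X1.carr_0)
    fix h assume h: "h \<in> carr X1" "nrm X1 h < r"
    then have hV: "h \<in> V0" using r2(2) V_subset_V0 by (auto simp: r_def)
    have "norm (dpair (g h) J) \<le> nrm Y1 (g h) * nrm X1 J" using dpair_bound(2)[of "g h" 1 J] g_carr[OF hV] J by simp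
    also have "\<dots> \<le> M * 1" using J r1(2) r1(3)[of h] h by (intro mult_mono) (auto simp: r_def)
    finally show "norm (dpair (g (0 + h)) J) \<le> M" by simp
    show "\<exists>L. has_cderiv X1 Cspace (\<lambda>x. dpair (g x) J) (0 + h) L"
      using dpair_g_analytic[OF J(1)] hV unfolding analytic_map_def by simp
  qed
  \<comment> \<open>\<open>cdir_lipschitz\<close> gives \<open>512 * M * \<eta> / r^2\<close> times
    \<open>nrm X1 J + 1\<close>; the latter factor is at most 2 for unit J, whence 1024.\<close>
  define \<eta> where "\<eta> = min (r / 4) (r\<^sup>2 / (1024 * M))"
  have \<eta>: "\<eta> > 0" "\<eta> \<le> r / 4" "1024 * M * \<eta> / r\<^sup>2 \<le> 1"
  proof -
    show "\<eta> > 0" "\<eta> \<le> r / 4" using r r1 by (auto simp: \<eta>_def)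
    have "\<eta> \<le> r\<^sup>2 / (1024 * M)" by (simp add: \<eta>_def)
    then show "1024 * M * \<eta> / r\<^sup>2 \<le> 1" using r r1(2) by (simp add: field_simps)
  qed
  have unit: "norm (dpair (L J) J - dpair (L0 J) J) \<le> 1"
    if x: "x \<in> V0" "nrm X1 x \<le> \<eta>" "has_cderiv X1 Y1 g x L" "has_cderiv X1 Y1 g 0 L0" and J: "J \<in> carr X1" "nrm X1 J \<le> 1" for x L L0 J
  proof -
    have xc: "x \<in> carr X1" using x(1) g_analytic by (auto simp: analytic_map_def open_in_def)
    have "norm (dpair (L J) J - dpair (L0 J) J) \<le> 512 * M * \<eta> / r\<^sup>2 * (nrm X1 J + 1)"
      using X1.cdir_lipschitz[OF b[OF J] xc x(2) J(1) \<eta>(1,2), unfolded add_0]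
      unfolding g_dpair_deriv[OF x(1,3) J(1) J(1)] g_dpair_deriv[OF zero_V0 x(4) J(1) J(1)] .
    also have "\<dots> \<le> 512 * M * \<eta> / r\<^sup>2 * 2" using J \<eta> r1 by (intro mult_left_mono) auto
    finally show ?thesis using \<eta>(3) by simp
  qed
  have "norm (dpair (L J) J - dpair (L0 J) J) \<le> (nrm X1 J)\<^sup>2"
    if x: "x \<in> V0" "nrm X1 x \<le> \<eta>" "has_cderiv X1 Y1 g x L" "has_cderiv X1 Y1 g 0 L0" and J: "J \<in> carr X1" for x L L0 J
  proof -
    have hom: "dpair (L (smul X1 c J)) (smul X1 c J) = c\<^sup>2 * dpair (L J) J" if "has_cderiv X1 Y1 g x L" for L c x
    proof -
      have "L (smul X1 c J) = smul Y1 c (L J)" using that J unfolding has_cderiv_def bounded_clin_def by blast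
      then show ?thesis by (simp add: lC_simps(2) dpair_smul_left dpair_smul_right power2_eq_square)
    qed
    \<comment> \<open>Multiplying by c instead of dividing by the norm also covers J of norm 0, for
      which c may be taken arbitrarily large.\<close>
    have sc: "norm (dpair (L J) J - dpair (L0 J) J) * c\<^sup>2 \<le> 1" if c: "c \<ge> 0" "c * nrm X1 J \<le> 1" for c
    proof -
      have "norm (dpair (L (smul X1 (of_real c) J)) (smul X1 (of_real c) J) - dpair (L0 (smul X1 (of_real c) J)) (smul X1 (of_real c) J)) \<le> 1"
        by (rule unit[OF x]) (use J c in \<open>auto simp: X1.nrm_smul\<close>)
      moreover have "(of_real c)\<^sup>2 * dpair (L J) J - (of_real c)\<^sup>2 * dpair (L0 J) J = of_real (c\<^sup>2) * (dpair (L J) J - dpair (L0 J) J)"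
        by (simp add: algebra_simps)
      ultimately show ?thesis unfolding hom[OF x(3)] hom[OF x(4)] by (simp only: norm_mult norm_of_real) (simp add: mult.commute)
    qed
    show ?thesis
    proof (cases "nrm X1 J = 0")
      case True
      show ?thesis
      proof (rule field_le_epsilon)
        fix e :: real assume e: "e > 0"
        have "norm (dpair (L J) J - dpair (L0 J) J) * (1 / sqrt e)\<^sup>2 \<le> 1" by (rule sc) (use True e in auto)
        then show "norm (dpair (L J) J - dpair (L0 J) J) \<le> (nrm X1 J)\<^sup>2 + e" using True e by (simp add: power_divide field_simps)
      qed
    next
      case False
      then have p: "nrm X1 J > 0" using X1.nrm_nonneg[of J] J by linarith
      have "norm (dpair (L J) J - dpair (L0 J) J) * (1 / nrm X1 J)\<^sup>2 \<le> 1" by (rule sc) (use p in auto)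
      then show ?thesis using p by (simp add: power_divide field_simps)
    qed
  qed
  then show ?thesis using \<eta>(1) by blast
qed

lemma hessian_0:
  assumes L: "has_cderiv X1 Y1 g 0 L" and J: "J \<in> carr X1"
  shows "L J = Lam J"
proof
  fix n
  have LJ: "L J \<in> carr Y1" using L J unfolding has_cderiv_def bounded_clin_def by blast
  show "L J n = Lam J n"
  proof (cases "n = 0")
    case True
    then show ?thesis using LJ by (simp add: lC_simps Lam_def)
  next
    case False
    have "has_cderiv X1 Cspace (\<lambda>x. g x n) 0 (\<lambda>h. L h n)"
      by (rule analytic_compose_functional(2)[OF g_analytic coord_bounded_clin_lC cnorm_lC cnorm_lC zero_V0 L])
    then have 1: "a0 n J = L J n" unfolding a0_def by (rule X1.cdir_eq[OF _ J])
    have "((\<lambda>m. J m * (if m = 0 then 0 else a0 n (unitv m))) has_sum (\<Sum>m\<in>{n}. J m * (if m = 0 then 0 else a0 n (unitv m)))) UNIV"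
      by (rule has_sum_finite_neutralI[of "{n}"]) (use False a0_unitv in auto)
    from has_sum_unique[OF bounded_clin_has_sum_lC[OF a0_bounded J] this]
    have "a0 n J = J n * (- 20 * of_real ((kn n)\<^sup>2))" using False a0_unitv[of n n] by simp
    then show ?thesis unfolding 1 by (simp add: Lam_def kn_def power_mult_distrib)
  qed
qed

text \<open>Since \<open>J 0 = 0\<close> and 1 + n <= 2 n for n >= 1, the squared norm is at most 4
  times the sum of n^2 |J_n|^2. Together with pi^2 >= 1, the factor 80 leaves ample room for the
  constant 2.\<close>

lemma Lam_bound:
  assumes J: "J \<in> lreal 1 2"
  shows "Re (dpair (Lam J) J) \<le> - 2 * (nrm X1 J)\<^sup>2"
proof -
  have s: "(\<lambda>n. (wj 1 n * norm (J n))\<^sup>2) summable_on UNIV" and J0: "J 0 = 0" and Jr: "\<And>n. J n \<in> \<real>"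
    using J by (auto simp: lreal_def lC_simps wl2_def)
  have w: "(wj 1 n * norm (J n))\<^sup>2 = (1 + real n)\<^sup>2 * (norm (J n))\<^sup>2" for n
    by (simp add: wj_def wt_def power_mult_distrib)
  have le: "(1 + real n)\<^sup>2 * (norm (J n))\<^sup>2 \<le> 4 * (real n)\<^sup>2 * (norm (J n))\<^sup>2" for n
  proof (cases "n = 0")
    case False
    then have "1 + real n \<le> 2 * real n" by simp
    then have "(1 + real n)\<^sup>2 \<le> (2 * real n)\<^sup>2" by (intro power_mono) auto
    then show ?thesis by (intro mult_right_mono) (auto simp: power_mult_distrib)
  qed (simp add: J0)
  have le': "(real n)\<^sup>2 * (norm (J n))\<^sup>2 \<le> (1 + real n)\<^sup>2 * (norm (J n))\<^sup>2" for n
    by (intro mult_right_mono power_mono) auto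
  have s1: "(\<lambda>n. (real n)\<^sup>2 * (norm (J n))\<^sup>2) summable_on UNIV"
    by (rule summable_on_comparison_test[OF s]) (use le' w in auto)
  define S where "S = (\<Sum>\<^sub>\<infinity>n. (real n)\<^sup>2 * (norm (J n))\<^sup>2)"
  have "(nrm X1 J)\<^sup>2 = (\<Sum>\<^sub>\<infinity>n. (wj 1 n * norm (J n))\<^sup>2)"
    by (simp add: lC_simps wn_def infsum_nonneg)
  also have "\<dots> \<le> (\<Sum>\<^sub>\<infinity>n. 4 * ((real n)\<^sup>2 * (norm (J n))\<^sup>2))"
    by (rule infsum_mono[OF s summable_on_cmult_right[OF s1]]) (use le w in \<open>simp add: mult.assoc\<close>)
  also have "\<dots> = 4 * S" unfolding S_def by (rule infsum_cmult_right[OF s1])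
  finally have 1: "(nrm X1 J)\<^sup>2 \<le> 4 * S" .
  have JJ: "J n * J n = of_real ((norm (J n))\<^sup>2)" for n
    using Jr[of n] by (auto elim!: Reals_cases simp: power2_eq_square simp flip: of_real_mult)
  have "Lam J n * J n = of_real (- 80 * pi\<^sup>2 * ((real n)\<^sup>2 * (norm (J n))\<^sup>2))" for n
    unfolding Lam_def using JJ[of n] by (simp add: mult.assoc)
  then have "dpair (Lam J) J = (\<Sum>\<^sub>\<infinity>n. of_real (- 80 * pi\<^sup>2 * ((real n)\<^sup>2 * (norm (J n))\<^sup>2)))"
    by (simp add: dpair_def)
  also have "\<dots> = of_real (\<Sum>\<^sub>\<infinity>n. - 80 * pi\<^sup>2 * ((real n)\<^sup>2 * (norm (J n))\<^sup>2))"
    by (rule infsumI[OF has_sum_of_real[OF has_sum_infsum[OF summable_on_cmult_right[OF s1]]]])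
  also have "(\<Sum>\<^sub>\<infinity>n. - 80 * pi\<^sup>2 * ((real n)\<^sup>2 * (norm (J n))\<^sup>2)) = - 80 * pi\<^sup>2 * S"
    unfolding S_def by (rule infsum_cmult_right[OF s1])
  finally have "Re (dpair (Lam J) J) = - 80 * pi\<^sup>2 * S" by simp
  moreover have "1 * S \<le> pi\<^sup>2 * S"
    using pi_gt3 by (intro mult_right_mono) (auto simp: S_def infsum_nonneg one_le_power)
  moreover have "S \<ge> 0" by (simp add: S_def infsum_nonneg)
  ultimately show ?thesis using 1 by (simp add: mult.commute)
qed

text \<open>\<open>\<omega>\<close> is known to be real only on the cone of nonnegative actions. A
  one-sided derivative gives real values in directions of the cone, and a real J is the difference
  of its positive and negative parts, both in the cone.\<close>

lemma g_deriv_real: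
  assumes I: "I \<in> lplus 1 2" and L: "has_cderiv X1 Y1 g I L" and J: "J \<in> lreal 1 2"
  shows "L J \<in> lreal (-1) 2"
proof -
  have Ic: "I \<in> carr X1" and Jc: "J \<in> carr X1" and Jr: "\<And>n. J n \<in> \<real>" using I J by (auto simp: lplus_def lreal_def)
  have bl: "bounded_clin X1 Y1 L" using L by (simp add: has_cderiv_def)
  have pos: "L H n \<in> \<real>" if H: "H \<in> lplus 1 2" for H n
  proof -
    have Hc: "H \<in> carr X1" using H by (rule lplus_carr)
    have d: "has_cderiv X1 Cspace (\<lambda>x. g x n) I (\<lambda>h. L h n)"
      by (rule analytic_compose_functional(2)[OF g_analytic coord_bounded_clin_lC cnorm_lC cnorm_lC _ L]) (use I V0 in blast)
    have "has_cderiv X1 Cspace (\<lambda>x. g x n) (I + smul X1 (of_real 0) H) (\<lambda>h. L h n)" using d by simp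
    from has_vector_derivative_real_field[OF X1.has_cderiv_line[OF this Hc]]
    have "((\<lambda>t. g (I + smul X1 (of_real t) H) n) has_vector_derivative L H n) (at 0 within {0..})"
      by (rule has_vector_derivative_at_within)
    from bounded_linear.has_vector_derivative[OF bounded_linear_Im this]
    have 1: "((\<lambda>t. Im (g (I + smul X1 (of_real t) H) n)) has_vector_derivative Im (L H n)) (at 0 within {0..})" .
    have "Im (g (I + smul X1 (of_real t) H) n) = 0" if "t \<in> {0..}" for t
    proof -
      have "I + smul X1 (of_real t) H \<in> lplus 1 2"
        using I H that X1.carr_add[OF Ic X1.carr_smul[OF Hc]] unfolding lplus_def lreal_def by (auto simp: lC_simps(2))
      then have "g (I + smul X1 (of_real t) H) n \<in> \<real>" using omega_real by (auto simp: g_eq lreal_def)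
      then show ?thesis by (simp add: complex_is_Real_iff)
    qed
    then have "((\<lambda>t. Im (g (I + smul X1 (of_real t) H) n)) has_vector_derivative 0) (at 0 within {0..})"
      by (intro has_vector_derivative_transform[OF _ _ has_vector_derivative_const[of 0]]) auto
    from vector_derivative_unique_within[OF _ 1 this] have "Im (L H n) = 0" by (simp add: at_within_Ici_at_right)
    then show ?thesis by (simp add: complex_is_Real_iff)
  qed
  define P where "P = (\<lambda>n. complex_of_real (max (Re (J n)) 0))"
  define Q where "Q = (\<lambda>n. complex_of_real (max (- Re (J n)) 0))"
  have c: "(\<lambda>n. complex_of_real (f (Re (J n)))) \<in> carr X1" if "\<And>x. \<bar>f x\<bar> \<le> \<bar>x\<bar>" for f :: "real \<Rightarrow> real"
  proof -
    have *: "norm (wj 1 n * norm (complex_of_real (f (Re (J n))))) \<le> 1 * (wj 1 n * norm (J n))" for n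
      using that[of "Re (J n)"] abs_Re_le_cmod[of "J n"] by (simp add: abs_mult mult_left_mono)
    have J: "J 0 = 0" "wl2 (wj 1) J" using Jc by (auto simp: lC_simps)
    from wl2_le(1)[OF J(2) _ *] J(1) that[of 0] show ?thesis by (simp add: lC_simps)
  qed
  have "P \<in> lplus 1 2" "Q \<in> lplus 1 2"
    using c[of "\<lambda>x. max x 0"] c[of "\<lambda>x. max (- x) 0"] by (auto simp: P_def Q_def lplus_def lreal_def)
  note pq = this
  have J: "J = P + smul X1 (- 1) Q"
  proof
    fix n
    have J: "J n = complex_of_real (Re (J n))" using Jr[of n] by simp
    also have "\<dots> = (P + smul X1 (- 1) Q) n" by (simp add: P_def Q_def lC_simps max_def)
    finally show "J n = (P + smul X1 (- 1) Q) n" .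
  qed
  have "L J = L P + smul Y1 (- 1) (L Q)"
    unfolding J bounded_clinD(3)[OF bl lplus_carr[OF pq(1)] X1.carr_smul[OF lplus_carr[OF pq(2)]]]
      bounded_clinD(2)[OF bl lplus_carr[OF pq(2)]] ..
  then have "L J n \<in> \<real>" for n using pos[OF pq(1)] pos[OF pq(2)] by (simp add: lC_simps(2))
  moreover have "L J \<in> carr Y1" by (rule bounded_clinD(1)[OF bl Jc])
  ultimately show ?thesis by (simp add: lreal_def)
qed

text \<open>The differential of \<open>G\<close> at x is the pairing with \<open>g x\<close>, so the
  second differential of \<open>G\<close> is the first differential of g, and its remainder is
  controlled by that of g through duality.\<close>

lemma second_differential:
  assumes I: "I \<in> V" and L: "has_cderiv X1 Y1 g I L"
  shows "has_second_differential V G I L"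
  unfolding has_second_differential_def
proof (intro conjI exI[of _ "\<lambda>x. dpair (g x)"] ballI allI impI G_gradient)
  show bl: "bounded_clin X1 Y1 L" using L by (simp add: has_cderiv_def)
  fix e :: real assume e: "e > 0"
  obtain d where d: "d > 0" "\<And>h. h \<in> carr X1 \<Longrightarrow> nrm X1 h < d \<Longrightarrow> nrm Y1 (rmd g I L h) \<le> e * nrm X1 h"
    by (rule has_cderivE[OF L e]) (rule that)
  obtain r where r: "r > 0" "\<And>y. y \<in> carr X1 \<Longrightarrow> nrm X1 (y - I) < r \<Longrightarrow> y \<in> V" using V_open I unfolding open_in_def by blast
  have Ic: "I \<in> carr X1" by (rule V_carr[OF I])
  show "\<exists>\<delta>>0. \<forall>h\<in>carr X1. nrm X1 h < \<delta> \<longrightarrow> I + h \<in> V \<and>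
      (\<forall>k\<in>carr X1. norm (dpair (g (I + h)) k - dpair (g I) k - dpair (L h) k) \<le> e * nrm X1 h * nrm X1 k)"
  proof (intro exI[of _ "min d r"] conjI ballI impI)
    show "min d r > 0" using d r by simp
    fix h assume h: "h \<in> carr X1" "nrm X1 h < min d r"
    show V: "I + h \<in> V" using r(2)[of "I + h"] h Ic X1.carr_add by simp
    fix k assume k: "k \<in> carr X1"
    have c: "g (I + h) \<in> carr Y1" "g I \<in> carr Y1" "L h \<in> carr Y1"
      using g_carr V I V_subset_V0 bounded_clinD(1)[OF bl] h by blast+
    have "dpair (g (I + h)) k - dpair (g I) k - dpair (L h) k = dpair (g (I + h) - g I - L h) k"
      using dpair_diff_left[of "g (I + h)" 1 "g I" k] dpair_diff_left[of "g (I + h) - g I" 1 "L h" k] c k Y1.carr_diff by simp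
    also have "norm \<dots> \<le> nrm Y1 (g (I + h) - g I - L h) * nrm X1 k"
      using dpair_bound(2)[of "g (I + h) - g I - L h" 1 k] c k Y1.carr_diff by simp
    also have "\<dots> \<le> e * nrm X1 h * nrm X1 k" using d(2)[of h] h k by (intro mult_right_mono) (auto simp: rmd_def)
    finally show "norm (dpair (g (I + h)) k - dpair (g I) k - dpair (L h) k) \<le> e * nrm X1 h * nrm X1 k" .
  qed
qed

text \<open>Near 0 the quadratic form exceeds that of \<open>Lam\<close> by at most the squared norm
  of J, which by \<open>Lam_bound\<close> is at most - 1/2 times the form of \<open>Lam\<close>.
  Half of \<open>Lam\<close> survives.\<close>

lemma concave_near_0:
  "\<exists>N. open_in X1 N \<and> 0 \<in> N \<and> (\<forall>I \<in> N \<inter> lplus 1 2. \<exists>A. has_second_differential V G I A \<and>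
    (\<forall>J\<in>lreal 1 2. A J \<in> lreal (-1) 2 \<and> Re (dpair (A J) J) \<le> 1/2 * Re (dpair (Lam J) J)))"
proof -
  obtain \<eta> where \<eta>: "\<eta> > 0" "\<And>x L L0 J. x \<in> V0 \<Longrightarrow> nrm X1 x \<le> \<eta> \<Longrightarrow> has_cderiv X1 Y1 g x L \<Longrightarrow> has_cderiv X1 Y1 g 0 L0 \<Longrightarrow>
     J\<in>carr X1 \<Longrightarrow> norm (dpair (L J) J - dpair (L0 J) J) \<le> (nrm X1 J)\<^sup>2"
    using hessian_continuous_0 by blast
  obtain L0 where L0: "has_cderiv X1 Y1 g 0 L0" using g_deriv[OF zero_V0] by blast
  define N where "N = {x \<in> carr X1. nrm X1 x < \<eta>}"
  have "open_in X1 N" unfolding N_def by (rule X1.open_in_ball)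
  moreover have "0 \<in> N" using \<eta>(1) by (simp add: N_def)
  moreover have "\<exists>A. has_second_differential V G I A \<and>
    (\<forall>J\<in>lreal 1 2. A J \<in> lreal (-1) 2 \<and> Re (dpair (A J) J) \<le> 1/2 * Re (dpair (Lam J) J))" if I: "I \<in> N" "I \<in> lplus 1 2" for I
  proof -
    have IV: "I \<in> V" "I \<in> V0" using I lplus_V V0 by auto
    obtain L where L: "has_cderiv X1 Y1 g I L" using g_deriv[OF IV(2)] by blast
    have "Re (dpair (L J) J) \<le> 1/2 * Re (dpair (Lam J) J)" if J: "J \<in> lreal 1 2" for J
    proof -
      have Jc: "J \<in> carr X1" using J by (simp add: lreal_def)
      have "norm (dpair (L J) J - dpair (Lam J) J) \<le> (nrm X1 J)\<^sup>2"
        using \<eta>(2)[OF IV(2) _ L L0 Jc] I(1) hessian_0[OF L0 Jc] by (simp add: N_def)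
      then have "Re (dpair (L J) J - dpair (Lam J) J) \<le> (nrm X1 J)\<^sup>2" using complex_Re_le_cmod order_trans by blast
      then show ?thesis using Lam_bound[OF J] by simp
    qed
    then show ?thesis using second_differential[OF IV(1) L] g_deriv_real[OF I(2) L] by blast
  qed
  ultimately show ?thesis by blast
qed

end

theorem theorem4p12:
  fixes W :: "(int \<Rightarrow> complex) set"
    and \<Phi> :: "(int \<Rightarrow> complex) \<Rightarrow> (int \<Rightarrow> complex)"
    and \<omega> :: "(nat \<Rightarrow> complex) \<Rightarrow> (nat \<Rightarrow> complex)"
  assumes birkhoff: "birkhoff_map W \<Phi>"
    and omega_analytic: "real_analytic_map (lC 1 2) (lC (-1) 2) (lplus 1 2) (lreal (-1) 2) \<omega>"
    and omega_extends: "\<forall>I\<in>lplus 5 1. \<omega> I = omega2_star \<Phi> I"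
  shows "\<exists>V G.
    lplus 1 2 \<subseteq> V \<and> analytic_map (lC 1 2) Cspace V G \<and> G ` lplus 1 2 \<subseteq> \<real> \<and>
    (\<forall>I\<in>lplus 5 1. G I = H2_star \<Phi> I) \<and>
    (\<forall>I\<in>lplus 1 2. has_l2_gradient G I (\<omega> I)) \<and>
    (\<exists>N. open_in (lC 1 2) N \<and> 0 \<in> N \<and>
      (\<forall>I \<in> N \<inter> lplus 1 2. \<exists>A. has_second_differential V G I A \<and>
        (\<forall>J\<in>lreal 1 2. A J \<in> lreal (-1) 2 \<and>
           Re (dpair (A J) J) \<le> 1/2 * Re (dpair (Lam J) J))))"
proof -
  have "real_analytic_map (h0C (5/2)) Cspace (h0 (5/2)) \<real> (\<lambda>z. H2 (inv_into (h0 (-1)) \<Phi> z))"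
    using birkhoff by (simp add: birkhoff_map_def analytic_function_of_actions_def)
  then obtain VK K where K: "h0 (5/2) \<subseteq> VK" "analytic_map (h0C (5/2)) Cspace VK K"
    "\<forall>z\<in>h0 (5/2). K z = H2 (inv_into (h0 (-1)) \<Phi> z)"
    unfolding real_analytic_map_def by (elim conjE exE)
  from omega_analytic obtain V0 g where g: "\<omega> ` lplus 1 2 \<subseteq> lreal (-1) 2" "lplus 1 2 \<subseteq> V0"
    "analytic_map (lC 1 2) (lC (-1) 2) V0 g" "\<forall>I\<in>lplus 1 2. g I = \<omega> I"
    unfolding real_analytic_map_def by (elim conjE exE)
  interpret kdv2 W \<Phi> \<omega> VK K V0 g
    by unfold_locales (use birkhoff omega_extends K g in auto)
  have "has_l2_gradient G I (\<omega> I)" if "I \<in> lplus 1 2" for I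
    using G_gradient[of I] that lplus_V g_eq[OF that] omega_carr[OF that] unfolding has_l2_gradient_def by auto
  then show ?thesis
    using lplus_V G_analytic G_real G_eq_H2_star concave_near_0
    by (rule_tac exI[of _ V], rule_tac exI[of _ G], intro conjI) auto
qed

end
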